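(* Let $q\ge3$ and $t\le q$ be positive integers, and set $r=r(q,t)$ to be $q-1$ if $t=1$; $2q-3$ if $t=2$ or $t=q=3$; $(q-t+1)t$ if $3\le t<\frac{q+1}{2}$; and $\lfloor (q+1)^2/4\rfloor$ otherwise. The $q$-Coloring problem on $t\text{-Clique}+k\mathrm{v}$ graphs admits a kernel with $O(k^r)$ vertices, encodable in $O(k^r\cdot\log k)$ bits, while for any real $\varepsilon>0$ it does not admit a compression of size $O(k^{r-\varepsilon})$ unless $\mathsf{NP}\subseteq\mathsf{coNP}/\mathsf{poly}$.
   Context: $t\text{-Clique}$ denotes the family of graphs that are disjoint unions of cliques (vertex set partitioned into cliques, no edges between parts) each of size at most $t$. The $q$-Coloring problem on $t\text{-Clique}+k\mathrm{v}$ graphs: input is a graph $G=(V,E)$ and a set $X\subseteq V$ with $|X|=k$ and $G\setminus X\in t\text{-Clique}$; decide whether $G$ has a proper coloring with $q$ colors; the parameter is $k$. A parameterized problem is a set $Q\subseteq\Sigma^*\times\mathbb{N}$. A compression of $Q$ into $Q'$ is a polynomial-time algorithm mapping $(x,k)$ to $(x',k')$ with $(x,k)\in Q\iff(x',k')\in Q'$ and $|x'|+k'\le h(k)$ for a computable $h$ (the size); $Q$ admits a compression of size $h$ if one exists into some parameterized problem. A kernel is a compression of a problem into itself; a kernel with $O(k^r)$ vertices outputs an equivalent instance of the same problem whose graph has $O(k^r)$ vertices. *)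

theory Defs
  imports
    Complex_Main
    "HOL-Library.Disjoint_Sets"
    "HOL-Library.Landau_Symbols"
    "HOL-Computational_Algebra.Polynomial"
begin

section \<open>Deterministic multi-tape Turing machines\<close>

text \<open>
  States and tape symbols are initial segments of the naturals. State 0 is the start state and
  state 1 the halting state; symbol 0 is the blank, symbols 1 and 2 are the input bits. Tapes are
  infinite in both directions. The input is written on the first tape, the output is read off
  the last tape (from cell 0 up to the first blank).
\<close>

record tm =
  tm_tapes :: nat
  tm_states :: nat
  tm_symbols :: nat
  tm_delta :: "nat \<Rightarrow> nat list \<Rightarrow> nat \<times> nat list \<times> int list"

definition tm_wf :: "tm \<Rightarrow> bool" where
  "tm_wf M \<longleftrightarrow> tm_tapes M \<ge> 1 \<and> tm_states M \<ge> 2 \<and> tm_symbols M \<ge> 3 \<and>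
     (\<forall>s rs. s < tm_states M \<and> length rs = tm_tapes M \<and> set rs \<subseteq> {..<tm_symbols M} \<longrightarrow>
       (case tm_delta M s rs of (s', ws, ds) \<Rightarrow>
          s' < tm_states M \<and>
          length ws = tm_tapes M \<and> set ws \<subseteq> {..<tm_symbols M} \<and>
          length ds = tm_tapes M \<and> set ds \<subseteq> {-1, 0, 1}))"

type_synonym tape = "(int \<Rightarrow> nat) \<times> int"
type_synonym config = "nat \<times> tape list"

definition tm_step :: "tm \<Rightarrow> config \<Rightarrow> config" where
  "tm_step M = (\<lambda>(s, ts).
     if s = 1 then (s, ts)
     else (case tm_delta M s (map (\<lambda>(c, p). c p) ts) of (s', ws, ds) \<Rightarrow>
       (s', map (\<lambda>((c, p), (w, d)). (c(p := w), p + d)) (zip ts (zip ws ds)))))"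

definition bit_symbol :: "bool \<Rightarrow> nat" where
  "bit_symbol b = (if b then 2 else 1)"

definition tm_init :: "tm \<Rightarrow> bool list \<Rightarrow> config" where
  "tm_init M w = (0,
     (\<lambda>i. if 0 \<le> i \<and> i < int (length w) then bit_symbol (w ! nat i) else 0, 0)
     # replicate (tm_tapes M - 1) (\<lambda>_. 0, 0))"

definition tm_yields :: "tm \<Rightarrow> bool list \<Rightarrow> nat \<Rightarrow> bool list \<Rightarrow> bool" where
  "tm_yields M w T y \<longleftrightarrow>
     (case (tm_step M ^^ T) (tm_init M w) of (s, ts) \<Rightarrow>
        s = 1 \<and>
        (\<forall>i < length y. fst (last ts) (int i) = bit_symbol (y ! i)) \<and>
        fst (last ts) (int (length y)) = 0)"

definition computable_via ::
  "('a \<Rightarrow> bool list) \<Rightarrow> ('b \<Rightarrow> bool list) \<Rightarrow> ('a \<Rightarrow> 'b) \<Rightarrow> bool" where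
  "computable_via enc_in enc_out f \<longleftrightarrow>
     (\<exists>M. tm_wf M \<and> (\<forall>a. \<exists>T. tm_yields M (enc_in a) T (enc_out (f a))))"

definition poly_time_via ::
  "('a \<Rightarrow> bool list) \<Rightarrow> ('b \<Rightarrow> bool list) \<Rightarrow> ('a \<Rightarrow> 'b) \<Rightarrow> bool" where
  "poly_time_via enc_in enc_out f \<longleftrightarrow>
     (\<exists>M (p :: nat poly). tm_wf M \<and>
        (\<forall>a. \<exists>T \<le> poly p (length (enc_in a)). tm_yields M (enc_in a) T (enc_out (f a))))"


section \<open>Encodings\<close>

definition enc_bits :: "bool list \<Rightarrow> bool list" where
  "enc_bits x = concat (map (\<lambda>b. [True, b]) x) @ [False]"

definition enc_pair :: "bool list \<times> bool list \<Rightarrow> bool list" where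
  "enc_pair = (\<lambda>(x, y). enc_bits x @ y)"

definition enc_unary :: "nat \<Rightarrow> bool list" where
  "enc_unary k = replicate k True"

fun binary :: "nat \<Rightarrow> bool list" where
  "binary n = (if n = 0 then [] else odd n # binary (n div 2))"

declare binary.simps [simp del]

definition enc_nat :: "nat \<Rightarrow> bool list" where
  "enc_nat n = enc_bits (binary n)"

definition enc_list :: "('a \<Rightarrow> bool list) \<Rightarrow> 'a list \<Rightarrow> bool list" where
  "enc_list e xs = concat (map (\<lambda>x. True # e x) xs) @ [False]"


section \<open>Complexity classes\<close>

type_synonym language = "bool list set"

definition NP :: "language set" where
  "NP = {L. \<exists>(V :: bool list \<times> bool list \<Rightarrow> bool) (p :: nat poly).
          poly_time_via enc_pair (\<lambda>b. [b]) V \<and>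
          (\<forall>x. x \<in> L \<longleftrightarrow> (\<exists>u. length u \<le> poly p (length x) \<and> V (x, u)))}"

definition coNP :: "language set" where
  "coNP = {L. - L \<in> NP}"

definition coNP_poly :: "language set" where
  "coNP_poly = {L. \<exists>L' \<in> coNP. \<exists>(adv :: nat \<Rightarrow> bool list) (p :: nat poly).
          (\<forall>n. length (adv n) \<le> poly p n) \<and>
          (\<forall>x. x \<in> L \<longleftrightarrow> enc_pair (x, adv (length x)) \<in> L')}"


section \<open>Parameterized problems and compressions\<close>

type_synonym param_problem = "(bool list \<times> nat) set"

text \<open>
  The parameter is written in unary, so that running times are polynomial in $|x| + k$.
\<close>

definition enc_param :: "bool list \<times> nat \<Rightarrow> bool list" where
  "enc_param = (\<lambda>(x, k). enc_pair (x, enc_unary k))"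

definition is_compression ::
  "param_problem \<Rightarrow> param_problem \<Rightarrow> (nat \<Rightarrow> nat) \<Rightarrow>
   (bool list \<times> nat \<Rightarrow> bool list \<times> nat) \<Rightarrow> bool" where
  "is_compression Q Q' h f \<longleftrightarrow>
     poly_time_via enc_param enc_param f \<and>
     computable_via enc_unary enc_unary h \<and>
     (\<forall>x k. (x, k) \<in> Q \<longleftrightarrow> f (x, k) \<in> Q') \<and>
     (\<forall>x k. length (fst (f (x, k))) + snd (f (x, k)) \<le> h k)"

definition admits_compression :: "param_problem \<Rightarrow> (nat \<Rightarrow> nat) \<Rightarrow> bool" where
  "admits_compression Q h \<longleftrightarrow> (\<exists>Q' f. is_compression Q Q' h f)"

definition is_kernel ::
  "param_problem \<Rightarrow> (nat \<Rightarrow> nat) \<Rightarrow> (bool list \<times> nat \<Rightarrow> bool list \<times> nat) \<Rightarrow> bool" where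
  "is_kernel Q h f \<longleftrightarrow> is_compression Q Q h f"


section \<open>Graphs\<close>

type_synonym graph = "nat set \<times> nat set set"

definition simple_graph :: "graph \<Rightarrow> bool" where
  "simple_graph = (\<lambda>(V, E). finite V \<and> E \<subseteq> {{u, v} | u v. u \<in> V \<and> v \<in> V \<and> u \<noteq> v})"

definition delete_vertices :: "graph \<Rightarrow> nat set \<Rightarrow> graph" where
  "delete_vertices = (\<lambda>(V, E) X. (V - X, {e \<in> E. e \<inter> X = {}}))"

definition t_Clique :: "nat \<Rightarrow> graph set" where
  "t_Clique t = {(V, E). finite V \<and>
     (\<exists>P. partition_on V P \<and> (\<forall>C \<in> P. card C \<le> t) \<and>
          E = {{u, v} | u v. u \<noteq> v \<and> (\<exists>C \<in> P. u \<in> C \<and> v \<in> C)})}"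

definition q_colorable :: "nat \<Rightarrow> graph \<Rightarrow> bool" where
  "q_colorable q = (\<lambda>(V, E). \<exists>c :: nat \<Rightarrow> nat.
     (\<forall>v \<in> V. c v < q) \<and> (\<forall>u v. {u, v} \<in> E \<and> u \<noteq> v \<longrightarrow> c u \<noteq> c v))"


section \<open>Coloring parameterized by the distance to a disjoint union of small cliques\<close>

text \<open>
  The graph has vertices \<open>0, \<dots>, n - 1\<close>; \<open>n\<close> is written in unary, so that an instance is at
  least as long as its number of vertices, and the edges and \<open>X\<close> are lists of binary numbers. An
  edge list rather than an adjacency matrix is needed for a graph with $O(m)$ vertices and $O(m)$
  edges to take $O(m \log m)$ bits.
\<close>

definition enc_graph :: "nat \<Rightarrow> (nat \<times> nat) list \<Rightarrow> nat list \<Rightarrow> bool list" where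
  "enc_graph n es xs =
     enc_unary n @ [False] @ enc_list (\<lambda>(u, v). enc_nat u @ enc_nat v) es @ enc_list enc_nat xs"

definition encodes :: "bool list \<Rightarrow> graph \<Rightarrow> nat set \<Rightarrow> bool" where
  "encodes x G X \<longleftrightarrow>
     (\<exists>n es xs. x = enc_graph n es xs \<and>
        G = ({..<n}, {{u, v} | u v. (u, v) \<in> set es}) \<and> X = set xs)"

definition clique_kv_instance ::
  "nat \<Rightarrow> bool list \<times> nat \<Rightarrow> graph \<Rightarrow> nat set \<Rightarrow> bool" where
  "clique_kv_instance t = (\<lambda>(x, k) G X.
     encodes x G X \<and> simple_graph G \<and> X \<subseteq> fst G \<and> card X = k \<and>
     delete_vertices G X \<in> t_Clique t)"

definition coloring_problem :: "nat \<Rightarrow> nat \<Rightarrow> param_problem" where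
  "coloring_problem q t = {i. \<exists>G X. clique_kv_instance t i G X \<and> q_colorable q G}"

definition coloring_kernel ::
  "nat \<Rightarrow> nat \<Rightarrow> (nat \<Rightarrow> nat) \<Rightarrow> (nat \<Rightarrow> nat) \<Rightarrow>
   (bool list \<times> nat \<Rightarrow> bool list \<times> nat) \<Rightarrow> bool" where
  "coloring_kernel q t g h f \<longleftrightarrow>
     is_kernel (coloring_problem q t) h f \<and>
     (\<forall>i. \<exists>G X. clique_kv_instance t (f i) G X \<and> card (fst G) \<le> g (snd i))"

definition r_exp :: "nat \<Rightarrow> nat \<Rightarrow> nat" where
  "r_exp q t =
     (if t = 1 then q - 1
      else if t = 2 \<or> (t = q \<and> q = 3) then 2 * q - 3
      else if 3 \<le> t \<and> real t < (real q + 1) / 2 then (q - t + 1) * t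
      else nat \<lfloor>(real q + 1)\<^sup>2 / 4\<rfloor>)"

end

theory Submission
  imports Defs "HOL-Combinatorics.Permutations"
begin

text \<open>
  Upper bound. For a colouring of \<open>X\<close>, a clique of \<open>G - X\<close> with \<open>s\<close> vertices cannot be
  coloured iff, by Hall's theorem, some \<open>s'\<close> of its vertices see the same \<open>q + 1 - s'\<close> colours
  in \<open>X\<close>. Each such obstruction is a function of the colouring, with values modulo a prime divisor
  of \<open>q\<close>, of degree at most \<open>r\<close>: it depends on at most \<open>s' (q + 1 - s')\<close> vertices, and
  for \<open>s' = 1, 2\<close> signs of permutations lower the degree by one. So the obstructions of \<open>G\<close>
  are spanned by \<open>O(k^r)\<close> of them, and the kernel consists of \<open>X\<close> and one clique for each
  of these.

  Lower bound. Conversely, cliques express every constraint on \<open>r\<close> vertices of \<open>X\<close>. This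
  allows the tableaux of about \<open>n^r\<close> NP computations to be selected by \<open>r\<close> indices in a graph
  with \<open>|X|\<close> close to \<open>n\<close>; a compression below \<open>k^r\<close> would distil the disjunction of any
  language in NP, which puts NP into coNP/poly by the argument of Fortnow and Santhanam.
\<close>

section \<open>Structured programs on Turing machine tapes\<close>

text \<open>The definitions speak of concrete machines only. Both directions between machines and
  the class \<open>pt\<close> of functions on trees are needed: kernel and reduction must become
  machines, while an assumed compression is given by a machine and must be composed with the
  reduction.

  The saving of one degree rests on one computation: the mixed difference over all \<open>q\<close>
  or \<open>2 * q - 2\<close> vertices that a clique of one or two vertices depends on is 0 or a sum
  of \<open>q\<close> equal terms, hence 0 modulo every divisor of \<open>q\<close>. A prime divisor
  is taken because elimination needs a field. The gadgets match this by spending one place on a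
  fixed palette colour.

  All instances share one tableau that leaves the bits of the input open, so its size does not
  depend on their number. Imposing a bit of the instance with a given index would involve
  \<open>r\<close> index coordinates and that bit, one variable too many; variables that merge the
  first coordinate with a bit of the input bring this down to \<open>r\<close>.\<close>

datatype com =
  Act nat "nat option" int
 | Seq com com (infixr ";;" 60)
 | Cond nat "nat set" com com
 | Loop nat "nat set" com

definition rd :: "tape list => nat => nat" where
 "rd ts r = fst (ts ! r) (snd (ts ! r))"

fun astep :: "com list \<times> tape list => com list \<times> tape list" where
 "astep ([], ts) = ([], ts)"
| "astep (Act r w d # k, ts) =
  (k, ts[r := ((fst (ts ! r))(snd (ts ! r) := (case w of None => rd ts r | Some a => a)), snd (ts ! r) + d)])"
| "astep ((c1 ;; c2) # k, ts) = (c1 # c2 # k, ts)"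
| "astep (Cond r A c1 c2 # k, ts) = ((if rd ts r \<in> A then c1 else c2) # k, ts)"
| "astep (Loop r A c # k, ts) = (if rd ts r \<in> A then c # Loop r A c # k else k, ts)"

text \<open>The states of the machine are the continuations that can occur during the execution.\<close>

fun conts :: "com => com list => com list set" where
 "conts (Act r w d) k = {Act r w d # k}"
| "conts (c1 ;; c2) k = insert ((c1 ;; c2) # k) (conts c1 (c2 # k) \<union> conts c2 k)"
| "conts (Cond r A c1 c2) k = insert (Cond r A c1 c2 # k) (conts c1 k \<union> conts c2 k)"
| "conts (Loop r A c) k = insert (Loop r A c # k) (conts c (Loop r A c # k))"

fun valid_com :: "nat => com => bool" where
 "valid_com n (Act r w d) \<longleftrightarrow> r < n & (case w of None => True | Some a => a < 3) & d \<in> {-1, 0, 1}"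
| "valid_com n (c1 ;; c2) \<longleftrightarrow> valid_com n c1 & valid_com n c2"
| "valid_com n (Cond r A c1 c2) \<longleftrightarrow> r < n & valid_com n c1 & valid_com n c2"
| "valid_com n (Loop r A c) \<longleftrightarrow> r < n & valid_com n c"

section \<open>Finitely many continuations as machine states\<close>

lemma finite_conts: "finite (conts c k)"
 by (induction c arbitrary: k) auto

lemma conts_start: "c # k \<in> conts c k"
 by (cases c) auto

lemma conts_closed: "l \<in> conts c k ==> fst (astep (l, ts)) \<in> insert k (conts c k)"
proof (induction c arbitrary: k)
 case (Act r w d) then show ?case by auto
next
 case (Seq c1 c2)
 then show ?case using conts_start[of c1 "c2 # k"] conts_start[of c2 k] by fastforce
next
 case (Cond r A c1 c2)
 then show ?case using conts_start[of c1 k] conts_start[of c2 k] Cond.IH(1)[of k] Cond.IH(2)[of k] by auto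
next
 case (Loop r A c)
 then show ?case using conts_start[of c "Loop r A c # k"] by fastforce
qed

lemma conts_valid: "l \<in> conts c k ==> valid_com n c ==> list_all (valid_com n) k ==> list_all (valid_com n) l"
 by (induction c arbitrary: k) fastforce+

text \<open>\<open>astep\<close> factored through the scanned symbols, which are all that
  \<open>tm_delta\<close> may depend on besides the state.\<close>

fun cact :: "com list => nat list => com list \<times> nat list \<times> int list" where
 "cact [] rs = ([], rs, replicate (length rs) 0)"
| "cact (Act r w d # k) rs =
  (k, rs[r := (case w of None => rs ! r | Some a => a)], (replicate (length rs) 0)[r := d])"
| "cact ((c1 ;; c2) # k) rs = (c1 # c2 # k, rs, replicate (length rs) 0)"
| "cact (Cond r A c1 c2 # k) rs = ((if rs ! r \<in> A then c1 else c2) # k, rs, replicate (length rs) 0)"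
| "cact (Loop r A c # k) rs =
  (if rs ! r \<in> A then c # Loop r A c # k else k, rs, replicate (length rs) 0)"

abbreviation apply_act :: "tape list => nat list => int list => tape list" where
 "apply_act ts ws ds \<equiv> map (%((c, p), (w, d)). (c(p := w), p + d)) (zip ts (zip ws ds))"

lemma apply_act_idle:
 "apply_act ts (map (%(c, p). c p) ts) (replicate (length ts) 0) = ts"
 by (rule nth_equalityI) (auto split: prod.splits)

lemma cact_astep:
 assumes "list_all (valid_com (length ts)) k" and "cact k (map (%(c, p). c p) ts) = (k', ws, ds)"
 shows "astep (k, ts) = (k', apply_act ts ws ds)"
proof (cases "(k, map (%(c, p). c p) ts)" rule: cact.cases)
 case (2 r w d k0 rs)
 then have k: "k = Act r w d # k0" and r: "r < length ts" using assms by auto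
 have "ts[r := ((fst (ts ! r))(snd (ts ! r) := (case w of None => rd ts r | Some a => a)), snd (ts ! r) + d)]
  = apply_act ts ((map (%(c, p). c p) ts)[r := (case w of None => rd ts r | Some a => a)])
    ((replicate (length ts) 0)[r := d])"
  by (rule nth_equalityI) (use r in \<open>auto simp: nth_list_update split: prod.splits\<close>)
 moreover have "map (%(c, p). c p) ts ! r = rd ts r"
  using r by (simp add: rd_def split_beta)
 ultimately show ?thesis using assms(2) k by (cases w) auto
next
 case 4
 then show ?thesis using assms apply_act_idle[of ts] by (auto simp: rd_def split_beta)
next
 case 5
 then show ?thesis using assms apply_act_idle[of ts] by (auto simp: rd_def split_beta)
qed (use assms apply_act_idle[of ts] in auto)

definition cstates :: "com => com list set" where
 "cstates c = insert [] (conts c [])"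

lemma cstates_closed: "l \<in> cstates c ==> fst (astep (l, ts)) \<in> cstates c"
 unfolding cstates_def using conts_closed by auto

lemma cstates_valid: "l \<in> cstates c ==> valid_com n c ==> list_all (valid_com n) l"
 unfolding cstates_def using conts_valid by auto

lemma cstates_cact:
 assumes "l \<in> cstates c" "valid_com (length rs) c"
 shows "fst (cact l rs) \<in> cstates c"
proof -
 \<comment> \<open>Tapes that show exactly the symbols \<open>rs\<close>; through them closure under
   \<open>astep\<close> carries over to \<open>cact\<close>.\<close>
 let ?ts = "map (%a. (%_. a, 0)) rs :: tape list"
 obtain k' ws ds where 1: "cact l rs = (k', ws, ds)" by (cases "cact l rs") auto
 have "map (%(c, p). c p) ?ts = rs" by (simp add: comp_def)
 then have "astep (l, ?ts) = (k', apply_act ?ts ws ds)"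
  using 1 cstates_valid[OF assms] by (intro cact_astep) (auto simp: comp_def)
 with 1 cstates_closed[OF assms(1), of ?ts] show ?thesis by simp
qed

text \<open>The numbers 0 and 1 are prescribed, being the start and the halting state of every
  \<open>tm\<close>.\<close>

definition cidx :: "com => com list => nat" where
 "cidx c = (SOME e. inj_on e (cstates c) & e [c] = 0 & e [] = 1)"

lemma cidx: "inj_on (cidx c) (cstates c)" "cidx c [c] = 0" "cidx c [] = 1"
proof -
 obtain e :: "com list => nat" where e: "inj_on e (cstates c)"
  using finite_imp_inj_to_nat_seg[of "cstates c"] finite_conts unfolding cstates_def by blast
 let ?e = "%k. if k = [c] then 0 else if k = [] then 1 else e k + 2"
 have "inj_on ?e (cstates c) & ?e [c] = 0 & ?e [] = 1"
  using e by (auto simp: inj_on_def)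
 then have "inj_on (cidx c) (cstates c) & cidx c [c] = 0 & cidx c [] = 1"
  unfolding cidx_def by (rule someI[where P = "%e. inj_on e (cstates c) & e [c] = 0 & e [] = 1"])
 then show "inj_on (cidx c) (cstates c)" "cidx c [c] = 0" "cidx c [] = 1" by auto
qed

text \<open>State numbers outside the range of \<open>cidx\<close> get a harmless transition, since
  \<open>tm_wf\<close> speaks about all numbers below \<open>tm_states\<close>.\<close>

definition com_tm :: "nat => com => tm" where
 "com_tm n c = \<lparr>tm_tapes = n, tm_states = Suc (Max (cidx c ` cstates c)), tm_symbols = 3,
  tm_delta = (%s rs. if s \<in> cidx c ` cstates c
    then (let (k, ws, ds) = cact (inv_into (cstates c) (cidx c) s) rs in (cidx c k, ws, ds))
    else (0, rs, replicate (length rs) 0))\<rparr>"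

lemma cidx_less: "l \<in> cstates c ==> cidx c l < Suc (Max (cidx c ` cstates c))"
 by (metis Max_ge finite_conts finite_imageI finite_insert imageI less_Suc_eq_le cstates_def)

lemma cact_wf:
 assumes "list_all (valid_com (length rs)) l" "set rs \<subseteq> {..<3}"
 shows "length (fst (snd (cact l rs))) = length rs" "set (fst (snd (cact l rs))) \<subseteq> {..<3}"
  "length (snd (snd (cact l rs))) = length rs" "set (snd (snd (cact l rs))) \<subseteq> {-1, 0, 1}"
proof -
 have u: "set (xs[r := x]) \<subseteq> A" if "set xs \<subseteq> A" "x \<in> A" for xs r x and A :: "'a set"
  using that set_update_subset_insert[of xs r x] by blast
 show "length (fst (snd (cact l rs))) = length rs" "length (snd (snd (cact l rs))) = length rs"
  by (cases "(l, rs)" rule: cact.cases; simp)+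
 show "set (fst (snd (cact l rs))) \<subseteq> {..<3}"
  using assms by (cases "(l, rs)" rule: cact.cases) (auto intro!: u split: option.splits dest!: subsetD[OF set_update_subset_insert])
 show "set (snd (snd (cact l rs))) \<subseteq> {-1, 0, 1}"
  using assms by (cases "(l, rs)" rule: cact.cases) (auto dest!: subsetD[OF set_update_subset_insert])
qed

lemma com_tm_wf:
 assumes "valid_com n c" "n \<ge> 1"
 shows "tm_wf (com_tm n c)"
proof -
 have c0: "[] \<in> cstates c" "[c] \<in> cstates c" using conts_start[of c "[]"] by (auto simp: cstates_def)
 have "cidx c [] < Suc (Max (cidx c ` cstates c))" by (rule cidx_less[OF c0(1)])
 then have 1: "Suc (Max (cidx c ` cstates c)) \<ge> 2" by (simp add: cidx)
 have "case tm_delta (com_tm n c) s rs of (s', ws, ds) =>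
     s' < tm_states (com_tm n c) & length ws = n & set ws \<subseteq> {..<3} &
     length ds = n & set ds \<subseteq> {-1, 0, 1}"
  if "s < tm_states (com_tm n c)" "length rs = n" "set rs \<subseteq> {..<3}" for s rs
 proof (cases "s \<in> cidx c ` cstates c")
  case False
  then show ?thesis using that by (auto simp: com_tm_def)
 next
  case True
  define l where "l = inv_into (cstates c) (cidx c) s"
  have l: "l \<in> cstates c" unfolding l_def by (rule inv_into_into[OF True])
  have v: "valid_com (length rs) c" using assms that by simp
  obtain k ws ds where e: "cact l rs = (k, ws, ds)" by (cases "cact l rs") auto
  have "k \<in> cstates c" using cstates_cact[OF l v] e by simp
  then show ?thesis using cact_wf[OF cstates_valid[OF l v] that(3)] cidx_less[of k c] True e that(2)
   by (auto simp: com_tm_def l_def)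
 qed
 then show ?thesis using 1 assms(2) unfolding tm_wf_def by (auto simp: com_tm_def)
qed

lemma com_tm_step:
 assumes "valid_com (length ts) c" "k \<in> cstates c"
 shows "tm_step (com_tm n c) (cidx c k, ts) = (cidx c (fst (astep (k, ts))), snd (astep (k, ts)))"
proof (cases "k = []")
 case True
 then show ?thesis by (simp add: tm_step_def cidx)
next
 case False
 then have "cidx c k \<noteq> 1"
  using assms(2) cidx(1,3)[of c] by (metis cstates_def inj_on_eq_iff insertI1)
 moreover obtain k' ws ds where e: "cact k (map (%(c, p). c p) ts) = (k', ws, ds)"
  by (cases "cact k (map (%(c, p). c p) ts)") auto
 ultimately show ?thesis
  using assms cidx(1)[of c] cact_astep[OF cstates_valid[OF assms(2,1)] e]
  by (auto simp: tm_step_def com_tm_def)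
qed

lemma astep_length: "length (snd (astep s)) = length (snd s)"
 by (cases s rule: astep.cases) auto

lemma com_tm_steps:
 assumes "valid_com (length ts) c" "k \<in> cstates c"
 shows "(tm_step (com_tm n c) ^^ m) (cidx c k, ts) =
  (cidx c (fst ((astep ^^ m) (k, ts))), snd ((astep ^^ m) (k, ts)))
  & fst ((astep ^^ m) (k, ts)) \<in> cstates c & length (snd ((astep ^^ m) (k, ts))) = length ts"
proof (induction m)
 case 0
 then show ?case using assms by simp
next
 case (Suc m)
 obtain k' ts' where e: "(astep ^^ m) (k, ts) = (k', ts')" by fastforce
 with Suc have "k' \<in> cstates c" "length ts' = length ts" by auto
 then show ?case using Suc e com_tm_step[of ts' c k' n] assms cstates_closed[of k' c ts'] astep_length[of "(k', ts')"]
  by simp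
qed

text \<open>The quantifier over the continuation \<open>k\<close> makes executions compose: a
  command never looks at what follows it.\<close>

definition exec :: "com => tape list => nat => tape list => bool" where
 "exec c ts n ts' \<longleftrightarrow> (\<forall>k. (astep ^^ n) (c # k, ts) = (k, ts'))"

lemma exec_Act:
 "exec (Act r w d) ts 1
  (ts[r := ((fst (ts ! r))(snd (ts ! r) := (case w of None => rd ts r | Some a => a)), snd (ts ! r) + d)])"
 by (simp add: exec_def)

lemma exec_Seq: "exec c1 ts n ts1 ==> exec c2 ts1 m ts2 ==> exec (c1 ;; c2) ts (n + m + 1) ts2"
proof -
 assume 1: "exec c1 ts n ts1" and 2: "exec c2 ts1 m ts2"
 have "n + m + 1 = m + (n + 1)" by simp
 then show ?thesis using 1 2 unfolding exec_def by (simp only: funpow_add funpow_swap1) (simp add: funpow_swap1)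
qed

lemma exec_Cond: "exec (if rd ts r \<in> A then c1 else c2) ts n ts' ==> exec (Cond r A c1 c2) ts (n + 1) ts'"
 unfolding exec_def by (simp add: funpow_swap1 del: funpow.simps add: funpow_Suc_right)

lemma exec_Loop_exit: "rd ts r \<notin> A ==> exec (Loop r A c) ts 1 ts"
 by (simp add: exec_def)

lemma exec_Loop_step:
 "rd ts r \<in> A ==> exec c ts n ts1 ==> exec (Loop r A c) ts1 m ts2 ==> exec (Loop r A c) ts (n + m + 1) ts2"
proof -
 assume 1: "rd ts r \<in> A" "exec c ts n ts1" "exec (Loop r A c) ts1 m ts2"
 have "n + m + 1 = m + (n + 1)" by simp
 then show ?thesis using 1 unfolding exec_def by (simp only: funpow_add funpow_swap1) (simp add: funpow_swap1)
qed


section \<open>Programs on stacks\<close>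

text \<open>Tapes 0 to 3 hold stacks with the top under the head; tape 4 is the output tape.\<close>

definition stk :: "tape => bool list => bool" where
 "stk t xs \<longleftrightarrow> (\<forall>i. fst t i =
  (if snd t \<le> i & i < snd t + int (length xs) then bit_symbol (xs ! nat (i - snd t)) else 0))"

definition outp :: "tape => bool list => bool" where
 "outp t ys \<longleftrightarrow> snd t = int (length ys) & (\<forall>i. fst t i =
  (if 0 \<le> i & i < int (length ys) then bit_symbol (ys ! nat i) else 0))"

definition reps :: "tape list => bool list list => bool" where
 "reps ts S \<longleftrightarrow> length ts = 5 & length S = 5 & (\<forall>i<4. stk (ts ! i) (S ! i)) & outp (ts ! 4) (S ! 4)"

definition run :: "com => bool list list => nat => bool list list => bool" where
 "run c S T S' \<longleftrightarrow> (\<forall>ts. reps ts S --> (\<exists>n\<le>T. \<exists>ts'. exec c ts n ts' & reps ts' S'))"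

definition top :: "bool list => nat" where
 "top xs = (case xs of [] => 0 | b # _ => bit_symbol b)"

lemma top_simps [simp]: "top [] = 0" "top (True # xs) = 2" "top (False # xs) = 1" "top (b # xs) \<in> {1, 2}"
 by (auto simp: top_def bit_symbol_def)

lemma reps_rd: "reps ts S ==> r < 4 ==> rd ts r = top (S ! r)"
 unfolding reps_def rd_def top_def stk_def by (cases "S ! r") auto

lemma run_mono: "run c S T S' ==> T \<le> T' ==> run c S T' S'"
 unfolding run_def by (meson le_trans)

lemma run_Seq: "run c1 S T1 S1 ==> run c2 S1 T2 S2 ==> run (c1 ;; c2) S (T1 + T2 + 1) S2"
 unfolding run_def by (meson exec_Seq add_mono le_refl)

lemma run_Cond:
 assumes "r < 4" "run (if top (S ! r) \<in> A then c1 else c2) S T S'"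
 shows "run (Cond r A c1 c2) S (T + 1) S'"
 unfolding run_def
proof (intro allI impI)
 fix ts assume "reps ts S"
 with assms obtain n ts' where "n \<le> T" "exec (if rd ts r \<in> A then c1 else c2) ts n ts'" "reps ts' S'"
  unfolding run_def by (metis reps_rd)
 then show "\<exists>n\<le>T + 1. \<exists>ts'. exec (Cond r A c1 c2) ts n ts' & reps ts' S'"
  using exec_Cond by (metis add_le_mono1)
qed

lemma run_Loop_exit: "r < 4 ==> top (S ! r) \<notin> A ==> run (Loop r A c) S 1 S"
 unfolding run_def by (metis exec_Loop_exit reps_rd le_refl)

lemma run_Loop_step:
 assumes "r < 4" "top (S ! r) \<in> A" "run c S T1 S1" "run (Loop r A c) S1 T2 S2"
 shows "run (Loop r A c) S (T1 + T2 + 1) S2"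
 unfolding run_def
proof (intro allI impI)
 fix ts assume ts: "reps ts S"
 then obtain n ts1 where 1: "n \<le> T1" "exec c ts n ts1" "reps ts1 S1" using assms(3) unfolding run_def by blast
 then obtain m ts2 where 2: "m \<le> T2" "exec (Loop r A c) ts1 m ts2" "reps ts2 S2"
  using assms(4) unfolding run_def by blast
 have "exec (Loop r A c) ts (n + m + 1) ts2"
  using exec_Loop_step[OF _ 1(2) 2(2)] assms(1,2) ts by (simp add: reps_rd)
 then show "\<exists>n\<le>T1 + T2 + 1. \<exists>ts'. exec (Loop r A c) ts n ts' & reps ts' S2"
  using 1 2 by (meson add_mono le_refl)
qed

definition skip :: com where "skip = Act 0 None 0"
definition push :: "nat => bool => com" where
 "push r b = Act r None (-1) ;; Act r (Some (bit_symbol b)) 0"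
definition pop :: "nat => com" where "pop r = Act r (Some 0) 1"
definition emit :: "bool => com" where "emit b = Act 4 (Some (bit_symbol b)) 1"

lemma valid_prims [simp]: "valid_com 5 skip" "r < 5 ==> valid_com 5 (push r b)" "r < 5 ==> valid_com 5 (pop r)"
 "valid_com 5 (emit b)"
 by (auto simp: skip_def push_def pop_def emit_def bit_symbol_def)

lemma reps_update:
 assumes "reps ts S" "r < 4" "stk t xs"
 shows "reps (ts[r := t]) (S[r := xs])"
 using assms unfolding reps_def by (auto simp: nth_list_update)

lemma run_skip: "run skip S 1 S"
 unfolding run_def
proof (intro allI impI)
 fix ts assume ts: "reps ts S"
 then have "ts[0 := ((fst (ts ! 0))(snd (ts ! 0) := rd ts 0), snd (ts ! 0) + 0)] = ts"
  by (simp add: rd_def)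
 then show "\<exists>n\<le>1. \<exists>ts'. exec skip ts n ts' & reps ts' S"
  using exec_Act[of 0 None 0 ts] ts unfolding skip_def by auto
qed

lemma run_push:
 assumes "r < 4" shows "run (push r b) S 3 (S[r := b # S ! r])"
 unfolding run_def
proof (intro allI impI)
 fix ts assume ts: "reps ts S"
 obtain c p where t: "ts ! r = (c, p)" by fastforce
 have l: "r < length ts" and s: "stk (c, p) (S ! r)" using ts assms t by (auto simp: reps_def)
 have "exec (push r b) ts (1 + 1 + 1) (ts[r := (c(p - 1 := bit_symbol b), p - 1)])"
  unfolding push_def
  using exec_Seq[OF exec_Act[of r None "-1" ts] exec_Act[of r "Some (bit_symbol b)" 0]] t l
  by (simp add: rd_def)
 moreover have "nat (i + 1 - p) - Suc 0 = nat (i - p)" if "p \<le> i" for i using that by simp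
 then have "stk (c(p - 1 := bit_symbol b), p - 1) (b # S ! r)"
  using s unfolding stk_def by (auto simp: nth_Cons' nat_diff_distrib algebra_simps Suc_nat_eq_nat_zadd1)
 ultimately show "\<exists>n\<le>3. \<exists>ts'. exec (push r b) ts n ts' & reps ts' (S[r := b # S ! r])"
  using reps_update[OF ts assms] by (intro exI[of _ "1 + 1 + 1"]) auto
qed

lemma run_pop:
 assumes "r < 4" shows "run (pop r) S 1 (S[r := tl (S ! r)])"
 unfolding run_def
proof (intro allI impI)
 fix ts assume ts: "reps ts S"
 obtain c p where t: "ts ! r = (c, p)" by fastforce
 have s: "stk (c, p) (S ! r)" using ts assms t by (auto simp: reps_def)
 have "exec (pop r) ts 1 (ts[r := (c(p := 0), p + 1)])"
  unfolding pop_def using exec_Act[of r "Some 0" 1 ts] t by (simp add: rd_def)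
 moreover have "nat (i + 1 - p) - Suc 0 = nat (i - p)" if "p \<le> i" for i using that by simp
 then have "stk (c(p := 0), p + 1) (tl (S ! r))"
  using s unfolding stk_def by (auto simp: nth_tl nat_diff_distrib algebra_simps Suc_nat_eq_nat_zadd1)
 ultimately show "\<exists>n\<le>1. \<exists>ts'. exec (pop r) ts n ts' & reps ts' (S[r := tl (S ! r)])"
  using reps_update[OF ts assms] by blast
qed

lemma run_emit: "run (emit b) [x0, x1, x2, x3, y] 1 [x0, x1, x2, x3, y @ [b]]"
 unfolding run_def
proof (intro allI impI)
 fix ts assume ts: "reps ts [x0, x1, x2, x3, y]"
 obtain c p where t: "ts ! 4 = (c, p)" by fastforce
 have s: "outp (c, p) y" using ts t by (auto simp: reps_def)
 have "exec (emit b) ts 1 (ts[4 := (c(p := bit_symbol b), p + 1)])"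
  unfolding emit_def using exec_Act[of 4 "Some (bit_symbol b)" 1 ts] t by (simp add: rd_def)
 moreover have "outp (c(p := bit_symbol b), p + 1) (y @ [b])"
  using s unfolding outp_def by (auto simp: nth_append)
 then have "reps (ts[4 := (c(p := bit_symbol b), p + 1)]) [x0, x1, x2, x3, y @ [b]]"
  using ts unfolding reps_def by (auto simp: nth_list_update less_Suc_eq numeral_nat)
 ultimately show "\<exists>n\<le>1. \<exists>ts'. exec (emit b) ts n ts' & reps ts' [x0, x1, x2, x3, y @ [b]]"
  by blast
qed

text \<open>Initially the head of tape 0 is on the first input bit, so the input already is a stack;
  tape 4 is the last tape, from which \<open>tm_yields\<close> reads the output.\<close>

lemma com_tm_yields:
 assumes "valid_com 5 c" "run c [w, [], [], [], []] T [x0, x1, x2, x3, y]"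
 shows "\<exists>n\<le>T. tm_yields (com_tm 5 c) w n y"
proof -
 define ts where "ts = snd (tm_init (com_tm 5 c) w)"
 have i: "tm_init (com_tm 5 c) w = (0, ts)" and l: "length ts = 5"
  by (auto simp: ts_def tm_init_def com_tm_def)
 have "reps ts [w, [], [], [], []]"
  unfolding reps_def using l
  by (auto simp: ts_def tm_init_def com_tm_def stk_def outp_def less_Suc_eq numeral_nat)
 then obtain n ts' where n: "n \<le> T" "exec c ts n ts'" "reps ts' [x0, x1, x2, x3, y]"
  using assms(2) unfolding run_def by blast
 then have "(astep ^^ n) ([c], ts) = ([], ts')" by (simp add: exec_def)
 moreover have "[c] \<in> cstates c" using conts_start[of c "[]"] by (auto simp: cstates_def)
 ultimately have "(tm_step (com_tm 5 c) ^^ n) (0, ts) = (1, ts')"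
  using com_tm_steps[where c = c and ts = ts and k = "[c]" and n = 5 and m = n] assms(1) l by (simp add: cidx)
 moreover have "last ts' = ts' ! 4" "outp (ts' ! 4) y"
  using n(3) last_conv_nth[of ts'] by (cases "ts' = []"; simp add: reps_def)+
 ultimately have "tm_yields (com_tm 5 c) w n y"
  unfolding tm_yields_def i by (auto simp: outp_def)
 then show ?thesis using n(1) by blast
qed

section \<open>Binary trees on stacks\<close>

datatype tree = Lf | Nd tree tree

text \<open>Preorder, one bit per node. The code is prefix-free, so a tree can lie on a stack above
  arbitrary data without a separator.\<close>

primrec code :: "tree => bool list" where
 "code Lf = [False]"
| "code (Nd a b) = True # code a @ code b"

lemma code_nonempty [simp]: "code t \<noteq> []" by (cases t) auto

lemma code_len: "1 \<le> length (code t)" by (cases t) auto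

lemma code_append_inj: "code a @ x = code b @ y ==> a = b & x = y"
proof (induction a arbitrary: b x y)
 case Lf then show ?case by (cases b) auto
next
 case (Nd a1 a2)
 from Nd.prems show ?case
 proof (cases b)
  case (Nd b1 b2)
  with Nd.prems have "code a1 @ (code a2 @ x) = code b1 @ (code b2 @ y)" by simp
  with Nd.IH(1) have "a1 = b1" "code a2 @ x = code b2 @ y" by blast+
  with Nd.IH(2) Nd show ?thesis by blast
 qed auto
qed

lemma run_prims:
 "run (push 0 b) [x0, x1, x2, x3, y] 3 [b # x0, x1, x2, x3, y]"
 "run (push 1 b) [x0, x1, x2, x3, y] 3 [x0, b # x1, x2, x3, y]"
 "run (push 2 b) [x0, x1, x2, x3, y] 3 [x0, x1, b # x2, x3, y]"
 "run (push 3 b) [x0, x1, x2, x3, y] 3 [x0, x1, x2, b # x3, y]"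
 "run (pop 0) [e # x0, x1, x2, x3, y] 1 [x0, x1, x2, x3, y]"
 "run (pop 1) [x0, e # x1, x2, x3, y] 1 [x0, x1, x2, x3, y]"
 "run (pop 2) [x0, x1, e # x2, x3, y] 1 [x0, x1, x2, x3, y]"
 "run (pop 3) [x0, x1, x2, e # x3, y] 1 [x0, x1, x2, x3, y]"
 "run (emit b) [x0, x1, x2, x3, y] 1 [x0, x1, x2, x3, y @ [b]]"
 "run skip S 1 S"
 using run_push[of 0 b "[x0, x1, x2, x3, y]"] run_push[of 1 b "[x0, x1, x2, x3, y]"]
  run_push[of 2 b "[x0, x1, x2, x3, y]"] run_push[of 3 b "[x0, x1, x2, x3, y]"]
  run_pop[of 0 "[e # x0, x1, x2, x3, y]"] run_pop[of 1 "[x0, e # x1, x2, x3, y]"]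
  run_pop[of 2 "[x0, x1, e # x2, x3, y]"] run_pop[of 3 "[x0, x1, x2, e # x3, y]"]
  run_emit run_skip
 by (simp_all add: numeral_nat)

lemma run_CondT: "r < 4 ==> top (S ! r) \<in> A ==> run c1 S T S' ==> run (Cond r A c1 c2) S (T + 1) S'"
 by (rule run_Cond) auto

lemma run_CondF: "r < 4 ==> top (S ! r) \<notin> A ==> run c2 S T S' ==> run (Cond r A c1 c2) S (T + 1) S'"
 by (rule run_Cond) auto

text \<open>Tape 3 counts in unary the subtrees still to be read: a leaf removes one, an inner node
  replaces one by two. Hence the loop stops right after the first complete tree, which then lies
  reversed on tape \<open>r\<close>.\<close>

definition mv :: "nat => com" where
 "mv r = push 3 True ;; Loop 3 {2} (pop 3 ;;
  Cond 0 {2} (pop 0 ;; push r True ;; push 3 True ;; push 3 True) (pop 0 ;; push r False))"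

text \<open>The assumption is a run of the loop from the state after \<open>t\<close>. This backward
  form lets the right subtree supply the assumption for the left one in the induction.\<close>

lemma mv_loop1:
 assumes "run (Loop 3 {2} (pop 3 ;;
  Cond 0 {2} (pop 0 ;; push 1 True ;; push 3 True ;; push 3 True) (pop 0 ;; push 1 False)))
  [x, rev (code t) @ a, b, d, y] T S'" (is "run ?L _ _ _")
 shows "run ?L [code t @ x, a, b, True # d, y] (T + 20 * length (code t)) S'"
 using assms
proof (induction t arbitrary: x a d T)
 case Lf
 show ?case
  by (simp only: code.simps append_Cons append_Nil, rule run_mono, rule run_Loop_step[OF _ _ _ Lf[simplified code.simps rev.simps append.simps]], simp, simp, rule run_Seq, rule run_prims,
    rule run_CondF, simp, simp, rule run_Seq, (rule run_prims)+, simp)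
next
 case (Nd l r)
 have "run ?L [code r @ x, rev (code l) @ True # a, b, True # d, y] (T + 20 * length (code r)) S'"
  by (rule Nd.IH(2)) (use Nd.prems in simp)
 note 1 = Nd.IH(1)[OF this]
 show ?case
  by (rule run_mono, rule run_Loop_step[OF _ _ _ 1], simp, simp, rule run_Seq, rule run_prims,
    simp only: code.simps append_Cons append_assoc,
    rule run_CondT, simp, simp, rule run_Seq, rule run_prims, rule run_Seq, rule run_prims,
    rule run_Seq, (rule run_prims)+, simp)
qed

lemma mv_loop2:
 assumes "run (Loop 3 {2} (pop 3 ;;
  Cond 0 {2} (pop 0 ;; push 2 True ;; push 3 True ;; push 3 True) (pop 0 ;; push 2 False)))
  [x, a, rev (code t) @ b, d, y] T S'" (is "run ?L _ _ _")
 shows "run ?L [code t @ x, a, b, True # d, y] (T + 20 * length (code t)) S'"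
 using assms
proof (induction t arbitrary: x b d T)
 case Lf
 show ?case
  by (simp only: code.simps append_Cons append_Nil, rule run_mono, rule run_Loop_step[OF _ _ _ Lf[simplified code.simps rev.simps append.simps]], simp, simp, rule run_Seq, rule run_prims,
    rule run_CondF, simp, simp, rule run_Seq, (rule run_prims)+, simp)
next
 case (Nd l r)
 have "run ?L [code r @ x, a, rev (code l) @ True # b, True # d, y] (T + 20 * length (code r)) S'"
  by (rule Nd.IH(2)) (use Nd.prems in simp)
 note 1 = Nd.IH(1)[OF this]
 show ?case
  by (rule run_mono, rule run_Loop_step[OF _ _ _ 1], simp, simp, rule run_Seq, rule run_prims,
    simp only: code.simps append_Cons append_assoc,
    rule run_CondT, simp, simp, rule run_Seq, rule run_prims, rule run_Seq, rule run_prims,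
    rule run_Seq, (rule run_prims)+, simp)
qed

lemma run_mv1: "run (mv 1) [code t @ x, a, b, [], y] (30 * length (code t)) [x, rev (code t) @ a, b, [], y]"
 unfolding mv_def
 by (rule run_mono, rule run_Seq, rule run_prims, rule mv_loop1, rule run_Loop_exit, simp, simp)
  (use code_len[of t] in \<open>simp add: algebra_simps\<close>)

lemma run_mv2: "run (mv 2) [code t @ x, a, b, [], y] (30 * length (code t)) [x, a, rev (code t) @ b, [], y]"
 unfolding mv_def
 by (rule run_mono, rule run_Seq, rule run_prims, rule mv_loop2, rule run_Loop_exit, simp, simp)
  (use code_len[of t] in \<open>simp add: algebra_simps\<close>)

definition bk :: "nat => com" where
 "bk r = Loop r {1, 2} (Cond r {2} (pop r ;; push 0 True) (pop r ;; push 0 False))"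

lemma run_bk1: "run (bk 1) [x, a, b, d, y] (10 * length a + 1) [rev a @ x, [], b, d, y]"
proof (induction a arbitrary: x)
 case Nil then show ?case unfolding bk_def by simp (rule run_mono, rule run_Loop_exit, auto)
next
 case (Cons e a)
 show ?case using Cons[of "e # x"] unfolding bk_def
  by (cases e) (rule run_mono, rule run_Loop_step, simp, simp, (rule run_CondT run_CondF, simp, simp)+, rule run_Seq,
   rule run_prims, rule run_prims, simp, simp)+
qed

lemma run_bk2: "run (bk 2) [x, a, b, d, y] (10 * length b + 1) [rev b @ x, a, [], d, y]"
proof (induction b arbitrary: x)
 case Nil then show ?case unfolding bk_def by simp (rule run_mono, rule run_Loop_exit, auto)
next
 case (Cons e a)
 show ?case using Cons[of "e # x"] unfolding bk_def
  by (cases e) (rule run_mono, rule run_Loop_step, simp, simp, (rule run_CondT run_CondF, simp, simp)+, rule run_Seq,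
   rule run_prims, rule run_prims, simp, simp)+
qed

definition clear :: "nat => com" where "clear r = Loop r {1, 2} (pop r)"

lemma run_clear1: "run (clear 1) [x, a, b, d, y] (10 * length a + 1) [x, [], b, d, y]"
proof (induction a)
 case Nil then show ?case unfolding clear_def by simp (rule run_mono, rule run_Loop_exit, auto)
next
 case (Cons e a)
 show ?case using Cons unfolding clear_def
  by - (rule run_mono, rule run_Loop_step, simp, use top_simps(4)[of e a] in simp, rule run_prims, assumption, simp)
qed

definition cp :: com where
 "cp = Loop 1 {1, 2} (Cond 1 {2} (pop 1 ;; push 0 True ;; push 2 True) (pop 1 ;; push 0 False ;; push 2 False))"

lemma run_cp: "run cp [x, a, b, d, y] (12 * length a + 1) [rev a @ x, [], rev a @ b, d, y]"
proof (induction a arbitrary: x b)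
 case Nil then show ?case unfolding cp_def by simp (rule run_mono, rule run_Loop_exit, auto)
next
 case (Cons e a)
 show ?case using Cons[of "e # x" "e # b"] unfolding cp_def
  by (cases e) (rule run_mono, rule run_Loop_step, simp, simp, (rule run_CondT run_CondF, simp, simp)+, rule run_Seq,
   rule run_prims, rule run_Seq, rule run_prims, rule run_prims, simp, simp)+
qed

definition mv21 :: com where
 "mv21 = Loop 2 {1, 2} (Cond 2 {2} (pop 2 ;; push 1 True) (pop 2 ;; push 1 False))"

lemma run_mv21: "run mv21 [x, a, b, d, y] (10 * length b + 1) [x, rev b @ a, [], d, y]"
proof (induction b arbitrary: a)
 case Nil then show ?case unfolding mv21_def by simp (rule run_mono, rule run_Loop_exit, auto)
next
 case (Cons e b)
 show ?case using Cons[of "e # a"] unfolding mv21_def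
  by (cases e) (rule run_mono, rule run_Loop_step, simp, simp, (rule run_CondT run_CondF, simp, simp)+, rule run_Seq,
   rule run_prims, rule run_prims, simp, simp)+
qed

definition swap :: com where "swap = mv 1 ;; mv 2 ;; bk 1 ;; bk 2"

lemma run_swap:
 "run swap [code s @ code t @ x, [], [], [], y] (60 * (length (code s) + length (code t)))
  [code t @ code s @ x, [], [], [], y]"
proof -
 have 1: "run (bk 1) [x, rev (code s), rev (code t), [], y] (10 * length (code s) + 1) [code s @ x, [], rev (code t), [], y]"
  using run_bk1[of x "rev (code s)"] by simp
 have 2: "run (bk 2) [code s @ x, [], rev (code t), [], y] (10 * length (code t) + 1) [code t @ code s @ x, [], [], [], y]"
  using run_bk2[of "code s @ x" "[]" "rev (code t)"] by simp
 show ?thesis unfolding swap_def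
  by (rule run_mono, rule run_Seq, rule run_mv1, rule run_Seq, simp only: append_Nil2, rule run_mv2, rule run_Seq, simp only: append_Nil2, rule 1, rule 2)
   (use code_len[of t] code_len[of s] in \<open>simp add: algebra_simps\<close>)
qed

definition drop_top :: com where "drop_top = mv 1 ;; clear 1"

lemma run_drop_top: "run drop_top [code t @ x, [], [], [], y] (60 * length (code t)) [x, [], [], [], y]"
 unfolding drop_top_def
 by (rule run_mono, rule run_Seq, rule run_mv1, rule run_clear1) (use code_len[of t] in simp)

definition dup :: com where "dup = mv 1 ;; cp ;; mv21 ;; bk 1"

lemma run_dup: "run dup [code t @ x, [], [], [], y] (80 * length (code t)) [code t @ code t @ x, [], [], [], y]"
proof -
 have 1: "run cp [x, rev (code t), [], [], y] (12 * length (code t) + 1) [code t @ x, [], code t, [], y]"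
  using run_cp[of x "rev (code t)" "[]"] by simp
 have 2: "run (bk 1) [code t @ x, rev (code t), [], [], y] (10 * length (code t) + 1) [code t @ code t @ x, [], [], [], y]"
  using run_bk1[of "code t @ x" "rev (code t)" "[]"] by simp
 show ?thesis unfolding dup_def
  by (rule run_mono, rule run_Seq, rule run_mv1, rule run_Seq, simp only: append_Nil2, rule 1, rule run_Seq, rule run_mv21, simp only: append_Nil2, rule 2)
   (use code_len[of t] in \<open>simp add: algebra_simps\<close>)
qed

text \<open>Brings an element and the accumulator together above the rest of the list, as
  \<open>foldc\<close> needs them.\<close>

definition rot :: com where "rot = mv 1 ;; mv 2 ;; mv 1 ;; bk 2 ;; bk 1"

lemma run_rot:
 "run rot [code a @ code l @ code s @ x, [], [], [], y] (60 * (length (code a) + length (code l) + length (code s)))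
  [code a @ code s @ code l @ x, [], [], [], y]"
proof -
 have 1: "run (bk 2) [x, rev (code s) @ rev (code a), rev (code l), [], y] (10 * length (code l) + 1)
   [code l @ x, rev (code s) @ rev (code a), [], [], y]"
  using run_bk2[of x _ "rev (code l)"] by simp
 have 2: "run (bk 1) [code l @ x, rev (code s) @ rev (code a), [], [], y] (10 * (length (code s) + length (code a)) + 1)
   [code a @ code s @ code l @ x, [], [], [], y]"
  using run_bk1[of "code l @ x" "rev (code s) @ rev (code a)" "[]"] by simp
 show ?thesis unfolding rot_def
  by (rule run_mono, rule run_Seq, rule run_mv1, rule run_Seq, rule run_mv2, rule run_Seq, rule run_mv1, rule run_Seq,
    simp only: append_Nil2, rule 1, rule 2)
   (use code_len[of a] code_len[of l] code_len[of s] in \<open>simp add: algebra_simps\<close>)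
qed

primrec pushl :: "bool list => com" where
 "pushl [] = skip"
| "pushl (b # bs) = pushl bs ;; push 0 b"

lemma run_pushl: "run (pushl bs) [x, a, b, d, y] (4 * length bs + 1) [bs @ x, a, b, d, y]"
proof (induction bs)
 case Nil show ?case by (simp only: pushl.simps append_Nil list.size, rule run_mono, rule run_prims, simp)
next
 case (Cons c bs)
 show ?case by simp (rule run_mono, rule run_Seq, rule Cons, rule run_prims, simp)
qed

lemma valid_pushl [simp]: "valid_com 5 (pushl bs)" by (induction bs) auto

definition mark :: com where "mark = pop 3 ;; push 3 False"

text \<open>Tape 3 holds a flag that \<open>mark\<close> lowers. If the second code ends early, its
  top reads 0, which matches neither bit, and further pops do nothing; a leftover of the second code
  lowers the flag in the second loop.\<close>

definition eqt :: com where
 "eqt = mv 1 ;; mv 2 ;; push 3 True ;;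
  Loop 1 {1, 2} (Cond 1 {2} (pop 1 ;; Cond 2 {2} skip mark) (pop 1 ;; Cond 2 {1} skip mark) ;; pop 2) ;;
  Loop 2 {1, 2} (pop 2 ;; mark) ;;
  Cond 3 {2} (pop 3 ;; push 0 False ;; push 0 False ;; push 0 True) (pop 3 ;; push 0 False)"

lemma valid_tree_prims [simp]: "r < 5 ==> valid_com 5 (mv r)" "r < 5 ==> valid_com 5 (bk r)"
 "r < 5 ==> valid_com 5 (clear r)" "valid_com 5 cp"
 "valid_com 5 mv21" "valid_com 5 swap" "valid_com 5 drop_top" "valid_com 5 dup" "valid_com 5 rot" "valid_com 5 eqt"
 by (auto simp: mv_def bk_def clear_def cp_def mv21_def swap_def drop_top_def dup_def rot_def eqt_def mark_def)

lemma run_mark: "run mark [x, a, b, [f], y] 5 [x, a, b, [False], y]"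
 unfolding mark_def by (rule run_mono, rule run_Seq, rule run_prims, rule run_prims) simp

lemma run_pop2: "run (pop 2) [x, a, b, d, y] 1 [x, a, tl b, d, y]"
 using run_pop[of 2 "[x, a, b, d, y]"] by (simp add: numeral_nat)

lemma run_eq_loop1:
 "\<exists>v' f'. run (Loop 1 {1, 2} (Cond 1 {2} (pop 1 ;; Cond 2 {2} skip mark) (pop 1 ;; Cond 2 {1} skip mark) ;; pop 2))
  [x, u, v, [f], y] (20 * length u + 1) [x, [], v', [f'], y] & length v' \<le> length v &
  ((f' & v' = []) \<longleftrightarrow> (f & u = v))"
proof (induction u arbitrary: v f)
 case Nil
 have "run (Loop 1 {1, 2} (Cond 1 {2} (pop 1 ;; Cond 2 {2} skip mark) (pop 1 ;; Cond 2 {1} skip mark) ;; pop 2))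
  [x, [], v, [f], y] (20 * length [] + 1) [x, [], v, [f], y]"
  by (rule run_mono, rule run_Loop_exit) auto
 then show ?case by fastforce
next
 case (Cons e u)
 let ?L = "Loop 1 {1, 2} (Cond 1 {2} (pop 1 ;; Cond 2 {2} skip mark) (pop 1 ;; Cond 2 {1} skip mark) ;; pop 2)"
 let ?f = "f & v \<noteq> [] & hd v = e"
 have s: "run (Cond 1 {2} (pop 1 ;; Cond 2 {2} skip mark) (pop 1 ;; Cond 2 {1} skip mark) ;; pop 2)
  [x, e # u, v, [f], y] 15 [x, u, tl v, [?f], y]"
 proof -
  have k: "run (Cond 2 {if e then 2 else 1} skip mark) [x, u, v, [f], y] 6 [x, u, v, [?f], y]"
  proof (cases "v \<noteq> [] & hd v = e")
   case True
   then have t: "top v = (if e then 2 else 1)" by (cases v) (auto simp: top_def bit_symbol_def)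
   have "run (Cond 2 {if e then 2 else 1} skip mark) [x, u, v, [f], y] (1 + 1) [x, u, v, [f], y]"
    by (rule run_CondT, simp, use t in simp, rule run_prims)
   then show ?thesis using True by (auto intro: run_mono)
  next
   case False
   then have t: "top v \<noteq> (if e then 2 else 1)" by (cases v) (auto simp: top_def bit_symbol_def)
   have "run (Cond 2 {if e then 2 else 1} skip mark) [x, u, v, [f], y] (5 + 1) [x, u, v, [False], y]"
    by (rule run_CondF) (use t in \<open>auto intro: run_mark\<close>)
   then show ?thesis using False by auto
  qed
  show ?thesis
  proof (cases e)
   case True
   then have k': "run (Cond 2 {2} skip mark) [x, u, v, [f], y] 6 [x, u, v, [?f], y]" using k by simp
   show ?thesis
    by (rule run_mono, rule run_Seq, rule run_CondT, simp, use True in simp, rule run_Seq, rule run_prims,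
      rule k', rule run_pop2, simp)
  next
   case False
   then have k': "run (Cond 2 {1} skip mark) [x, u, v, [f], y] 6 [x, u, v, [?f], y]" using k by simp
   show ?thesis
    by (rule run_mono, rule run_Seq, rule run_CondF, simp, use False in simp, rule run_Seq, rule run_prims,
      rule k', rule run_pop2, simp)
  qed
 qed
 obtain v' f' where 1: "run ?L [x, u, tl v, [?f], y] (20 * length u + 1) [x, [], v', [f'], y]" "length v' \<le> length (tl v)"
  "(f' & v' = []) \<longleftrightarrow> (?f & u = tl v)" using Cons[of "tl v" ?f] by blast
 have "run ?L [x, e # u, v, [f], y] (20 * length (e # u) + 1) [x, [], v', [f'], y]"
  by (rule run_mono, rule run_Loop_step[OF _ _ s 1(1)]) (use top_simps(4)[of e u] in auto)
 moreover have "(?f & u = tl v) \<longleftrightarrow> (f & e # u = v)" by (cases v) auto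
 moreover have "length v' \<le> length v" using 1(2) by simp
 ultimately show ?case using 1(3) by blast
qed

lemma run_eq_loop2:
 "run (Loop 2 {1, 2} (pop 2 ;; mark)) [x, a, v, [f], y] (20 * length v + 1) [x, a, [], [f & v = []], y]"
proof (induction v arbitrary: f)
 case Nil then show ?case by simp (rule run_mono, rule run_Loop_exit, auto)
next
 case (Cons e v)
 have "run (Loop 2 {1, 2} (pop 2 ;; mark)) [x, a, v, [False], y] (20 * length v + 1) [x, a, [], [False], y]"
  using Cons[of False] by simp
 then show ?case
  by - (simp, rule run_mono, rule run_Loop_step, simp, use top_simps(4)[of e v] in simp, rule run_Seq, rule run_prims,
   rule run_mark, assumption, simp)
qed

lemma run_eqt:
 "run eqt [code s @ code t @ x, [], [], [], y] (100 * (length (code s) + length (code t)))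
  [code (if s = t then Nd Lf Lf else Lf) @ x, [], [], [], y]"
proof -
 obtain v f where 1: "run (Loop 1 {1, 2} (Cond 1 {2} (pop 1 ;; Cond 2 {2} skip mark) (pop 1 ;; Cond 2 {1} skip mark) ;; pop 2))
  [x, rev (code s), rev (code t), [True], y] (20 * length (code s) + 1) [x, [], v, [f], y]"
  "length v \<le> length (code t)" "(f & v = []) \<longleftrightarrow> rev (code s) = rev (code t)"
  using run_eq_loop1[of x "rev (code s)" "rev (code t)" True y] by auto
 have e: "(f & v = []) \<longleftrightarrow> s = t" using 1(3) code_append_inj[of s "[]" t "[]"] by auto
 have 2: "run (Cond 3 {2} (pop 3 ;; push 0 False ;; push 0 False ;; push 0 True) (pop 3 ;; push 0 False))
  [x, [], [], [f & v = []], y] 14 [code (if s = t then Nd Lf Lf else Lf) @ x, [], [], [], y]"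
 proof (cases "s = t")
  case True
  then show ?thesis
   by (simp add: e) (rule run_mono, rule run_CondT, simp, simp, rule run_Seq, rule run_prims, rule run_Seq, rule run_prims,
    rule run_Seq, rule run_prims, rule run_prims, simp)
 next
  case False
  then show ?thesis
   by (simp add: e) (rule run_mono, rule run_CondF, simp, simp, rule run_Seq, rule run_prims, rule run_prims, simp)
 qed
 show ?thesis unfolding eqt_def
  by (rule run_mono, rule run_Seq, rule run_mv1, rule run_Seq, simp only: append_Nil2, rule run_mv2, rule run_Seq, simp only: append_Nil2, rule run_prims,
    rule run_Seq, rule 1, rule run_Seq, rule run_eq_loop2, rule 2)
   (use code_len[of t] code_len[of s] 1(2) in \<open>simp add: algebra_simps\<close>)
qed

section \<open>Polynomial-time functions on structured data\<close>

class codable =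
 fixes tr :: "'a => tree"
 assumes tr_inj: "tr a = tr b ==> a = b"

lemma tr_eq_iff [simp]: "tr a = tr b \<longleftrightarrow> a = b"
 using tr_inj by blast

instantiation bool :: codable
begin
definition tr_bool :: "bool => tree" where "tr_bool b = (if b then Nd Lf Lf else Lf)"
instance by standard (auto simp: tr_bool_def split: if_splits)
end

text \<open>Numbers are unary, with the tree of a list of leaves. Polynomial bounds are thus in the
  value, which fits instances whose parameter and number of vertices are written in unary.\<close>

instantiation nat :: codable
begin
primrec tr_nat :: "nat => tree" where
 "tr_nat 0 = Lf"
| "tr_nat (Suc n) = Nd Lf (tr_nat n)"
instance
proof
 show "tr a = tr b ==> a = b" for a b :: nat
  by (induction a arbitrary: b) (metis tr_nat.simps tree.distinct(1) tree.inject not0_implies_Suc)+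
qed
end

instantiation list :: (codable) codable
begin
primrec tr_list :: "'a list => tree" where
 "tr_list [] = Lf"
| "tr_list (x # xs) = Nd (tr x) (tr_list xs)"
instance
proof
 fix a b :: "'a list"
 show "tr a = tr b ==> a = b"
 proof (induction a arbitrary: b)
  case Nil then show ?case by (cases b) auto
 next
  case (Cons x a) then show ?case by (cases b) auto
 qed
qed
end

instantiation prod :: (codable, codable) codable
begin
definition tr_prod :: "'a \<times> 'b => tree" where "tr_prod p = Nd (tr (fst p)) (tr (snd p))"
instance by standard (auto simp: tr_prod_def prod_eq_iff)
end

section \<open>Sizes of values and polynomial bounds\<close>

definition esz :: "'a::codable => nat" where "esz v = length (code (tr v))"

lemma esz_simps [simp]:
 "esz [] = 1" "esz (x # xs) = Suc (esz x + esz xs)" "esz (a, b) = Suc (esz a + esz b)"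
 "esz n = 2 * n + 1" "esz b' = (if b' then 3 else 1)"
 by (simp_all add: esz_def tr_prod_def tr_bool_def) (induction n, auto)

lemma esz_pos [simp]: "1 \<le> esz v" "0 < esz v" "Suc 0 \<le> esz v" "esz v \<noteq> 0"
 using code_len[of "tr v"] by (auto simp: esz_def)

lemma esz_append: "Suc (esz (xs @ ys)) = esz xs + esz ys"
 by (induction xs) auto

lemma esz_append_le: "esz (xs @ ys) \<le> esz xs + esz ys"
 using esz_append[of xs ys] by linarith

lemma esz_rev [simp]: "esz (rev xs) = esz xs"
proof (induction xs)
 case (Cons a xs) then show ?case using esz_append[of "rev xs" "[a]"] by simp
qed simp

lemma esz_mem: "a \<in> set xs ==> esz a < esz xs"
 by (induction xs) auto

lemma esz_length: "length xs < esz xs"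
proof (induction xs)
 case (Cons a xs) then show ?case by simp
qed simp

lemma esz_drop: "esz (drop n xs) \<le> esz xs"
 using esz_append[of "take n xs" "drop n xs"] esz_pos(1)[of "take n xs"] unfolding append_take_drop_id by linarith

text \<open>A single monomial suffices: as \<open>esz\<close> is at least 1, sums are again
  dominated by monomials.\<close>

definition bnd :: "('a::codable => nat) => bool" where
 "bnd g \<longleftrightarrow> (\<exists>K d. \<forall>v. g v \<le> K * esz v ^ d)"

named_theorems bnd_intros

lemma bnd_mono: "bnd h ==> (\<And>v. g v \<le> h v) ==> bnd g"
 unfolding bnd_def by (meson le_trans)

lemma bnd_const [bnd_intros]: "bnd (%v. c)"
 unfolding bnd_def by (intro exI[of _ c] exI[of _ 0]) simp

lemma bnd_esz_id [bnd_intros]: "bnd (%v. esz v)"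
 unfolding bnd_def by (intro exI[of _ 1]) simp

lemma bnd_add [bnd_intros]:
 assumes "bnd g" "bnd h" shows "bnd (%v. g v + h v)"
proof -
 obtain K d K' d' where *: "\<And>v. g v \<le> K * esz v ^ d" "\<And>v. h v \<le> K' * esz v ^ d'"
  using assms unfolding bnd_def by blast
 have "g v + h v \<le> (K + K') * esz v ^ (d + d')" for v
 proof -
  have "g v \<le> K * esz v ^ (d + d')" "h v \<le> K' * esz v ^ (d + d')"
   by (meson * le_trans mult_le_mono2 power_increasing le_add1 le_add2 esz_pos(1))+
  then show ?thesis by (simp add: algebra_simps)
 qed
 then show ?thesis unfolding bnd_def by blast
qed

lemma bnd_mult [bnd_intros]:
 assumes "bnd g" "bnd h" shows "bnd (%v. g v * h v)"
proof -
 obtain K d K' d' where *: "\<And>v. g v \<le> K * esz v ^ d" "\<And>v. h v \<le> K' * esz v ^ d'"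
  using assms unfolding bnd_def by blast
 have "g v * h v \<le> (K * K') * esz v ^ (d + d')" for v
  using mult_le_mono[OF *(1)[of v] *(2)[of v]] by (simp add: power_add ac_simps)
 then show ?thesis unfolding bnd_def by blast
qed

lemma bnd_Suc [bnd_intros]: "bnd g ==> bnd (%v. Suc (g v))"
 using bnd_add[OF _ bnd_const[of 1]] by simp

lemma bnd_power [bnd_intros]: "bnd g ==> bnd (%v. g v ^ d)"
 by (induction d) (auto intro!: bnd_intros)

lemma bnd_comp:
 assumes "bnd g" "bnd (%v. esz (f v))" shows "bnd (%v. g (f v))"
proof -
 obtain K d where *: "\<And>v. g v \<le> K * esz v ^ d" using assms unfolding bnd_def by blast
 have "bnd (%v. K * esz (f v) ^ d)" using assms(2) by (intro bnd_intros)
 then show ?thesis by (rule bnd_mono) (rule *)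
qed

definition computes :: "com => ('a::codable => 'b::codable) => ('a => nat) => bool" where
 "computes c f T \<longleftrightarrow> valid_com 5 c &
  (\<forall>v x y. run c [code (tr v) @ x, [], [], [], y] (T v) [code (tr (f v)) @ x, [], [], [], y])"

text \<open>The size of the result is bounded along with the time: in a composition it is the input
  size of the second program.\<close>

definition pt :: "('a::codable => 'b::codable) => bool" where
 "pt f \<longleftrightarrow> (\<exists>c T. computes c f T & bnd T) & bnd (%v. esz (f v))"

named_theorems pt_intros

lemma ptI: "computes c f T ==> bnd T ==> bnd (%v. esz (f v)) ==> pt f"
 unfolding pt_def by blast

lemma pt_bnd: "pt f ==> bnd (%v. esz (f v))"
 by (simp add: pt_def)

lemma pt_cong: "pt f ==> (\<And>v. g v = f v) ==> pt g"
 by (metis ext)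

lemma pt_comp:
 assumes "pt g" "pt f" shows "pt (%v. g (f v))"
proof -
 obtain cf Tf cg Tg where 1: "computes cf f Tf" "bnd Tf" "computes cg g Tg" "bnd Tg"
  using assms unfolding pt_def by blast
 have "computes (cf ;; cg) (%v. g (f v)) (%v. Tf v + Tg (f v) + 1)"
  using 1 unfolding computes_def by (intro conjI allI, simp) (rule run_Seq; blast)
 moreover have "bnd (%v. esz (g (f v)))" by (rule bnd_comp[OF pt_bnd[OF assms(1)] pt_bnd[OF assms(2)]])
 moreover have "bnd (%v. Tf v + Tg (f v) + 1)"
  by (intro bnd_intros 1 bnd_comp[OF 1(4)] pt_bnd[OF assms(2)])
 ultimately show ?thesis by (blast intro: ptI)
qed

text \<open>Change of type for free: values with the same tree are the same data for a
  program.\<close>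

lemma pt_same: "(\<And>v. tr (f v) = tr v) ==> pt f"
proof -
 assume *: "\<And>v. tr (f v) = tr v"
 then have "computes skip f (%v. 1)" "\<And>v. esz (f v) = esz v"
  by (simp_all add: computes_def run_skip esz_def del: One_nat_def)
 then show ?thesis by (intro ptI[of skip f "%v. 1"]) (auto intro: bnd_intros)
qed

lemma pt_id [pt_intros]: "pt (%v. v)"
 by (rule pt_same) simp

lemma pt_const [pt_intros]: "pt (%v. c)"
proof (rule ptI)
 show "computes (drop_top ;; pushl (code (tr c))) (%v::'a. c) (%v. 60 * esz v + (4 * esz c + 1) + 1)"
  unfolding computes_def esz_def by (intro conjI allI, simp, rule run_Seq, rule run_drop_top, rule run_pushl)
qed (intro bnd_intros)+

lemma pt_Pair [pt_intros]:
 assumes "pt f" "pt g" shows "pt (%v. (f v, g v))"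
proof -
 obtain cf Tf cg Tg where 1: "computes cf f Tf" "bnd Tf" "computes cg g Tg" "bnd Tg"
  using assms unfolding pt_def by blast
 have b: "bnd (%v. esz (f v))" "bnd (%v. esz (g v))" by (intro pt_bnd assms)+
 show ?thesis
 proof (rule ptI)
  show "computes (dup ;; cf ;; swap ;; cg ;; swap ;; push 0 True) (%v. (f v, g v))
   (%v. 80 * esz v + (Tf v + (60 * (esz (f v) + esz v) + (Tg v + (60 * (esz (g v) + esz (f v)) + 3 + 1) + 1) + 1) + 1) + 1)"
   unfolding computes_def
  proof (intro conjI allI)
   fix v :: 'a and x y
   have c: "run cf [code (tr v) @ code (tr v) @ x, [], [], [], y] (Tf v) [code (tr (f v)) @ code (tr v) @ x, [], [], [], y]"
    "run cg [code (tr v) @ code (tr (f v)) @ x, [], [], [], y] (Tg v) [code (tr (g v)) @ code (tr (f v)) @ x, [], [], [], y]"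
    using 1 unfolding computes_def by blast+
   have p: "run (push 0 True) [code (tr (f v)) @ code (tr (g v)) @ x, [], [], [], y] 3 [code (tr (f v, g v)) @ x, [], [], [], y]"
    using run_prims(1)[of True "code (tr (f v)) @ code (tr (g v)) @ x"] by (simp add: tr_prod_def)
   show "run (dup ;; cf ;; swap ;; cg ;; swap ;; push 0 True) [code (tr v) @ x, [], [], [], y]
   (80 * esz v + (Tf v + (60 * (esz (f v) + esz v) + (Tg v + (60 * (esz (g v) + esz (f v)) + 3 + 1) + 1) + 1) + 1) + 1)
   [code (tr (f v, g v)) @ x, [], [], [], y]"
    unfolding esz_def by (rule run_Seq, rule run_dup, rule run_Seq, rule c, rule run_Seq, rule run_swap, rule run_Seq, rule c, rule run_Seq, rule run_swap, rule p)
  qed (use 1 in \<open>auto simp: computes_def\<close>)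
 qed (auto intro!: bnd_intros 1 b)
qed

text \<open>Covers \<open>fst\<close> and \<open>hd\<close> alike, with \<open>d\<close> as the
  value at a leaf; \<open>pt_right\<close> does the same for \<open>snd\<close>, \<open>tl\<close>
  and the predecessor.\<close>

lemma pt_left:
 assumes "\<And>v. (\<exists>b. tr v = Nd (tr (f v)) b) \<or> (tr v = Lf & f v = d)"
 shows "pt f"
proof (rule ptI)
 let ?T = "%v::'a. 130 * esz v + 4 * esz d + 20"
 show "computes (Cond 0 {2} (pop 0 ;; swap ;; drop_top) (pop 0 ;; pushl (code (tr d)))) f ?T"
  unfolding computes_def
 proof (intro conjI allI)
  fix v :: 'a and x y
  show "run (Cond 0 {2} (pop 0 ;; swap ;; drop_top) (pop 0 ;; pushl (code (tr d)))) [code (tr v) @ x, [], [], [], y] (?T v)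
   [code (tr (f v)) @ x, [], [], [], y]"
   using assms[of v]
  proof
   assume "\<exists>b. tr v = Nd (tr (f v)) b"
   then obtain b where b: "tr v = Nd (tr (f v)) b" by blast
   have "esz v = Suc (length (code (tr (f v))) + length (code b))" by (simp add: esz_def b)
   then show ?thesis unfolding b
    by - (simp only: code.simps append_Cons append_assoc, rule run_mono, rule run_CondT, simp, simp, rule run_Seq, rule run_prims, rule run_Seq, rule run_swap,
     rule run_drop_top, simp)
  next
   assume "tr v = Lf & f v = d"
   then show ?thesis
    by (simp only: code.simps append_Cons append_Nil)
     (rule run_mono, rule run_CondF, simp, simp, rule run_Seq, rule run_prims, rule run_pushl, simp add: esz_def)
  qed
 qed simp
 have "esz (f v) \<le> esz v + esz d" for v
  using assms[of v] by (auto simp: esz_def)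
 then show "bnd (%v. esz (f v))" by (rule bnd_mono[rotated]) (intro bnd_intros)
qed (intro bnd_intros)

lemma pt_right:
 assumes "\<And>v. (\<exists>b. tr v = Nd b (tr (f v))) \<or> (tr v = Lf & f v = d)"
 shows "pt f"
proof (rule ptI)
 let ?T = "%v::'a. 130 * esz v + 4 * esz d + 20"
 show "computes (Cond 0 {2} (pop 0 ;; drop_top) (pop 0 ;; pushl (code (tr d)))) f ?T"
  unfolding computes_def
 proof (intro conjI allI)
  fix v :: 'a and x y
  show "run (Cond 0 {2} (pop 0 ;; drop_top) (pop 0 ;; pushl (code (tr d)))) [code (tr v) @ x, [], [], [], y] (?T v)
   [code (tr (f v)) @ x, [], [], [], y]"
   using assms[of v]
  proof
   assume "\<exists>b. tr v = Nd b (tr (f v))"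
   then obtain b where b: "tr v = Nd b (tr (f v))" by blast
   have "esz v = Suc (length (code (tr (f v))) + length (code b))" by (simp add: esz_def b)
   then show ?thesis unfolding b
    by - (simp only: code.simps append_Cons append_assoc, rule run_mono, rule run_CondT, simp, simp, rule run_Seq, rule run_prims,
     rule run_drop_top, simp)
  next
   assume "tr v = Lf & f v = d"
   then show ?thesis
    by (simp only: code.simps append_Cons append_Nil)
     (rule run_mono, rule run_CondF, simp, simp, rule run_Seq, rule run_prims, rule run_pushl, simp add: esz_def)
  qed
 qed simp
 have "esz (f v) \<le> esz v + esz d" for v
  using assms[of v] by (auto simp: esz_def)
 then show "bnd (%v. esz (f v))" by (rule bnd_mono[rotated]) (intro bnd_intros)
qed (intro bnd_intros)

lemma pt_fst [pt_intros]: "pt f ==> pt (%v. fst (f v))"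
 by (rule pt_comp[of fst]) (rule pt_left[of _ undefined], simp add: tr_prod_def)

lemma pt_snd [pt_intros]: "pt f ==> pt (%v. snd (f v))"
 by (rule pt_comp[of snd]) (rule pt_right[of _ undefined], simp add: tr_prod_def)

lemma pt_hd [pt_intros]: "pt f ==> pt (%v. hd (f v))"
proof (rule pt_comp[of hd])
 show "pt (hd :: 'b list => 'b)"
  by (rule pt_left[of _ "hd []"]) (case_tac v; simp)
qed

lemma pt_tl [pt_intros]: "pt f ==> pt (%v. tl (f v))"
proof (rule pt_comp[of tl])
 show "pt (tl :: 'b list => 'b list)"
  by (rule pt_right[of _ "[]"]) (case_tac v; simp)
qed

lemma pt_pred [pt_intros]: "pt f ==> pt (%v. f v - Suc 0)"
proof (rule pt_comp[of "%n. n - Suc 0"])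
 show "pt (%n. n - Suc 0)"
  by (rule pt_right[of _ "0"]) (case_tac v; simp)
qed

lemma pt_Cons [pt_intros]: "pt f ==> pt g ==> pt (%v. f v # g v)"
 using pt_comp[OF pt_same[of "%p. fst p # snd p"] pt_Pair[of f g]] by (simp add: tr_prod_def)

lemma pt_Suc [pt_intros]: "pt f ==> pt (%v. Suc (f v))"
proof -
 assume f: "pt f"
 \<comment> \<open>As a tree, \<open>n\<close> is a list of \<open>n\<close> zeros, so the successor
   is a \<open>Cons\<close>.\<close>
 have 1: "pt (%n::nat. replicate n (0::nat))"
 proof (rule pt_same)
  show "tr (replicate n (0::nat)) = tr n" for n by (induction n) auto
 qed
 have 2: "pt (%l::nat list. 0 # l)" by (intro pt_intros)
 have 3: "pt (%v. 0 # replicate (f v) (0::nat))" by (rule pt_comp[OF 2 pt_comp[OF 1 f]])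
 obtain c T where c: "computes c (%v. 0 # replicate (f v) (0::nat)) T" "bnd T" using 3 unfolding pt_def by blast
 have "tr (0 # replicate n (0::nat)) = tr (Suc n)" for n by (induction n) auto
 then have "computes c (%v. Suc (f v)) T" using c unfolding computes_def by metis
 moreover have "bnd (%v. esz (Suc (f v)))" using pt_bnd[OF f]
  by (rule bnd_mono[OF bnd_add[OF _ bnd_const[of 2]]]) simp
 ultimately show ?thesis using c(2) ptI by blast
qed

lemma pt_If [pt_intros]:
 assumes "pt b" "pt f" "pt g" shows "pt (%v. if b v then f v else g v)"
proof -
 obtain cf Tf cg Tg cb Tb where 1: "computes cf f Tf" "bnd Tf" "computes cg g Tg" "bnd Tg" "computes cb b Tb" "bnd Tb"
  using assms unfolding pt_def by blast
 have bb: "bnd (%v. esz (f v))" "bnd (%v. esz (g v))" by (intro pt_bnd assms)+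
 let ?c = "dup ;; cb ;; Cond 0 {2} (pop 0 ;; pop 0 ;; pop 0 ;; cf) (pop 0 ;; cg)"
 let ?T = "%v. 80 * esz v + Tb v + Tf v + Tg v + 20"
 show ?thesis
 proof (rule ptI)
  show "computes ?c (%v. if b v then f v else g v) ?T"
   unfolding computes_def
  proof (intro conjI allI)
   fix v :: 'a and x y
   have c: "run cb [code (tr v) @ code (tr v) @ x, [], [], [], y] (Tb v) [code (tr (b v)) @ code (tr v) @ x, [], [], [], y]"
    "run cf [code (tr v) @ x, [], [], [], y] (Tf v) [code (tr (f v)) @ x, [], [], [], y]"
    "run cg [code (tr v) @ x, [], [], [], y] (Tg v) [code (tr (g v)) @ x, [], [], [], y]"
    using 1 unfolding computes_def by blast+
   have "run (Cond 0 {2} (pop 0 ;; pop 0 ;; pop 0 ;; cf) (pop 0 ;; cg)) [code (tr (b v)) @ code (tr v) @ x, [], [], [], y] (Tf v + Tg v + 10)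
    [code (tr (if b v then f v else g v)) @ x, [], [], [], y]"
   proof (cases "b v")
    case True
    show ?thesis
     by (simp only: True tr_bool_def if_True code.simps append_Cons append_Nil)
     (rule run_mono, rule run_CondT, simp, simp, rule run_Seq, rule run_prims, rule run_Seq, rule run_prims,
      rule run_Seq, rule run_prims, rule c, simp)
   next
    case False
    show ?thesis
     by (simp only: False tr_bool_def if_False code.simps append_Cons append_Nil)
     (rule run_mono, rule run_CondF, simp, simp, rule run_Seq, rule run_prims, rule c, simp)
   qed
   then show "run ?c [code (tr v) @ x, [], [], [], y] (?T v) [code (tr (if b v then f v else g v)) @ x, [], [], [], y]"
    by - (rule run_mono, rule run_Seq, rule run_dup, rule run_Seq, rule c, assumption, simp add: esz_def)
  qed (use 1 in \<open>auto simp: computes_def\<close>)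
  show "bnd (%v. esz (if b v then f v else g v))"
   by (rule bnd_mono[OF bnd_add[OF bb]]) auto
 qed (intro bnd_intros 1)
qed

lemma pt_eq [pt_intros]:
 assumes "pt f" "pt g" shows "pt (%v. f v = g v)"
proof -
 have "pt (%p::'b \<times> 'b. fst p = snd p)"
 proof (rule ptI)
  show "computes (pop 0 ;; eqt) (%p::'b \<times> 'b. fst p = snd p) (%p. 100 * esz p + 2)"
   unfolding computes_def
  proof (intro conjI allI)
   fix v :: "'b \<times> 'b" and x y
   obtain a b where v: "v = (a, b)" by fastforce
   have t: "tr (a = b) = (if tr a = tr b then Nd Lf Lf else Lf)" by (simp add: tr_bool_def)
   show "run (pop 0 ;; eqt) [code (tr v) @ x, [], [], [], y] (100 * esz v + 2) [code (tr (fst v = snd v)) @ x, [], [], [], y]"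
    unfolding v tr_prod_def fst_conv snd_conv t
    by (simp only: code.simps append_Cons append_assoc)
     (rule run_mono, rule run_Seq, rule run_prims, rule run_eqt, simp add: esz_def tr_prod_def)
  qed simp
  show "bnd (%v::'b \<times> 'b. esz (fst v = snd v))"
   by (rule bnd_mono[OF bnd_const[of 3]]) simp
 qed (intro bnd_intros)
 from pt_comp[OF this pt_Pair[OF assms]] show ?thesis by simp
qed

section \<open>Folding over lists\<close>

definition foldc :: "com => com" where
 "foldc c = Loop 0 {2} (pop 0 ;; rot ;; push 0 True ;; c ;; swap)"

text \<open>\<open>M\<close> bounds the cost of one round only for accumulators that actually occur,
  those after a prefix \<open>l1\<close>. The \<open>False\<close> left on top is the code of the
  exhausted list.\<close>

lemma run_foldc:
 assumes "computes c (%p. G (fst p) (snd p)) T"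
  and "\<And>l1 a l2. l = l1 @ a # l2 ==>
   T (a, fold G l1 s) + 60 * (2 * esz l + esz (fold G l1 s) + esz (fold G (l1 @ [a]) s)) + 20 \<le> M"
 shows "run (foldc c) [code (tr l) @ code (tr s) @ x, [], [], [], y] (length l * M + 1)
  [False # code (tr (fold G l s)) @ x, [], [], [], y]"
 using assms(2)
proof (induction l arbitrary: s)
 case Nil
 then show ?case unfolding foldc_def by simp (rule run_mono, rule run_Loop_exit, auto)
next
 case (Cons a l)
 have IH: "run (foldc c) [code (tr l) @ code (tr (G a s)) @ x, [], [], [], y] (length l * M + 1)
  [False # code (tr (fold G l (G a s))) @ x, [], [], [], y]"
 proof (rule Cons.IH)
  fix l1 b l2 assume "l = l1 @ b # l2"
  then show "T (b, fold G l1 (G a s)) + 60 * (2 * esz l + esz (fold G l1 (G a s)) + esz (fold G (l1 @ [b]) (G a s))) + 20 \<le> M"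
   using Cons.prems[of "a # l1" b l2] by simp
 qed
 have c: "run c [code (tr (a, s)) @ code (tr l) @ x, [], [], [], y] (T (a, s)) [code (tr (G a s)) @ code (tr l) @ x, [], [], [], y]"
  using assms(1) unfolding computes_def by (metis fst_conv snd_conv)
 have c': "run c [True # code (tr a) @ code (tr s) @ code (tr l) @ x, [], [], [], y] (T (a, s)) [code (tr (G a s)) @ code (tr l) @ x, [], [], [], y]"
  using c by (simp add: tr_prod_def)
 have M: "T (a, s) + 60 * (2 * esz (a # l) + esz s + esz (G a s)) + 20 \<le> M" using Cons.prems[of "[]" a l] by simp
 have "run (pop 0 ;; rot ;; push 0 True ;; c ;; swap) [code (tr (a # l)) @ code (tr s) @ x, [], [], [], y] (M - 1)
  [code (tr l) @ code (tr (G a s)) @ x, [], [], [], y]"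
  by (simp only: tr_list.simps code.simps append_Cons append_assoc)
   (rule run_mono, rule run_Seq, rule run_prims, rule run_Seq, rule run_rot, rule run_Seq, rule run_prims, rule run_Seq, rule c',
    rule run_swap, use M in \<open>simp add: esz_def algebra_simps\<close>)
 then have "run (foldc c) [code (tr (a # l)) @ code (tr s) @ x, [], [], [], y] ((M - 1) + (length l * M + 1) + 1)
  [False # code (tr (fold G l (G a s))) @ x, [], [], [], y]"
  using IH unfolding foldc_def by - (rule run_Loop_step, auto)
 then show ?case using M by (auto intro: run_mono)
qed

text \<open>A polynomial step may square the size in every round, so iteration is safe only if all
  intermediate accumulators obey one polynomial bound \<open>B\<close>.\<close>

lemma pt_fold:
 assumes F: "pt (%p. F (fst p) (fst (snd p)) (snd (snd p)))" and g: "pt g" and h: "pt h"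
  and B: "bnd B" and FB: "\<And>x l1 l2. g x = l1 @ l2 ==> esz (fold (F x) l1 (h x)) \<le> B x"
 shows "pt (%x. fold (F x) (g x) (h x))"
proof -
 \<comment> \<open>The loop body sees only the element and the accumulator; the parameter
   \<open>x\<close> therefore travels inside the accumulator.\<close>
 define G where "G = (%a s. (fst s, F (fst s) a (snd s)))"
 have fG: "fold G l (x, s) = (x, fold (F x) l s)" for l x s
  by (induction l arbitrary: s) (auto simp: G_def)
 have "pt (%p. F (fst (snd p)) (fst p) (snd (snd p)))"
  using pt_comp[OF F, of "%p. (fst (snd p), (fst p, snd (snd p)))"] by (simp add: pt_intros)
 then have "pt (%p. G (fst p) (snd p))" unfolding G_def by (intro pt_intros)
 then obtain c T where c: "computes c (%p. G (fst p) (snd p)) T" "bnd T" unfolding pt_def by blast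
 then obtain K d where K: "\<And>p. T p \<le> K * esz p ^ d" unfolding bnd_def by blast
 let ?m = "%x. esz (g x) + esz x + B x + 2"
 let ?M = "%x. K * ?m x ^ d + 60 * (2 * esz (g x) + (Suc (esz x + B x)) + Suc (esz x + B x)) + 20"
 have "pt (%x. (g x, (x, h x)))" by (intro pt_intros g h)
 then obtain c0 T0 where c0: "computes c0 (%x. (g x, (x, h x))) T0" "bnd T0" unfolding pt_def by blast
 have "pt (%x. (x, fold (F x) (g x) (h x)))"
 proof (rule ptI)
  let ?c = "c0 ;; pop 0 ;; foldc c ;; pop 0"
  let ?T = "%x. T0 x + (1 + ((esz (g x) * ?M x + 1) + 1 + 1) + 1) + 1"
  show "computes ?c (%x. (x, fold (F x) (g x) (h x))) ?T"
   unfolding computes_def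
  proof (intro conjI allI)
   fix v x y
   have 0: "run c0 [code (tr v) @ x, [], [], [], y] (T0 v) [True # code (tr (g v)) @ code (tr (v, h v)) @ x, [], [], [], y]"
    using c0(1) unfolding computes_def by (simp add: tr_prod_def)
   have 1: "run (foldc c) [code (tr (g v)) @ code (tr (v, h v)) @ x, [], [], [], y] (length (g v) * ?M v + 1)
    [False # code (tr (fold G (g v) (v, h v))) @ x, [], [], [], y]"
   proof (rule run_foldc[OF c(1)])
    fix l1 a l2 assume l: "g v = l1 @ a # l2"
    have 2: "esz (fold (F v) l1 (h v)) \<le> B v" "esz (fold (F v) (l1 @ [a]) (h v)) \<le> B v"
     using FB[of v l1 "a # l2"] FB[of v "l1 @ [a]" l2] l by auto
    have "esz a \<le> esz (g v)" using esz_mem[of a "g v"] l by auto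
    then have "esz (a, fold G l1 (v, h v)) \<le> ?m v" using 2 by (simp add: fG)
    then have "T (a, fold G l1 (v, h v)) \<le> K * ?m v ^ d"
     by (intro order_trans[OF K] mult_le_mono power_mono) auto
    then show "T (a, fold G l1 (v, h v)) + 60 * (2 * esz (g v) + esz (fold G l1 (v, h v)) + esz (fold G (l1 @ [a]) (v, h v))) + 20 \<le> ?M v"
     using 2 by (simp add: fG del: fold_append fold_simps)
   qed
   then have 1: "run (foldc c) [code (tr (g v)) @ code (tr (v, h v)) @ x, [], [], [], y] (esz (g v) * ?M v + 1)
    [False # code (tr (v, fold (F v) (g v) (h v))) @ x, [], [], [], y]"
    using esz_length[of "g v"] unfolding fG by (elim run_mono) (simp add: mult_le_mono1)
   show "run ?c [code (tr v) @ x, [], [], [], y] (?T v) [code (tr (v, fold (F v) (g v) (h v))) @ x, [], [], [], y]"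
    by (rule run_Seq, rule 0, rule run_Seq, rule run_prims, rule run_Seq, rule 1, rule run_prims)
  qed (use c c0 in \<open>auto simp: computes_def foldc_def\<close>)
  show "bnd ?T" by (intro bnd_intros c0 pt_bnd[OF g] B)
  have "esz (x, fold (F x) (g x) (h x)) \<le> Suc (esz x + B x)" for x
   using FB[of x "g x" "[]"] by simp
  then show "bnd (%x. esz (x, fold (F x) (g x) (h x)))"
   by (rule bnd_mono[rotated]) (intro bnd_intros B)
 qed
 from pt_snd[OF this] show ?thesis by simp
qed

lemma bnd_elem:
 assumes "bnd (H :: 'x::codable \<times> 'a::codable => nat)" "pt g"
 shows "\<exists>D. bnd D & (\<forall>x. \<forall>a \<in> set (g x). H (x, a) \<le> D x)"
proof -
 obtain K d where K: "\<And>p. H p \<le> K * esz p ^ d" using assms(1) unfolding bnd_def by blast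
 have "H (x, a) \<le> K * (Suc (esz x + esz (g x))) ^ d" if "a \<in> set (g x)" for x a
  using esz_mem[OF that] by (intro order_trans[OF K] mult_le_mono power_mono) auto
 moreover have "bnd (%x. K * (Suc (esz x + esz (g x))) ^ d)" by (intro bnd_intros pt_bnd[OF assms(2)])
 ultimately show ?thesis by blast
qed

text \<open>Growth by an amount that depends on the parameter and the element, but not on the
  accumulator, adds up to a polynomial.\<close>

lemma pt_fold_add:
 assumes F: "pt (%p. F (fst p) (fst (snd p)) (snd (snd p)))" and g: "pt g" and h: "pt h"
  and H: "bnd (H :: 'x::codable \<times> 'a::codable => nat)"
  and FH: "\<And>x a s. a \<in> set (g x) ==> esz (F x a s) \<le> esz s + H (x, a)"
 shows "pt (%x. fold (F x) (g x) (h x))"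
proof -
 obtain D where D: "bnd D" "\<And>x a. a \<in> set (g x) ==> H (x, a) \<le> D x" using bnd_elem[OF H g] by blast
 have *: "esz (fold (F x) l s) \<le> esz s + length l * D x" if "set l \<subseteq> set (g x)" for x l s
  using that
 proof (induction l arbitrary: s)
  case (Cons a l)
  have "esz (F x a s) \<le> esz s + D x" using FH[of a x s] D(2)[of a x] Cons.prems by force
  with Cons.IH[of "F x a s"] Cons.prems show ?case by simp
 qed simp
 show ?thesis
 proof (rule pt_fold[OF F g h])
  show "bnd (%x. esz (h x) + esz (g x) * D x)" by (intro bnd_intros D pt_bnd g h)
  fix x l1 l2 assume l: "g x = l1 @ l2"
  have "esz (fold (F x) l1 (h x)) \<le> esz (h x) + length l1 * D x" by (rule *) (simp add: l)
  moreover have "length l1 \<le> esz (g x)" using esz_length[of "g x"] l by simp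
  ultimately show "esz (fold (F x) l1 (h x)) \<le> esz (h x) + esz (g x) * D x"
   by (meson add_left_mono le_trans mult_le_mono1)
 qed
qed

section \<open>Closure under logical, arithmetic and list operations\<close>

lemma pt_case_prod [pt_intros]:
 "pt (%v. g v (fst (f v)) (snd (f v))) ==> pt (%v. case f v of (a, b) => g v a b)"
 by (simp add: split_beta)

lemma pt_not [pt_intros]: "pt b ==> pt (%v. \<not> b v)"
 by (rule pt_cong[OF pt_If[OF _ pt_const[of False] pt_const[of True], of b]]) auto

lemma pt_conj [pt_intros]: "pt a ==> pt b ==> pt (%v. a v & b v)"
 by (rule pt_cong[OF pt_If[OF _ _ pt_const[of False], of a b]]) auto

lemma pt_disj [pt_intros]: "pt a ==> pt b ==> pt (%v. a v \<or> b v)"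
 by (rule pt_cong[OF pt_If[OF _ pt_const[of True], of a b]]) auto

lemma pt_imp [pt_intros]: "pt a ==> pt b ==> pt (%v. a v --> b v)"
 by (rule pt_cong[OF pt_If[OF _ _ pt_const[of True], of a b]]) auto

lemma pt_replicate_False: "pt f ==> pt (%v. replicate (f v) False)"
proof (rule pt_comp[of "%n. replicate n False"])
 have "tr (replicate n False) = tr n" for n by (induction n) (auto simp: tr_bool_def)
 then show "pt (%n. replicate n False)" by (intro pt_same)
qed

lemma pt_length [pt_intros]:
 assumes "pt f" shows "pt (%v. length (f v))"
proof -
 have *: "fold (%_ n. Suc n) l n0 = length l + n0" for l :: "'b list" and n0
  by (induction l arbitrary: n0) auto
 have "pt (%v. fold (%_ n. Suc n) (f v) 0)"
  by (rule pt_fold_add[where H = "%_. 2"]) (intro pt_intros assms bnd_intros | simp)+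
 then show ?thesis by (simp add: *)
qed

lemma pt_rev [pt_intros]:
 assumes "pt f" shows "pt (%v. rev (f v))"
proof -
 have "pt (%v. fold Cons (f v) [])"
 proof (rule pt_fold_add[where H = "%p. Suc (esz p)"])
  show "bnd (%p::'a \<times> 'b. Suc (esz p))" by (intro bnd_intros)
 qed (intro pt_intros assms | simp)+
 then show ?thesis by (simp add: fold_Cons_rev)
qed

lemma pt_append [pt_intros]:
 assumes "pt f" "pt g" shows "pt (%v. f v @ g v)"
proof -
 have "pt (%v. fold Cons (rev (f v)) (g v))"
 proof (rule pt_fold_add[where H = "%p. Suc (esz p)"])
  show "bnd (%p::'a \<times> 'b. Suc (esz p))" by (intro bnd_intros)
 qed (intro pt_intros assms | simp)+
 then show ?thesis by (simp add: fold_Cons_rev)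
qed

lemma pt_map [pt_intros]:
 assumes F: "pt (%p. F (fst p) (snd p))" and g: "pt g"
 shows "pt (%x. map (%a. F x a) (g x))"
proof -
 have *: "fold (%a acc. F x a # acc) l s = rev (map (F x) l) @ s" for x l s
  by (induction l arbitrary: s) auto
 have F': "pt (%p. F (fst p) (fst (snd p)))"
  using pt_comp[OF F, of "%p. (fst p, fst (snd p))"] by (simp add: pt_intros)
 have "pt (%x. rev (fold (%a acc. F x a # acc) (g x) []))"
 proof (rule pt_rev, rule pt_fold_add[where H = "%p. Suc (esz (F (fst p) (snd p)))"])
  show "bnd (%p. Suc (esz (F (fst p) (snd p))))" by (intro bnd_intros pt_bnd F)
 qed (intro pt_intros g F' | simp)+
 then show ?thesis by (simp add: *)
qed

lemma pt_filter [pt_intros]: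
 assumes F: "pt (%p. P (fst p) (snd p))" and g: "pt g"
 shows "pt (%x. filter (%a. P x a) (g x))"
proof -
 have *: "fold (%a acc. if P x a then a # acc else acc) l s = rev (filter (P x) l) @ s" for x l s
  by (induction l arbitrary: s) auto
 have F': "pt (%p. P (fst p) (fst (snd p)))"
  using pt_comp[OF F, of "%p. (fst p, fst (snd p))"] by (simp add: pt_intros)
 have "pt (%x. rev (fold (%a acc. if P x a then a # acc else acc) (g x) []))"
 proof (rule pt_rev, rule pt_fold_add[where H = "%p. Suc (esz p)"])
  show "bnd (%p::'a \<times> 'b. Suc (esz p))" by (intro bnd_intros)
 qed (intro pt_intros g F' | simp)+
 then show ?thesis by (simp add: *)
qed

lemma pt_concat [pt_intros]:
 assumes "pt f" shows "pt (%v. concat (f v))"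
proof -
 have *: "fold (%a acc. acc @ a) l s = s @ concat l" for l and s :: "'b list"
  by (induction l arbitrary: s) auto
 have "pt (%v. fold (%a acc. acc @ a) (f v) [])"
 proof (rule pt_fold_add[where H = "%p. esz p"])
  show "bnd (%p::'a \<times> 'b list. esz p)" by (intro bnd_intros)
  show "esz (s @ a) \<le> esz s + esz (x, a)" for x :: 'a and a s :: "'b list" using esz_append_le[of s a] by simp
 qed (intro pt_intros assms | simp)+
 then show ?thesis by (simp add: *)
qed

lemma pt_Ball [pt_intros]:
 assumes "pt (%p. P (fst p) (snd p))" "pt g" shows "pt (%x. \<forall>a\<in>set (g x). P x a)"
proof -
 have "pt (%x. filter (%a. \<not> P x a) (g x) = [])" by (intro pt_intros assms)
 then show ?thesis by (simp add: filter_empty_conv)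
qed

lemma pt_Bex [pt_intros]:
 assumes "pt (%p. P (fst p) (snd p))" "pt g" shows "pt (%x. \<exists>a\<in>set (g x). P x a)"
proof -
 have "pt (%x. \<not> (\<forall>a\<in>set (g x). \<not> P x a))" by (intro pt_intros assms)
 then show ?thesis by simp
qed

lemma pt_member [pt_intros]:
 assumes "pt f" "pt g" shows "pt (%x. f x \<in> set (g x))"
proof -
 have "pt (%x. \<exists>a\<in>set (g x). a = f x)"
  by (intro pt_intros assms pt_comp[OF assms(1)])
 then show ?thesis by simp
qed

lemma pt_add [pt_intros]:
 assumes "pt f" "pt g" shows "pt (%v. f v + g v :: nat)"
proof -
 have *: "fold (%_ n. Suc n) (replicate m False) n0 = m + n0" for m n0
  by (induction m arbitrary: n0) auto
 have "pt (%v. fold (%_ n. Suc n) (replicate (f v) False) (g v))"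
  by (rule pt_fold_add[where H = "%_. 2"]) (intro pt_intros pt_replicate_False assms bnd_intros | simp)+
 then show ?thesis by (simp add: *)
qed

lemma pt_diff [pt_intros]:
 assumes "pt f" "pt g" shows "pt (%v. f v - g v :: nat)"
proof -
 have *: "fold (%_ n. n - Suc 0) (replicate m False) n0 = n0 - m" for m n0
  by (induction m arbitrary: n0) auto
 have "pt (%v. fold (%_ n. n - Suc 0) (replicate (g v) False) (f v))"
  by (rule pt_fold_add[where H = "%_. 2"]) (intro pt_intros pt_replicate_False assms bnd_intros | simp)+
 then show ?thesis by (simp only: * add_0_right)
qed

lemma pt_mult [pt_intros]:
 assumes "pt f" "pt g" shows "pt (%v. f v * g v :: nat)"
proof -
 have *: "fold (%_ n. n + k) (replicate m False) n0 = m * k + n0" for m n0 k :: nat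
  by (induction m arbitrary: n0) auto
 have "pt (%v. fold (%_ n. n + g v) (replicate (f v) False) 0)"
 proof (rule pt_fold_add[where H = "%p. esz (g (fst p))"])
  show "bnd (%p::'a \<times> bool. esz (g (fst p)))"
   by (rule pt_bnd, rule pt_comp[OF assms(2)]) (intro pt_intros)
 qed (intro pt_intros pt_replicate_False assms pt_comp[OF assms(2)] | simp)+
 then show ?thesis by (simp only: * add_0_right)
qed

lemma pt_power [pt_intros]: "pt f ==> pt (%v. (f v :: nat) ^ d)"
 by (induction d) (auto intro!: pt_intros)

lemma pt_le [pt_intros]: "pt f ==> pt g ==> pt (%v. (f v :: nat) \<le> g v)"
 by (rule pt_cong[of "%v. f v - g v = 0"]) (intro pt_intros | simp)+

lemma pt_less [pt_intros]: "pt f ==> pt g ==> pt (%v. (f v :: nat) < g v)"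
 by (rule pt_cong[of "%v. Suc (f v) - g v = 0"]) (intro pt_intros | simp add: Suc_le_eq)+

lemma pt_upt [pt_intros]:
 assumes "pt f" "pt g" shows "pt (%v. [f v..<g v])"
proof -
 have *: "fold (%_ l. length l # l) (replicate m False) [] = rev [0..<m]" for m
 proof (induction m)
  case (Suc m)
  have "replicate (Suc m) False = replicate m False @ [False]" by (metis replicate_Suc replicate_append_same)
  then show ?case using Suc by (simp del: replicate.simps)
 qed simp
 \<comment> \<open>Each round of the fold prepends the current length, so the growth depends on the
   accumulator and the size bound has to be given explicitly.\<close>
 have e: "esz [0..<m] \<le> 1 + m * (2 * m + 2)" for m
 proof (induction m)
  case (Suc m) then show ?case using esz_append[of "[0..<m]" "[m]"] by (simp add: algebra_simps)
 qed simp
 have "pt (%v. fold (%_ l. length l # l) (replicate (f v) False) [])" if f: "pt f" for f :: "'a => nat"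
 proof (rule pt_fold[where B = "%v. 1 + esz (f v) * (2 * esz (f v) + 2)"])
  fix x l1 l2 assume l: "replicate (f x) False = l1 @ l2"
  then have "l1 = replicate (length l1) False" by (metis append_eq_conv_conj take_replicate length_replicate)
  then have 1: "fold (%_ l. length l # l) l1 [] = rev [0..<length l1]" using * by metis
  have "length l1 \<le> f x" using l by (metis le_add1 length_append length_replicate)
  then have "esz (rev [0..<length l1]) \<le> 1 + f x * (2 * f x + 2)"
   unfolding esz_rev by (intro order_trans[OF e] add_mono mult_le_mono) auto
  also have "\<dots> \<le> 1 + esz (f x) * (2 * esz (f x) + 2)" by (intro add_mono mult_le_mono) auto
  finally show "esz (fold (%_ l. length l # l) l1 []) \<le> 1 + esz (f x) * (2 * esz (f x) + 2)" unfolding 1 .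
 qed (intro pt_intros pt_replicate_False f bnd_intros pt_bnd)+
 from this[of "%v. g v - f v"] have "pt (%v. rev [0..<g v - f v])" unfolding * by (simp add: pt_intros assms)
 from pt_rev[OF this] have u: "pt (%v. [0..<g v - f v])" by simp
 have "pt (%v. map (%k. f v + k) [0..<g v - f v])"
  by (rule pt_map[OF _ u]) (intro pt_intros pt_comp[OF assms(1)])
 moreover have "map (%k. i + k) [0..<j - i] = [i..<j]" for i j
  by (rule nth_equalityI) auto
 ultimately show ?thesis by simp
qed

lemma pt_drop [pt_intros]:
 assumes "pt f" "pt g" shows "pt (%v. drop (g v) (f v))"
proof -
 have *: "fold (%_ l. tl l) (replicate m False) l = drop m l" for m and l :: "'b list"
  by (induction m arbitrary: l) (auto simp: drop_Suc)
 have t: "esz (tl l) \<le> esz l" for l :: "'b list" by (cases l) auto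
 have "pt (%v. fold (%_ l. tl l) (replicate (g v) False) (f v))"
  by (rule pt_fold_add[where H = "%_. 2"]) (intro pt_intros pt_replicate_False assms bnd_intros | simp add: t le_SucI)+
 then show ?thesis by (simp only: * add_0_right)
qed

text \<open>In contrast to \<open>(!)\<close>, the value outside the list is the same for all lists and indices.\<close>

definition nthd :: "'a list => nat => 'a" where "nthd xs n = hd (drop n xs)"

lemma nthd_nth: "n < length xs ==> nthd xs n = xs ! n"
 by (simp add: nthd_def hd_drop_conv_nth)

lemma pt_nthd [pt_intros]: "pt f ==> pt g ==> pt (%v. nthd (f v) (g v))"
 unfolding nthd_def by (intro pt_intros)

lemma pt_take [pt_intros]:
 assumes "pt f" "pt g" shows "pt (%v. take (g v) (f v))"
proof -
 have *: "take n l = rev (drop (length l - n) (rev l))" for n and l :: "'b list"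
  by (cases "n \<le> length l") (auto simp: rev_drop)
 show ?thesis unfolding * by (intro pt_intros assms)
qed

lemma pt_zip [pt_intros]:
 assumes "pt f" "pt g" shows "pt (%v. zip (f v) (g v))"
proof -
 have *: "zip xs ys = map (%i. (nthd xs i, nthd ys i)) [0..<if length xs \<le> length ys then length xs else length ys]"
  for xs :: "'b list" and ys :: "'c list"
  by (rule nth_equalityI) (auto simp: nthd_nth)
 show ?thesis unfolding * by (intro pt_intros assms pt_comp[OF assms(1)] pt_comp[OF assms(2)])
qed

text \<open>\<open>d\<close> is a constant of the program: there are \<open>length (f v) ^ d\<close>
  lists, polynomially many only for fixed \<open>d\<close>.\<close>

lemma pt_n_lists [pt_intros]: "pt f ==> pt (%v. List.n_lists d (f v))"
proof (induction d)
 case (Suc d)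
 show ?case unfolding List.n_lists.simps by (intro pt_intros Suc.IH Suc.prems pt_comp[OF Suc.prems])
qed (simp add: pt_const)

lemma pt_takeWhile [pt_intros]:
 assumes F: "pt (%p. P (fst p) (snd p))" and g: "pt g"
 shows "pt (%x. takeWhile (%a. P x a) (g x))"
proof -
 let ?F = "%x a s. if fst s & P x a then (True, a # snd s) else (False, snd s)"
 have 0: "fold (?F x) l (False, s) = (False, s)" for x l s by (induction l) auto
 have *: "snd (fold (?F x) l (True, s)) = rev (takeWhile (P x) l) @ s" for x l s
  by (induction l arbitrary: s) (auto simp: 0)
 have F': "pt (%p. P (fst p) (fst (snd p)))"
  using pt_comp[OF F, of "%p. (fst p, fst (snd p))"] by (simp add: pt_intros)
 have "pt (%x. rev (snd (fold (?F x) (g x) (True, []))))"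
 proof (rule pt_rev, rule pt_snd, rule pt_fold_add[where H = "%p. esz p + 3"])
  show "bnd (%p::'a \<times> 'b. esz p + 3)" by (intro bnd_intros)
  show "esz (?F x a s) \<le> esz s + (esz (x, a) + 3)" for x a s by (cases s) auto
 qed (intro pt_intros g F')+
 then show ?thesis by (simp add: *)
qed

lemma pt_replicate [pt_intros]:
 assumes "pt f" "pt g" shows "pt (%v. replicate (g v) (f v))"
proof -
 have *: "replicate n a = map (%i. a) [0..<n]" for n and a :: 'b
  by (simp add: map_replicate_const)
 show ?thesis unfolding * by (intro pt_intros assms pt_comp[OF assms(1)])
qed

lemma pt_last [pt_intros]: "pt f ==> pt (%v. last (f v))"
proof -
 assume f: "pt f"
 have "last xs = (if xs = [] then last [] else hd (rev xs))" for xs :: "'b list"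
  by (simp add: hd_rev)
 then have *: "(%v. last (f v)) = (%v. if f v = [] then last [] else hd (rev (f v)))" by (intro ext)
 show ?thesis unfolding * by (intro pt_intros f)
qed

lemma pt_sum_list [pt_intros]: "pt f ==> pt (%v. sum_list (f v) :: nat)"
proof -
 assume f: "pt f"
 have *: "fold (%a s. s + a) l n = sum_list l + n" for l and n :: nat by (induction l arbitrary: n) auto
 have "pt (%v. fold (%a s. s + a) (f v) 0)"
 proof (rule pt_fold_add[where H = "%p. esz p"])
  show "bnd (%p::'a \<times> nat. esz p)" by (intro bnd_intros)
 qed (intro pt_intros f | simp)+
 then show ?thesis by (simp add: *)
qed

text \<open>A finite table can be built into a program. This serves for the transition function of a
  given machine and for the values of \<open>vf\<close> on colour lists.\<close>

lemma pt_finite: "finite A ==> \<exists>g. pt g & (\<forall>a\<in>A. g a = F a)"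
proof (induction A rule: finite_induct)
 case empty
 then show ?case using pt_const by blast
next
 case (insert x A)
 then obtain g where g: "pt g" "\<forall>a\<in>A. g a = F a" by blast
 have "pt (%a. if a = x then F x else g a)" by (intro pt_intros g)
 then show ?case using g(2) by (intro exI[of _ "%a. if a = x then F x else g a"]) auto
qed

section \<open>Polynomial-time functions and Turing machines\<close>

definition read_in :: com where
 "read_in = Loop 0 {1, 2} (Cond 0 {2} (pop 0 ;; push 1 True) (pop 0 ;; push 1 False)) ;; push 0 False ;;
  Loop 1 {1, 2} (Cond 1 {2} (pop 1 ;; push 0 False ;; push 0 False ;; push 0 True ;; push 0 True)
   (pop 1 ;; push 0 False ;; push 0 True))"

lemma run_read_in:
 "run read_in [w, [], [], [], y] (40 * length w + 10) [code (tr w), [], [], [], y]"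
proof -
 have 1: "run (Loop 0 {1, 2} (Cond 0 {2} (pop 0 ;; push 1 True) (pop 0 ;; push 1 False)))
  [w, a, [], [], y] (10 * length w + 1) [[], rev w @ a, [], [], y]" for w a
 proof (induction w arbitrary: a)
  case Nil then show ?case by simp (rule run_mono, rule run_Loop_exit, auto)
 next
  case (Cons e w)
  show ?case using Cons[of "e # a"]
   by (cases e) (rule run_mono, rule run_Loop_step, simp, simp, (rule run_CondT run_CondF, simp, simp)+, rule run_Seq,
    rule run_prims, rule run_prims, simp, simp)+
 qed
 have 2: "run (Loop 1 {1, 2} (Cond 1 {2} (pop 1 ;; push 0 False ;; push 0 False ;; push 0 True ;; push 0 True)
   (pop 1 ;; push 0 False ;; push 0 True))) [code (tr xs), a, [], [], y] (20 * length a + 1)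
   [code (tr (rev a @ xs)), [], [], [], y]" (is "run ?L _ _ _") for a xs
 proof (induction a arbitrary: xs)
  case Nil then show ?case by simp (rule run_mono, rule run_Loop_exit, auto)
 next
  case (Cons e a)
  show ?case
  proof (cases e)
   case True
   have IH: "run ?L [True # True # False # False # code (tr xs), a, [], [], y] (20 * length a + 1)
    [code (tr (rev (e # a) @ xs)), [], [], [], y]"
    using Cons[of "True # xs"] True by (simp add: tr_bool_def)
   show ?thesis
    by (rule run_mono, rule run_Loop_step[OF _ _ _ IH], simp, use top_simps(4)[of e a] in simp, rule run_CondT, simp,
      use True in simp, rule run_Seq, rule run_prims, rule run_Seq, rule run_prims, rule run_Seq, rule run_prims,
      rule run_Seq, rule run_prims, rule run_prims, simp)
  next
   case False
   have IH: "run ?L [True # False # code (tr xs), a, [], [], y] (20 * length a + 1)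
    [code (tr (rev (e # a) @ xs)), [], [], [], y]"
    using Cons[of "False # xs"] False by (simp add: tr_bool_def)
   show ?thesis
    by (rule run_mono, rule run_Loop_step[OF _ _ _ IH], simp, use top_simps(4)[of e a] in simp, rule run_CondF, simp,
      use False in simp, rule run_Seq, rule run_prims, rule run_Seq, rule run_prims, rule run_prims, simp)
  qed
 qed
 have 1: "run (Loop 0 {1, 2} (Cond 0 {2} (pop 0 ;; push 1 True) (pop 0 ;; push 1 False)))
  [w, [], [], [], y] (10 * length w + 1) [[], rev w, [], [], y]" using 1[of w "[]"] by simp
 have 2: "run (Loop 1 {1, 2} (Cond 1 {2} (pop 1 ;; push 0 False ;; push 0 False ;; push 0 True ;; push 0 True)
   (pop 1 ;; push 0 False ;; push 0 True))) [[False], rev w, [], [], y] (20 * length w + 1)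
   [code (tr w), [], [], [], y]" using 2[of "[]" "rev w"] by simp
 show ?thesis unfolding read_in_def
  by (rule run_mono, rule run_Seq, rule 1, rule run_Seq, rule run_prims, rule 2, simp)
qed

definition write_out :: com where
 "write_out = Loop 0 {2} (pop 0 ;; Cond 0 {2} (pop 0 ;; pop 0 ;; pop 0 ;; emit True) (pop 0 ;; emit False))"

lemma run_write_out:
 "run write_out [code (tr ys), [], [], [], y] (20 * length ys + 1) [[False], [], [], [], y @ ys]"
proof (induction ys arbitrary: y)
 case Nil then show ?case unfolding write_out_def by simp (rule run_mono, rule run_Loop_exit, auto)
next
 case (Cons e ys)
 have IH: "run write_out [code (tr ys), [], [], [], y @ [e]] (20 * length ys + 1) [[False], [], [], [], y @ e # ys]"
  using Cons[of "y @ [e]"] by simp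
 show ?case
 proof (cases e)
  case True
  have c: "code (tr (e # ys)) = True # True # False # False # code (tr ys)" "e = True" using True by (simp_all add: tr_bool_def)
  show ?thesis unfolding c(1) using IH unfolding write_out_def c(2)
   by - (rule run_mono, rule run_Loop_step, simp, simp, rule run_Seq, rule run_prims, rule run_CondT, simp, simp,
    rule run_Seq, rule run_prims, rule run_Seq, rule run_prims, rule run_Seq, rule run_prims, rule run_prims, assumption, simp)
 next
  case False
  have c: "code (tr (e # ys)) = True # False # code (tr ys)" "e = False" using False by (simp_all add: tr_bool_def)
  show ?thesis unfolding c(1) using IH unfolding write_out_def c(2)
   by - (rule run_mono, rule run_Loop_step, simp, simp, rule run_Seq, rule run_prims, rule run_CondF, simp, simp,
    rule run_Seq, rule run_prims, rule run_prims, assumption, simp)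
 qed
qed

lemma esz_bits_le: "esz (w :: bool list) \<le> 4 * length w + 1"
 by (induction w) auto

lemma pt_poly_time:
 assumes "pt g" and "\<And>a. g (enc_in a) = enc_out (f a)"
 shows "poly_time_via enc_in enc_out f"
proof -
 obtain c T where c: "computes c g T" "bnd T" using assms(1) unfolding pt_def by blast
 let ?T = "%w. 40 * esz w + 10 + (T w + (20 * esz (g w) + 1) + 1) + 1"
 have "bnd ?T" by (intro bnd_intros c pt_bnd assms)
 then obtain K d where K: "\<And>w. ?T w \<le> K * esz w ^ d" unfolding bnd_def by blast
 \<comment> \<open>The factor \<open>[:1, 4:]\<close> arises because a bit string of length
   \<open>n\<close> has size at most \<open>4 * n + 1\<close>.\<close>
 let ?M = "com_tm 5 (read_in ;; c ;; write_out)" and ?p = "[:K:] * [:1, 4:] ^ d"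
 have v: "valid_com 5 (read_in ;; c ;; write_out)"
  using c by (simp add: computes_def read_in_def write_out_def)
 have "\<exists>T \<le> poly ?p (length w). tm_yields ?M w T (g w)" for w
 proof -
  have "run c [code (tr w) @ [], [], [], [], []] (T w) [code (tr (g w)) @ [], [], [], [], []]"
   using c(1) unfolding computes_def by blast
  then have r: "run c [code (tr w), [], [], [], []] (T w) [code (tr (g w)), [], [], [], []]" by simp
  have "run (read_in ;; c ;; write_out) [w, [], [], [], []] (?T w) [[False], [], [], [], [] @ g w]"
   by (rule run_mono, rule run_Seq, rule run_read_in, rule run_Seq, rule r, rule run_write_out)
    (use esz_length[of w] esz_length[of "g w"] in simp)
  then obtain n where "n \<le> ?T w" "tm_yields ?M w n (g w)" using com_tm_yields[OF v] by fastforce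
  moreover have "K * esz w ^ d \<le> poly ?p (length w)"
   using esz_bits_le[of w] by (simp add: poly_power power_mono mult.commute)
  ultimately show ?thesis using K[of w] by (meson le_trans)
 qed
 moreover have "tm_wf ?M" by (rule com_tm_wf[OF v]) simp
 ultimately show ?thesis unfolding poly_time_via_def using assms(2) by metis
qed

lemma poly_time_computable: "poly_time_via enc_in enc_out f ==> computable_via enc_in enc_out f"
 unfolding poly_time_via_def computable_via_def by blast

section \<open>From machines to polynomial-time functions\<close>

definition win :: "nat => nat => tape => nat list \<times> nat" where
 "win B N t = (map (%i. fst t (int i - int B)) [0..<N], nat (snd t + int B))"

definition wcfg :: "nat => nat => config => nat \<times> (nat list \<times> nat) list" where
 "wcfg B N cf = (fst cf, map (win B N) (snd cf))"

text \<open>One step on windows, in which tape cell \<open>i - B\<close> is stored at index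
  \<open>i\<close>. The moves delivered by \<open>D\<close> are shifted by one to be natural
  numbers, whence the final \<open>- 1\<close>.\<close>

definition wstep :: "(nat \<times> nat list => nat \<times> nat list \<times> nat list) => nat \<times> (nat list \<times> nat) list => nat \<times> (nat list \<times> nat) list" where
 "wstep D s = (if fst s = 1 then s else
  (fst (D (fst s, map (%t. nthd (fst t) (snd t)) (snd s))),
   map (%q. (take (snd (fst q)) (fst (fst q)) @ fst (snd q) # drop (Suc (snd (fst q))) (fst (fst q)), snd (fst q) + snd (snd q) - 1))
    (zip (snd s) (zip (fst (snd (D (fst s, map (%t. nthd (fst t) (snd t)) (snd s)))))
     (snd (snd (D (fst s, map (%t. nthd (fst t) (snd t)) (snd s)))))))))"

text \<open>The bound on the heads keeps a run inside its window, and the blank cells beyond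
  \<open>i + n\<close> limit the length of the output.\<close>

definition tm_inv :: "tm => nat => nat => config => bool" where
 "tm_inv M n i cf \<longleftrightarrow> fst cf < tm_states M & length (snd cf) = tm_tapes M &
  (\<forall>t \<in> set (snd cf). \<bar>snd t\<bar> \<le> int i & (\<forall>j. fst t j < tm_symbols M) & (\<forall>j > int (i + n). fst t j = 0))"

lemma tm_inv_init: "tm_wf M ==> tm_inv M (length w) i (tm_init M w)"
 by (auto simp: tm_inv_def tm_init_def tm_wf_def bit_symbol_def)

lemma tm_heads:
 assumes "tm_inv M n i (s, ts)"
 shows "length (map (%(c, p). c p) ts) = tm_tapes M" "set (map (%(c, p). c p) ts) \<subseteq> {..<tm_symbols M}"
 using assms by (auto simp: tm_inv_def)

lemma tm_delta_wf:
 assumes "tm_wf M" "tm_inv M n i (s, ts)" "tm_delta M s (map (%(c, p). c p) ts) = (s', ws, ds)"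
 shows "s' < tm_states M" "length ws = tm_tapes M" "set ws \<subseteq> {..<tm_symbols M}" "length ds = tm_tapes M" "set ds \<subseteq> {-1, 0, 1}"
proof -
 have sl: "s < tm_states M" using assms(2) by (simp add: tm_inv_def)
 have "\<forall>s rs. s < tm_states M & length rs = tm_tapes M & set rs \<subseteq> {..<tm_symbols M} -->
   (case tm_delta M s rs of (s', ws, ds) =>
     s' < tm_states M & length ws = tm_tapes M & set ws \<subseteq> {..<tm_symbols M} &
     length ds = tm_tapes M & set ds \<subseteq> {-1, 0, 1})"
  using assms(1) unfolding tm_wf_def by (elim conjE)
 from this[THEN spec, THEN spec, THEN mp, OF conjI[OF sl conjI[OF tm_heads[OF assms(2)]]]]
 have "case tm_delta M s (map (%(c, p). c p) ts) of (s', ws, ds) =>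
     s' < tm_states M & length ws = tm_tapes M & set ws \<subseteq> {..<tm_symbols M} &
     length ds = tm_tapes M & set ds \<subseteq> {-1, 0, 1}"
  .
 then show "s' < tm_states M" "length ws = tm_tapes M" "set ws \<subseteq> {..<tm_symbols M}" "length ds = tm_tapes M" "set ds \<subseteq> {-1, 0, 1}"
  unfolding assms(3) by auto
qed

lemma tm_inv_step:
 assumes "tm_wf M" "tm_inv M n i cf" shows "tm_inv M n (Suc i) (tm_step M cf)"
proof -
 obtain s ts where cf: "cf = (s, ts)" by fastforce
 show ?thesis
 proof (cases "s = 1")
  case True
  then have "tm_step M cf = cf" by (simp add: tm_step_def cf)
  then show ?thesis using assms(2) unfolding tm_inv_def by auto
 next
  case False
  obtain s' ws ds where d: "tm_delta M s (map (%(c, p). c p) ts) = (s', ws, ds)" by (metis prod_cases3)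
  note w = tm_delta_wf[OF assms(1) assms(2)[unfolded cf] d]
  have st: "tm_step M cf = (s', apply_act ts ws ds)" using False d by (simp add: tm_step_def cf)
  have ts: "length ts = tm_tapes M" using assms(2) by (simp add: tm_inv_def cf)
  have "\<bar>snd t\<bar> \<le> int (Suc i) & (\<forall>j. fst t j < tm_symbols M) & (\<forall>j > int (Suc i + n). fst t j = 0)"
   if "t \<in> set (apply_act ts ws ds)" for t
  proof -
   from that
   obtain j where j: "j < tm_tapes M" "t = (case (ts ! j, ws ! j, ds ! j) of ((c, p), (w, d)) => (c(p := w), p + d))"
    using ts w by (auto simp: in_set_conv_nth)
   obtain c p where t: "ts ! j = (c, p)" by fastforce
   have "(c, p) \<in> set ts" using t j ts by (metis nth_mem)
   then have 1: "\<bar>p\<bar> \<le> int i" "\<forall>j. c j < tm_symbols M" "\<forall>j > int (i + n). c j = 0"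
    using assms(2) by (auto simp: tm_inv_def cf)
   have 2: "ws ! j < tm_symbols M" "ds ! j \<in> {-1, 0, 1}" using w j by (metis nth_mem lessThan_iff subsetD)+
   show ?thesis using 1 2 by (auto simp: j t)
  qed
  then show ?thesis unfolding st tm_inv_def using w ts by simp
 qed
qed

text \<open>Since \<open>i < B\<close>, every stored head position is at least 1, so the subtraction
  that undoes the shift of the moves never truncates.\<close>

lemma wstep_sim:
 assumes "tm_wf M" "tm_inv M n i cf" "i < B" "2 * B < N"
  and D: "\<And>s rs. s < tm_states M ==> length rs = tm_tapes M ==> set rs \<subseteq> {..<tm_symbols M} ==>
   D (s, rs) = (case tm_delta M s rs of (s', ws, ds) => (s', ws, map (%d. nat (d + 1)) ds))"
 shows "wstep D (wcfg B N cf) = wcfg B N (tm_step M cf)"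
proof -
 obtain s ts where cf: "cf = (s, ts)" by fastforce
 obtain s' ws ds where d: "tm_delta M s (map (%(c, p). c p) ts) = (s', ws, ds)" by (metis prod_cases3)
 note w = tm_delta_wf[OF assms(1) assms(2)[unfolded cf] d]
 have ts: "length ts = tm_tapes M" using assms(2) by (simp add: tm_inv_def cf)
 have p: "\<bar>snd t\<bar> \<le> int i" if "t \<in> set ts" for t using assms(2) that by (auto simp: tm_inv_def cf)
 have rs: "map (%t. nthd (fst t) (snd t)) (map (win B N) ts) = map (%(c, p). c p) ts"
 proof (simp, intro ballI)
  fix t assume "t \<in> set ts"
  then have "\<bar>snd t\<bar> \<le> int i" by (rule p)
  then show "nthd (fst (win B N t)) (snd (win B N t)) = (case t of (c, p) => c p)"
   using assms(3,4) by (subst nthd_nth) (auto simp: win_def split: prod.splits)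
 qed
 have Ds: "D (s, map (%(c, p). c p) ts) = (s', ws, map (%d. nat (d + 1)) ds)"
  using D[OF _ tm_heads[OF assms(2)[unfolded cf]]] assms(2) d by (simp add: tm_inv_def cf)
 have "map (%q. (take (snd (fst q)) (fst (fst q)) @ fst (snd q) # drop (Suc (snd (fst q))) (fst (fst q)), snd (fst q) + snd (snd q) - 1))
    (zip (map (win B N) ts) (zip ws (map (%d. nat (d + 1)) ds))) = map (win B N) (apply_act ts ws ds)"
 proof (rule nth_equalityI)
  fix j assume "j < length (map (%q. (take (snd (fst q)) (fst (fst q)) @ fst (snd q) # drop (Suc (snd (fst q))) (fst (fst q)), snd (fst q) + snd (snd q) - 1))
    (zip (map (win B N) ts) (zip ws (map (%d. nat (d + 1)) ds))))"
  then have j: "j < length ts" "j < length ws" "j < length ds" by auto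
  obtain c p where t: "ts ! j = (c, p)" by fastforce
  have pp: "\<bar>p\<bar> \<le> int i" using p[OF nth_mem[OF j(1)]] t by simp
  have dj: "ds ! j \<in> {-1, 0, 1}" using w j by (metis nth_mem subsetD)
  have 1: "nat (p + int B) + nat (ds ! j + 1) - 1 = nat (p + ds ! j + int B)"
   using pp dj assms(3) by auto
  have 2: "take (nat (p + int B)) (map (%i. c (int i - int B)) [0..<N]) @ ws ! j # drop (Suc (nat (p + int B))) (map (%i. c (int i - int B)) [0..<N])
   = map (%i. (c(p := ws ! j)) (int i - int B)) [0..<N]"
  proof (rule nth_equalityI)
   have l: "nat (p + int B) < N" using pp assms(3,4) by linarith
   then show "length (take (nat (p + int B)) (map (%i. c (int i - int B)) [0..<N]) @ ws ! j # drop (Suc (nat (p + int B))) (map (%i. c (int i - int B)) [0..<N]))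
    = length (map (%i. (c(p := ws ! j)) (int i - int B)) [0..<N])" by simp
   fix m assume "m < length (take (nat (p + int B)) (map (%i. c (int i - int B)) [0..<N]) @ ws ! j # drop (Suc (nat (p + int B))) (map (%i. c (int i - int B)) [0..<N]))"
   then have m: "m < N" using l by simp
   have "(int m - int B = p) \<longleftrightarrow> m = nat (p + int B)" using pp assms(3) by linarith
   then show "(take (nat (p + int B)) (map (%i. c (int i - int B)) [0..<N]) @ ws ! j # drop (Suc (nat (p + int B))) (map (%i. c (int i - int B)) [0..<N])) ! m
    = map (%i. (c(p := ws ! j)) (int i - int B)) [0..<N] ! m"
    using m l by (auto simp: nth_append nth_Cons' min_def)
  qed
  show "map (%q. (take (snd (fst q)) (fst (fst q)) @ fst (snd q) # drop (Suc (snd (fst q))) (fst (fst q)), snd (fst q) + snd (snd q) - 1))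
    (zip (map (win B N) ts) (zip ws (map (%d. nat (d + 1)) ds))) ! j = map (win B N) (apply_act ts ws ds) ! j"
   using j t 1 2 by (simp add: win_def)
 qed simp
 note m = this
 show ?thesis
 proof (cases "s = 1")
  case True
  then show ?thesis by (simp add: wstep_def wcfg_def cf tm_step_def)
 next
  case False
  then have "tm_step M (s, ts) = (s', apply_act ts ws ds)" using d by (simp add: tm_step_def)
  then show ?thesis by (simp only: wstep_def wcfg_def cf fst_conv snd_conv rs Ds m False if_False)
 qed
qed

lemma pt_poly [pt_intros]: "pt f ==> pt (%v. poly (p :: nat poly) (f v))"
proof (induction p)
 case 0 then show ?case by (simp add: pt_const)
next
 case (pCons a p) then show ?case by (auto intro!: pt_intros)
qed

lemma esz_bounded_list: "(\<And>a. a \<in> set l ==> esz a \<le> e) ==> esz l \<le> 1 + length l * (e + 1)"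
 by (induction l) fastforce+

text \<open>Simulation of the machine on finite windows. A compression is assumed to exist only as a
  machine; this makes it composable with programs.\<close>

lemma pt_of_poly_time:
 fixes a :: "'x::codable => 'a"
 assumes f: "poly_time_via enc_in enc_out f" and u: "pt (%x. enc_in (a x))"
 shows "pt (%x. enc_out (f (a x)))"
proof -
 obtain M p where M: "tm_wf M" "\<And>a. \<exists>T \<le> poly p (length (enc_in a)). tm_yields M (enc_in a) T (enc_out (f a))"
  using f unfolding poly_time_via_def by blast
 let ?A = "{..<tm_states M} \<times> {rs. set rs \<subseteq> {..<tm_symbols M} & length rs = tm_tapes M}"
 have "finite ?A" by (intro finite_cartesian_product finite_lists_length_eq) auto
 then obtain D where D: "pt D" "\<And>x. x \<in> ?A ==> D x = (case tm_delta M (fst x) (snd x) of (s', ws, ds) => (s', ws, map (%d. nat (d + 1)) ds))"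
  using pt_finite[of ?A "%x. case tm_delta M (fst x) (snd x) of (s', ws, ds) => (s', ws, map (%d. nat (d + 1)) ds)"] by blast
 define w where "w = (%x. enc_in (a x))"
 \<comment> \<open>More than the number of steps, so no head leaves the window. After halting
   nothing changes, so exactly \<open>B x\<close> steps can be simulated on every input.\<close>
 define B where "B = (%x. Suc (poly p (length (w x))))"
 define N where "N = (%x. 2 * B x + 2 + length (w x))"
 have w: "pt w" using u by (simp add: w_def)
 have BN: "pt B" "pt N" unfolding B_def N_def by (intro pt_intros w)+
 let ?z = "%x. (replicate (N x) (0::nat), B x)"
 define ini where "ini = (%x. (0::nat, (replicate (B x) 0 @ map (%b. if b then 2 else 1) (w x) @ replicate (N x - B x - length (w x)) (0::nat), B x)
  # replicate (tm_tapes M - 1) (?z x)))"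
 have pini: "pt ini" unfolding ini_def by (intro pt_intros w BN)
 have ini: "ini x = wcfg (B x) (N x) (tm_init M (w x))" for x
 proof -
  have Nle: "B x + length (w x) \<le> N x" by (simp add: N_def)
  have "replicate (B x) 0 @ map (%b. if b then 2 else 1) (w x) @ replicate (N x - B x - length (w x)) (0::nat)
   = map (%i. if 0 \<le> int i - int (B x) & int i - int (B x) < int (length (w x)) then bit_symbol (w x ! nat (int i - int (B x))) else 0) [0..<N x]"
  proof (rule nth_equalityI)
   fix i assume "i < length (replicate (B x) 0 @ map (%b. if b then 2 else 1) (w x) @ replicate (N x - B x - length (w x)) (0::nat))"
   then have i: "i < N x" using Nle by simp
   consider "i < B x" | "B x \<le> i" "i - B x < length (w x)" | "B x \<le> i" "length (w x) \<le> i - B x" by linarith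
   then show "(replicate (B x) 0 @ map (%b. if b then 2 else 1) (w x) @ replicate (N x - B x - length (w x)) (0::nat)) ! i
    = map (%i. if 0 \<le> int i - int (B x) & int i - int (B x) < int (length (w x)) then bit_symbol (w x ! nat (int i - int (B x))) else 0) [0..<N x] ! i"
    by cases (use i Nle in \<open>auto simp: nth_append bit_symbol_def nat_diff_distrib\<close>)
  qed (use Nle in simp)
  then show ?thesis by (simp add: ini_def wcfg_def tm_init_def win_def map_replicate_const)
 qed
 let ?cf = "%x i. (tm_step M ^^ i) (tm_init M (w x))"
 have inv: "tm_inv M (length (w x)) i (?cf x i)" for x i
  by (induction i) (auto intro: tm_inv_init tm_inv_step M)
 have sim: "(wstep D ^^ i) (ini x) = wcfg (B x) (N x) (?cf x i)" if "i \<le> B x" for i x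
  using that
 proof (induction i)
  case 0 then show ?case by (simp add: ini)
 next
  case (Suc i)
  then have "(wstep D ^^ Suc i) (ini x) = wstep D (wcfg (B x) (N x) (?cf x i))" by simp
  also have "\<dots> = wcfg (B x) (N x) (tm_step M (?cf x i))"
  proof (rule wstep_sim[OF M(1) inv])
   show "i < B x" using Suc.prems by simp
   show "2 * B x < N x" by (simp add: N_def)
   show "D (s, rs) = (case tm_delta M s rs of (s', ws, ds) => (s', ws, map (%d. nat (d + 1)) ds))"
    if "s < tm_states M" "length rs = tm_tapes M" "set rs \<subseteq> {..<tm_symbols M}" for s rs
    using D(2)[of "(s, rs)"] that by simp
  qed
  finally show ?case by simp
 qed
 define E where "E = (%x. Suc (2 * tm_states M + 1 + (1 + tm_tapes M * (Suc ((1 + N x * (2 * tm_symbols M + 2)) + (4 * B x + 1)) + 1))))"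
 have size: "esz (wcfg (B x) (N x) (?cf x i)) \<le> E x" if "i \<le> B x" for x i
 proof -
  obtain s ts where cf: "?cf x i = (s, ts)" by fastforce
  have I: "s < tm_states M" "length ts = tm_tapes M" "\<And>t. t \<in> set ts ==> \<bar>snd t\<bar> \<le> int i & (\<forall>j. fst t j < tm_symbols M)"
   using inv[where x = x and i = i] by (auto simp: cf tm_inv_def)
  have "esz (win (B x) (N x) t) \<le> Suc ((1 + N x * (2 * tm_symbols M + 2)) + (4 * B x + 1))" if t: "t \<in> set ts" for t
  proof -
   have "esz (map (%i. fst t (int i - int (B x))) [0..<N x]) \<le> 1 + length (map (%i. fst t (int i - int (B x))) [0..<N x]) * (2 * tm_symbols M + 1 + 1)"
    by (rule esz_bounded_list) (use I(3)[OF t] in \<open>auto simp: less_imp_le\<close>)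
   moreover have "nat (snd t + int (B x)) \<le> 2 * B x" using I(3)[OF t] \<open>i \<le> B x\<close> by linarith
   ultimately show ?thesis by (simp add: win_def)
  qed
  then have "esz (map (win (B x) (N x)) ts) \<le> 1 + length (map (win (B x) (N x)) ts) * (Suc ((1 + N x * (2 * tm_symbols M + 2)) + (4 * B x + 1)) + 1)"
   by (intro esz_bounded_list) auto
  then show ?thesis using I by (simp add: wcfg_def cf E_def)
 qed
 have "bnd E"
 proof -
  have "bnd N" by (rule bnd_mono[OF pt_bnd[OF BN(2)]]) simp
  moreover have "bnd B" by (rule bnd_mono[OF pt_bnd[OF BN(1)]]) simp
  ultimately show ?thesis unfolding E_def by (intro bnd_intros)
 qed
 have fr: "fold (%_. g) (replicate m False) s = (g ^^ m) s" for g m and s :: "nat \<times> (nat list \<times> nat) list"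
  by (induction m arbitrary: s) (auto simp: funpow_swap1)
 have "pt (wstep D)" unfolding wstep_def[abs_def] by (intro pt_intros pt_comp[OF D(1)])
 then have Dp: "pt (%p :: 'x \<times> bool \<times> nat \<times> (nat list \<times> nat) list. wstep D (snd (snd p)))"
  by (rule pt_comp) (intro pt_intros)
 have "pt (%x. fold (%_. wstep D) (replicate (B x) False) (ini x))"
 proof (rule pt_fold[where B = E])
  fix x l1 l2 assume l: "replicate (B x) False = l1 @ l2"
  then have 1: "l1 = replicate (length l1) False" by (metis append_eq_conv_conj take_replicate length_replicate)
  have 2: "length l1 \<le> B x" using l by (metis le_add1 length_append length_replicate)
  show "esz (fold (%_. wstep D) l1 (ini x)) \<le> E x"
   by (subst 1) (simp only: fr sim[OF 2] size[OF 2])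
 qed (intro Dp pini pt_replicate_False BN \<open>bnd E\<close>)+
 then have "pt (%x. wcfg (B x) (N x) (?cf x (B x)))" by (simp only: fr sim[OF order_refl])
 then have out: "pt (%x. map (%s. s = 2) (takeWhile (%s. s \<noteq> 0) (drop (B x) (fst (last (snd (wcfg (B x) (N x) (?cf x (B x)))))))))"
  by (intro pt_intros BN)
 have "map (%s. s = 2) (takeWhile (%s. s \<noteq> 0) (drop (B x) (fst (last (snd (wcfg (B x) (N x) (?cf x (B x)))))))) = enc_out (f (a x))" for x
 proof -
  let ?y = "enc_out (f (a x))"
  obtain T where T: "T \<le> poly p (length (w x))" "tm_yields M (w x) T ?y" using M(2)[of "a x"] by (auto simp: w_def)
  obtain s ts where cf: "?cf x T = (s, ts)" by fastforce
  have y: "s = 1" "\<forall>i < length ?y. fst (last ts) (int i) = bit_symbol (?y ! i)" "fst (last ts) (int (length ?y)) = 0"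
   using T(2) by (auto simp: tm_yields_def cf)
  have halt: "(tm_step M ^^ m) (1, ts) = (1, ts)" for m by (induction m) (auto simp: tm_step_def)
  have TB: "B x = (B x - T) + T" using T by (simp add: B_def)
  have "?cf x (B x) = (tm_step M ^^ (B x - T)) (?cf x T)" by (subst TB) (simp add: funpow_add)
  then have e: "?cf x (B x) = (1, ts)" using halt by (simp add: cf y)
  have ne: "ts \<noteq> []" using inv[where x = x and i = "B x"] M(1) by (auto simp: e tm_inv_def tm_wf_def)
  then have "last ts \<in> set ts" by simp
  then have z: "\<forall>j > int (B x + length (w x)). fst (last ts) j = 0"
   using inv[where x = x and i = "B x"] by (auto simp: e tm_inv_def)
  \<comment> \<open>The output ends inside the window: a longer one would have to occupy cells that
    the run cannot have reached and that are blank.\<close>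
  have ly: "length ?y < N x - B x"
  proof (rule ccontr)
   assume "\<not> length ?y < N x - B x"
   then have "B x + length (w x) + 1 < length ?y" by (simp add: N_def)
   then have "fst (last ts) (int (B x + length (w x) + 1)) = bit_symbol (?y ! (B x + length (w x) + 1))" using y(2) by blast
   moreover have "fst (last ts) (int (B x + length (w x) + 1)) = 0" using z by simp
   ultimately show False by (simp add: bit_symbol_def split: if_splits)
  qed
  have "drop (B x) (fst (last (map (win (B x) (N x)) ts))) = map (%i. fst (last ts) (int i)) [0..<N x - B x]"
   using ne by (simp add: last_map win_def drop_map drop_upt) (rule nth_equalityI, auto)
  also have "[0..<N x - B x] = [0..<length ?y] @ length ?y # [Suc (length ?y)..<N x - B x]"
  proof -
   have "[0..<m] = [0..<l] @ l # [Suc l..<m]" if "l < m" for l m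
    using that upt_add_eq_append[of 0 l "m - l"] upt_conv_Cons[of l m] by simp
   from this[OF ly] show ?thesis .
  qed
  also have "map (%i. fst (last ts) (int i)) \<dots> = map bit_symbol ?y @ 0 # map (%i. fst (last ts) (int i)) [Suc (length ?y)..<N x - B x]"
  proof -
   have "map (%i. fst (last ts) (int i)) [0..<length ?y] = map bit_symbol ?y"
    by (rule nth_equalityI) (use y(2) in auto)
   then show ?thesis using y(3) by simp
  qed
  finally have dr: "drop (B x) (fst (last (map (win (B x) (N x)) ts))) = map bit_symbol ?y @ 0 # map (%i. fst (last ts) (int i)) [Suc (length ?y)..<N x - B x]" .
  have "takeWhile (%s. s \<noteq> 0) (map bit_symbol z @ 0 # r) = map bit_symbol z" for z r
   by (induction z) (auto simp: bit_symbol_def)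
  then have "takeWhile (%s. s \<noteq> 0) (drop (B x) (fst (last (map (win (B x) (N x)) ts)))) = map bit_symbol ?y"
   unfolding dr .
  moreover have "map (%s. s = 2) (map bit_symbol z) = z" for z by (induction z) (auto simp: bit_symbol_def)
  ultimately show ?thesis by (simp add: e wcfg_def)
 qed
 then show ?thesis using out by simp
qed

section \<open>Distillation\<close>

lemma poly_nat_mono: "a \<le> b ==> poly (p :: nat poly) a \<le> poly p b"
 by (induction p) (auto intro!: add_mono mult_le_mono)

section \<open>Decoding of pairs and membership in NP\<close>

definition dec_len :: "bool list => nat" where
 "dec_len w = length (takeWhile (%i. nthd w (2 * i)) [0..<length w])"

definition dec_fst :: "bool list => bool list" where
 "dec_fst w = map (%i. nthd w (2 * i + 1)) [0..<dec_len w]"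

definition dec_snd :: "bool list => bool list" where
 "dec_snd w = drop (2 * dec_len w + 1) w"

lemma pt_dec_len [pt_intros]: "pt f ==> pt (%v. dec_len (f v))"
 by (rule pt_comp[of dec_len]) (unfold dec_len_def[abs_def], intro pt_intros)

lemma pt_dec_fst [pt_intros]: "pt f ==> pt (%v. dec_fst (f v))"
 by (rule pt_comp[of dec_fst]) (unfold dec_fst_def[abs_def], intro pt_intros)

lemma pt_dec_snd [pt_intros]: "pt f ==> pt (%v. dec_snd (f v))"
 by (rule pt_comp[of dec_snd]) (unfold dec_snd_def[abs_def], intro pt_intros)

lemma length_enc_bits: "length (enc_bits x) = 2 * length x + 1"
 by (induction x) (auto simp: enc_bits_def)

lemma enc_bits_Cons: "enc_bits (b # x) = True # b # enc_bits x"
 by (simp add: enc_bits_def)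

lemma enc_bits_nth:
 "i < length x ==> (enc_bits x @ y) ! (2 * i) = True"
 "i < length x ==> (enc_bits x @ y) ! Suc (2 * i) = x ! i"
 "(enc_bits x @ y) ! (2 * length x) = False"
proof -
 show "i < length x ==> (enc_bits x @ y) ! (2 * i) = True"
  by (induction x arbitrary: i) (auto simp: enc_bits_Cons nth_Cons' less_Suc_eq_0_disj)
 show "i < length x ==> (enc_bits x @ y) ! Suc (2 * i) = x ! i"
  by (induction x arbitrary: i) (auto simp: enc_bits_Cons nth_Cons' less_Suc_eq_0_disj)
 show "(enc_bits x @ y) ! (2 * length x) = False"
  by (induction x) (auto simp: enc_bits_Cons enc_bits_def)
qed

lemma dec_len_enc [simp]: "dec_len (enc_bits x @ y) = length x"
proof -
 let ?w = "enc_bits x @ y"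
 have l: "length x < length ?w" "2 * length x < length ?w" by (simp_all add: length_enc_bits)
 have "[0..<length ?w] = [0..<length x] @ length x # [Suc (length x)..<length ?w]"
  using l upt_add_eq_append[of 0 "length x" "length ?w - length x"] upt_conv_Cons[of "length x" "length ?w"] by simp
 moreover have "nthd ?w (2 * length x) = False" using l by (subst nthd_nth) (auto simp: enc_bits_nth)
 moreover have "nthd ?w (2 * i) = True" if "i < length x" for i
  using l that by (subst nthd_nth) (auto simp: enc_bits_nth)
 ultimately have "takeWhile (%i. nthd ?w (2 * i)) [0..<length ?w] = [0..<length x]"
  by (simp add: takeWhile_append)
 then show ?thesis unfolding dec_len_def by simp
qed

lemma dec_enc [simp]: "dec_fst (enc_bits x @ y) = x" "dec_snd (enc_bits x @ y) = y"
proof -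
 show "dec_fst (enc_bits x @ y) = x" unfolding dec_fst_def
  by (rule nth_equalityI) (auto simp: nthd_nth length_enc_bits enc_bits_nth)
 show "dec_snd (enc_bits x @ y) = y" by (simp add: dec_snd_def length_enc_bits)
qed

lemma pt_enc_bits [pt_intros]: "pt f ==> pt (%v. enc_bits (f v))"
 unfolding enc_bits_def by (intro pt_intros)

lemma pt_enc_pair [pt_intros]: "pt f ==> pt g ==> pt (%v. enc_pair (f v, g v))"
 unfolding enc_pair_def by (simp add: pt_intros)

lemma NP_I:
 assumes "pt (V :: bool list \<times> bool list => bool)" and "\<And>x. x \<in> L \<longleftrightarrow> (\<exists>u. length u \<le> poly p (length x) & V (x, u))"
 shows "L \<in> NP"
proof -
 have "poly_time_via enc_pair (%b. [b]) V"
 proof (rule pt_poly_time)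
  show "pt (%w. [V (dec_fst w, dec_snd w)])" by (intro pt_intros pt_comp[OF assms(1)])
 qed (auto simp: enc_pair_def split: prod.splits)
 then show ?thesis unfolding NP_def using assms(2) by blast
qed

section \<open>Outputs that cover many non-members\<close>

lemma card_short_bit_lists: "card {z :: bool list. length z < N} < 2 ^ N" "finite {z :: bool list. length z < N}"
proof -
 have e: "{z :: bool list. length z < N} = (\<Union>i<N. {z. set z \<subseteq> UNIV & length z = i})" by auto
 show "finite {z :: bool list. length z < N}" unfolding e by (intro finite_UN_I finite_lists_length_eq) auto
 have "card {z :: bool list. length z < N} \<le> (\<Sum>i<N. card {z :: bool list. set z \<subseteq> UNIV & length z = i})"
  unfolding e by (rule card_UN_le) simp
 also have "\<dots> = (\<Sum>i<N. 2 ^ i)" by (simp add: card_lists_length_eq[of UNIV, simplified])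
 also have "\<dots> < 2 ^ N" by (induction N) auto
 finally show "card {z :: bool list. length z < N} < 2 ^ N" .
qed

text \<open>Pigeonhole. All \<open>N\<close>-tuples with output \<open>z\<close> have their entries
  in \<open>T z\<close>; if every \<open>T z\<close> had at most half the elements of
  \<open>S\<close>, the fewer than \<open>2 ^ N\<close> possible outputs would account for fewer
  than \<open>card S ^ N\<close> tuples.\<close>

lemma popular_output:
 fixes S :: "'a set" and g :: "'a list => bool list"
 assumes "finite S" "S \<noteq> {}" and g: "\<And>xs. set xs \<subseteq> S ==> length xs = N ==> length (g xs) < N"
 shows "\<exists>z. card S < 2 * card {x \<in> S. \<exists>xs. set xs \<subseteq> S & length xs = N & x \<in> set xs & g xs = z}"
proof (rule ccontr)
 define T where "T = (%z. {x \<in> S. \<exists>xs. set xs \<subseteq> S & length xs = N & x \<in> set xs & g xs = z})"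
 let ?Z = "{z :: bool list. length z < N}" and ?X = "{xs. set xs \<subseteq> S & length xs = N}"
 assume "\<not> ?thesis"
 then have T: "2 * card (T z) \<le> card S" for z by (simp add: T_def not_less)
 have fT: "finite (T z)" for z using assms(1) by (simp add: T_def)
 have "?X \<subseteq> (\<Union>z\<in>?Z. {xs. set xs \<subseteq> T z & length xs = N})" using g by (auto simp: T_def)
 then have "card ?X \<le> card (\<Union>z\<in>?Z. {xs. set xs \<subseteq> T z & length xs = N})"
  by (intro card_mono finite_UN_I finite_lists_length_eq card_short_bit_lists fT)
 also have "\<dots> \<le> (\<Sum>z\<in>?Z. card {xs. set xs \<subseteq> T z & length xs = N})"
  by (rule card_UN_le) (rule card_short_bit_lists)
 also have "\<dots> = (\<Sum>z\<in>?Z. card (T z) ^ N)" by (simp add: card_lists_length_eq fT)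
 finally have "2 ^ N * card S ^ N \<le> 2 ^ N * (\<Sum>z\<in>?Z. card (T z) ^ N)"
  using assms(1) by (simp add: card_lists_length_eq)
 also have "\<dots> = (\<Sum>z\<in>?Z. (2 * card (T z)) ^ N)" by (simp add: sum_distrib_left power_mult_distrib)
 also have "\<dots> \<le> (\<Sum>z\<in>?Z. card S ^ N)" by (intro sum_mono power_mono T) simp
 also have "\<dots> = card ?Z * card S ^ N" by simp
 finally have "2 ^ N \<le> card ?Z" using assms(1,2) by (simp add: card_gt_0_iff)
 then show False using card_short_bit_lists(1)[of N] by simp
qed

text \<open>A popular output covers more than half of what is left, so \<open>j\<close> rounds
  exhaust a set with fewer than \<open>2 ^ j\<close> elements.\<close>

lemma few_outputs_cover:
 fixes S :: "'a set" and g :: "'a list => bool list"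
 assumes "finite S" "card S < 2 ^ j" and g: "\<And>xs. set xs \<subseteq> S ==> length xs = N ==> length (g xs) < N"
 shows "\<exists>A. length A \<le> j & (\<forall>z\<in>set A. \<exists>xs. set xs \<subseteq> S & length xs = N & g xs = z) &
  (\<forall>x\<in>S. \<exists>xs. set xs \<subseteq> S & length xs = N & x \<in> set xs & g xs \<in> set A)"
 using assms
proof (induction j arbitrary: S)
 case 0 then show ?case by auto
next
 case (Suc j)
 show ?case
 proof (cases "S = {}")
  case True then show ?thesis by (intro exI[of _ "[]"]) auto
 next
  case False
  define T where "T = (%z. {x \<in> S. \<exists>xs. set xs \<subseteq> S & length xs = N & x \<in> set xs & g xs = z})"
  have "\<exists>z. card S < 2 * card (T z)"
   unfolding T_def by (rule popular_output[OF Suc.prems(1) False]) (rule Suc.prems(3))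
  then obtain z where z: "card S < 2 * card (T z)" by blast
  have TS: "T z \<subseteq> S" by (auto simp: T_def)
  have "card (S - T z) = card S - card (T z)" using TS Suc.prems(1) by (simp add: card_Diff_subset finite_subset)
  then have c: "card (S - T z) < 2 ^ j" using z Suc.prems(2) by simp
  have "\<exists>A. length A \<le> j & (\<forall>y\<in>set A. \<exists>xs. set xs \<subseteq> S - T z & length xs = N & g xs = y) &
   (\<forall>x\<in>S - T z. \<exists>xs. set xs \<subseteq> S - T z & length xs = N & x \<in> set xs & g xs \<in> set A)"
   by (rule Suc.IH) (use Suc.prems c in auto)
  then obtain A where A: "length A \<le> j" "\<forall>y\<in>set A. \<exists>xs. set xs \<subseteq> S - T z & length xs = N & g xs = y"
   "\<forall>x\<in>S - T z. \<exists>xs. set xs \<subseteq> S - T z & length xs = N & x \<in> set xs & g xs \<in> set A" by blast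
  have "card (T z) \<noteq> 0" using z by linarith
  then have "T z \<noteq> {}" by auto
  then have "\<exists>xs. set xs \<subseteq> S & length xs = N & g xs = z" by (auto simp: T_def)
  moreover have "\<exists>xs. set xs \<subseteq> S & length xs = N & x \<in> set xs & g xs \<in> set (z # A)" if "x \<in> S" for x
  proof (cases "x \<in> T z")
   case True then show ?thesis by (auto simp: T_def)
  next
   case False
   with that have "x \<in> S - T z" by simp
   from bspec[OF A(3) this] obtain xs where "set xs \<subseteq> S - T z" "length xs = N" "x \<in> set xs" "g xs \<in> set A" by (elim exE conjE)
   then show ?thesis by (intro exI[of _ xs]) auto
  qed
  moreover have "\<exists>xs. set xs \<subseteq> S & length xs = N & g xs = y" if "y \<in> set A" for y
  proof -
   from bspec[OF A(2) that] obtain xs where "set xs \<subseteq> S - T z" "length xs = N" "g xs = y" by (elim exE conjE)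
   then show ?thesis by (intro exI[of _ xs]) auto
  qed
  ultimately show ?thesis using A(1) by (intro exI[of _ "z # A"]) simp
 qed
qed

text \<open>Brings words shorter than \<open>N\<close> to the common length \<open>N\<close>, so
  that the advice can be cut into blocks; the last \<open>True\<close> marks the end of the
  word.\<close>

definition pad :: "nat => bool list => bool list" where
 "pad N z = z @ True # replicate (N - Suc (length z)) False"

lemma pad_inj: "pad N y = pad N z ==> y = z"
proof -
 have "rev (dropWhile Not (rev (pad N z))) = z @ [True]" for z
  by (simp add: pad_def dropWhile_append)
 then show "pad N y = pad N z ==> y = z" by (metis append1_eq_conv)
qed

lemma length_pad: "length z < N ==> length (pad N z) = N"
 by (simp add: pad_def)

abbreviation chunk :: "nat => 'a list => nat => 'a list" where
 "chunk N a i \<equiv> take N (drop (i * N) a)"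

lemma chunk_concat:
 assumes "\<forall>x\<in>set xs. length x = N" "i < length xs"
 shows "chunk N (concat xs) i = xs ! i"
 using assms
proof (induction xs arbitrary: i)
 case (Cons x xs)
 show ?case
 proof (cases i)
  case (Suc k)
  have "drop (N + k * N) (x @ concat xs) = drop (k * N) (concat xs)" using Cons.prems by (simp add: drop_append)
  then show ?thesis using Cons Suc by simp
 qed (use Cons.prems in auto)
qed simp

lemma length_concat_eq: "\<forall>x\<in>set xs. length x = N ==> length (concat xs) = length xs * N"
 by (induction xs) auto

text \<open>The advice for length \<open>n\<close> consists of at most \<open>n + 1\<close> outputs
  outside \<open>Z\<close> that cover all non-members of that length. A word \<open>x\<close> is
  then a non-member iff some tuple containing \<open>x\<close> is mapped to one of them, and such a
  tuple is a certificate of polynomial length.\<close>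

theorem or_distillation:
 fixes P :: "nat poly"
 assumes g: "pt (g :: bool list list => bool list)"
  and cor: "\<And>xs n. length xs = poly P n ==> \<forall>x\<in>set xs. length x = n ==> g xs \<in> Z \<longleftrightarrow> (\<exists>x\<in>set xs. x \<in> L)"
  and small: "\<And>xs n. length xs = poly P n ==> \<forall>x\<in>set xs. length x = n ==> length (g xs) < poly P n"
 shows "L \<in> coNP_poly"
proof -
 let ?N = "%n. poly P n"
 have "\<exists>A. length A \<le> Suc n & (\<forall>z\<in>set A. z \<notin> Z & length z < ?N n) &
  (\<forall>x. length x = n & x \<notin> L --> (\<exists>xs. length xs = ?N n & (\<forall>x\<in>set xs. length x = n) & x \<in> set xs & g xs \<in> set A))" for n
 proof -
  define S where "S = {x. length x = n & x \<notin> L}"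
  have fin: "finite {x :: bool list. set x \<subseteq> UNIV & length x = n}" by (rule finite_lists_length_eq) simp
  have sub: "S \<subseteq> {x. set x \<subseteq> UNIV & length x = n}" by (auto simp: S_def)
  have "card S \<le> card {x :: bool list. set x \<subseteq> UNIV & length x = n}" by (rule card_mono[OF fin sub])
  also have "\<dots> = 2 ^ n" using card_lists_length_eq[of "UNIV :: bool set" n] by simp
  finally have "card S < 2 ^ Suc n" by (meson le_less_trans lessI power_strict_increasing_iff one_less_numeral_iff semiring_norm(76))
  moreover have "length (g xs) < ?N n" if "set xs \<subseteq> S" "length xs = ?N n" for xs
   using that by (intro small) (auto simp: S_def)
  ultimately have "\<exists>A. length A \<le> Suc n & (\<forall>z\<in>set A. \<exists>xs. set xs \<subseteq> S & length xs = ?N n & g xs = z) &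
   (\<forall>x\<in>S. \<exists>xs. set xs \<subseteq> S & length xs = ?N n & x \<in> set xs & g xs \<in> set A)"
   by (intro few_outputs_cover[OF finite_subset[OF sub fin]])
  then obtain A where A: "length A \<le> Suc n" "\<forall>z\<in>set A. \<exists>xs. set xs \<subseteq> S & length xs = ?N n & g xs = z"
   "\<forall>x\<in>S. \<exists>xs. set xs \<subseteq> S & length xs = ?N n & x \<in> set xs & g xs \<in> set A"
   by blast
  have "z \<notin> Z & length z < ?N n" if "z \<in> set A" for z
  proof -
   from bspec[OF A(2) that] obtain xs where xs: "set xs \<subseteq> S" "length xs = ?N n" "g xs = z" by (elim exE conjE)
   then have "\<forall>x\<in>set xs. length x = n" by (auto simp: S_def)
   from cor[OF xs(2) this] small[OF xs(2) this] xs show ?thesis by (auto simp: S_def)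
  qed
  moreover have "\<exists>xs. length xs = ?N n & (\<forall>x\<in>set xs. length x = n) & x \<in> set xs & g xs \<in> set A" if "length x = n & x \<notin> L" for x
  proof -
   from that have "x \<in> S" by (simp add: S_def)
   from bspec[OF A(3) this] obtain xs where "set xs \<subseteq> S" "length xs = ?N n" "x \<in> set xs" "g xs \<in> set A" by (elim exE conjE)
   then show ?thesis by (intro exI[of _ xs]) (auto simp: S_def)
  qed
  ultimately show ?thesis using A(1) by blast
 qed
 then obtain A where A: "\<And>n. length (A n) \<le> Suc n" "\<And>n z. z \<in> set (A n) ==> z \<notin> Z & length z < ?N n"
  "\<And>n x. length x = n ==> x \<notin> L ==> \<exists>xs. length xs = ?N n & (\<forall>x\<in>set xs. length x = n) & x \<in> set xs & g xs \<in> set (A n)"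
  by metis
 define adv where "adv = (%n. concat (map (pad (?N n)) (A n)))"
 define xsof where "xsof = (%n u. map (%i. chunk n u i) [0..<?N n] :: bool list list)"
 \<comment> \<open>The certificate \<open>u\<close> is the concatenation of a tuple of words; the
   padded output of \<open>g\<close> on it is compared with the advice block by block.\<close>
 define W where "W = (%w u. length u = ?N (length (dec_fst w)) * length (dec_fst w) &
  dec_fst w \<in> set (xsof (length (dec_fst w)) u) &
  (\<exists>i\<in>set [0..<Suc (length (dec_fst w))]. pad (?N (length (dec_fst w))) (g (xsof (length (dec_fst w)) u)) = chunk (?N (length (dec_fst w))) (dec_snd w) i))"
 have px: "pt (%v. xsof (a v) (b v))" if "pt a" "pt b" for a and b :: "'a::codable => bool list"
  unfolding xsof_def by (intro pt_intros that pt_comp[OF that(1)] pt_comp[OF that(2)])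
 have ppad: "pt (%v. pad (a v) (b v))" if "pt a" "pt b" for a and b :: "'a::codable => bool list"
  unfolding pad_def by (intro pt_intros that)
 have padlen: "\<forall>z\<in>set (map (pad (?N n)) (A n)). length z = ?N n" for n
  using A(2) length_pad by auto
 have chunk_adv: "chunk (?N n) (adv n) i = pad (?N n) (A n ! i)" if "i < length (A n)" for n i
  unfolding adv_def using chunk_concat[OF padlen, of i n] that by simp
 define L' where "L' = {w. \<not> (\<exists>u. length u \<le> poly (P * [:0, 1:]) (length w) & W w u)}"
 have "- L' \<in> NP"
 proof (rule NP_I[of "%p. W (fst p) (snd p)" _ "P * [:0, 1:]"])
  show "pt (%p. W (fst p) (snd p))" unfolding W_def
   by (intro pt_intros px ppad pt_comp[OF g])
 qed (auto simp: L'_def)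
 then have 1: "L' \<in> coNP" by (simp add: coNP_def)
 have 2: "length (adv n) \<le> poly ([:1, 1:] * P) n" for n
 proof -
  have "length (adv n) = length (A n) * ?N n" unfolding adv_def
   using length_concat_eq[OF padlen[of n]] by simp
  also have "\<dots> \<le> Suc n * ?N n" using A(1) by (intro mult_le_mono) auto
  finally show ?thesis by simp
 qed
 have 3: "x \<in> L \<longleftrightarrow> enc_pair (x, adv (length x)) \<in> L'" for x
 proof -
  let ?n = "length x" and ?w = "enc_pair (x, adv (length x))"
  have w: "dec_fst ?w = x" "dec_snd ?w = adv ?n" by (simp_all add: enc_pair_def)
  show ?thesis
  proof
   assume x: "x \<in> L"
   have "\<not> W ?w u" for u
   proof
    assume "W ?w u"
    then have u: "length u = ?N ?n * ?n" "x \<in> set (xsof ?n u)"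
     and "\<exists>i\<in>set [0..<Suc ?n]. pad (?N ?n) (g (xsof ?n u)) = chunk (?N ?n) (adv ?n) i" unfolding W_def w by blast+
    then obtain i where i: "pad (?N ?n) (g (xsof ?n u)) = chunk (?N ?n) (adv ?n) i" by blast
    have xs: "length (xsof ?n u) = ?N ?n" "\<forall>y\<in>set (xsof ?n u). length y = ?n"
    proof -
     show "length (xsof ?n u) = ?N ?n" by (simp add: xsof_def)
     have "length (chunk ?n u i) = ?n" if "i < ?N ?n" for i
     proof -
      have "Suc i * ?n \<le> ?N ?n * ?n" using that by (intro mult_le_mono1) simp
      then show ?thesis using u(1) by simp
     qed
     then show "\<forall>y\<in>set (xsof ?n u). length y = ?n" by (auto simp: xsof_def)
    qed
    have gZ: "g (xsof ?n u) \<in> Z" using cor[OF xs] u(2) x by blast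
    show False
    proof (cases "i < length (A ?n)")
     case True
     then have "g (xsof ?n u) = A ?n ! i" using i chunk_adv pad_inj by metis
     then show False using gZ A(2)[of "A ?n ! i" ?n] True by simp
    next
     \<comment> \<open>Fewer than \<open>n + 1\<close> outputs may be listed; past the end of the
       advice a block is empty, and a padded word never is.\<close>
     case False
     have "length (adv ?n) = length (A ?n) * ?N ?n" unfolding adv_def
      using length_concat_eq[OF padlen[of ?n]] by simp
     also have "\<dots> \<le> i * ?N ?n" using False by (intro mult_le_mono1) simp
     finally have "chunk (?N ?n) (adv ?n) i = []" by simp
     then have "pad (?N ?n) (g (xsof ?n u)) = []" using i by (rule trans[rotated])
     then show False by (simp add: pad_def)
    qed
   qed
   then show "?w \<in> L'" by (simp add: L'_def)
  next
   assume w': "?w \<in> L'"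
   show "x \<in> L"
   proof (rule ccontr)
    assume "x \<notin> L"
    then obtain xs where xs: "length xs = ?N ?n" "\<forall>y\<in>set xs. length y = ?n" "x \<in> set xs" "g xs \<in> set (A ?n)"
     using A(3)[OF refl] by blast
    have lu: "length (concat xs) = ?N ?n * ?n" using length_concat_eq[OF xs(2)] xs(1) by simp
    have xo: "xsof ?n (concat xs) = xs"
     unfolding xsof_def using chunk_concat[OF xs(2)] xs(1) by (intro nth_equalityI) auto
    obtain i where i: "i < length (A ?n)" "A ?n ! i = g xs" using xs(4) by (metis in_set_conv_nth)
    have "W ?w (concat xs)" unfolding W_def w xo
     using lu xs(3) i A(1)[of ?n] chunk_adv[OF i(1)] by (intro conjI bexI[of _ i]) auto
    moreover have "length (concat xs) \<le> poly (P * [:0, 1:]) (length ?w)"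
    proof -
     have l: "?n \<le> length ?w" by (simp add: enc_pair_def length_enc_bits)
     have "?N ?n * ?n \<le> ?N (length ?w) * length ?w" by (intro mult_le_mono poly_nat_mono l)
     then show ?thesis unfolding lu by (simp add: ac_simps)
    qed
    ultimately show False using w' unfolding L'_def by blast
   qed
  qed
 qed
 show ?thesis unfolding coNP_poly_def using 1 2 3 by blast
qed

section \<open>Hall's theorem and the clique gadget\<close>

text \<open>Halmos-Vaughan induction. If every proper nonempty subfamily has a surplus, one
  arbitrary choice does no harm; otherwise a tight subfamily is served first and its values are
  removed from the other sets.\<close>

lemma hall:
 fixes L :: "'a => 'b set"
 assumes "finite I" "\<And>i. i \<in> I ==> finite (L i)" "\<And>J. J \<subseteq> I ==> card J \<le> card (\<Union>(L ` J))"
 shows "\<exists>c. inj_on c I & (\<forall>i\<in>I. c i \<in> L i)"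
 using assms
proof (induction I arbitrary: L rule: finite_psubset_induct)
 case (psubset I)
 note fin = psubset.prems(1) and hall = psubset.prems(2)
 have finU: "finite (\<Union>(L ` J))" if "J \<subseteq> I" for J
  using that fin psubset.hyps by (meson finite_UN finite_subset subsetD)
 show ?case
 proof (cases "I = {}")
  case True then show ?thesis by simp
 next
  case False
  show ?thesis
  proof (cases "\<exists>J. J \<subset> I & J \<noteq> {} & card (\<Union>(L ` J)) \<le> card J")
   case False
   obtain i where i: "i \<in> I" using \<open>I \<noteq> {}\<close> by blast
   have "card {i} \<le> card (\<Union>(L ` {i}))" using i by (intro hall) simp
   then have "L i \<noteq> {}" by auto
   then obtain x where x: "x \<in> L i" by blast
   define L' where "L' = (%j. L j - {x})"
   have "\<exists>c. inj_on c (I - {i}) & (\<forall>j\<in>I - {i}. c j \<in> L' j)"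
   proof (rule psubset.IH)
    show "I - {i} \<subset> I" using i by blast
    show "finite (L' j)" if "j \<in> I - {i}" for j using that fin by (simp add: L'_def)
    fix J assume J: "J \<subseteq> I - {i}"
    show "card J \<le> card (\<Union>(L' ` J))"
    proof (cases "J = {}")
     case False
     then have "card J < card (\<Union>(L ` J))" using J i \<open>\<not> (\<exists>J. _ J)\<close> by (metis Diff_subset Diff_iff insertI1 not_le psubsetI subset_iff)
     moreover have "\<Union>(L' ` J) = \<Union>(L ` J) - {x}" by (auto simp: L'_def)
     ultimately show ?thesis using card_Diff_singleton_if[of "\<Union>(L ` J)" x] by (cases "x \<in> \<Union>(L ` J)") simp_all
    qed simp
   qed
   then obtain c where c: "inj_on c (I - {i})" "\<forall>j\<in>I - {i}. c j \<in> L' j" by blast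
   have "inj_on (c(i := x)) I" using c by (auto simp: inj_on_def L'_def)
   moreover have "\<forall>j\<in>I. (c(i := x)) j \<in> L j" using c x by (auto simp: L'_def)
   ultimately show ?thesis by blast
  next
   case True
   then obtain J where J: "J \<subset> I" "J \<noteq> {}" "card (\<Union>(L ` J)) \<le> card J" by blast
   have finJ: "finite J" using J psubset.hyps by (meson finite_subset psubset_imp_subset)
   have "\<exists>c. inj_on c J & (\<forall>j\<in>J. c j \<in> L j)"
    by (rule psubset.IH) (use J fin hall in auto)
   then obtain c where c: "inj_on c J" "\<forall>j\<in>J. c j \<in> L j" by blast
   define U where "U = \<Union>(L ` J)"
   have "\<exists>d. inj_on d (I - J) & (\<forall>j\<in>I - J. d j \<in> L j - U)"
   proof (rule psubset.IH)
    show "I - J \<subset> I" using J by blast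
    show "finite (L j - U)" if "j \<in> I - J" for j using that fin by simp
    fix K assume K: "K \<subseteq> I - J"
    have finK: "finite K" using K psubset.hyps by (meson finite_Diff finite_subset)
    have "card K + card J = card (K \<union> J)" using K finK finJ by (intro card_Un_disjoint[symmetric]) auto
    also have "\<dots> \<le> card (\<Union>(L ` (K \<union> J)))" using K J by (intro hall) auto
    also have "\<Union>(L ` (K \<union> J)) = \<Union>((%j. L j - U) ` K) \<union> U" by (auto simp: U_def)
    also have "card \<dots> \<le> card (\<Union>((%j. L j - U) ` K)) + card U" by (rule card_Un_le)
    finally show "card K \<le> card (\<Union>((%j. L j - U) ` K))" using J(3) by (simp add: U_def)
   qed
   then obtain d where d: "inj_on d (I - J)" "\<forall>j\<in>I - J. d j \<in> L j - U" by blast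
   let ?c = "%j. if j \<in> J then c j else d j"
   have "c j \<in> U" if "j \<in> J" for j using c that by (auto simp: U_def)
   then have "inj_on ?c I" using c(1) d unfolding inj_on_def by (metis DiffE DiffI)
   moreover have "\<forall>j\<in>I. ?c j \<in> L j" using c d by auto
   ultimately show ?thesis by blast
  qed
 qed
qed

text \<open>Every clique vertex keeps at least \<open>s - 1\<close> colours, so Hall's condition can
  fail only for the whole clique. Then all vertices keep the same \<open>s - 1\<close> colours,
  which means that the lists \<open>D j\<close> have no repetitions and the same range.\<close>

lemma clique_gadget:
 fixes D :: "nat => nat list"
 assumes s: "1 \<le> s" "s \<le> q" and D: "\<And>j. j < s ==> length (D j) = q + 1 - s & set (D j) \<subseteq> {..<q}"
 shows "(\<exists>col. inj_on col {..<s} & (\<forall>j<s. col j < q & col j \<notin> set (D j))) \<longleftrightarrow>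
    \<not> (\<forall>j<s. distinct (D j) & set (D j) = set (D 0))"
proof
 assume "\<exists>col. inj_on col {..<s} & (\<forall>j<s. col j < q & col j \<notin> set (D j))"
 then obtain col where col: "inj_on col {..<s}" "\<And>j. j < s ==> col j < q & col j \<notin> set (D j)" by blast
 show "\<not> (\<forall>j<s. distinct (D j) & set (D j) = set (D 0))"
 proof
  assume a: "\<forall>j<s. distinct (D j) & set (D j) = set (D 0)"
  have "col j \<in> {..<q} - set (D 0)" if "j < s" for j
   using col(2)[OF that] a[rule_format, OF that] by (metis DiffI lessThan_iff)
  then have "col ` {..<s} \<subseteq> {..<q} - set (D 0)" by (intro image_subsetI) simp
  then have "card (col ` {..<s}) \<le> card ({..<q} - set (D 0))" by (intro card_mono) auto
  also have "\<dots> = q - card (set (D 0))" using D[of 0] s by (simp add: card_Diff_subset)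
  also have "card (set (D 0)) = q + 1 - s" using a s D[of 0] by (metis distinct_card less_le_trans zero_less_one)
  finally show False using card_image[OF col(1)] s by simp
 qed
next
 assume a: "\<not> (\<forall>j<s. distinct (D j) & set (D j) = set (D 0))"
 define L where "L = (%j. {..<q} - set (D j))"
 have Lc: "card (L j) = q - card (set (D j))" if "j < s" for j
  using D[OF that] by (simp add: L_def card_Diff_subset)
 have cD: "card (set (D j)) \<le> q + 1 - s" if "j < s" for j
  using D[OF that] card_length[of "D j"] by simp
 have big: "s - 1 \<le> card (L j)" if "j < s" for j
  using Lc[OF that] cD[OF that] s by linarith
 have "\<exists>c. inj_on c {..<s} & (\<forall>j\<in>{..<s}. c j \<in> L j)"
 proof (rule hall)
  fix J assume J: "J \<subseteq> {..<s}"
  have finU: "finite (\<Union>(L ` J))" using J by (auto simp: L_def intro: finite_subset[of _ "{..<q}"])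
  show "card J \<le> card (\<Union>(L ` J))"
  proof (rule ccontr)
   assume n: "\<not> card J \<le> card (\<Union>(L ` J))"
   then obtain j where j: "j \<in> J" by fastforce
   have LU: "card (L i) \<le> card (\<Union>(L ` J))" if "i \<in> J" for i
    using finU that by (intro card_mono) auto
   have "s - 1 \<le> card (\<Union>(L ` J))" using big LU[OF j] J j by fastforce
   then have c: "card J \<ge> s" "card (\<Union>(L ` J)) \<le> s - 1"
    using n card_mono[OF _ J] by auto
   then have Js: "J = {..<s}" using J card_subset_eq[of "{..<s}" J] card_mono[OF _ J] by auto
   have eq: "L i = \<Union>(L ` J)" if "i < s" for i
    by (rule card_subset_eq[OF finU]) (use that Js LU[of i] big[of i] c in auto)
   have "distinct (D i) & set (D i) = set (D 0)" if i: "i < s" for i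
   proof
    have "card (L i) \<le> s - 1" using eq[OF i] c by simp
    then have "q + 1 - s \<le> card (set (D i))" using Lc[OF i] s card_mono[of "{..<q}" "set (D i)"] D[OF i] by simp
    then show "distinct (D i)" using D[OF i] by (intro card_distinct) (use cD[OF i] in simp)
    have "L i = L 0" using eq[OF i] eq[of 0] s by simp
    then show "set (D i) = set (D 0)" using D[OF i] D[of 0] s unfolding L_def by (metis double_diff less_le_trans order_refl zero_less_one)
   qed
   then show False using a by blast
  qed
 qed (auto simp: L_def)
 then show "\<exists>col. inj_on col {..<s} & (\<forall>j<s. col j < q & col j \<notin> set (D j))"
  by (auto simp: L_def)
qed


section \<open>Encoded graphs\<close>

lemma enc_bits_append_inj: "enc_bits x @ y = enc_bits x' @ y' ==> x = x' & y = y'"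
 by (metis dec_enc)

fun bits_val :: "bool list => nat" where
 "bits_val [] = 0"
| "bits_val (b # bs) = (if b then 1 else 0) + 2 * bits_val bs"

lemma bits_val_binary [simp]: "bits_val (binary n) = n"
proof (induction n rule: binary.induct)
 case (1 n)
 then show ?case by (subst binary.simps) (auto simp: odd_iff_mod_2_eq_one)
qed

lemma binary_inj [simp]: "binary m = binary n \<longleftrightarrow> m = n"
 by (metis bits_val_binary)

lemma enc_nat_append_inj: "enc_nat m @ y = enc_nat n @ y' ==> m = n & y = y'"
 unfolding enc_nat_def using enc_bits_append_inj binary_inj by blast

lemma enc_list_append_inj:
 assumes "\<And>a b y y'. e a @ y = e b @ y' ==> a = b & y = y'"
 shows "enc_list e xs @ y = enc_list e ys @ y' ==> xs = ys & y = y'"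
proof (induction xs arbitrary: ys)
 case Nil then show ?case by (cases ys) (auto simp: enc_list_def)
next
 case (Cons a xs)
 show ?case
 proof (cases ys)
  case Nil then show ?thesis using Cons.prems by (simp add: enc_list_def)
 next
  case (Cons b zs)
  with Cons.prems have "e a @ (enc_list e xs @ y) = e b @ (enc_list e zs @ y')" by (simp add: enc_list_def)
  from assms[OF this] Cons.IH show ?thesis using Cons by simp
 qed
qed

lemma enc_graph_inj:
 assumes "enc_graph n es xs = enc_graph n' es' xs'" shows "n = n' & es = es' & xs = xs'"
proof -
 have u: "replicate n True @ False # y = replicate n' True @ False # y' ==> n = n' & y = y'" for n n' y y'
 proof (induction n arbitrary: n')
  case 0 then show ?case by (cases n') auto
 next
  case (Suc n) then show ?case by (cases n') auto
 qed
 let ?e = "%(u, v). enc_nat u @ enc_nat v"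
 have 1: "n = n'" "enc_list ?e es @ enc_list enc_nat xs = enc_list ?e es' @ enc_list enc_nat xs'"
  using u[of n "enc_list ?e es @ enc_list enc_nat xs" n' "enc_list ?e es' @ enc_list enc_nat xs'"] assms
  unfolding enc_graph_def enc_unary_def by auto
 have pe: "a = b & y = y'" if "?e a @ y = ?e b @ y'" for a b y y'
 proof (cases a, cases b)
  fix u v u' v' assume ab: "a = (u, v)" "b = (u', v')"
  then have "enc_nat u @ (enc_nat v @ y) = enc_nat u' @ (enc_nat v' @ y')" using that by simp
  from enc_nat_append_inj[OF this] enc_nat_append_inj show ?thesis using ab by blast
 qed
 have 2: "es = es'" "enc_list enc_nat xs = enc_list enc_nat xs'"
  using enc_list_append_inj[OF pe 1(2)] by auto
 have "enc_list enc_nat xs @ [] = enc_list enc_nat xs' @ []" using 2(2) by simp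
 then have "xs = xs'" by (rule enc_list_append_inj[THEN conjunct1, rotated]) (rule enc_nat_append_inj)
 then show ?thesis using 1 2 by simp
qed

lemma encodes_unique: "encodes x G X ==> encodes x G' X' ==> G = G' & X = X'"
 unfolding encodes_def using enc_graph_inj by metis

text \<open>The word determines graph and modulator, so the existential quantifier in the problem
  leaves no choice and any witness may be examined.\<close>

lemma coloring_problem_iff:
 "clique_kv_instance t i G X ==> i \<in> coloring_problem q t \<longleftrightarrow> q_colorable q G"
proof -
 assume a: "clique_kv_instance t i G X"
 have e: "encodes (fst i) G X" if "clique_kv_instance t i G X" for G X
  using that by (cases i) (simp add: clique_kv_instance_def)
 have "G' = G" if "clique_kv_instance t i G' X'" for G' X'
  using encodes_unique[OF e[OF that] e[OF a]] by simp
 then show ?thesis using a unfolding coloring_problem_def by blast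
qed

section \<open>Graphs given by named vertices\<close>

definition ix :: "'a list => 'a => nat" where "ix vs u = length (takeWhile (%v. v \<noteq> u) vs)"

lemma ix: "u \<in> set vs ==> ix vs u < length vs" "u \<in> set vs ==> vs ! ix vs u = u"
 by (induction vs) (auto simp: ix_def)

lemma ix_nth: "distinct vs ==> i < length vs ==> ix vs (vs ! i) = i"
 by (metis ix nth_eq_iff_index_eq nth_mem)

lemma ix_inj: "u \<in> set vs ==> v \<in> set vs ==> ix vs u = ix vs v \<longleftrightarrow> u = v"
 by (metis ix(2))

definition mk_edges :: "'a list => ('a \<times> 'a) list => (nat \<times> nat) list" where
 "mk_edges vs es = map (%e. (ix vs (fst e), ix vs (snd e))) es"

lemma mk_edges_iff: "(a, b) \<in> set (mk_edges vs es) \<longleftrightarrow> (\<exists>u v. (u, v) \<in> set es & a = ix vs u & b = ix vs v)"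
 by (force simp: mk_edges_def)

text \<open>Vertices carry structured names and are numbered by position; as \<open>Xs\<close> comes
  first, the modulator is an initial segment.\<close>

definition mk_graph :: "'a list => 'a list => ('a \<times> 'a) list => bool list" where
 "mk_graph Xs Os es = enc_graph (length (Xs @ Os)) (mk_edges (Xs @ Os) es) [0..<length Xs]"

definition abs_graph :: "'a list => ('a \<times> 'a) list => graph" where
 "abs_graph vs es = ({..<length vs}, {{u, v} | u v. (u, v) \<in> set (mk_edges vs es)})"

text \<open>The promise on the graph without the modulator is checked through a labelling
  \<open>cl\<close> of its vertices by the names of their cliques.\<close>

lemma mk_graph_instance:
 assumes d: "distinct (Xs @ Os)"
  and es: "\<And>u v. (u, v) \<in> set es ==> u \<in> set (Xs @ Os) & v \<in> set (Xs @ Os) & u \<noteq> v"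
  and cl: "\<And>u v. u \<in> set Os ==> v \<in> set Os ==> u \<noteq> v ==> ((u, v) \<in> set es \<or> (v, u) \<in> set es) \<longleftrightarrow> cl u = cl v"
  and ct: "\<And>u. u \<in> set Os ==> card {v \<in> set Os. cl v = cl u} \<le> t"
 shows "clique_kv_instance t (mk_graph Xs Os es, length Xs) (abs_graph (Xs @ Os) es) {..<length Xs}"
proof -
 define vs where "vs = Xs @ Os"
 define E where "E = {{u, v} | u v. (u, v) \<in> set (mk_edges vs es)}"
 have G: "abs_graph (Xs @ Os) es = ({..<length vs}, E)" by (simp add: abs_graph_def vs_def E_def)
 have dv: "distinct vs" using d by (simp add: vs_def)
 have e1: "\<exists>i j. i < length vs & j < length vs & i \<noteq> j & a = i & b = j & (vs ! i, vs ! j) \<in> set es"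
  if "(a, b) \<in> set (mk_edges vs es)" for a b
 proof -
  from that obtain u v where uv: "(u, v) \<in> set es" "a = ix vs u" "b = ix vs v" unfolding mk_edges_iff by blast
  have "u \<in> set vs" "v \<in> set vs" "u \<noteq> v" using es[OF uv(1)] by (simp_all add: vs_def)
  then have "a < length vs" "b < length vs" "a \<noteq> b" "vs ! a = u" "vs ! b = v"
   using ix[of u vs] ix[of v vs] ix_inj[of u vs v] by (simp_all add: uv)
  then show ?thesis using uv(1) by blast
 qed
 have e2: "(i, j) \<in> set (mk_edges vs es)" if "i < length vs" "j < length vs" "(vs ! i, vs ! j) \<in> set es" for i j
  unfolding mk_edges_iff using that dv by (metis ix_nth)
 have "encodes (mk_graph Xs Os es) (abs_graph (Xs @ Os) es) {..<length Xs}"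
  unfolding encodes_def mk_graph_def abs_graph_def by fastforce
 moreover have "simple_graph (abs_graph (Xs @ Os) es)"
 proof -
  have "\<exists>u v. {a, b} = {u, v} & u < length vs & v < length vs & u \<noteq> v" if "(a, b) \<in> set (mk_edges vs es)" for a b
   using e1[OF that] by blast
  then show ?thesis unfolding G simple_graph_def E_def by auto
 qed
 moreover have "{..<length Xs} \<subseteq> fst (abs_graph (Xs @ Os) es)" by (auto simp: abs_graph_def)
 moreover have "delete_vertices (abs_graph (Xs @ Os) es) {..<length Xs} \<in> t_Clique t"
 proof -
  let ?k = "length Xs"
  define V' where "V' = {?k..<length vs}"
  have O: "vs ! i \<in> set Os" if "i \<in> V'" for i
   using that by (auto simp: V'_def vs_def nth_append)
  define B where "B = (%u. {i \<in> V'. cl (vs ! i) = cl (vs ! u)})"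
  have part: "partition_on V' (B ` V')"
  proof (rule partition_onI)
   show "\<Union>(B ` V') = V'" by (auto simp: B_def)
   show "disjnt p p'" if "p \<in> B ` V'" "p' \<in> B ` V'" "p \<noteq> p'" for p p'
    using that by (auto simp: B_def disjnt_def)
   show "{} \<notin> B ` V'" by (auto simp: B_def)
  qed
  have card: "card C \<le> t" if "C \<in> B ` V'" for C
  proof -
   obtain u where u: "u \<in> V'" "C = B u" using \<open>C \<in> B ` V'\<close> by blast
   have "inj_on ((!) vs) C" using dv u by (auto simp: inj_on_def B_def V'_def nth_eq_iff_index_eq)
   moreover have "(!) vs ` C \<subseteq> {v \<in> set Os. cl v = cl (vs ! u)}" using O u by (auto simp: B_def)
   ultimately have "card C \<le> card {v \<in> set Os. cl v = cl (vs ! u)}" by (intro card_inj_on_le[of "(!) vs"]) auto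
   then show ?thesis using ct[OF O[OF u(1)]] by simp
  qed
  have E': "{e \<in> E. e \<inter> {..<?k} = {}} = {{u, v} |u v. u \<noteq> v & (\<exists>C\<in>B ` V'. u \<in> C & v \<in> C)}" (is "?A = ?B")
  proof
   show "?A \<subseteq> ?B"
   proof
    fix e assume e: "e \<in> ?A"
    then obtain a b where ab: "e = {a, b}" "(a, b) \<in> set (mk_edges vs es)" unfolding E_def by blast
    have "a < length vs" "b < length vs" "a \<noteq> b" "(vs ! a, vs ! b) \<in> set es" using e1[OF ab(2)] by blast+
    then have i: "a \<in> V'" "b \<in> V'" "a \<noteq> b" "(vs ! a, vs ! b) \<in> set es" using e ab(1) by (auto simp: V'_def)
    then have "vs ! a \<noteq> vs ! b" using dv by (auto simp: V'_def nth_eq_iff_index_eq)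
    then have "cl (vs ! a) = cl (vs ! b)" using cl[OF O[OF i(1)] O[OF i(2)]] i by blast
    then have "a \<in> B a" "b \<in> B a" using i by (auto simp: B_def)
    then show "e \<in> ?B" using ab i by blast
   qed
   show "?B \<subseteq> ?A"
   proof
    fix e assume "e \<in> ?B"
    then obtain a b where ab: "e = {a, b}" "a \<noteq> b" "a \<in> V'" "b \<in> V'" "cl (vs ! a) = cl (vs ! b)" by (auto simp: B_def)
    then have "vs ! a \<noteq> vs ! b" using dv by (auto simp: V'_def nth_eq_iff_index_eq)
    then have "(vs ! a, vs ! b) \<in> set es \<or> (vs ! b, vs ! a) \<in> set es" using cl[OF O[OF ab(3)] O[OF ab(4)]] ab by blast
    then have "(a, b) \<in> set (mk_edges vs es) \<or> (b, a) \<in> set (mk_edges vs es)" using e2 ab by (auto simp: V'_def)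
    then have "e \<in> E" using ab unfolding E_def by blast
    then show "e \<in> ?A" using ab by (auto simp: V'_def)
   qed
  qed
  have V: "{..<length vs} - {..<?k} = V'" by (auto simp: V'_def)
  have "finite V'" by (simp add: V'_def)
  moreover have "delete_vertices (abs_graph (Xs @ Os) es) {..<?k} = (V', {{u, v} |u v. u \<noteq> v & (\<exists>C\<in>B ` V'. u \<in> C & v \<in> C)})"
   unfolding G delete_vertices_def case_prod_conv V E' ..
  ultimately show ?thesis unfolding t_Clique_def using part card
   by (simp only: mem_Collect_eq case_prod_conv) (intro conjI exI[of _ "B ` V'"] ballI TrueI refl; assumption?)
 qed
 ultimately show ?thesis by (simp add: clique_kv_instance_def)
qed

lemma mk_graph_colorable:
 assumes d: "distinct vs" and es: "\<And>u v. (u, v) \<in> set es ==> u \<in> set vs & v \<in> set vs & u \<noteq> v"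
 shows "q_colorable q (abs_graph vs es) \<longleftrightarrow>
  (\<exists>c. (\<forall>u\<in>set vs. c u < q) & (\<forall>e\<in>set es. c (fst e) \<noteq> c (snd e)))"
proof
 assume "q_colorable q (abs_graph vs es)"
 then obtain c :: "nat => nat" where c0: "\<forall>v\<in>{..<length vs}. c v < q"
  "\<forall>u v. {u, v} \<in> {{u, v} | u v. (u, v) \<in> set (mk_edges vs es)} & u \<noteq> v --> c u \<noteq> c v"
  unfolding q_colorable_def abs_graph_def case_prod_conv by blast
 have c: "\<And>v. v < length vs ==> c v < q"
  "\<And>u v. {u, v} \<in> {{u, v} | u v. (u, v) \<in> set (mk_edges vs es)} ==> u \<noteq> v ==> c u \<noteq> c v"
  using c0(1) c0(2)[THEN spec, THEN spec, THEN mp, OF conjI] by simp_all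
 have "c (ix vs u) \<noteq> c (ix vs v)" if "(u, v) \<in> set es" for u v
 proof (rule c(2))
  have "(ix vs u, ix vs v) \<in> set (mk_edges vs es)" using that by (auto simp: mk_edges_iff)
  then show "{ix vs u, ix vs v} \<in> {{u, v} | u v. (u, v) \<in> set (mk_edges vs es)}" by blast
  show "ix vs u \<noteq> ix vs v" using es[OF that] ix_inj[of u vs v] by blast
 qed
 then show "\<exists>c. (\<forall>u\<in>set vs. c u < q) & (\<forall>e\<in>set es. c (fst e) \<noteq> c (snd e))"
  using c(1) ix(1)[of _ vs] by (intro exI[of _ "%u. c (ix vs u)"] conjI ballI) (simp, force)
next
 assume "\<exists>c. (\<forall>u\<in>set vs. c u < q) & (\<forall>e\<in>set es. c (fst e) \<noteq> c (snd e))"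
 then obtain c where c: "\<forall>u\<in>set vs. c u < q" "\<forall>e\<in>set es. c (fst e) \<noteq> c (snd e)" by blast
 have "c (vs ! a) \<noteq> c (vs ! b)" if "{a, b} \<in> {{u, v} | u v. (u, v) \<in> set (mk_edges vs es)}" for a b
 proof -
  from that obtain u v where uv: "{a, b} = {ix vs u, ix vs v}" "(u, v) \<in> set es" unfolding mk_edges_iff by blast
  have "c u \<noteq> c v" "vs ! ix vs u = u" "vs ! ix vs v = v"
   using bspec[OF c(2) uv(2)] es[OF uv(2)] ix(2)[of u vs] ix(2)[of v vs] by simp_all
  then show ?thesis using uv(1) by (metis doubleton_eq_iff)
 qed
 then show "q_colorable q (abs_graph vs es)"
  unfolding q_colorable_def abs_graph_def case_prod_conv using c(1)
  by (intro exI[of _ "%i. c (vs ! i)"] conjI allI impI ballI) (simp, blast)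
qed

section \<open>Encoding graphs in polynomial time\<close>

lemma pt_ix [pt_intros]:
 assumes "pt f" "pt g" shows "pt (%v. ix (f v) (g v))"
 unfolding ix_def by (intro pt_intros assms pt_comp[OF assms(2)])

lemma pt_half: "pt f ==> pt (%v. f v div (2::nat))"
proof -
 assume f: "pt f"
 have "length (filter (%i. 2 * i + 2 \<le> m) [0..<m]) = m div 2" for m :: nat
 proof -
  have "set (filter (%i. 2 * i + 2 \<le> m) [0..<m]) = {..<m div 2}" by auto
  moreover have "length (filter (%i. 2 * i + 2 \<le> m) [0..<m]) = card (set (filter (%i. 2 * i + 2 \<le> m) [0..<m]))"
   by (rule distinct_card[symmetric]) simp
  ultimately show ?thesis by simp
 qed
 moreover have "pt (%v. length (filter (%i. 2 * i + 2 \<le> f v) [0..<f v]))" by (intro pt_intros f pt_comp[OF f])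
 ultimately show ?thesis by simp
qed

lemma pt_binary [pt_intros]: "pt f ==> pt (%v. binary (f v))"
proof -
 assume f: "pt f"
 \<comment> \<open>Repeated halving. The loop runs as many rounds as the value of the number and
   idles once 0 is reached; this is affordable since numbers are unary.\<close>
 let ?F = "%(_::bool) s. if fst s = 0 then s else (fst s div 2, snd s @ [\<not> (2 * (fst s div 2) = fst s)])"
 have *: "fold ?F (replicate m False) (n, a) = (0, a @ binary n)" if "n \<le> m" for m n a
  using that
 proof (induction m arbitrary: n a)
  case 0 then show ?case by (simp add: binary.simps)
 next
  case (Suc m)
  show ?case
  proof (cases "n = 0")
   case True
   then show ?thesis using Suc.IH[of 0 a] by (simp del: fold_replicate)
  next
   case False
   have "odd n = (2 * (n div 2) \<noteq> n)" by (metis dvd_mult_div_cancel dvd_triv_left)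
   then have bn: "binary n = (2 * (n div 2) \<noteq> n) # binary (n div 2)" using False by (subst binary.simps) (simp only: if_False)
   have "n div 2 \<le> m" using Suc.prems False by simp
   from Suc.IH[OF this, of "a @ [2 * (n div 2) \<noteq> n]"] False show ?thesis
    unfolding bn by (simp only: replicate_Suc fold_simps fst_conv snd_conv if_False append_assoc append_Cons append_Nil)
  qed
 qed
 have "pt (%v. fold ?F (replicate (f v) False) (f v, []))"
 proof (rule pt_fold_add[where H = "%_. 10"])
  show "esz (?F a s) \<le> esz s + 10" for a :: bool and s :: "nat \<times> bool list"
  proof -
   obtain n b where s: "s = (n, b)" by fastforce
   define d where "d = (\<not> (2 * (n div 2) = n))"
   have "esz (b @ [d]) \<le> esz b + 5" using esz_append_le[of b "[d]"] by (simp split: if_splits)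
   moreover have "?F a s = (if n = 0 then (n, b) else (n div 2, b @ [d]))" by (simp only: s d_def fst_conv snd_conv)
   moreover obtain h where h: "n div 2 = h" "h \<le> n" by simp
   ultimately show ?thesis by (simp add: s h(1))
  qed
 qed (intro pt_intros pt_half pt_replicate_False f bnd_intros)+
 then have "pt (%v. snd (fold ?F (replicate (f v) False) (f v, [])))" by (intro pt_intros)
 then show ?thesis unfolding *[OF order_refl] by simp
qed

lemma pt_enc_nat [pt_intros]: "pt f ==> pt (%v. enc_nat (f v))"
 unfolding enc_nat_def by (intro pt_intros)

lemma pt_enc_graph [pt_intros]: "pt f ==> pt g ==> pt h ==> pt (%v. enc_graph (f v) (g v) (h v))"
 unfolding enc_graph_def enc_unary_def enc_list_def by (intro pt_intros)

lemma pt_mk_graph [pt_intros]: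
 assumes "pt f" "pt g" "pt h" shows "pt (%v. mk_graph (f v) (g v) (h v))"
 unfolding mk_graph_def mk_edges_def
 by (intro pt_intros assms pt_comp[OF assms(1)] pt_comp[OF assms(2)])

section \<open>From constrained formulas to graphs\<close>

lemma pt_remdups [pt_intros]:
 assumes "pt f" shows "pt (%v. remdups (f v))"
proof -
 let ?F = "%x acc. if x \<in> set acc then acc else x # acc"
 have *: "remdups xs = fold ?F (rev xs) []" for xs :: "'b list"
 proof (induction xs)
  case (Cons a xs)
  then have "set (fold ?F (rev xs) []) = set xs" by (metis set_remdups)
  then show ?case using Cons by simp
 qed simp
 have "pt (%v. fold ?F (rev (f v)) [])"
 proof (rule pt_fold_add[where H = "%p. Suc (esz p)"])
  show "bnd (%p::'a \<times> 'b. Suc (esz p))" by (intro bnd_intros)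
 qed (intro pt_intros assms | simp)+
 then show ?thesis unfolding * .
qed

text \<open>A loop over a fixed list is unrolled into the program, so its body may depend on the
  list element in any way.\<close>

lemma pt_concat_const:
 assumes "\<And>j. j \<in> set js ==> pt (%v. F j v)" shows "pt (%v. concat (map (%j. F j v) js))"
 using assms by (induction js) (auto intro!: pt_intros)

lemma mem_concat_map: "u \<in> set (concat (map f xs)) \<longleftrightarrow> (\<exists>x\<in>set xs. u \<in> set (f x))"
 by auto

lemma mem_map: "u \<in> set (map f xs) \<longleftrightarrow> (\<exists>x\<in>set xs. u = f x)"
 by auto

definition prp :: "('a => nat) => ('a \<times> 'a) list => bool" where
 "prp \<kappa> E \<longleftrightarrow> (\<forall>e\<in>set E. \<kappa> (fst e) \<noteq> \<kappa> (snd e))"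

lemma prp_simps [simp]:
 "prp \<kappa> []" "prp \<kappa> (e # E) \<longleftrightarrow> \<kappa> (fst e) \<noteq> \<kappa> (snd e) & prp \<kappa> E"
 "prp \<kappa> (E @ E') \<longleftrightarrow> prp \<kappa> E & prp \<kappa> E'" "prp \<kappa> (concat (map f xs)) \<longleftrightarrow> (\<forall>x\<in>set xs. prp \<kappa> (f x))"
 by (auto simp: prp_def)

type_synonym lit = "bool \<times> nat list"

definition lit_true :: "(nat list => bool) => lit => bool" where
 "lit_true \<beta> l \<longleftrightarrow> \<beta> (snd l) = fst l"

text \<open>Besides clauses there are forbidden tuples, each of which must contain a false variable.
  The two are kept apart because clauses cost vertices of the modulator, whereas tuples cost only
  cliques outside it.\<close>

definition sat :: "lit list list => nat list list list => (nat list => bool) => bool" where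
 "sat cls fs \<beta> \<longleftrightarrow> (\<forall>cl\<in>set cls. \<exists>l\<in>set cl. lit_true \<beta> l) & (\<forall>tu\<in>set fs. \<exists>v\<in>set tu. \<not> \<beta> v)"

definition slot_col :: "(nat => nat) => bool \<times> nat => nat" where
 "slot_col \<kappa> it = (if fst it then \<kappa> (snd it) else snd it)"

text \<open>
 A gadget is a clique whose vertices see slot vertices (entries \<open>(True, j)\<close>) and palette colours
 (entries \<open>(False, c)\<close>). Slot \<open>j\<close> has one of the colours \<open>tc j\<close> (true) and \<open>ac j\<close> (false), and the
 clique cannot be coloured iff all slots are true.
\<close>

locale gadget =
 fixes q t r :: nat and tc ac :: "nat => nat" and T F B :: nat and nb :: "(bool \<times> nat) list list"
 assumes TFB: "T < q" "F < q" "B < q" "T \<noteq> F" "T \<noteq> B" "F \<noteq> B"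
  and cols: "\<And>j. j < r ==> tc j < q & ac j < q & tc j \<noteq> ac j & tc j \<noteq> T"
  and nb_t: "length nb \<le> t"
  and nb_ok: "\<And>a it. a \<in> set nb ==> it \<in> set a ==> if fst it then snd it < r else snd it < q"
  and spec: "\<And>\<kappa>. (\<And>j. j < r ==> \<kappa> j \<in> {tc j, ac j}) ==>
   (\<exists>col. inj_on col {..<length nb} & (\<forall>a<length nb. col a < q & col a \<notin> slot_col \<kappa> ` set (nb ! a)))
   \<longleftrightarrow> \<not> (\<forall>j<r. \<kappa> j = tc j)"
begin

text \<open>Restricts the colour of \<open>u\<close> to \<open>S\<close> once the palette is
  coloured canonically. First entries of vertex names: 0 palette, 1 literals, 2 slots, 3 connectors
  between literals and slots, 4 gates of clauses, 5 cliques outside the modulator.\<close>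

definition avoid :: "nat list => nat list => (nat list \<times> nat list) list" where
 "avoid u S = map (%c. (u, [0, c])) (filter (%c. c \<notin> set S) [0..<q])"

definition lit_vertex :: "lit => nat list" where
 "lit_vertex l = 1 # (if fst l then 1 else 0) # snd l"

text \<open>The disjunction of no literals is the palette vertex of colour \<open>F\<close>, where
  the chain of gates of a clause starts.\<close>

definition or_out :: "nat => nat => nat list" where
 "or_out i p = (if p = 0 then [0, F] else [4, i, p - 1, 2])"

text \<open>Only one implication is enforced, that a true variable gives its slot the colour
  \<open>tc j\<close>: a literal coloured \<open>T\<close> excludes \<open>ac j\<close>, either
  directly or through a connector with the colours \<open>T\<close> and \<open>ac j\<close>. This
  suffices because tuples are only ever forbidden.\<close>

definition E_slot :: "nat => nat list => (nat list \<times> nat list) list" where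
 "E_slot j v = avoid (2 # j # v) [tc j, ac j] @
  (if ac j = T then [(1 # 1 # v, 2 # j # v)]
   else avoid (3 # j # v) [T, ac j] @ [(3 # j # v, 1 # 1 # v), (3 # j # v, 2 # j # v)])"

definition E_var :: "nat list => (nat list \<times> nat list) list" where
 "E_var v = avoid (1 # 0 # v) [T, F] @ avoid (1 # 1 # v) [T, F] @ [(1 # 0 # v, 1 # 1 # v)] @
  concat (map (%j. E_slot j v) [0..<r])"

text \<open>The gate of the classical reduction from 3-SAT to 3-Coloring: a triangle whose third
  vertex can have colour \<open>T\<close> only if one of the two inputs has it.\<close>

definition E_or :: "nat => nat => lit => (nat list \<times> nat list) list" where
 "E_or i p l = avoid [4, i, p, 0] [T, F, B] @ avoid [4, i, p, 1] [T, F, B] @ avoid [4, i, p, 2] [T, F] @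
  [([4, i, p, 0], [4, i, p, 1]), ([4, i, p, 0], [4, i, p, 2]), ([4, i, p, 1], [4, i, p, 2]),
   ([4, i, p, 0], or_out i p), ([4, i, p, 1], lit_vertex l)]"

definition E_clause :: "nat => lit list => (nat list \<times> nat list) list" where
 "E_clause i cl = concat (map (%p. E_or i p (nthd cl p)) [0..<length cl]) @ avoid (or_out i (length cl)) [T]"

definition item :: "nat list list => bool \<times> nat => nat list" where
 "item tu it = (if fst it then 2 # snd it # nthd tu (snd it) else [0, snd it])"

definition E_forbid :: "nat => nat list list => (nat list \<times> nat list) list" where
 "E_forbid k tu = concat (map (%a. map (%b. ([5, k, a], [5, k, b])) [Suc a..<length nb]) [0..<length nb]) @
  concat (map (%a. concat (map (%it. [([5, k, a], item tu it)]) (nb ! a))) [0..<length nb])"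

definition E_pal :: "(nat list \<times> nat list) list" where
 "E_pal = concat (map (%c. map (%d. ([0, c], [0, d])) (filter (%d. d \<noteq> c) [0..<q])) [0..<q])"

definition vars :: "lit list list => nat list list" where
 "vars cls = map snd (concat cls)"

definition edges :: "lit list list => nat list list list => (nat list \<times> nat list) list" where
 "edges cls fs = E_pal @ concat (map E_var (vars cls)) @
  concat (map (%i. E_clause i (nthd cls i)) [0..<length cls]) @
  concat (map (%k. E_forbid k (nthd fs k)) [0..<length fs])"

text \<open>The modulator. It depends on the clauses only, so forbidden tuples do not enlarge the
  parameter.\<close>

definition inner :: "lit list list => nat list list" where
 "inner cls = remdups (map (%c. [0, c]) [0..<q] @
  concat (map (%v. [1 # 0 # v, 1 # 1 # v] @ concat (map (%j. [2 # j # v, 3 # j # v]) [0..<r])) (vars cls)) @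
  concat (map (%i. concat (map (%p. [[4, i, p, 0], [4, i, p, 1], [4, i, p, 2]]) [0..<length (nthd cls i)])) [0..<length cls]))"

definition outer :: "nat list list list => nat list list" where
 "outer fs = remdups (concat (map (%k. map (%a. [5, k, a]) [0..<length nb]) [0..<length fs]))"

lemma pt_avoid [pt_intros]: "pt f ==> pt (%v. avoid (f v) S)"
proof -
 assume f: "pt f"
 show ?thesis unfolding avoid_def by (intro pt_intros pt_comp[OF f])
qed

lemma pt_edges: "pt f ==> pt g ==> pt (%v. edges (f v) (g v))"
proof -
 assume f: "pt f" and g: "pt g"
 have slot: "pt (%v. E_slot j v)" for j
  unfolding E_slot_def One_nat_def by (cases "ac j = T") (simp_all only: if_True if_False, (intro pt_intros)+)
 have slots: "pt (%v. concat (map (%j. E_slot j v) [0..<r]))" by (rule pt_concat_const) (rule slot)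
 have lits: "pt (%v. avoid (1 # 0 # v) [T, F])" "pt (%v. avoid (1 # 1 # v) [T, F])" "pt (%v :: nat list. [(1 # 0 # v, 1 # 1 # v)])"
  by (intro pt_intros)+
 have 1: "pt E_var" unfolding E_var_def[abs_def]
  by (rule pt_append[OF lits(1) pt_append[OF lits(2) pt_append[OF lits(3) slots]]])
 have 2: "pt (%p. E_or (fst p) (fst (snd p)) (snd (snd p)))"
  unfolding E_or_def or_out_def lit_vertex_def One_nat_def by (intro pt_intros)
 have 2: "pt (%p. E_clause (fst p) (snd p))" unfolding E_clause_def or_out_def One_nat_def
  by (intro pt_intros pt_comp[OF 2, where f = "%x. (a x, b x, c x)" for a b c, simplified])
 have items: "pt (%p. concat (map (%it. [([5, fst p, a], item (snd p) it)]) (nb ! a)))" for a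
  by (rule pt_concat_const) (unfold item_def, intro pt_intros)
 have "pt (%p::nat \<times> nat list list. concat (map (%a. map (%b. ([5, fst p, a], [5, fst p, b])) [Suc a..<length nb]) [0..<length nb]))"
  by (intro pt_intros)
 moreover have "pt (%p. concat (map (%a. concat (map (%it. [([5, fst p, a], item (snd p) it)]) (nb ! a))) [0..<length nb]))"
  by (rule pt_concat_const) (rule items)
 ultimately have 3: "pt (%p. E_forbid (fst p) (snd p))" unfolding E_forbid_def by (rule pt_append)
 show ?thesis unfolding edges_def vars_def
  by (intro pt_intros f g pt_comp[OF f] pt_comp[OF g] pt_comp[OF 1]
   pt_comp[OF 2, where f = "%x. (a x, b x)" for a b, simplified] pt_comp[OF 3, where f = "%x. (a x, b x)" for a b, simplified])
qed

lemma pt_inner: "pt f ==> pt (%v. inner (f v))"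
proof -
 assume f: "pt f"
 show ?thesis unfolding inner_def vars_def One_nat_def by (intro pt_intros f pt_comp[OF f])
qed

lemma pt_outer: "pt f ==> pt (%v. outer (f v))"
 unfolding outer_def by (intro pt_intros)

lemma set_inner: "u \<in> set (inner cls) \<longleftrightarrow> (\<exists>c<q. u = [0, c]) \<or>
 (\<exists>v\<in>set (vars cls). u = 1 # 0 # v \<or> u = 1 # 1 # v \<or> (\<exists>j<r. u = 2 # j # v \<or> u = 3 # j # v)) \<or>
 (\<exists>i<length cls. \<exists>p<length (cls ! i). u = [4, i, p, 0] \<or> u = [4, i, p, 1] \<or> u = [4, i, p, 2])"
proof -
 have 1: "u \<in> set (map (%c. [0, c]) [0..<q]) \<longleftrightarrow> (\<exists>c<q. u = [0, c])" by auto
 have 2: "u \<in> set (concat (map (%v. [1 # 0 # v, 1 # 1 # v] @ concat (map (%j. [2 # j # v, 3 # j # v]) [0..<r])) (vars cls))) \<longleftrightarrow>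
  (\<exists>v\<in>set (vars cls). u = 1 # 0 # v \<or> u = 1 # 1 # v \<or> (\<exists>j<r. u = 2 # j # v \<or> u = 3 # j # v))" by auto
 have 3: "u \<in> set (concat (map (%i. concat (map (%p. [[4, i, p, 0], [4, i, p, 1], [4, i, p, 2]]) [0..<length (nthd cls i)])) [0..<length cls])) \<longleftrightarrow>
  (\<exists>i<length cls. \<exists>p<length (cls ! i). u = [4, i, p, 0] \<or> u = [4, i, p, 1] \<or> u = [4, i, p, 2])" by (auto simp: nthd_nth)
 show ?thesis unfolding inner_def set_remdups set_append Un_iff 1 2 3 by blast
qed

lemma set_outer: "u \<in> set (outer fs) \<longleftrightarrow> (\<exists>k<length fs. \<exists>a<length nb. u = [5, k, a])"
 unfolding outer_def set_remdups mem_concat_map mem_map set_upt Bex_def atLeastLessThan_iff by simp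

end

section \<open>Endpoints of the edges and the promise\<close>

definition allE :: "('a => 'a => bool) => ('a \<times> 'a) list => bool" where
 "allE P E \<longleftrightarrow> (\<forall>e\<in>set E. P (fst e) (snd e))"

lemma allE_simps [simp]:
 "allE P []" "allE P (e # E) \<longleftrightarrow> P (fst e) (snd e) & allE P E"
 "allE P (E @ E') \<longleftrightarrow> allE P E & allE P E'" "allE P (concat (map f xs)) \<longleftrightarrow> (\<forall>x\<in>set xs. allE P (f x))"
 by (auto simp: allE_def)

lemma allE_map: "allE P (map f xs) \<longleftrightarrow> (\<forall>x\<in>set xs. P (fst (f x)) (snd (f x)))"
 by (auto simp: allE_def)

context gadget
begin

lemma allE_avoid [simp]: "allE P (avoid u S) \<longleftrightarrow> (\<forall>c<q. c \<notin> set S --> P u [0, c])"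
 unfolding avoid_def allE_map by auto

lemma inner_pal [simp]: "c < q ==> [0, c] \<in> set (inner cls)"
 unfolding set_inner by blast

lemma inner_lit [simp]: "v \<in> set (vars cls) ==> Suc 0 # 0 # v \<in> set (inner cls)" "v \<in> set (vars cls) ==> Suc 0 # Suc 0 # v \<in> set (inner cls)"
 unfolding set_inner One_nat_def by blast+

lemma inner_slot [simp]: "v \<in> set (vars cls) ==> j < r ==> 2 # j # v \<in> set (inner cls)" "v \<in> set (vars cls) ==> j < r ==> 3 # j # v \<in> set (inner cls)"
 unfolding set_inner by blast+

lemma inner_or [simp]: "i < length cls ==> p < length (cls ! i) ==> [4, i, p, 0] \<in> set (inner cls)"
 "i < length cls ==> p < length (cls ! i) ==> [4, i, p, Suc 0] \<in> set (inner cls)"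
 "i < length cls ==> p < length (cls ! i) ==> [4, i, p, 2] \<in> set (inner cls)"
 unfolding set_inner One_nat_def by blast+

lemma inner_hd: "u \<in> set (inner cls) ==> hd u \<noteq> 5"
 unfolding set_inner by (elim disjE exE bexE conjE) simp_all

lemma outer_hd: "u \<in> set (outer fs) ==> hd u = 5"
 unfolding set_outer by (elim exE conjE) simp

lemma or_out_inner [simp]:
 assumes "i < length cls" "p \<le> length (cls ! i)" shows "or_out i p \<in> set (inner cls)"
 using assms TFB unfolding or_out_def by (cases p) simp_all

lemma lit_vertex_inner [simp]: "cl \<in> set cls ==> l \<in> set cl ==> lit_vertex l \<in> set (inner cls)"
proof -
 assume "cl \<in> set cls" "l \<in> set cl"
 then have "snd l \<in> set (vars cls)" by (auto simp: vars_def)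
 then show ?thesis by (simp add: lit_vertex_def)
qed

abbreviation inn :: "lit list list => nat list => nat list => bool" where
 "inn cls u v \<equiv> u \<in> set (inner cls) & v \<in> set (inner cls) & u \<noteq> v"

lemma E_pal_ends: "allE (inn cls) E_pal"
 unfolding E_pal_def allE_simps allE_map by simp

lemma E_slot_ends: "v \<in> set (vars cls) ==> j < r ==> allE (inn cls) (E_slot j v)"
 unfolding E_slot_def by simp

lemma E_var_ends: "v \<in> set (vars cls) ==> allE (inn cls) (E_var v)"
 unfolding E_var_def using E_slot_ends by simp

lemma E_clause_ends:
 assumes "i < length cls" "cls ! i \<noteq> []" shows "allE (inn cls) (E_clause i (cls ! i))"
proof -
 have l: "lit_vertex (nthd (cls ! i) p) \<in> set (inner cls)" if "p < length (cls ! i)" for p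
  using lit_vertex_inner[OF nth_mem[OF assms(1)] nth_mem[OF that]] that by (simp add: nthd_nth)
 have "allE (inn cls) (E_or i p (nthd (cls ! i) p))" if "p < length (cls ! i)" for p
  using that assms l[OF that] TFB unfolding E_or_def by (simp add: or_out_def lit_vertex_def[of "nthd (cls ! i) p", symmetric]) (simp add: lit_vertex_def)
 then show ?thesis unfolding E_clause_def using assms by (simp add: or_out_def)
qed

definition outn :: "nat list list list => lit list list => nat list => nat list => bool" where
 "outn fs cls u v \<longleftrightarrow> u \<in> set (outer fs) & (v \<in> set (inner cls) \<or> v \<in> set (outer fs) & u \<noteq> v & take 2 u = take 2 v)"

lemma E_forbid_ends:
 assumes "k < length fs" "length (fs ! k) = r" "set (fs ! k) \<subseteq> set (vars cls)"
 shows "allE (outn fs cls) (E_forbid k (fs ! k))"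
proof -
 have o: "[5, k, a] \<in> set (outer fs)" if "a < length nb" for a unfolding set_outer using that assms(1) by blast
 have "item (fs ! k) it \<in> set (inner cls)" if "a < length nb" "it \<in> set (nb ! a)" for a it
 proof -
  have ok: "if fst it then snd it < r else snd it < q" using nb_ok[of "nb ! a" it] that by simp
  show ?thesis
  proof (cases "fst it")
   case True
   then have j: "snd it < r" using ok by simp
   then have "nthd (fs ! k) (snd it) \<in> set (vars cls)" using assms by (auto simp: nthd_nth)
   then show ?thesis using True j by (simp add: item_def)
  next
   case False
   then show ?thesis using ok by (simp add: item_def)
  qed
 qed
 then show ?thesis unfolding E_forbid_def allE_simps allE_map outn_def using o by simp
qed

lemma edges_ends:
 assumes ne: "\<And>tu. tu \<in> set fs ==> length tu = r & set tu \<subseteq> set (vars cls)" and cl: "[] \<notin> set cls"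
 shows "allE (%u v. inn cls u v \<or> outn fs cls u v) (edges cls fs)"
proof -
 have m: "allE P E ==> (\<And>u v. P u v ==> Q u v) ==> allE Q E" for P Q E unfolding allE_def by blast
 have 1: "allE (%u v. inn cls u v \<or> outn fs cls u v) E_pal" by (rule m[OF E_pal_ends[of cls]]) blast
 have 2: "allE (%u v. inn cls u v \<or> outn fs cls u v) (E_var v)" if "v \<in> set (vars cls)" for v
  by (rule m[OF E_var_ends[OF that]]) blast
 have 3: "allE (%u v. inn cls u v \<or> outn fs cls u v) (E_clause i (nthd cls i))" if "i < length cls" for i
 proof -
  have "cls ! i \<noteq> []" using that cl nth_mem[OF that] by metis
  from m[OF E_clause_ends[OF that this]] show ?thesis using that by (simp add: nthd_nth)
 qed
 have 4: "allE (%u v. inn cls u v \<or> outn fs cls u v) (E_forbid k (nthd fs k))" if "k < length fs" for k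
 proof -
  have h: "length (fs ! k) = r" "set (fs ! k) \<subseteq> set (vars cls)" using ne[OF nth_mem[OF that]] by simp_all
  from m[OF E_forbid_ends[OF that h]] show ?thesis using that by (simp add: nthd_nth)
 qed
 show ?thesis unfolding edges_def using 1 2 3 4 by simp
qed

lemma edges_ends':
 assumes "\<And>tu. tu \<in> set fs ==> length tu = r & set tu \<subseteq> set (vars cls)" "[] \<notin> set cls" "(u, v) \<in> set (edges cls fs)"
 shows "inn cls u v \<or> outn fs cls u v"
 using edges_ends[OF assms(1,2)] assms(3) unfolding allE_def by fastforce

lemma disjoint_inner_outer: "set (inner cls) \<inter> set (outer fs) = {}"
 using inner_hd outer_hd by blast

lemma distinct_vertices: "distinct (inner cls @ outer fs)"
 using disjoint_inner_outer by (simp add: inner_def outer_def)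

lemma edges_ok:
 assumes "\<And>tu. tu \<in> set fs ==> length tu = r & set tu \<subseteq> set (vars cls)" "[] \<notin> set cls" "(u, v) \<in> set (edges cls fs)"
 shows "u \<in> set (inner cls @ outer fs) & v \<in> set (inner cls @ outer fs) & u \<noteq> v"
proof -
 from edges_ends'[OF assms] consider "inn cls u v" | "outn fs cls u v" by blast
 then show ?thesis
 proof cases
  case 2
  then show ?thesis using disjoint_inner_outer[of cls fs] unfolding outn_def set_append by blast
 qed simp
qed

text \<open>\<open>take 2\<close> turns the name of an outer vertex into \<open>[5, k]\<close>, the
  name of the clique of the \<open>k\<close>-th forbidden tuple.\<close>

lemma graph_instance:
 assumes ne: "\<And>tu. tu \<in> set fs ==> length tu = r & set tu \<subseteq> set (vars cls)" and cl: "[] \<notin> set cls"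
 shows "clique_kv_instance t (mk_graph (inner cls) (outer fs) (edges cls fs), length (inner cls))
  (abs_graph (inner cls @ outer fs) (edges cls fs)) {..<length (inner cls)}"
proof (rule mk_graph_instance[where cl = "take 2"])
 show "distinct (inner cls @ outer fs)" by (rule distinct_vertices)
 show "u \<in> set (inner cls @ outer fs) & v \<in> set (inner cls @ outer fs) & u \<noteq> v" if "(u, v) \<in> set (edges cls fs)" for u v
  by (rule edges_ok[OF ne cl that])
next
 fix u assume u: "u \<in> set (outer fs)"
 then obtain k a where ka: "k < length fs" "a < length nb" "u = [5, k, a]" unfolding set_outer by blast
 have "v \<in> (%b. [5, k, b]) ` {..<length nb}" if v: "v \<in> set (outer fs)" "take 2 v = take 2 u" for v
 proof -
  obtain k' a' where ka': "k' < length fs" "a' < length nb" "v = [5, k', a']" using v(1) unfolding set_outer by blast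
  then have "k' = k" using v(2) ka by simp
  then show ?thesis using ka' by (intro image_eqI[of _ _ a']) simp_all
 qed
 then have "{v \<in> set (outer fs). take 2 v = take 2 u} \<subseteq> (%b. [5, k, b]) ` {..<length nb}" by blast
 then have "card {v \<in> set (outer fs). take 2 v = take 2 u} \<le> card ((%b. [5, k, b]) ` {..<length nb})"
  by (intro card_mono) simp_all
 also have "\<dots> \<le> length nb" using card_image_le[of "{..<length nb}" "%b. [5, k, b]"] by simp
 finally show "card {v \<in> set (outer fs). take 2 v = take 2 u} \<le> t" using nb_t by simp
next
 fix u v assume uv: "u \<in> set (outer fs)" "v \<in> set (outer fs)" "u \<noteq> v"
 obtain k a where ka: "k < length fs" "a < length nb" "u = [5, k, a]" using uv(1) unfolding set_outer by blast
 obtain k' a' where ka': "k' < length fs" "a' < length nb" "v = [5, k', a']" using uv(2) unfolding set_outer by blast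
 show "((u, v) \<in> set (edges cls fs) \<or> (v, u) \<in> set (edges cls fs)) \<longleftrightarrow> take 2 u = take 2 v"
 proof
  have *: "take 2 x = take 2 y" if "(x, y) \<in> set (edges cls fs)" "x \<in> set (outer fs)" "y \<in> set (outer fs)" for x y
   using edges_ends'[OF ne cl that(1)] that(2,3) disjoint_inner_outer[of cls fs] unfolding outn_def by blast
  assume "(u, v) \<in> set (edges cls fs) \<or> (v, u) \<in> set (edges cls fs)"
  then show "take 2 u = take 2 v" using *[of u v] *[of v u] uv by argo
 next
  assume "take 2 u = take 2 v"
  then have k: "k' = k" using ka ka' by simp
  then have aa: "a \<noteq> a'" using ka ka' uv(3) by blast
  have E: "([5, k, b], [5, k, b']) \<in> set (edges cls fs)" if "b < b'" "b' < length nb" for b b'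
  proof -
   have "([5, k, b], [5, k, b']) \<in> set (map (%b'. ([5, k, b], [5, k, b'])) [Suc b..<length nb])" using that by simp
   moreover have "b \<in> set [0..<length nb]" using that by simp
   ultimately have "([5, k, b], [5, k, b']) \<in> set (E_forbid k (nthd fs k))"
    unfolding E_forbid_def set_append mem_concat_map Un_iff by blast
   moreover have "k \<in> set [0..<length fs]" using ka(1) by simp
   ultimately show ?thesis unfolding edges_def set_append mem_concat_map Un_iff by blast
  qed
  show "(u, v) \<in> set (edges cls fs) \<or> (v, u) \<in> set (edges cls fs)"
   using E[of a a'] E[of a' a] aa ka(2) ka'(2) unfolding ka(3) ka'(3) k by (cases "a < a'") simp_all
 qed
qed

lemma length_inner: "length (inner cls) \<le> q + (2 + 2 * r) * length (concat cls) + 3 * length (concat cls)"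
proof -
 have 1: "length (concat (map (%v. [1 # 0 # v, 1 # 1 # v] @ concat (map (%j. [2 # j # v, 3 # j # v]) [0..<r])) vs)) = (2 + 2 * r) * length vs" for vs :: "nat list list"
 proof (induction vs)
  case (Cons v vs)
  have "length (concat (map (%j. [2 # j # v, 3 # j # v]) [0..<r])) = 2 * r" by (simp add: length_concat comp_def sum_list_triv)
  then show ?case using Cons by simp
 qed simp
 have 2: "length (concat (map (%i. concat (map (%p. [[4, i, p, 0], [4, i, p, 1], [4, i, p, 2]]) [0..<length (nthd cls i)])) [0..<length cls])) = 3 * length (concat cls)"
 proof -
  have "map (%i. length (concat (map (%p. [[4, i, p, 0], [4, i, p, 1], [4, i, p, 2]]) [0..<length (nthd cls i)]))) [0..<length cls]
   = map (%c. 3 * length c) cls"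
   by (rule nth_equalityI) (simp_all add: nthd_nth length_concat comp_def sum_list_triv)
  then have "length (concat (map (%i. concat (map (%p. [[4, i, p, 0], [4, i, p, 1], [4, i, p, 2]]) [0..<length (nthd cls i)])) [0..<length cls]))
   = sum_list (map (%c. 3 * length c) cls)" by (simp only: length_concat map_map comp_def)
  then show ?thesis by (simp add: length_concat sum_list_const_mult)
 qed
 show ?thesis unfolding inner_def
  by (rule order_trans[OF length_remdups_leq]) (simp only: length_append 1 2 length_map length_upt vars_def)
qed

end

section \<open>Colourings and satisfying assignments\<close>

context gadget
begin

abbreviation proper :: "(nat list => nat) => (nat list \<times> nat list) list => bool" where
 "proper \<kappa> \<equiv> allE (%u v. \<kappa> u \<noteq> \<kappa> v)"

lemma proper_avoid:
 assumes "\<And>c. c < q ==> \<kappa> [0, c] = c" "\<kappa> u < q"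
 shows "proper \<kappa> (avoid u S) \<longleftrightarrow> \<kappa> u \<in> set S"
 unfolding allE_avoid using assms by metis

lemma coloring_sound:
 assumes ne: "\<And>tu. tu \<in> set fs ==> length tu = r & set tu \<subseteq> set (vars cls)" and cl: "[] \<notin> set cls"
  and q: "\<And>u. u \<in> set (inner cls @ outer fs) ==> \<kappa> u < q" and pal: "\<And>c. c < q ==> \<kappa> [0, c] = c"
  and E: "proper \<kappa> (edges cls fs)"
 shows "sat cls fs (%v. \<kappa> (1 # 1 # v) = T)"
proof -
 let ?\<beta> = "%v. \<kappa> (1 # 1 # v) = T"
 have Ev: "\<And>v. v \<in> set (vars cls) ==> proper \<kappa> (E_var v)"
  and Ec: "\<And>i. i < length cls ==> proper \<kappa> (E_clause i (cls ! i))"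
  and Ef: "\<And>k. k < length fs ==> proper \<kappa> (E_forbid k (fs ! k))"
  using E unfolding edges_def by (simp_all add: nthd_nth)
 have qi: "\<kappa> u < q" if "u \<in> set (inner cls)" for u using q that by simp
 have av: "\<kappa> u \<in> set S" if "u \<in> set (inner cls)" "proper \<kappa> (avoid u S)" for u S
  using proper_avoid[OF pal qi[OF that(1)]] that(2) by blast
 have var: "\<kappa> (1 # 0 # v) \<in> {T, F}" "\<kappa> (1 # 1 # v) \<in> {T, F}" "\<kappa> (1 # 0 # v) \<noteq> \<kappa> (1 # 1 # v)"
  "\<And>j. j < r ==> proper \<kappa> (E_slot j v)" if v: "v \<in> set (vars cls)" for v
 proof -
  have "proper \<kappa> (E_var v)" by (rule Ev[OF v])
  then have *: "proper \<kappa> (avoid (1 # 0 # v) [T, F])" "proper \<kappa> (avoid (1 # 1 # v) [T, F])" "\<kappa> (1 # 0 # v) \<noteq> \<kappa> (1 # 1 # v)"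
   "\<forall>j\<in>set [0..<r]. proper \<kappa> (E_slot j v)"
   unfolding E_var_def allE_simps(3,4) by simp_all
  show "\<kappa> (1 # 0 # v) \<noteq> \<kappa> (1 # 1 # v)" by (rule *(3))
  show "\<kappa> (1 # 0 # v) \<in> {T, F}" "\<kappa> (1 # 1 # v) \<in> {T, F}"
   using av[OF _ *(1)] av[OF _ *(2)] v by simp_all
  show "\<And>j. j < r ==> proper \<kappa> (E_slot j v)" using *(4) by simp
 qed
 have slot: "\<kappa> (2 # j # v) \<in> {tc j, ac j}" "?\<beta> v ==> \<kappa> (2 # j # v) = tc j" if v: "v \<in> set (vars cls)" and j: "j < r" for v j
 proof -
  have s: "proper \<kappa> (avoid (2 # j # v) [tc j, ac j])"
   and s': "if ac j = T then \<kappa> (1 # 1 # v) \<noteq> \<kappa> (2 # j # v) else proper \<kappa> (avoid (3 # j # v) [T, ac j]) & \<kappa> (3 # j # v) \<noteq> \<kappa> (1 # 1 # v) & \<kappa> (3 # j # v) \<noteq> \<kappa> (2 # j # v)"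
   using var(4)[OF v j] unfolding E_slot_def allE_simps(3) by (simp_all split: if_splits)
  show 1: "\<kappa> (2 # j # v) \<in> {tc j, ac j}" using av[OF _ s] v j by simp
  have 3: "\<kappa> (3 # j # v) \<in> {T, ac j}" if "ac j \<noteq> T" using av[of "3 # j # v" "[T, ac j]"] s' that v j by simp
  show "\<kappa> (2 # j # v) = tc j" if "?\<beta> v"
  proof (cases "ac j = T")
   case True then show ?thesis using s' 1 that by auto
  next
   case False then show ?thesis using s' 1 3 that by auto
  qed
 qed
 have lit: "\<kappa> (lit_vertex l) \<in> {T, F}" "\<kappa> (lit_vertex l) = T ==> lit_true ?\<beta> l" if "c \<in> set cls" "l \<in> set c" for c l
 proof -
  have v: "snd l \<in> set (vars cls)" using that by (auto simp: vars_def)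
  show "\<kappa> (lit_vertex l) \<in> {T, F}" using var(1,2)[OF v] by (simp add: lit_vertex_def)
  show "lit_true ?\<beta> l" if "\<kappa> (lit_vertex l) = T"
   using var(1-3)[OF v] that TFB by (cases "fst l") (simp_all add: lit_vertex_def lit_true_def)
 qed
 have "\<exists>l\<in>set c. lit_true ?\<beta> l" if "c \<in> set cls" for c
 proof -
  from that obtain i where i: "i < length cls" "cls ! i = c" unfolding in_set_conv_nth by blast
  have "proper \<kappa> (E_clause i c)" using Ec[OF i(1)] i(2) by simp
  then have or: "\<And>p. p < length c ==> proper \<kappa> (E_or i p (c ! p))" and fin: "proper \<kappa> (avoid (or_out i (length c)) [T])"
   unfolding E_clause_def allE_simps by (simp_all add: nthd_nth)
  have out: "\<kappa> (or_out i p) \<in> {T, F}" "\<kappa> (or_out i p) = T ==> \<exists>l\<in>set (take p c). lit_true ?\<beta> l" if "p \<le> length c" for p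
  proof -
   have "\<kappa> (or_out i p) \<in> {T, F} & (\<kappa> (or_out i p) = T --> (\<exists>l\<in>set (take p c). lit_true ?\<beta> l))"
    using that
   proof (induction p)
    case 0
    then show ?case using pal TFB by (simp add: or_out_def)
   next
    case (Suc p)
    then have p: "p < length c" "p < length (cls ! i)" using i by simp_all
    let ?x = "\<kappa> [4, i, p, 0]" and ?y = "\<kappa> [4, i, p, 1]" and ?o = "\<kappa> [4, i, p, 2]"
    have e: "proper \<kappa> (avoid [4, i, p, 0] [T, F, B])" "proper \<kappa> (avoid [4, i, p, 1] [T, F, B])" "proper \<kappa> (avoid [4, i, p, 2] [T, F])"
     "?x \<noteq> ?y" "?x \<noteq> ?o" "?y \<noteq> ?o" "?x \<noteq> \<kappa> (or_out i p)" "?y \<noteq> \<kappa> (lit_vertex (c ! p))"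
     using or[OF p(1)] unfolding E_or_def allE_simps(3) by simp_all
    have xs: "?x \<in> {T, F, B}" "?y \<in> {T, F, B}" "?o \<in> {T, F}"
     using av[OF _ e(1)] av[OF _ e(2)] av[OF _ e(3)] i(1) p(2) by simp_all
    have o: "or_out i (Suc p) = [4, i, p, 2]" by (simp add: or_out_def)
    have IH: "\<kappa> (or_out i p) \<in> {T, F}" "\<kappa> (or_out i p) = T --> (\<exists>l\<in>set (take p c). lit_true ?\<beta> l)" using Suc by simp_all
    have l: "\<kappa> (lit_vertex (c ! p)) \<in> {T, F}" "\<kappa> (lit_vertex (c ! p)) = T ==> lit_true ?\<beta> (c ! p)"
     using lit[OF \<open>c \<in> set cls\<close> nth_mem[OF p(1)]] by simp_all
    \<comment> \<open>If the output has colour \<open>T\<close>, the other two vertices of the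
      triangle have colours \<open>F\<close> and \<open>B\<close>, and the input next to
      \<open>F\<close> can only have colour \<open>T\<close>.\<close>
    have "\<kappa> (or_out i p) = T \<or> \<kappa> (lit_vertex (c ! p)) = T" if "?o = T"
    proof -
     have "?x = F \<or> ?x = B" "?y = F \<or> ?y = B" using that e(5,6) xs(1,2) by simp_all
     then have "?x = F \<or> ?y = F" using e(4) by argo
     then show ?thesis using e(7,8) IH(1) l(1) by (metis empty_iff insert_iff)
    qed
    then have "?o = T ==> \<exists>l\<in>set (take (Suc p) c). lit_true ?\<beta> l"
     using IH(2) l(2) unfolding take_Suc_conv_app_nth[OF p(1)] set_append by (metis UnI1 UnI2 list.set_intros(1))
    then show ?case using xs(3) unfolding o by blast
   qed
   then show "\<kappa> (or_out i p) \<in> {T, F}" "\<kappa> (or_out i p) = T ==> \<exists>l\<in>set (take p c). lit_true ?\<beta> l" by blast+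
  qed
  have "or_out i (length c) \<in> set (inner cls)" using i by simp
  from av[OF this fin] have "\<kappa> (or_out i (length c)) = T" by simp
  from out(2)[OF order_refl this] show ?thesis by simp
 qed
 \<comment> \<open>If all variables of \<open>tu\<close> were true, all its slots would show
   \<open>tc\<close>, and \<open>spec\<close> would deny the clique the colouring that \<kappa>
   gives it.\<close>
 moreover have "\<exists>v\<in>set tu. \<not> ?\<beta> v" if "tu \<in> set fs" for tu
 proof (rule ccontr)
  assume "\<not> (\<exists>v\<in>set tu. \<not> ?\<beta> v)"
  then have tru: "?\<beta> v" if "v \<in> set tu" for v using that by blast
  from that obtain k where k: "k < length fs" "fs ! k = tu" unfolding in_set_conv_nth by blast
  have tu: "length tu = r" "set tu \<subseteq> set (vars cls)" using ne[OF that] by simp_all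
  have "proper \<kappa> (E_forbid k tu)" using Ef[OF k(1)] k(2) by simp
  then have e1: "\<And>a b. a < b ==> b < length nb ==> \<kappa> [5, k, a] \<noteq> \<kappa> [5, k, b]"
   and e2: "\<And>a it. a < length nb ==> it \<in> set (nb ! a) ==> \<kappa> [5, k, a] \<noteq> \<kappa> (item tu it)"
   unfolding E_forbid_def allE_simps allE_map by simp_all
  let ?\<kappa> = "%j. \<kappa> (2 # j # tu ! j)" and ?col = "%a. \<kappa> [5, k, a]"
  have t: "?\<kappa> j = tc j" if "j < r" for j
  proof -
   have "tu ! j \<in> set tu" using tu(1) that by simp
   then show ?thesis using slot(2)[of "tu ! j" j] tru tu(2) that by blast
  qed
  have "inj_on ?col {..<length nb}"
   unfolding inj_on_def using e1 by (metis lessThan_iff linorder_neqE_nat)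
  moreover have "?col a < q & ?col a \<notin> slot_col ?\<kappa> ` set (nb ! a)" if a: "a < length nb" for a
  proof
   have "[5, k, a] \<in> set (outer fs)" unfolding set_outer using a k by blast
   then show "?col a < q" using q by simp
   have "?col a \<noteq> slot_col ?\<kappa> it" if it: "it \<in> set (nb ! a)" for it
   proof -
    have ok: "if fst it then snd it < r else snd it < q" using nb_ok[of "nb ! a" it] it a by simp
    then have "\<kappa> (item tu it) = slot_col ?\<kappa> it"
     using pal tu by (cases "fst it") (simp_all add: item_def slot_col_def nthd_nth)
    then show ?thesis using e2[OF a it] by simp
   qed
   then show "?col a \<notin> slot_col ?\<kappa> ` set (nb ! a)" by blast
  qed
  ultimately have "\<exists>col. inj_on col {..<length nb} & (\<forall>a<length nb. col a < q & col a \<notin> slot_col ?\<kappa> ` set (nb ! a))" by blast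
  moreover have "?\<kappa> j \<in> {tc j, ac j}" if "j < r" for j using t[OF that] by simp
  ultimately have "\<not> (\<forall>j<r. ?\<kappa> j = tc j)" using spec[of ?\<kappa>] by blast
  then show False using t by blast
 qed
 ultimately show ?thesis unfolding sat_def by blast
qed

text \<open>In a gate, \<open>a\<close> says that an earlier literal of the clause is true and
  \<open>b\<close> that the current one is. The colours \<open>gc\<close> of the cliques come from
  \<open>spec\<close>.\<close>

definition colf :: "lit list list => (nat list => bool) => (nat => nat => nat) => nat list => nat" where
 "colf cls \<beta> gc u =
  (if hd u = 0 then u ! 1
  else if hd u = 1 then (if (u ! 1 = 1) = \<beta> (drop 2 u) then T else F)
  else if hd u = 2 then (if \<beta> (drop 2 u) then tc (u ! 1) else ac (u ! 1))
  else if hd u = 3 then (if \<beta> (drop 2 u) then ac (u ! 1) else T)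
  else if hd u = 4 then
   (let a = (\<exists>l\<in>set (take (u ! 2) (cls ! (u ! 1))). lit_true \<beta> l); b = lit_true \<beta> (cls ! (u ! 1) ! (u ! 2)) in
    if u ! 3 = 2 then (if a \<or> b then T else F)
    else if u ! 3 = 0 then (if a then F else if b then B else T)
    else (if a then B else if b then F else B))
  else gc (u ! 1) (u ! 2))"

lemma coloring_complete:
 assumes ne: "\<And>tu. tu \<in> set fs ==> length tu = r & set tu \<subseteq> set (vars cls)" and sat: "sat cls fs \<beta>"
 shows "\<exists>\<kappa>. (\<forall>u\<in>set (inner cls @ outer fs). \<kappa> u < q) & proper \<kappa> (edges cls fs)"
proof -
 have "\<exists>col. inj_on col {..<length nb} & (\<forall>a<length nb. col a < q &
  col a \<notin> slot_col (%j. if \<beta> (fs ! k ! j) then tc j else ac j) ` set (nb ! a))" if k: "k < length fs" for k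
 proof (subst spec)
  show "(if \<beta> (fs ! k ! j) then tc j else ac j) \<in> {tc j, ac j}" for j by simp
  have l: "length (fs ! k) = r" using ne[OF nth_mem[OF k]] by simp
  obtain v where v: "v \<in> set (fs ! k)" "\<not> \<beta> v" using sat nth_mem[OF k] unfolding sat_def by blast
  then obtain j where j: "j < r" "fs ! k ! j = v" using l unfolding in_set_conv_nth by blast
  then have "(if \<beta> (fs ! k ! j) then tc j else ac j) \<noteq> tc j" using v(2) cols[OF j(1)] by auto
  then show "\<not> (\<forall>j<r. (if \<beta> (fs ! k ! j) then tc j else ac j) = tc j)" using j(1) by blast
 qed
 then have "\<forall>k. \<exists>col. k < length fs --> inj_on col {..<length nb} & (\<forall>a<length nb. col a < q &
  col a \<notin> slot_col (%j. if \<beta> (fs ! k ! j) then tc j else ac j) ` set (nb ! a))" by blast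
 from choice[OF this] obtain gc where gc0: "\<forall>k. k < length fs --> inj_on (gc k) {..<length nb} & (\<forall>a<length nb. gc k a < q &
  gc k a \<notin> slot_col (%j. if \<beta> (fs ! k ! j) then tc j else ac j) ` set (nb ! a))" by (elim exE)
 then have gc: "\<And>k. k < length fs ==> inj_on (gc k) {..<length nb}"
  "\<And>k a. k < length fs ==> a < length nb ==> gc k a < q"
  "\<And>k a. k < length fs ==> a < length nb ==> gc k a \<notin> slot_col (%j. if \<beta> (fs ! k ! j) then tc j else ac j) ` set (nb ! a)"
  by blast+
 define \<kappa> where "\<kappa> = colf cls \<beta> gc"
 have k0: "\<kappa> [0, c] = c" for c by (simp add: \<kappa>_def colf_def)
 have k1: "\<kappa> (1 # 0 # v) = (if \<beta> v then F else T)" "\<kappa> (1 # 1 # v) = (if \<beta> v then T else F)" for v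
  by (simp_all add: \<kappa>_def colf_def)
 have k2: "\<kappa> (2 # j # v) = (if \<beta> v then tc j else ac j)" for j v by (simp add: \<kappa>_def colf_def)
 have k3: "\<kappa> (3 # j # v) = (if \<beta> v then ac j else T)" for j v by (simp add: \<kappa>_def colf_def)
 define pre where "pre = (%i p. \<exists>l\<in>set (take p (cls ! i)). lit_true \<beta> l)"
 define cur where "cur = (%i p. lit_true \<beta> (cls ! i ! p))"
 have k4: "\<kappa> [4, i, p, 0] = (if pre i p then F else if cur i p then B else T)"
  "\<kappa> [4, i, p, 1] = (if pre i p then B else if cur i p then F else B)"
  "\<kappa> [4, i, p, 2] = (if pre i p \<or> cur i p then T else F)" for i p
  by (simp_all add: \<kappa>_def colf_def pre_def cur_def Let_def)
 have k5: "\<kappa> [5, k, a] = gc k a" for k a by (simp add: \<kappa>_def colf_def)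
 have kl: "\<kappa> (lit_vertex l) = (if lit_true \<beta> l then T else F)" for l
  using k1[of "snd l"] by (cases "fst l") (simp_all add: lit_vertex_def lit_true_def)
 have pre0: "\<not> pre i 0" for i by (simp add: pre_def)
 have preS: "pre i (Suc p) = (pre i p \<or> cur i p)" if "p < length (cls ! i)" for i p
  using that unfolding pre_def cur_def by (auto simp: take_Suc_conv_app_nth)
 have ko: "\<kappa> (or_out i p) = (if pre i p then T else F)" if "p \<le> length (cls ! i)" for i p
 proof (cases p)
  case 0 then show ?thesis by (simp add: or_out_def k0 pre0)
 next
  case (Suc p') then show ?thesis using that preS[of p' i] by (simp add: or_out_def k4)
 qed
 have qb: "\<kappa> u < q" if "u \<in> set (inner cls)" for u
  using that unfolding set_inner
  by (elim disjE exE bexE conjE) (use TFB cols in \<open>simp_all add: k0 k1[unfolded One_nat_def] k2 k3 k4[unfolded One_nat_def]\<close>)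
 have av: "proper \<kappa> (avoid u S)" if "\<kappa> u \<in> set S" for u S
  using that unfolding allE_avoid k0 by metis
 have 1: "proper \<kappa> E_pal" unfolding E_pal_def allE_simps allE_map by (simp add: k0)
 have slot: "proper \<kappa> (E_slot j v)" if "j < r" for j v
 proof -
  have c: "tc j \<noteq> ac j" "tc j \<noteq> T" using cols[OF that] by simp_all
  have "proper \<kappa> (avoid (2 # j # v) [tc j, ac j])" "proper \<kappa> (avoid (3 # j # v) [T, ac j])"
   by (rule av, simp add: k2 k3)+
  then show ?thesis unfolding E_slot_def using c TFB by (simp add: k1[unfolded One_nat_def] k2 k3)
 qed
 have 2: "proper \<kappa> (E_var v)" for v
 proof -
  have "proper \<kappa> (avoid (1 # 0 # v) [T, F])" "proper \<kappa> (avoid (1 # 1 # v) [T, F])" by (rule av, simp add: k1[unfolded One_nat_def])+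
  then show ?thesis unfolding E_var_def using slot TFB by (simp add: k1[unfolded One_nat_def])
 qed
 have 3: "proper \<kappa> (E_clause i (nthd cls i))" if i: "i < length cls" for i
 proof -
  have "proper \<kappa> (E_or i p (cls ! i ! p))" if p: "p < length (cls ! i)" for p
  proof -
   have "proper \<kappa> (avoid [4, i, p, 0] [T, F, B])" "proper \<kappa> (avoid [4, i, p, 1] [T, F, B])" "proper \<kappa> (avoid [4, i, p, 2] [T, F])"
    by (rule av, simp add: k4[unfolded One_nat_def])+
   then show ?thesis unfolding E_or_def using ko[of p i] p kl[of "cls ! i ! p"] TFB
    by (simp add: k4[unfolded One_nat_def] cur_def)
  qed
  moreover have "proper \<kappa> (avoid (or_out i (length (cls ! i))) [T])"
  proof (rule av)
   have "pre i (length (cls ! i))" using sat nth_mem[OF i] unfolding sat_def pre_def by simp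
   then show "\<kappa> (or_out i (length (cls ! i))) \<in> set [T]" by (simp add: ko)
  qed
  ultimately show ?thesis using i unfolding E_clause_def by (simp add: nthd_nth)
 qed
 have 4: "proper \<kappa> (E_forbid k (nthd fs k))" if k: "k < length fs" for k
 proof -
  have l: "length (fs ! k) = r" using ne[OF nth_mem[OF k]] by simp
  have "gc k a \<noteq> \<kappa> (item (fs ! k) it)" if a: "a < length nb" "it \<in> set (nb ! a)" for a it
  proof -
   have ok: "if fst it then snd it < r else snd it < q" using nb_ok[of "nb ! a" it] a by simp
   then have "\<kappa> (item (fs ! k) it) = slot_col (%j. if \<beta> (fs ! k ! j) then tc j else ac j) it"
    using l by (cases "fst it") (simp_all add: item_def slot_col_def nthd_nth k0 k2)
   then show ?thesis using gc(3)[OF k a(1)] a(2) by (metis imageI)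
  qed
  moreover have "gc k a \<noteq> gc k b" if "a < b" "b < length nb" for a b
   using gc(1)[OF k] that by (metis inj_on_eq_iff lessThan_iff less_trans less_irrefl)
  ultimately show ?thesis unfolding E_forbid_def allE_simps allE_map using k by (simp add: nthd_nth k5)
 qed
 have "proper \<kappa> (edges cls fs)" unfolding edges_def using 1 2 3 4 by simp
 moreover have "\<kappa> u < q" if "u \<in> set (outer fs)" for u
  using that gc(2) unfolding set_outer by (elim exE conjE) (simp add: k5)
 ultimately show ?thesis using qb unfolding set_append by blast
qed

text \<open>The palette is a clique on \<open>q\<close> vertices, so its colours form a permutation
  of all colours; the inverse permutation is applied everywhere.\<close>

lemma palette_normalize:
 assumes \<kappa>: "\<And>u. u \<in> V ==> \<kappa> u < q" and V: "\<And>c. c < q ==> [0, c] \<in> V"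
  and E: "proper \<kappa> E" "proper \<kappa> E_pal" and EV: "\<And>u v. (u, v) \<in> set E ==> u \<in> V & v \<in> V"
 shows "\<exists>\<kappa>'. (\<forall>u\<in>V. \<kappa>' u < q) & (\<forall>c<q. \<kappa>' [0, c] = c) & proper \<kappa>' E"
proof -
 let ?\<pi> = "%c. \<kappa> [0, c]"
 have inj: "inj_on ?\<pi> {..<q}"
 proof (rule inj_onI, rule ccontr)
  fix c d assume cd: "c \<in> {..<q}" "d \<in> {..<q}" "\<kappa> [0, c] = \<kappa> [0, d]" "c \<noteq> d"
  then show False using E(2) unfolding E_pal_def allE_simps allE_map by (auto dest!: bspec[of _ _ c] bspec[of _ _ d])
 qed
 moreover have "?\<pi> ` {..<q} \<subseteq> {..<q}" using \<kappa> V by auto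
 ultimately have bij: "bij_betw ?\<pi> {..<q} {..<q}" by (simp add: endo_inj_surj bij_betw_def)
 let ?i = "inv_into {..<q} ?\<pi>"
 have bi: "bij_betw ?i {..<q} {..<q}" by (rule bij_betw_inv_into[OF bij])
 have "\<forall>u\<in>V. ?i (\<kappa> u) < q" using \<kappa> bi by (metis bij_betwE lessThan_iff)
 moreover have "\<forall>c<q. ?i (\<kappa> [0, c]) = c" by (intro allI impI inv_into_f_f[OF inj]) simp
 moreover have "proper (%u. ?i (\<kappa> u)) E" unfolding allE_def
 proof
  fix e assume e: "e \<in> set E"
  then have "fst e \<in> V" "snd e \<in> V" using EV[of "fst e" "snd e"] by simp_all
  then have "\<kappa> (fst e) \<in> {..<q}" "\<kappa> (snd e) \<in> {..<q}" using \<kappa> by simp_all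
  moreover have "\<kappa> (fst e) \<noteq> \<kappa> (snd e)" using E(1) e unfolding allE_def by blast
  ultimately show "?i (\<kappa> (fst e)) \<noteq> ?i (\<kappa> (snd e))" using bi by (metis bij_betw_def inj_on_eq_iff)
 qed
 ultimately show ?thesis by (intro exI[of _ "%u. ?i (\<kappa> u)"]) simp
qed

theorem graph_colorable:
 assumes ne: "\<And>tu. tu \<in> set fs ==> length tu = r & set tu \<subseteq> set (vars cls)" and cl: "[] \<notin> set cls"
 shows "(mk_graph (inner cls) (outer fs) (edges cls fs), length (inner cls)) \<in> coloring_problem q t \<longleftrightarrow> (\<exists>\<beta>. sat cls fs \<beta>)"
proof -
 have "q_colorable q (abs_graph (inner cls @ outer fs) (edges cls fs)) \<longleftrightarrow>
  (\<exists>\<kappa>. (\<forall>u\<in>set (inner cls @ outer fs). \<kappa> u < q) & proper \<kappa> (edges cls fs))"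
  unfolding allE_def by (rule mk_graph_colorable[OF distinct_vertices edges_ok[OF ne cl]])
 also have "\<dots> \<longleftrightarrow> (\<exists>\<beta>. sat cls fs \<beta>)"
 proof
  assume "\<exists>\<kappa>. (\<forall>u\<in>set (inner cls @ outer fs). \<kappa> u < q) & proper \<kappa> (edges cls fs)"
  then obtain \<kappa> where \<kappa>: "\<And>u. u \<in> set (inner cls @ outer fs) ==> \<kappa> u < q" "proper \<kappa> (edges cls fs)" by blast
  have "\<exists>\<kappa>'. (\<forall>u\<in>set (inner cls @ outer fs). \<kappa>' u < q) & (\<forall>c<q. \<kappa>' [0, c] = c) & proper \<kappa>' (edges cls fs)"
  proof (rule palette_normalize[OF \<kappa>(1) _ \<kappa>(2)])
   show "proper \<kappa> E_pal" using \<kappa>(2) unfolding edges_def by simp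
   show "u \<in> set (inner cls @ outer fs) & v \<in> set (inner cls @ outer fs)" if "(u, v) \<in> set (edges cls fs)" for u v
    using edges_ok[OF ne cl that] by blast
  qed simp_all
  then obtain \<kappa>' where "\<And>u. u \<in> set (inner cls @ outer fs) ==> \<kappa>' u < q" "\<And>c. c < q ==> \<kappa>' [0, c] = c" "proper \<kappa>' (edges cls fs)" by blast
  from coloring_sound[OF ne cl this] show "\<exists>\<beta>. sat cls fs \<beta>" by blast
 next
  assume "\<exists>\<beta>. sat cls fs \<beta>"
  then obtain \<beta> where "sat cls fs \<beta>" by blast
  from coloring_complete[OF ne this] show "\<exists>\<kappa>. (\<forall>u\<in>set (inner cls @ outer fs). \<kappa> u < q) & proper \<kappa> (edges cls fs)" .
 qed
 finally show ?thesis using coloring_problem_iff[OF graph_instance[OF ne cl]] by simp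
qed

end

section \<open>The exponent\<close>

lemma floor_quarter: "nat \<lfloor>(real q + 1)\<^sup>2 / 4\<rfloor> = (q + 1)\<^sup>2 div 4"
proof -
 have "(real q + 1)\<^sup>2 / 4 = real ((q + 1)\<^sup>2) / real 4" by simp
 then have "\<lfloor>(real q + 1)\<^sup>2 / 4\<rfloor> = int ((q + 1)\<^sup>2 div 4)" by (metis floor_divide_of_nat_eq)
 then show ?thesis by simp
qed

text \<open>With \<open>a = s\<close> and \<open>b = q + 1 - s\<close> this is
  \<open>4 * a * b \<le> (a + b)^2\<close>, rounded down.\<close>

lemma quarter_ge: "s \<le> q + 1 ==> s * (q + 1 - s) \<le> (q + 1)\<^sup>2 div (4::nat)"
proof -
 assume s: "s \<le> q + 1"
 define a b where "a = int s" and "b = int (q + 1 - s)"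
 have "0 \<le> (a - b)\<^sup>2" by simp
 then have "4 * (a * b) \<le> (a + b)\<^sup>2" by (simp add: power2_eq_square algebra_simps)
 moreover have "a + b = int (q + 1)" using s by (simp add: a_def b_def)
 ultimately have "int (4 * (s * (q + 1 - s))) \<le> int ((q + 1)\<^sup>2)" unfolding a_def b_def by (simp add: mult.assoc)
 then have "4 * (s * (q + 1 - s)) \<le> (q + 1)\<^sup>2" by linarith
 then show ?thesis by (simp add: less_eq_div_iff_mult_less_eq mult.commute)
qed

text \<open>The maximum is attained at half of \<open>q + 1\<close>, rounded up.\<close>

lemma quarter_eq: "((q + 2) div 2) * (q + 1 - (q + 2) div 2) = (q + 1)\<^sup>2 div (4::nat)"
proof (cases "even q")
 case True
 then obtain k where k: "q = 2 * k" by blast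
 have "(q + 1)\<^sup>2 = 4 * (k * (k + 1)) + 1" by (simp add: k power2_eq_square algebra_simps)
 then have "(q + 1)\<^sup>2 div 4 = k * (k + 1)" by presburger
 then show ?thesis by (simp add: k algebra_simps)
next
 case False
 then obtain k where k: "q = 2 * k + 1" by (metis oddE)
 have "(q + 1)\<^sup>2 = 4 * ((k + 1) * (k + 1))" by (simp add: k power2_eq_square algebra_simps)
 then have "(q + 1)\<^sup>2 div 4 = (k + 1) * (k + 1)" by presburger
 moreover have "(q + 2) div 2 = k + 1" by (simp add: k)
 ultimately show ?thesis by (simp add: k)
qed

lemma half_bound: "real t < (real q + 1) / 2 \<longleftrightarrow> 2 * t < q + 1"
 by (simp add: field_simps) linarith

text \<open>The clique size \<open>s\<close> that realises the exponent. For
  \<open>t = q = 3\<close> a triangle offers \<open>3 * 1 = 3\<close> slots, no more than the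
  \<open>2 * 3 - 3\<close> slots of an edge, so that case joins \<open>t = 2\<close>.\<close>

lemma r_exp_cases:
 assumes "q \<ge> 3" "1 \<le> t" "t \<le> q"
 obtains "t = 1" "r_exp q t = q - 1" | "2 \<le> t" "r_exp q t = 2 * q - 3"
 | s where "3 \<le> s" "s \<le> t" "r_exp q t = s * (q + 1 - s)"
proof -
 consider (1) "t = 1" | (2) "t = 2 \<or> (t = q & q = 3)" | (3) "3 \<le> t" "\<not> (t = q & q = 3)" "2 * t < q + 1"
  | (4) "3 \<le> t" "\<not> (t = q & q = 3)" "q + 1 \<le> 2 * t" using assms by linarith
 then show thesis
 proof cases
  case 1 then show thesis using that(1) by (simp add: r_exp_def)
 next
  case 2
  then have "r_exp q t = 2 * q - 3" "2 \<le> t" by (auto simp: r_exp_def)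
  then show thesis using that(2) by blast
 next
  case 3
  have "r_exp q t = t * (q + 1 - t)" unfolding r_exp_def half_bound using 3 assms by (simp add: mult.commute Suc_diff_le)
  then show thesis using that(3) 3 by blast
 next
  case 4
  have "r_exp q t = (q + 1)\<^sup>2 div 4" unfolding r_exp_def half_bound floor_quarter using 4 by auto
  then have "r_exp q t = ((q + 2) div 2) * (q + 1 - (q + 2) div 2)" by (simp only: quarter_eq)
  moreover have "(q + 2) div 2 \<le> t" using 4 by linarith
  moreover have "3 \<le> (q + 2) div 2" using 4 assms by linarith
  ultimately show thesis using that(3) by blast
 qed
qed

text \<open>The counterpart for the kernel: no clique size up to \<open>t\<close> leads to
  obstructions of degree above the exponent.\<close>

lemma r_exp_ge:
 assumes "q \<ge> 3" "1 \<le> t" "t \<le> q"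
 shows "q - 1 \<le> r_exp q t" "2 \<le> t ==> 2 * q - 3 \<le> r_exp q t"
  "3 \<le> s ==> s \<le> t ==> s * (q + 1 - s) \<le> r_exp q t"
proof -
 consider (1) "t = 1" | (2) "t = 2 \<or> (t = q & q = 3)" | (3) "3 \<le> t" "\<not> (t = q & q = 3)" "2 * t < q + 1"
  | (4) "3 \<le> t" "\<not> (t = q & q = 3)" "q + 1 \<le> 2 * t" using assms by linarith
 then have "q - 1 \<le> r_exp q t & (2 \<le> t --> 2 * q - 3 \<le> r_exp q t) & (3 \<le> s --> s \<le> t --> s * (q + 1 - s) \<le> r_exp q t)"
 proof cases
  case 1 then show ?thesis by (simp add: r_exp_def)
 next
  case 2
  then have "r_exp q t = 2 * q - 3" by (auto simp: r_exp_def)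
  moreover have "s = 3 & q = 3" if "3 \<le> s" "s \<le> t" using 2 that by auto
  ultimately show ?thesis using assms by auto
 next
  case 3
  have r: "r_exp q t = t * (q + 1 - t)" unfolding r_exp_def half_bound using 3 assms by (simp add: mult.commute Suc_diff_le)
  \<comment> \<open>Up to \<open>(q + 1) / 2\<close> the product \<open>s * (q + 1 - s)\<close>
    increases with \<open>s\<close>.\<close>
  have mono: "s * (q + 1 - s) \<le> t * (q + 1 - t)" if "s \<le> t" for s
  proof -
   from that obtain d where d: "t = s + d" using le_Suc_ex by blast
   from 3(3) obtain e where e: "q + 1 = 2 * t + e" using le_Suc_ex[of "2 * t" "q + 1"] by auto
   have e1: "q + 1 - s = s + 2 * d + e" "q + 1 - t = s + d + e" using d e by simp_all
   show ?thesis unfolding e1 unfolding d by (simp add: algebra_simps)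
  qed
  have "2 * (q - 1) \<le> r_exp q t" using mono[of 2] 3 r by simp
  then show ?thesis using mono r assms by auto
 next
  case 4
  have r: "r_exp q t = (q + 1)\<^sup>2 div 4" unfolding r_exp_def half_bound floor_quarter using 4 by auto
  have "2 * (q - 1) \<le> r_exp q t" using quarter_ge[of 2 q] r assms by simp
  then show ?thesis using quarter_ge[of s q] r assms by auto
 qed
 then show "q - 1 \<le> r_exp q t" "2 \<le> t ==> 2 * q - 3 \<le> r_exp q t"
  "3 \<le> s ==> s \<le> t ==> s * (q + 1 - s) \<le> r_exp q t" by blast+
qed

section \<open>Gadgets that realise the exponent\<close>

lemma gadgetI:
 assumes "T < q" "F < q" "B < q" "T \<noteq> F" "T \<noteq> B" "F \<noteq> B"
  and cols: "\<And>j. j < r ==> tc j < q & ac j < q & tc j \<noteq> ac j & tc j \<noteq> T"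
  and s: "1 \<le> length nb" "length nb \<le> t" "length nb \<le> q"
  and nb: "\<And>a it. a \<in> set nb ==> it \<in> set a ==> if fst it then snd it < r else snd it < q"
  and len: "\<And>a. a \<in> set nb ==> length a = q + 1 - length nb"
  and spec: "\<And>\<kappa>. (\<And>j. j < r ==> \<kappa> j \<in> {tc j, ac j}) ==>
   (\<forall>a<length nb. distinct (map (slot_col \<kappa>) (nb ! a)) & set (map (slot_col \<kappa>) (nb ! a)) = set (map (slot_col \<kappa>) (nb ! 0)))
   \<longleftrightarrow> (\<forall>j<r. \<kappa> j = tc j)"
 shows "gadget q t r tc ac T F B nb"
proof
 fix \<kappa> :: "nat => nat" assume \<kappa>: "\<And>j. j < r ==> \<kappa> j \<in> {tc j, ac j}"
 have kq: "\<kappa> j < q" if "j < r" for j using \<kappa>[OF that] cols[OF that] by auto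
 have "(\<exists>col. inj_on col {..<length nb} & (\<forall>a<length nb. col a < q & col a \<notin> set (map (slot_col \<kappa>) (nb ! a)))) \<longleftrightarrow>
  \<not> (\<forall>a<length nb. distinct (map (slot_col \<kappa>) (nb ! a)) & set (map (slot_col \<kappa>) (nb ! a)) = set (map (slot_col \<kappa>) (nb ! 0)))"
 proof (rule clique_gadget[OF s(1,3)])
  fix a assume a: "a < length nb"
  have "slot_col \<kappa> it < q" if "it \<in> set (nb ! a)" for it
   using nb[OF nth_mem[OF a] that] kq by (cases "fst it") (simp_all add: slot_col_def)
  then show "length (map (slot_col \<kappa>) (nb ! a)) = q + 1 - length nb & set (map (slot_col \<kappa>) (nb ! a)) \<subseteq> {..<q}"
   using len[OF nth_mem[OF a]] by auto
 qed
 then show "(\<exists>col. inj_on col {..<length nb} & (\<forall>a<length nb. col a < q & col a \<notin> slot_col \<kappa> ` set (nb ! a))) \<longleftrightarrow> \<not> (\<forall>j<r. \<kappa> j = tc j)"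
  using spec[OF \<kappa>] by (simp only: set_map)
qed (use assms in \<open>simp_all\<close>)

lemma all_less_1: "(\<forall>a<(1::nat). P a) \<longleftrightarrow> P 0"
 by simp

lemma all_less_2: "(\<forall>a<(2::nat). P a) \<longleftrightarrow> P 0 & P 1"
 unfolding less_2_cases_iff by auto

text \<open>A single vertex that sees the palette colour \<open>q - 1\<close> and
  \<open>q - 1\<close> slots. It is stuck iff the slots show all other colours, which none of them
  does at its false value \<open>q - 1\<close>.\<close>

lemma gadget_1:
 assumes q: "q \<ge> 3" and "1 \<le> t"
 shows "gadget q t (q - 1) (%j. j) (%_. q - 1) (q - 1) 0 1 [map (%j. (True, j)) [0..<q - 1] @ [(False, q - 1)]]"
  (is "gadget q t ?r ?tc ?ac _ _ _ ?nb")
proof (rule gadgetI)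
 fix \<kappa> :: "nat => nat" assume \<kappa>: "\<And>j. j < q - 1 ==> \<kappa> j \<in> {j, q - 1}"
 have m: "map (slot_col \<kappa>) (?nb ! 0) = map \<kappa> [0..<q - 1] @ [q - 1]" by (simp add: slot_col_def comp_def)
 have d: "distinct (map \<kappa> [0..<q - 1] @ [q - 1]) \<longleftrightarrow> (\<forall>j<q - 1. \<kappa> j = j)"
 proof
  assume "distinct (map \<kappa> [0..<q - 1] @ [q - 1])"
  then have n: "q - 1 \<notin> \<kappa> ` {0..<q - 1}" by simp
  show "\<forall>j<q - 1. \<kappa> j = j"
  proof (intro allI impI)
   fix j assume j: "j < q - 1"
   then have "\<kappa> j \<in> \<kappa> ` {0..<q - 1}" by simp
   then have "\<kappa> j \<noteq> q - 1" using n by metis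
   then show "\<kappa> j = j" using \<kappa>[OF j] by blast
  qed
 next
  assume "\<forall>j<q - 1. \<kappa> j = j"
  then have "map \<kappa> [0..<q - 1] = [0..<q - 1]" by (intro map_idI) simp
  then show "distinct (map \<kappa> [0..<q - 1] @ [q - 1])" by simp
 qed
 have l: "length ?nb = 1" by simp
 show "(\<forall>a<length ?nb. distinct (map (slot_col \<kappa>) (?nb ! a)) & set (map (slot_col \<kappa>) (?nb ! a)) = set (map (slot_col \<kappa>) (?nb ! 0)))
   \<longleftrightarrow> (\<forall>j<q - 1. \<kappa> j = j)"
  unfolding l all_less_1 m d by (rule conj_cong[OF refl refl, THEN trans]) simp
next
 fix a it assume "a \<in> set ?nb" "it \<in> set a"
 then have "it \<in> set (map (%j. (True, j)) [0..<q - 1] @ [(False, q - 1)])" by simp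
 then consider j where "j < q - 1" "it = (True, j)" | "it = (False, q - 1)" by auto
 then show "if fst it then snd it < q - 1 else snd it < q" by cases (use q in simp_all)
next
 fix a assume "a \<in> set ?nb"
 then show "length a = q + 1 - length ?nb" using q by simp
qed (use assms in simp_all)

text \<open>An edge is stuck iff both ends see the same \<open>q - 1\<close> distinct colours. The
  second end sees the fixed colour \<open>q - 2\<close>, so none of its slots may have the false
  value \<open>q - 2\<close>; then \<open>q - 1\<close> is missing there, which excludes the false
  value \<open>q - 1\<close> at the first end.\<close>

lemma gadget_2:
 assumes q: "q \<ge> 3" and "2 \<le> t"
 shows "gadget q t (2 * q - 3) (%j. if j < q - 1 then j else j - (q - 1)) (%j. if j < q - 1 then q - 1 else q - 2) (q - 1) 0 1
  [map (%j. (True, j)) [0..<q - 1], map (%j. (True, j)) [q - 1..<2 * q - 3] @ [(False, q - 2)]]"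
  (is "gadget q t ?r ?tc ?ac _ _ _ ?nb")
proof (rule gadgetI)
 fix \<kappa> :: "nat => nat" assume \<kappa>: "\<And>j. j < ?r ==> \<kappa> j \<in> {?tc j, ?ac j}"
 let ?D0 = "map \<kappa> [0..<q - 1]" and ?D1 = "map \<kappa> [q - 1..<2 * q - 3] @ [q - 2]"
 have m: "map (slot_col \<kappa>) (?nb ! 0) = ?D0" "map (slot_col \<kappa>) (?nb ! 1) = ?D1"
  by (simp_all add: slot_col_def comp_def)
 have d: "distinct ?D0 & distinct ?D1 & set ?D1 = set ?D0 \<longleftrightarrow> (\<forall>j<?r. \<kappa> j = ?tc j)"
 proof
  assume a: "distinct ?D0 & distinct ?D1 & set ?D1 = set ?D0"
  then have n: "q - 2 \<notin> \<kappa> ` {q - 1..<2 * q - 3}" by simp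
  have y: "\<kappa> j = j - (q - 1)" if j: "q - 1 \<le> j" "j < ?r" for j
  proof -
   have "\<kappa> j \<in> \<kappa> ` {q - 1..<2 * q - 3}" using j by simp
   then have "\<kappa> j \<noteq> q - 2" using n by metis
   then show ?thesis using \<kappa>[OF j(2)] j(1) by simp
  qed
  have "q - 1 \<notin> \<kappa> ` {q - 1..<2 * q - 3}"
  proof
   assume "q - 1 \<in> \<kappa> ` {q - 1..<2 * q - 3}"
   then obtain j where j: "q - 1 \<le> j" "j < ?r" "q - 1 = \<kappa> j" unfolding image_iff Bex_def atLeastLessThan_iff by blast
   then show False using y[OF j(1,2)] q by simp
  qed
  then have n1: "q - 1 \<notin> set ?D1" using q by simp
  have e: "set ?D1 = set ?D0" using a by (elim conjE)
  have n0: "q - 1 \<notin> \<kappa> ` {0..<q - 1}" using n1 unfolding e set_map set_upt .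
  show "\<forall>j<?r. \<kappa> j = ?tc j"
  proof (intro allI impI)
   fix j assume j: "j < ?r"
   show "\<kappa> j = ?tc j"
   proof (cases "j < q - 1")
    case True
    then have "\<kappa> j \<in> \<kappa> ` {0..<q - 1}" by simp
    then have "\<kappa> j \<noteq> q - 1" using n0 by metis
    then show ?thesis using \<kappa>[OF j] True by simp
   next
    case False
    then show ?thesis using y[of j] j by simp
   qed
  qed
 next
  assume a: "\<forall>j<?r. \<kappa> j = ?tc j"
  have "\<kappa> j = j" if "j < q - 1" for j
  proof -
   have "j < ?r" using that q by simp
   then show ?thesis using a that by simp
  qed
  then have d0: "?D0 = [0..<q - 1]" by (intro map_idI) simp
  have "map \<kappa> [q - 1..<2 * q - 3] = [0..<q - 2]"
  proof (rule nth_equalityI)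
   show "length (map \<kappa> [q - 1..<2 * q - 3]) = length [0..<q - 2]" using q by simp
   fix i assume "i < length (map \<kappa> [q - 1..<2 * q - 3])"
   then have i: "q - 1 + i < ?r" "i < q - 2" using q by simp_all
   then have "\<kappa> (q - 1 + i) = q - 1 + i - (q - 1)" using a by simp
   then show "map \<kappa> [q - 1..<2 * q - 3] ! i = [0..<q - 2] ! i" using i by simp
  qed
  moreover have "[0..<q - 1] = [0..<q - 2] @ [q - 2]"
   using upt_Suc_append[of 0 "q - 2"] q by (simp add: Suc_diff_Suc numeral_2_eq_2)
  ultimately have d1: "?D1 = [0..<q - 1]" by simp
  show "distinct ?D0 & distinct ?D1 & set ?D1 = set ?D0" unfolding d0 d1 by simp
 qed
 have l: "length ?nb = 2" by simp
 show "(\<forall>a<length ?nb. distinct (map (slot_col \<kappa>) (?nb ! a)) & set (map (slot_col \<kappa>) (?nb ! a)) = set (map (slot_col \<kappa>) (?nb ! 0)))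
   \<longleftrightarrow> (\<forall>j<?r. \<kappa> j = ?tc j)"
  unfolding l all_less_2 m d[symmetric] by blast
next
 fix j assume "j < ?r"
 then show "?tc j < q & ?ac j < q & ?tc j \<noteq> ?ac j & ?tc j \<noteq> q - 1"
  using q by (cases "j < q - 1") (simp_all, linarith+)
next
 fix a it assume "a \<in> set ?nb" "it \<in> set a"
 then have "it \<in> set (map (%j. (True, j)) [0..<q - 1]) \<or> it \<in> set (map (%j. (True, j)) [q - 1..<2 * q - 3] @ [(False, q - 2)])"
  by (simp only: set_simps) blast
 then consider j where "j < q - 1" "it = (True, j)" | j where "j < ?r" "it = (True, j)" | "it = (False, q - 2)"
  unfolding set_append mem_map Bex_def set_upt atLeastLessThan_iff Un_iff by (elim disjE exE conjE) simp_all
 then show "if fst it then snd it < ?r else snd it < q" by cases (use q in simp_all)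
next
 fix a assume "a \<in> set ?nb"
 then have "a = map (%j. (True, j)) [0..<q - 1] \<or> a = map (%j. (True, j)) [q - 1..<2 * q - 3] @ [(False, q - 2)]" by simp
 then have "length a = q - 1" using q by (elim disjE) simp_all
 then show "length a = q + 1 - length ?nb" by simp
qed (use assms in simp_all)

text \<open>The false value is \<open>m + 1\<close> at clique vertex 1 and \<open>m\<close> at the
  others, so equality of the ranges excludes both. Room for two extra colours besides
  \<open>0, ..., m - 1\<close> requires \<open>m + 2 \<le> q\<close>, which is where
  \<open>3 \<le> s\<close> enters.\<close>

lemma gadget_3:
 assumes "3 \<le> s" "s \<le> t" "t \<le> q"
 defines "m \<equiv> q + 1 - s"
 shows "gadget q t (s * m) (%j. j mod m) (%j. if j div m = 1 then m + 1 else m) m 0 (m + 1)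
  (map (%a. map (%b. (True, a * m + b)) [0..<m]) [0..<s])" (is "gadget q t ?r ?tc ?ac _ _ _ ?nb")
proof (rule gadgetI)
 have m: "1 \<le> m" "m + 1 < q" using assms by (simp_all add: m_def)
 have am: "a * m + b < s * m" if "a < s" "b < m" for a b
 proof -
  have "a * m + b < Suc a * m" using that by simp
  also have "\<dots> \<le> s * m" using that by (intro mult_le_mono1) simp
  finally show ?thesis .
 qed
 show "m < q" "0 < q" "m + 1 < q" "m \<noteq> 0" "m \<noteq> m + 1" "0 \<noteq> m + 1" using m by simp_all
 have md: "j mod m < m" for j using m by simp
 show "?tc j < q & ?ac j < q & ?tc j \<noteq> ?ac j & ?tc j \<noteq> m" if "j < ?r" for j
 proof -
  obtain x where x: "j mod m = x" "x < m" using md by blast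
  show ?thesis unfolding x(1) using x(2) m by (cases "j div m = 1") simp_all
 qed
 show "1 \<le> length ?nb" "length ?nb \<le> t" "length ?nb \<le> q" using assms by simp_all
 show "if fst it then snd it < ?r else snd it < q" if "a \<in> set ?nb" "it \<in> set a" for a it
  using that am by auto
 show "length a = q + 1 - length ?nb" if "a \<in> set ?nb" for a using that by (auto simp: m_def)
 fix \<kappa> :: "nat => nat" assume \<kappa>: "\<And>j. j < ?r ==> \<kappa> j \<in> {?tc j, ?ac j}"
 let ?D = "%a. map (%b. \<kappa> (a * m + b)) [0..<m]"
 have D: "map (slot_col \<kappa>) (?nb ! a) = ?D a" if "a < s" for a using that by (simp add: slot_col_def comp_def)
 have k: "\<kappa> (a * m + b) \<in> {b, if a = 1 then m + 1 else m}" if "a < s" "b < m" for a b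
 proof -
  have "(a * m + b) mod m = b" "(a * m + b) div m = a" using that by simp_all
  then show ?thesis using \<kappa>[OF am[OF that]] by simp
 qed
 have "(\<forall>a<s. distinct (?D a) & set (?D a) = set (?D 0)) \<longleftrightarrow> (\<forall>a<s. \<forall>b<m. \<kappa> (a * m + b) = b)"
 proof
  assume a: "\<forall>a<s. distinct (?D a) & set (?D a) = set (?D 0)"
  have s: "0 < s" "1 < s" using assms by simp_all
  have "set (?D 1) = set (?D 0)" using a s by blast
  moreover have "m \<notin> set (?D 1)" using k[OF s(2)] by force
  moreover have "m + 1 \<notin> set (?D 0)" using k[OF s(1)] by force
  ultimately have n: "m \<notin> set (?D 0)" "m + 1 \<notin> set (?D 0)" by blast+
  show "\<forall>a<s. \<forall>b<m. \<kappa> (a * m + b) = b"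
  proof (intro allI impI)
   fix c b assume cb: "c < s" "b < m"
   have "set (?D c) = set (?D 0)" using a cb by blast
   moreover have "\<kappa> (c * m + b) \<in> set (?D c)" using cb by simp
   ultimately have "\<kappa> (c * m + b) \<noteq> m" "\<kappa> (c * m + b) \<noteq> m + 1" using n by metis+
   then show "\<kappa> (c * m + b) = b" using k[OF cb] by (simp split: if_splits)
  qed
 next
  assume a: "\<forall>a<s. \<forall>b<m. \<kappa> (a * m + b) = b"
  have "?D a = [0..<m]" if "a < s" for a by (rule map_idI) (use a that in simp)
  then show "\<forall>a<s. distinct (?D a) & set (?D a) = set (?D 0)" using assms(1)
   by (metis distinct_upt gr0I not_numeral_le_zero)
 qed
 also have "\<dots> \<longleftrightarrow> (\<forall>j<?r. \<kappa> j = ?tc j)"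
 proof
  assume a: "\<forall>a<s. \<forall>b<m. \<kappa> (a * m + b) = b"
  show "\<forall>j<?r. \<kappa> j = ?tc j"
  proof (intro allI impI)
   fix j assume "j < s * m"
   then have "j div m < s" using m by (simp add: less_mult_imp_div_less)
   then have "\<kappa> (j div m * m + j mod m) = j mod m" using a md by blast
   then show "\<kappa> j = j mod m" by simp
  qed
 next
  assume a: "\<forall>j<?r. \<kappa> j = ?tc j"
  show "\<forall>a<s. \<forall>b<m. \<kappa> (a * m + b) = b"
  proof (intro allI impI)
   fix c b assume cb: "c < s" "b < m"
   then have "\<kappa> (c * m + b) = (c * m + b) mod m" using a am by blast
   then show "\<kappa> (c * m + b) = b" using cb by simp
  qed
 qed
 finally show "(\<forall>a<length ?nb. distinct (map (slot_col \<kappa>) (?nb ! a)) & set (map (slot_col \<kappa>) (?nb ! a)) = set (map (slot_col \<kappa>) (?nb ! 0)))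
   \<longleftrightarrow> (\<forall>j<?r. \<kappa> j = ?tc j)"
 proof -
  assume e: "(\<forall>a<s. distinct (?D a) & set (?D a) = set (?D 0)) \<longleftrightarrow> (\<forall>j<?r. \<kappa> j = ?tc j)"
  have l: "length ?nb = s" by simp
  have z: "map (slot_col \<kappa>) (?nb ! 0) = ?D 0" by (rule D) (use assms(1) in simp)
  have "(\<forall>a<length ?nb. distinct (map (slot_col \<kappa>) (?nb ! a)) & set (map (slot_col \<kappa>) (?nb ! a)) = set (map (slot_col \<kappa>) (?nb ! 0)))
   \<longleftrightarrow> (\<forall>a<s. distinct (?D a) & set (?D a) = set (?D 0))"
   unfolding l z by (intro all_cong) (simp only: D)
  from trans[OF this e] show ?thesis .
 qed
qed

lemma gadget_exists:
 assumes "q \<ge> 3" "1 \<le> t" "t \<le> q"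
 shows "\<exists>tc ac T F B nb. gadget q t (r_exp q t) tc ac T F B nb"
 using r_exp_cases[OF assms]
proof cases
 case 1
 then show ?thesis unfolding 1(2) using gadget_1[OF assms(1,2)] by blast
next
 case 2
 then show ?thesis unfolding 2(2) using gadget_2[OF assms(1) 2(1)] by blast
next
 case (3 s)
 then show ?thesis unfolding 3(3) using gadget_3[OF 3(1,2) assms(3)] by blast
qed

section \<open>Computation tableaux\<close>

abbreviation St :: "nat => nat => nat list" where "St \<tau> s \<equiv> [0, \<tau>, s]"
abbreviation Hd :: "nat => nat => nat => nat list" where "Hd \<tau> k p \<equiv> [1, \<tau>, k, p]"
abbreviation Ce :: "nat => nat => nat => nat => nat list" where "Ce \<tau> k p a \<equiv> [2, \<tau>, k, p, a]"

text \<open>A halted configuration repeats itself, so all time steps obey the same clauses up to the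
  fixed time \<open>T\<close>; moves are shifted by one to be natural numbers.\<close>

definition nd :: "tm => nat \<times> nat list => nat \<times> nat list \<times> nat list" where
 "nd M x = (if fst x = 1 then (1, snd x, replicate (tm_tapes M) 1) else
  (case tm_delta M (fst x) (snd x) of (s', ws, ds) => (s', ws, map (%d. nat (d + 1)) ds)))"

definition pos :: "config => nat => int" where "pos cf k = snd (snd cf ! k)"
definition cell :: "config => nat => int => nat" where "cell cf k = fst (snd cf ! k)"

lemma nd_step:
 assumes M: "tm_wf M" and inv: "tm_inv M n \<tau> cf" and Z: "\<tau> < Z"
  and nd: "nd M (fst cf, map (%k. cell cf k (pos cf k)) [0..<tm_tapes M]) = (s', ws, es)"
 shows "fst (tm_step M cf) = s'" "length ws = tm_tapes M" "length es = tm_tapes M"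
  "\<And>k. k < tm_tapes M ==> cell (tm_step M cf) k = (cell cf k)(pos cf k := ws ! k)"
  "\<And>k. k < tm_tapes M ==> nat (pos (tm_step M cf) k + int Z) = nat (pos cf k + int Z) + es ! k - 1"
proof -
 obtain s ts where cf: "cf = (s, ts)" by fastforce
 let ?K = "tm_tapes M"
 have l: "length ts = ?K" using inv by (simp add: cf tm_inv_def)
 have p: "\<bar>snd (ts ! k)\<bar> \<le> int \<tau>" if "k < ?K" for k using inv that l by (simp add: cf tm_inv_def)
 have rs: "map (%k. cell cf k (pos cf k)) [0..<?K] = map (%(c, p). c p) ts"
  by (rule nth_equalityI) (simp_all add: l cell_def pos_def cf split_beta)
 have "fst (tm_step M cf) = s' & length ws = ?K & length es = ?K &
  (\<forall>k<?K. cell (tm_step M cf) k = (cell cf k)(pos cf k := ws ! k)) &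
  (\<forall>k<?K. nat (pos (tm_step M cf) k + int Z) = nat (pos cf k + int Z) + es ! k - 1)"
 proof (cases "s = 1")
  case True
  then have e: "tm_step M cf = cf" by (simp add: cf tm_step_def)
  have f: "fst cf = 1" using True cf by simp
  have "(1, map (%k. cell cf k (pos cf k)) [0..<?K], replicate ?K 1) = (s', ws, es)"
   using nd by (simp only: nd_def fst_conv snd_conv f if_True simp_thms)
  then have "s' = 1" "ws = map (%k. cell cf k (pos cf k)) [0..<?K]" "es = replicate ?K 1" by (metis Pair_inject)+
  then show ?thesis unfolding e using True by (simp add: cf)
 next
  case False
  obtain s1 ws1 ds where d: "tm_delta M s (map (%(c, p). c p) ts) = (s1, ws1, ds)" by (metis prod_cases3)
  note w = tm_delta_wf[OF M inv[unfolded cf] d]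
  have st: "tm_step M cf = (s1, apply_act ts ws1 ds)" using False d by (simp add: tm_step_def cf)
  have eq: "s' = s1" "ws = ws1" "es = map (%d. nat (d + 1)) ds"
   using nd False d unfolding rs by (simp_all add: nd_def cf)
  have "cell (tm_step M cf) k = (cell cf k)(pos cf k := ws ! k) &
   nat (pos (tm_step M cf) k + int Z) = nat (pos cf k + int Z) + es ! k - 1" if k: "k < ?K" for k
  proof -
   have "ds ! k \<in> {-1, 0, 1}" using w(4,5) k by (metis nth_mem subsetD)
   then have "nat (snd (ts ! k) + ds ! k + int Z) = nat (snd (ts ! k) + int Z) + nat (ds ! k + 1) - 1"
    using p[OF k] Z by auto
   then show ?thesis unfolding st using k w l by (simp add: cell_def pos_def cf eq split_beta)
  qed
  then show ?thesis using w eq by (simp add: st)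
 qed
 then show "fst (tm_step M cf) = s'" "length ws = ?K" "length es = ?K"
  "\<And>k. k < ?K ==> cell (tm_step M cf) k = (cell cf k)(pos cf k := ws ! k)"
  "\<And>k. k < ?K ==> nat (pos (tm_step M cf) k + int Z) = nat (pos cf k + int Z) + es ! k - 1" by blast+
qed

section \<open>The clauses of the tableau\<close>

definition csat :: "(nat list => bool) => lit list list => bool" where
 "csat \<beta> cls \<longleftrightarrow> (\<forall>cl\<in>set cls. \<exists>l\<in>set cl. lit_true \<beta> l)"

lemma csat_simps [simp]:
 "csat \<beta> []" "csat \<beta> (cl # cls) \<longleftrightarrow> (\<exists>l\<in>set cl. lit_true \<beta> l) & csat \<beta> cls"
 "csat \<beta> (cls @ cls') \<longleftrightarrow> csat \<beta> cls & csat \<beta> cls'"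
 "csat \<beta> (concat (map f xs)) \<longleftrightarrow> (\<forall>x\<in>set xs. csat \<beta> (f x))"
 by (auto simp: csat_def)

lemma csat_map: "csat \<beta> (map g xs) \<longleftrightarrow> (\<forall>x\<in>set xs. \<exists>l\<in>set (g x). lit_true \<beta> l)"
 by (auto simp: csat_def)

lemma lit_true_simps [simp]: "lit_true \<beta> (True, v) \<longleftrightarrow> \<beta> v" "lit_true \<beta> (False, v) \<longleftrightarrow> \<not> \<beta> v"
 by (simp_all add: lit_true_def)

definition ante :: "nat => nat => nat list => nat \<times> nat list => lit list" where
 "ante K \<tau> ps x = (False, St \<tau> (fst x)) #
  concat (map (%k. [(False, Hd \<tau> k (nthd ps k)), (False, Ce \<tau> k (nthd ps k) (snd x ! k))]) [0..<K])"

definition conse :: "nat => nat => nat list => nat \<times> nat list \<times> nat list => lit list" where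
 "conse K \<tau> ps y = (True, St (Suc \<tau>) (fst y)) #
  concat (map (%k. [(True, Hd (Suc \<tau>) k (nthd ps k + snd (snd y) ! k - 1)), (True, Ce (Suc \<tau>) k (nthd ps k) (fst (snd y) ! k))]) [0..<K])"

text \<open>Horn clauses for every guess \<open>ps\<close> of the head positions and every possible
  reading \<open>x\<close>. As the number of tapes is fixed, there are polynomially many.\<close>

definition trans :: "tm => nat => nat list => nat \<times> nat list => lit list list" where
 "trans M \<tau> ps x = map (%l. l # ante (tm_tapes M) \<tau> ps x) (conse (tm_tapes M) \<tau> ps (nd M x))"

definition rules :: "tm => (nat \<times> nat list) list" where
 "rules M = List.product [0..<tm_states M] (List.n_lists (tm_tapes M) [0..<tm_symbols M])"

text \<open>Tape cell 0 has index \<open>Z\<close>, and the layout follows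
  \<open>enc_pair (x, u)\<close>. The bits of \<open>x\<close>, at odd offsets, are left open until
  an instance is selected; the witness is any word of length at most \<open>U\<close>, as a blank is
  followed by blanks only.\<close>

definition tab_init :: "nat => nat => nat => nat => nat => lit list list" where
 "tab_init K n U Z P = [(True, St 0 0)] #
  map (%k. [(True, Hd 0 k Z)]) [0..<K] @
  concat (map (%k. map (%p. [(True, Ce 0 k p 0)]) [0..<P]) [1..<K]) @
  map (%p. [(True, Ce 0 0 p 0)]) [0..<Z] @
  map (%b. [(True, Ce 0 0 (Z + 2 * b) 2)]) [0..<n] @
  map (%b. [(True, Ce 0 0 (Z + 2 * b + 1) 1), (True, Ce 0 0 (Z + 2 * b + 1) 2)]) [0..<n] @
  [[(True, Ce 0 0 (Z + 2 * n) 1)]] @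
  map (%w. [(True, Ce 0 0 (Z + 2 * n + 1 + w) 0), (True, Ce 0 0 (Z + 2 * n + 1 + w) 1), (True, Ce 0 0 (Z + 2 * n + 1 + w) 2)]) [0..<U] @
  map (%w. [(False, Ce 0 0 (Z + 2 * n + 1 + w) 0), (True, Ce 0 0 (Z + 2 * n + 1 + Suc w) 0)]) [0..<U] @
  map (%p. [(True, Ce 0 0 p 0)]) [Z + 2 * n + 1 + U..<P]"

definition tab_step :: "tm => nat => nat => lit list list" where
 "tab_step M T P =
  concat (map (%\<tau>. concat (map (%ps. concat (map (%x. trans M \<tau> ps x) (rules M))) (List.n_lists (tm_tapes M) [0..<P]))) [0..<T]) @
  concat (map (%\<tau>. concat (map (%k. concat (map (%p. concat (map (%p'. map (%a.
   [(False, Hd \<tau> k p), (False, Ce \<tau> k p' a), (True, Ce (Suc \<tau>) k p' a)]) [0..<tm_symbols M])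
   (filter (%p'. p' \<noteq> p) [0..<P]))) [0..<P])) [0..<tm_tapes M])) [0..<T])"

text \<open>The tableau is one-sided: clauses propagate the facts of a run, but none says that a
  cell holds only one symbol. Acceptance is therefore expressed by forbidding all other final states
  and output symbols.\<close>

definition tab_acc :: "tm => nat => nat => lit list list" where
 "tab_acc M T Z = map (%s. [(False, St T s)]) (filter (%s. s \<noteq> 1) [0..<tm_states M]) @
  map (%a. [(False, Ce T (tm_tapes M - 1) Z a)]) (filter (%a. a \<noteq> 2) [0..<tm_symbols M])"

text \<open>With cell 0 at index \<open>Suc T\<close>, heads move between the indices 1 and
  \<open>2 * T + 1\<close> within \<open>T\<close> steps; the rest of the width makes room for the
  input.\<close>

definition tab :: "tm => nat => nat => nat => lit list list" where
 "tab M n U T = tab_init (tm_tapes M) n U (Suc T) (2 * T + 2 * n + U + 5) @ tab_step M T (2 * T + 2 * n + U + 5) @ tab_acc M T (Suc T)"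

lemma pt_tab:
 assumes n: "pt n" and U: "pt U" and T: "pt T" shows "pt (%v. tab M (n v) (U v) (T v))"
proof -
 have 1: "pt (%v. tab_init K (n v) (U v) (f v) (g v))" if f: "pt f" and g: "pt g" for K and f g :: "'a => nat"
  unfolding tab_init_def One_nat_def
  by (intro pt_intros f g n U pt_comp[OF f] pt_comp[OF g] pt_comp[OF n] pt_comp[OF U])
 have tr: "pt (%p. trans M (fst p) (snd p) x)" for x
 proof -
  have a: "pt (%p. ante (tm_tapes M) (fst p) (snd p) x)"
   unfolding ante_def by (rule pt_Cons, intro pt_intros) (rule pt_concat_const, intro pt_intros)
  have c: "pt (%p. conse (tm_tapes M) (fst p) (snd p) (nd M x))"
   unfolding conse_def One_nat_def by (rule pt_Cons, intro pt_intros) (rule pt_concat_const, intro pt_intros)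
  show ?thesis unfolding trans_def by (intro pt_intros a c pt_comp[OF a, where f = "%x. (a x, b x)" for a b, simplified])
 qed
 have trs: "pt (%p. concat (map (%x. trans M (fst p) (snd p) x) (rules M)))"
  by (rule pt_concat_const) (rule tr)
 note trs' = pt_comp[OF trs, where f = "%x. (a x, b x)" for a b, simplified]
 have A: "pt (%v. concat (map (%\<tau>. concat (map (%ps. concat (map (%x. trans M \<tau> ps x) (rules M))) (List.n_lists (tm_tapes M) [0..<g v]))) [0..<T v]))"
  if g: "pt g" for g :: "'a => nat"
  by (rule pt_concat, rule pt_map, rule pt_concat, rule pt_map, rule trs') (intro pt_intros T pt_comp[OF g])+
 have B: "pt (%v. concat (map (%\<tau>. concat (map (%k. concat (map (%p. concat (map (%p'. map (%a.
   [(False, Hd \<tau> k p), (False, Ce \<tau> k p' a), (True, Ce (Suc \<tau>) k p' a)]) [0..<tm_symbols M])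
   (filter (%p'. p' \<noteq> p) [0..<g v]))) [0..<g v])) [0..<tm_tapes M])) [0..<T v]))"
  if g: "pt g" for g :: "'a => nat"
  unfolding One_nat_def by (intro pt_intros T pt_comp[OF g])
 have 2: "pt (%v. tab_step M (T v) (g v))" if g: "pt g" for g :: "'a => nat"
  unfolding tab_step_def by (rule pt_append[OF A[OF g] B[OF g]])
 have 3: "pt (%v. tab_acc M (T v) (Suc (T v)))"
  unfolding tab_acc_def by (intro pt_intros pt_comp[OF T] T)
 show ?thesis unfolding tab_def by (intro pt_append 1 2 3) (intro pt_intros n U T)+
qed

lemma tab_nonempty: "[] \<notin> set (tab M n U T)"
proof -
 have *: "[] \<notin> set (tab_init K n U Z P)" for K Z P unfolding tab_init_def by auto
 have "[] \<notin> set (trans M \<tau> ps x)" for \<tau> ps x unfolding trans_def by auto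
 then have "[] \<notin> set (tab_step M T P)" for P unfolding tab_step_def by auto
 moreover have "[] \<notin> set (tab_acc M T Z)" for Z unfolding tab_acc_def by auto
 ultimately show ?thesis using * unfolding tab_def by simp
qed

section \<open>Tableaux and accepting runs\<close>

abbreviation bit_wrong :: "bool => nat" where "bit_wrong b \<equiv> (if b then 1 else 2)"

lemma init_cell0:
 "cell (tm_init M w) 0 i = (if 0 \<le> i & i < int (length w) then bit_symbol (w ! nat i) else 0)"
 by (simp add: cell_def tm_init_def)

lemma init_other: "0 < k ==> k < tm_tapes M ==> cell (tm_init M w) k i = 0" "k < tm_tapes M ==> pos (tm_init M w) k = 0"
 by (simp_all add: cell_def pos_def tm_init_def nth_Cons')

lemma mem_rules:
 "x \<in> set (rules M) \<longleftrightarrow> fst x < tm_states M & length (snd x) = tm_tapes M & set (snd x) \<subseteq> {..<tm_symbols M}"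
 by (cases x) (auto simp: rules_def set_n_lists)

lemma ante_true:
 "(\<exists>l\<in>set (ante K \<tau> ps x). lit_true \<beta> l) \<longleftrightarrow>
  \<not> (\<beta> (St \<tau> (fst x)) & (\<forall>k<K. \<beta> (Hd \<tau> k (nthd ps k)) & \<beta> (Ce \<tau> k (nthd ps k) (snd x ! k))))"
 unfolding ante_def by auto

lemma conse_true:
 "(\<forall>l\<in>set (conse K \<tau> ps y). lit_true \<beta> l) \<longleftrightarrow>
  \<beta> (St (Suc \<tau>) (fst y)) & (\<forall>k<K. \<beta> (Hd (Suc \<tau>) k (nthd ps k + snd (snd y) ! k - 1)) & \<beta> (Ce (Suc \<tau>) k (nthd ps k) (fst (snd y) ! k)))"
 unfolding conse_def by auto

lemma csat_trans:
 "csat \<beta> (trans M \<tau> ps x) \<longleftrightarrow>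
  (\<forall>l\<in>set (ante (tm_tapes M) \<tau> ps x). \<not> lit_true \<beta> l) --> (\<forall>l\<in>set (conse (tm_tapes M) \<tau> ps (nd M x)). lit_true \<beta> l)"
 unfolding trans_def csat_map by auto

lemma csat_tab_step:
 "csat \<beta> (tab_step M T P) \<longleftrightarrow>
  (\<forall>\<tau><T. \<forall>ps. length ps = tm_tapes M & set ps \<subseteq> {..<P} --> (\<forall>x\<in>set (rules M). csat \<beta> (trans M \<tau> ps x))) &
  (\<forall>\<tau><T. \<forall>k<tm_tapes M. \<forall>p<P. \<forall>p'<P. p' \<noteq> p --> (\<forall>a<tm_symbols M. \<beta> (Hd \<tau> k p) --> \<beta> (Ce \<tau> k p' a) --> \<beta> (Ce (Suc \<tau>) k p' a)))"
 (is "_ \<longleftrightarrow> ?A & ?B")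
proof -
 have "csat \<beta> (tab_step M T P) \<longleftrightarrow>
  (\<forall>\<tau>\<in>set [0..<T]. \<forall>ps\<in>set (List.n_lists (tm_tapes M) [0..<P]). \<forall>x\<in>set (rules M). csat \<beta> (trans M \<tau> ps x)) &
  (\<forall>\<tau>\<in>set [0..<T]. \<forall>k\<in>set [0..<tm_tapes M]. \<forall>p\<in>set [0..<P]. \<forall>p'\<in>set (filter (%p'. p' \<noteq> p) [0..<P]). \<forall>a\<in>set [0..<tm_symbols M].
   \<exists>l\<in>set [(False, Hd \<tau> k p), (False, Ce \<tau> k p' a), (True, Ce (Suc \<tau>) k p' a)]. lit_true \<beta> l)"
  unfolding tab_step_def csat_simps csat_map ..
 moreover have "(\<forall>\<tau>\<in>set [0..<T]. \<forall>ps\<in>set (List.n_lists (tm_tapes M) [0..<P]). \<forall>x\<in>set (rules M). csat \<beta> (trans M \<tau> ps x)) \<longleftrightarrow> ?A"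
  unfolding set_n_lists set_upt by (simp add: Ball_def lessThan_atLeast0)
 moreover have "(\<forall>\<tau>\<in>set [0..<T]. \<forall>k\<in>set [0..<tm_tapes M]. \<forall>p\<in>set [0..<P]. \<forall>p'\<in>set (filter (%p'. p' \<noteq> p) [0..<P]). \<forall>a\<in>set [0..<tm_symbols M].
   \<exists>l\<in>set [(False, Hd \<tau> k p), (False, Ce \<tau> k p' a), (True, Ce (Suc \<tau>) k p' a)]. lit_true \<beta> l) \<longleftrightarrow> ?B"
  by (simp add: Ball_def) blast
 ultimately show ?thesis by blast
qed

lemma csat_tab_init:
 "csat \<beta> (tab_init K n U Z P) \<longleftrightarrow> \<beta> (St 0 0) & (\<forall>k<K. \<beta> (Hd 0 k Z)) & (\<forall>k. 1 \<le> k & k < K --> (\<forall>p<P. \<beta> (Ce 0 k p 0))) &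
  (\<forall>p<Z. \<beta> (Ce 0 0 p 0)) & (\<forall>b<n. \<beta> (Ce 0 0 (Z + 2 * b) 2)) &
  (\<forall>b<n. \<beta> (Ce 0 0 (Z + 2 * b + 1) 1) \<or> \<beta> (Ce 0 0 (Z + 2 * b + 1) 2)) & \<beta> (Ce 0 0 (Z + 2 * n) 1) &
  (\<forall>w<U. \<beta> (Ce 0 0 (Z + 2 * n + 1 + w) 0) \<or> \<beta> (Ce 0 0 (Z + 2 * n + 1 + w) 1) \<or> \<beta> (Ce 0 0 (Z + 2 * n + 1 + w) 2)) &
  (\<forall>w<U. \<not> \<beta> (Ce 0 0 (Z + 2 * n + 1 + w) 0) \<or> \<beta> (Ce 0 0 (Z + 2 * n + 1 + Suc w) 0)) &
  (\<forall>p. Z + 2 * n + 1 + U \<le> p & p < P --> \<beta> (Ce 0 0 p 0))"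
proof -
 have b: "(\<exists>l\<in>set [a]. Q l) \<longleftrightarrow> Q a" "(\<exists>l\<in>set [a, b]. Q l) \<longleftrightarrow> Q a \<or> Q b" "(\<exists>l\<in>set [a, b, c]. Q l) \<longleftrightarrow> Q a \<or> Q b \<or> Q c"
  for Q :: "lit => bool" and a b c by simp_all
 show ?thesis
  unfolding tab_init_def csat_simps csat_map set_upt Ball_def atLeastLessThan_iff b lit_true_simps
  by (simp only: le0 simp_thms csat_simps(1))
qed

lemma csat_tab_acc:
 "csat \<beta> (tab_acc M T Z) \<longleftrightarrow> (\<forall>s<tm_states M. s \<noteq> 1 --> \<not> \<beta> (St T s)) & (\<forall>a<tm_symbols M. a \<noteq> 2 --> \<not> \<beta> (Ce T (tm_tapes M - 1) Z a))"
 unfolding tab_acc_def csat_simps csat_map by (simp add: Ball_def imp_conjL)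

lemma enc_pair_cases:
 fixes x u :: "bool list"
 defines "w \<equiv> enc_pair (x, u)"
 shows "length w = 2 * length x + 1 + length u"
  "\<And>b. b < length x ==> w ! (2 * b) = True" "\<And>b. b < length x ==> w ! (2 * b + 1) = x ! b" "w ! (2 * length x) = False"
  "\<And>i. i < length u ==> w ! (2 * length x + 1 + i) = u ! i"
proof -
 show "length w = 2 * length x + 1 + length u" by (simp add: w_def enc_pair_def length_enc_bits)
 show "w ! (2 * b) = True" "w ! (2 * b + 1) = x ! b" if "b < length x" for b
  using enc_bits_nth(1,2)[OF that, of u] by (simp_all add: w_def enc_pair_def)
 show "w ! (2 * length x) = False" using enc_bits_nth(3)[of x u] by (simp add: w_def enc_pair_def)
 show "w ! (2 * length x + 1 + i) = u ! i" for i
  by (simp add: w_def enc_pair_def nth_append length_enc_bits)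
qed

lemma input_position_cases:
 fixes p Z n :: nat
 obtains "p < Z" | b where "b < n" "p = Z + 2 * b" | b where "b < n" "p = Z + 2 * b + 1" | "p = Z + 2 * n"
  | w where "p = Z + 2 * n + 1 + w"
proof -
 consider "p < Z" | "Z \<le> p" "p - Z < 2 * n" | "p = Z + 2 * n" | "Z + 2 * n + 1 \<le> p" by linarith
 then show thesis
 proof cases
  case 2
  define i where "i = p - Z"
  have i: "p = Z + i" "i < 2 * n" using 2 by (simp_all add: i_def)
  show thesis
  proof (cases "even i")
   case True
   then obtain b where "i = 2 * b" by blast
   then show thesis using that(2)[of b] i by simp
  next
   case False
   then obtain b where "i = 2 * b + 1" by (rule oddE)
   then show thesis using that(3)[of b] i by simp
  qed
 next
  case 4
  then have "p = Z + 2 * n + 1 + (p - (Z + 2 * n + 1))" by simp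
  then show thesis by (rule that(5))
 qed (use that in blast)+
qed

lemma init_cell_input:
 fixes x u :: "bool list" and M :: tm and Z :: nat
 defines "c \<equiv> %p. cell (tm_init M (enc_pair (x, u))) 0 (int p - int Z)"
 shows "p < Z ==> c p = 0" "b < length x ==> c (Z + 2 * b) = 2" "b < length x ==> c (Z + 2 * b + 1) = bit_symbol (x ! b)"
  "c (Z + 2 * length x) = 1" "w < length u ==> c (Z + 2 * length x + 1 + w) = bit_symbol (u ! w)"
  "length u \<le> w ==> c (Z + 2 * length x + 1 + w) = 0"
proof -
 note e = enc_pair_cases[where x = x and u = u]
 have ci: "c (Z + i) = (if i < length (enc_pair (x, u)) then bit_symbol (enc_pair (x, u) ! i) else 0)" for i
  unfolding c_def init_cell0 by simp
 show "p < Z ==> c p = 0" unfolding c_def init_cell0 by simp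
 show "c (Z + 2 * b) = 2" if "b < length x"
  using ci[of "2 * b"] e(1) e(2)[OF that] that by (simp add: bit_symbol_def)
 show "c (Z + 2 * b + 1) = bit_symbol (x ! b)" if "b < length x"
  using ci[of "2 * b + 1"] e(1) e(3)[OF that] that by simp
 show "c (Z + 2 * length x) = 1" using ci[of "2 * length x"] e(1,4) by (simp add: bit_symbol_def)
 show "c (Z + 2 * length x + 1 + w) = bit_symbol (u ! w)" if "w < length u"
  using ci[of "2 * length x + 1 + w"] e(1) e(5)[OF that] that by (simp add: add.assoc)
 show "c (Z + 2 * length x + 1 + w) = 0" if "length u \<le> w"
  using ci[of "2 * length x + 1 + w"] e(1) that by (simp add: add.assoc)
qed

lemma tm_inv_run: "tm_wf M ==> tm_inv M (length w) \<tau> ((tm_step M ^^ \<tau>) (tm_init M w))"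
 by (induction \<tau>) (simp_all add: tm_inv_init tm_inv_step)

lemma tm_inv_bounds:
 assumes "tm_inv M m \<tau> cf" "k < tm_tapes M"
 shows "\<bar>pos cf k\<bar> \<le> int \<tau>" "cell cf k i < tm_symbols M"
 using assms by (simp_all add: tm_inv_def pos_def cell_def)

text \<open>The facts of the actual run are forced by induction on time, whatever other facts
  \<beta> may satisfy besides them: each step instantiates the clauses at the true positions and
  symbols.\<close>

lemma tab_run:
 assumes M: "tm_wf M" and st: "csat \<beta> (tab_step M T P)" and P: "2 * T + 1 < P" "Z = Suc T"
  and i1: "\<beta> (St 0 0)" and i2: "\<And>k. k < tm_tapes M ==> \<beta> (Hd 0 k Z)"
  and i3: "\<And>k p. k < tm_tapes M ==> p < P ==> \<beta> (Ce 0 k p (cell (tm_init M w) k (int p - int Z)))"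
 defines "cf \<equiv> %\<tau>. (tm_step M ^^ \<tau>) (tm_init M w)"
 assumes "\<tau> \<le> T"
 shows "\<beta> (St \<tau> (fst (cf \<tau>))) & (\<forall>k<tm_tapes M. \<beta> (Hd \<tau> k (nat (pos (cf \<tau>) k + int Z)))) &
  (\<forall>k<tm_tapes M. \<forall>p<P. \<beta> (Ce \<tau> k p (cell (cf \<tau>) k (int p - int Z))))"
 using assms(9)
proof (induction \<tau>)
 case 0
 have "fst (cf 0) = 0" by (simp add: cf_def tm_init_def)
 moreover have "pos (cf 0) k = 0" if "k < tm_tapes M" for k using init_other(2)[OF that] by (simp add: cf_def)
 ultimately show ?case using i1 i2 i3 by (simp add: cf_def)
next
 case (Suc \<tau>)
 let ?K = "tm_tapes M" and ?c = "cf \<tau>"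
 have inv: "tm_inv M (length w) \<tau> ?c" unfolding cf_def by (rule tm_inv_run[OF M])
 have IH: "\<beta> (St \<tau> (fst ?c))" "\<And>k. k < ?K ==> \<beta> (Hd \<tau> k (nat (pos ?c k + int Z)))"
  "\<And>k p. k < ?K ==> p < P ==> \<beta> (Ce \<tau> k p (cell ?c k (int p - int Z)))" using Suc by simp_all
 define rs where "rs = map (%k. cell ?c k (pos ?c k)) [0..<?K]"
 define ps where "ps = map (%k. nat (pos ?c k + int Z)) [0..<?K]"
 have tT: "\<tau> < T" "\<tau> < Z" using Suc.prems P by simp_all
 have psk: "nthd ps k = nat (pos ?c k + int Z)" "nat (pos ?c k + int Z) < P" "int (nat (pos ?c k + int Z)) - int Z = pos ?c k" if "k < ?K" for k
  using that tm_inv_bounds(1)[OF inv that] tT P by (simp_all add: ps_def nthd_nth)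
 have ps: "length ps = ?K & set ps \<subseteq> {..<P}" using psk(2) by (auto simp: ps_def)
 have x: "(fst ?c, rs) \<in> set (rules M)" unfolding mem_rules using inv tm_inv_bounds(2)[OF inv] by (auto simp: rs_def tm_inv_def)
 have "csat \<beta> (trans M \<tau> ps (fst ?c, rs))" using st ps x tT unfolding csat_tab_step by blast
 moreover have "\<not> (\<exists>l\<in>set (ante ?K \<tau> ps (fst ?c, rs)). lit_true \<beta> l)"
 proof -
  have "\<beta> (Ce \<tau> k (nthd ps k) (rs ! k))" if "k < ?K" for k
   using IH(3)[OF that psk(2)[OF that]] psk(1,3)[OF that] that by (simp add: rs_def)
  then show ?thesis unfolding ante_true using IH(1,2) psk(1) by simp
 qed
 ultimately have "\<forall>l\<in>set (conse ?K \<tau> ps (nd M (fst ?c, rs))). lit_true \<beta> l" unfolding csat_trans by blast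
 then have co: "\<beta> (St (Suc \<tau>) (fst (nd M (fst ?c, rs))))"
  "\<And>k. k < ?K ==> \<beta> (Hd (Suc \<tau>) k (nthd ps k + snd (snd (nd M (fst ?c, rs))) ! k - 1))"
  "\<And>k. k < ?K ==> \<beta> (Ce (Suc \<tau>) k (nthd ps k) (fst (snd (nd M (fst ?c, rs))) ! k))"
  unfolding conse_true by blast+
 obtain s' ws es where ndx: "nd M (fst ?c, rs) = (s', ws, es)" by (metis prod_cases3)
 note step = nd_step[OF M inv tT(2) ndx[unfolded rs_def]]
 have cS: "cf (Suc \<tau>) = tm_step M ?c" by (simp add: cf_def)
 have fr: "\<beta> (Ce (Suc \<tau>) k p (cell ?c k (int p - int Z)))" if "k < ?K" "p < P" "p \<noteq> nat (pos ?c k + int Z)" for k p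
  using st IH(2)[OF that(1)] IH(3)[OF that(1,2)] psk(2)[OF that(1)] that tT(1) tm_inv_bounds(2)[OF inv that(1)]
  unfolding csat_tab_step by blast
 show ?case unfolding cS
 proof (intro conjI allI impI)
  show "\<beta> (St (Suc \<tau>) (fst (tm_step M ?c)))" using co(1) step(1) ndx by simp
  show "\<beta> (Hd (Suc \<tau>) k (nat (pos (tm_step M ?c) k + int Z)))" if "k < ?K" for k
   using co(2)[OF that] psk(1)[OF that] step(5)[OF that] ndx by simp
  show "\<beta> (Ce (Suc \<tau>) k p (cell (tm_step M ?c) k (int p - int Z)))" if k: "k < ?K" and p: "p < P" for k p
  proof (cases "p = nat (pos ?c k + int Z)")
   case True
   then show ?thesis using co(3)[OF k] psk(1,3)[OF k] step(4)[OF k] ndx by simp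
  next
   case False
   then have "int p - int Z \<noteq> pos ?c k" using psk(3)[OF k] by linarith
   then show ?thesis using fr[OF k p False] step(4)[OF k] by simp
  qed
 qed
qed

text \<open>The wrong symbols at the bits of \<open>x\<close> are excluded from outside; this is how
  an instance is imposed on the common tableau.\<close>

lemma tab_sound:
 assumes M: "tm_wf M" and \<beta>: "csat \<beta> (tab M n U T)" and x: "length x = n"
  and bits: "\<And>b. b < n ==> \<not> \<beta> (Ce 0 0 (Suc T + 2 * b + 1) (bit_wrong (x ! b)))"
 shows "\<exists>u. length u \<le> U & fst ((tm_step M ^^ T) (tm_init M (enc_pair (x, u)))) = 1 &
  cell ((tm_step M ^^ T) (tm_init M (enc_pair (x, u)))) (tm_tapes M - 1) 0 = 2"
proof -
 define Z P where "Z = Suc T" and "P = 2 * T + 2 * n + U + 5"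
 have st: "csat \<beta> (tab_step M T P)" and acc: "csat \<beta> (tab_acc M T Z)" and ini: "csat \<beta> (tab_init (tm_tapes M) n U Z P)"
  using \<beta> by (simp_all add: tab_def Z_def P_def)
 from ini have i1: "\<beta> (St 0 0)" and i2: "\<And>k. k < tm_tapes M ==> \<beta> (Hd 0 k Z)"
  and i3: "\<And>k p. 1 \<le> k ==> k < tm_tapes M ==> p < P ==> \<beta> (Ce 0 k p 0)"
  and i4: "\<And>p. p < Z ==> \<beta> (Ce 0 0 p 0)" and i5: "\<And>b. b < n ==> \<beta> (Ce 0 0 (Z + 2 * b) 2)"
  and i6: "\<And>b. b < n ==> \<beta> (Ce 0 0 (Z + 2 * b + 1) 1) \<or> \<beta> (Ce 0 0 (Z + 2 * b + 1) 2)" and i7: "\<beta> (Ce 0 0 (Z + 2 * n) 1)"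
  and i8: "\<And>w. w < U ==> \<beta> (Ce 0 0 (Z + 2 * n + 1 + w) 0) \<or> \<beta> (Ce 0 0 (Z + 2 * n + 1 + w) 1) \<or> \<beta> (Ce 0 0 (Z + 2 * n + 1 + w) 2)"
  and i9: "\<And>w. w < U ==> \<beta> (Ce 0 0 (Z + 2 * n + 1 + w) 0) ==> \<beta> (Ce 0 0 (Z + 2 * n + 1 + Suc w) 0)"
  and i10: "\<And>p. Z + 2 * n + 1 + U \<le> p ==> p < P ==> \<beta> (Ce 0 0 p 0)"
  unfolding csat_tab_init by blast+
 define g where "g = (%w a. \<beta> (Ce 0 0 (Z + 2 * n + 1 + w) a))"
 \<comment> \<open>The witness ends at the first cell where a blank holds, or at \<open>U\<close>;
   every earlier cell must hold a bit symbol.\<close>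
 define len where "len = (LEAST w. g w 0 \<or> w = U)"
 have lenU: "len \<le> U" unfolding len_def by (rule Least_le) simp
 have len1: "\<not> g w 0" if "w < len" for w using not_less_Least[OF that[unfolded len_def]] by blast
 have len0: "g len 0 \<or> len = U" unfolding len_def by (rule LeastI[of _ U]) simp
 have len2: "g w 0" if "len \<le> w" "w < U" for w
  using that
 proof (induction w rule: dec_induct)
  case base then show ?case using len0 by auto
 next
  case (step w)
  then have "g w 0" "w < U" by simp_all
  then show ?case using i9[of w] by (simp add: g_def)
 qed
 define u where "u = map (%w. g w 2) [0..<len]"
 have lu: "length u = len" by (simp add: u_def)
 have gu: "g w (bit_symbol (u ! w))" if "w < len" for w
  using i8[of w] len1[OF that] that lenU by (cases "g w 2") (simp_all add: u_def bit_symbol_def g_def)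
 have cellin: "\<beta> (Ce 0 k p (cell (tm_init M (enc_pair (x, u))) k (int p - int Z)))" if k: "k < tm_tapes M" and p: "p < P" for k p
 proof (cases "k = 0")
  case False
  then show ?thesis using i3[of k p] init_other(1)[of k M] k p by simp
 next
  case True
  note ic = init_cell_input[where M = M and Z = Z and x = x and u = u]
  show ?thesis
  proof (cases rule: input_position_cases[where p = p and Z = Z and n = n])
   case 1 then show ?thesis using i4 ic(1) True by simp
  next
   case (2 b) then show ?thesis using i5 ic(2)[of b] True x by simp
  next
   case (3 b)
   have "\<not> \<beta> (Ce 0 0 (Z + 2 * b + 1) (bit_wrong (x ! b)))" using bits[OF 3(1)] by (simp add: Z_def)
   then have "\<beta> (Ce 0 0 (Z + 2 * b + 1) (bit_symbol (x ! b)))" using i6[OF 3(1)] by (cases "x ! b") (simp_all add: bit_symbol_def)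
   then show ?thesis using ic(3)[of b] 3 True x by simp
  next
   case 4 then show ?thesis using i7 ic(4) True x by simp
  next
   case (5 w)
   show ?thesis
   proof (cases "w < len")
    case True
    then show ?thesis using gu[OF True] ic(5)[of w] 5 \<open>k = 0\<close> x lu by (simp add: g_def)
   next
    case False
    have "\<beta> (Ce 0 0 p 0)"
    proof (cases "w < U")
     case True then show ?thesis using len2[of w] False 5 by (simp add: g_def)
    next
     case False then show ?thesis using i10[of p] 5 p by simp
    qed
    then show ?thesis using ic(6)[of w] False 5 \<open>k = 0\<close> x lu by simp
   qed
  qed
 qed
 have P2: "2 * T + 1 < P" by (simp add: P_def)
 let ?cf = "(tm_step M ^^ T) (tm_init M (enc_pair (x, u)))"
 have run: "\<beta> (St T (fst ?cf)) & (\<forall>k<tm_tapes M. \<beta> (Hd T k (nat (pos ?cf k + int Z)))) &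
  (\<forall>k<tm_tapes M. \<forall>p<P. \<beta> (Ce T k p (cell ?cf k (int p - int Z))))"
  by (rule tab_run[OF M st P2 Z_def i1 i2 cellin order_refl])
 have inv: "tm_inv M (length (enc_pair (x, u))) T ?cf" by (rule tm_inv_run[OF M])
 have K: "tm_tapes M - 1 < tm_tapes M" using M by (simp add: tm_wf_def)
 have ZP: "Z < P" by (simp add: Z_def P_def)
 have "fst ?cf < tm_states M" using inv by (simp add: tm_inv_def)
 then have "fst ?cf = 1" using acc run unfolding csat_tab_acc by blast
 moreover have "\<beta> (Ce T (tm_tapes M - 1) Z (cell ?cf (tm_tapes M - 1) (int Z - int Z)))" using run K ZP by blast
 then have "cell ?cf (tm_tapes M - 1) 0 = 2" using acc tm_inv_bounds(2)[OF inv K, of 0] unfolding csat_tab_acc by auto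
 ultimately show ?thesis using lenU lu by blast
qed

lemma tab_complete:
 fixes M :: tm and x u :: "bool list" and T :: nat
 defines "cf \<equiv> %\<tau>. (tm_step M ^^ \<tau>) (tm_init M (enc_pair (x, u)))"
 assumes M: "tm_wf M" and x: "length x = n" and u: "length u \<le> U"
  and acc: "fst (cf T) = 1" "cell (cf T) (tm_tapes M - 1) 0 = 2"
  and bS: "\<And>\<tau> s. \<beta> (St \<tau> s) \<longleftrightarrow> s = fst (cf \<tau>)"
  and bH: "\<And>\<tau> k p. \<beta> (Hd \<tau> k p) \<longleftrightarrow> int p = pos (cf \<tau>) k + int (Suc T)"
  and bC: "\<And>\<tau> k p a. \<beta> (Ce \<tau> k p a) \<longleftrightarrow> a = cell (cf \<tau>) k (int p - int (Suc T))"
 shows "csat \<beta> (tab M n U T)"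
proof -
 define Z P where "Z = Suc T" and "P = 2 * T + 2 * n + U + 5"
 note bH' = bH[folded Z_def] and bC' = bC[folded Z_def]
 have cf0: "cf 0 = tm_init M (enc_pair (x, u))" by (simp add: cf_def)
 note ic = init_cell_input[where M = M and Z = Z and x = x and u = u, folded cf0]
 have "csat \<beta> (tab_init (tm_tapes M) n U Z P)"
  unfolding csat_tab_init bS bC'
 proof (intro conjI allI impI)
  show "0 = fst (cf 0)" by (simp add: cf0 tm_init_def)
  show "\<beta> (Hd 0 k Z)" if "k < tm_tapes M" for k unfolding bH' using init_other(2)[OF that] by (simp add: cf0)
  show "0 = cell (cf 0) k (int p - int Z)" if "1 \<le> k & k < tm_tapes M" for k p using init_other(1)[of k M] that by (simp add: cf0)
  show "0 = cell (cf 0) 0 (int p - int Z)" if "p < Z" for p using ic(1)[OF that] by simp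
  show "2 = cell (cf 0) 0 (int (Z + 2 * b) - int Z)" if "b < n" for b using ic(2)[of b] that x by simp
  show "1 = cell (cf 0) 0 (int (Z + 2 * b + 1) - int Z) \<or> 2 = cell (cf 0) 0 (int (Z + 2 * b + 1) - int Z)" if "b < n" for b
   using ic(3)[of b] that x by (simp add: bit_symbol_def)
  show "1 = cell (cf 0) 0 (int (Z + 2 * n) - int Z)" using ic(4) x by simp
  show "0 = cell (cf 0) 0 (int (Z + 2 * n + 1 + w) - int Z) \<or> 1 = cell (cf 0) 0 (int (Z + 2 * n + 1 + w) - int Z) \<or> 2 = cell (cf 0) 0 (int (Z + 2 * n + 1 + w) - int Z)" for w
  proof (cases "w < length u")
   case True then show ?thesis using ic(5)[OF True] x by (simp add: bit_symbol_def)
  next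
   case False then show ?thesis using ic(6)[of w] x by simp
  qed
  show "0 \<noteq> cell (cf 0) 0 (int (Z + 2 * n + 1 + w) - int Z) \<or> 0 = cell (cf 0) 0 (int (Z + 2 * n + 1 + Suc w) - int Z)" for w
  proof (rule disj_imp[THEN iffD2, OF impI])
   assume that: "\<not> 0 \<noteq> cell (cf 0) 0 (int (Z + 2 * n + 1 + w) - int Z)"
   have "length u \<le> w"
   proof (rule ccontr)
    assume "\<not> length u \<le> w"
    then show False using ic(5)[of w] that x by (simp add: bit_symbol_def split: if_splits)
   qed
   then show "0 = cell (cf 0) 0 (int (Z + 2 * n + 1 + Suc w) - int Z)" using ic(6)[of "Suc w"] x by simp
  qed
  show "0 = cell (cf 0) 0 (int p - int Z)" if "Z + 2 * n + 1 + U \<le> p & p < P" for p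
  proof -
   have "p = Z + 2 * n + 1 + (p - (Z + 2 * n + 1))" using that by simp
   moreover have "length u \<le> p - (Z + 2 * n + 1)" using conjunct1[OF that] u by linarith
   ultimately show ?thesis using ic(6)[of "p - (Z + 2 * n + 1)"] x by metis
  qed
 qed
 moreover have "csat \<beta> (tab_step M T P)"
  unfolding csat_tab_step
 proof (intro conjI allI impI ballI)
  fix \<tau> ps y assume \<tau>: "\<tau> < T" and ps: "length ps = tm_tapes M & set ps \<subseteq> {..<P}" and y: "y \<in> set (rules M)"
  let ?K = "tm_tapes M"
  have inv: "tm_inv M (length (enc_pair (x, u))) \<tau> (cf \<tau>)" unfolding cf_def by (rule tm_inv_run[OF M])
  show "csat \<beta> (trans M \<tau> ps y)" unfolding csat_trans
  proof
   assume "\<forall>l\<in>set (ante ?K \<tau> ps y). \<not> lit_true \<beta> l"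
   then have a: "fst y = fst (cf \<tau>)" "\<And>k. k < ?K ==> int (nthd ps k) = pos (cf \<tau>) k + int Z"
    "\<And>k. k < ?K ==> snd y ! k = cell (cf \<tau>) k (int (nthd ps k) - int Z)"
    using ante_true[of ?K \<tau> ps y \<beta>] unfolding bS bH' bC' by blast+
   have "snd y = map (%k. cell (cf \<tau>) k (pos (cf \<tau>) k)) [0..<?K]"
    using y a(2,3) unfolding mem_rules by (intro nth_equalityI) simp_all
   then have yy: "y = (fst (cf \<tau>), map (%k. cell (cf \<tau>) k (pos (cf \<tau>) k)) [0..<?K])" using a(1) by (simp add: prod_eq_iff)
   obtain s' ws es where ndx: "nd M y = (s', ws, es)" by (metis prod_cases3)
   have tZ: "\<tau> < Z" using \<tau> by (simp add: Z_def)
   note step = nd_step[OF M inv tZ ndx[unfolded yy]]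
   have cS: "cf (Suc \<tau>) = tm_step M (cf \<tau>)" by (simp add: cf_def)
   show "\<forall>l\<in>set (conse ?K \<tau> ps (nd M y)). lit_true \<beta> l"
    unfolding conse_true ndx fst_conv snd_conv bS cS bC'
   proof (intro conjI allI impI)
    show "s' = fst (tm_step M (cf \<tau>))" using step(1) by simp
    fix k assume k: "k < ?K"
    have "\<bar>pos (cf \<tau>) k\<bar> \<le> int \<tau>" by (rule tm_inv_bounds(1)[OF inv k])
    have "tm_inv M (length (enc_pair (x, u))) (Suc \<tau>) (tm_step M (cf \<tau>))" by (rule tm_inv_step[OF M inv])
    from tm_inv_bounds(1)[OF this k] have b: "\<bar>pos (tm_step M (cf \<tau>)) k\<bar> \<le> int (Suc \<tau>)" .
    have "nthd ps k = nat (pos (cf \<tau>) k + int Z)" using a(2)[OF k] by linarith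
    then have "nthd ps k + es ! k - 1 = nat (pos (tm_step M (cf \<tau>)) k + int Z)" using step(5)[OF k] by simp
    then show "\<beta> (Hd (Suc \<tau>) k (nthd ps k + es ! k - 1))" unfolding bH' cS using b tZ by simp
    have "int (nthd ps k) - int Z = pos (cf \<tau>) k" using a(2)[OF k] by simp
    then show "ws ! k = cell (tm_step M (cf \<tau>)) k (int (nthd ps k) - int Z)" using step(4)[OF k] by simp
   qed
  qed
 next
  fix \<tau> k p p' a assume h: "\<tau> < T" "k < tm_tapes M" "p' \<noteq> p" "\<beta> (Hd \<tau> k p)" "\<beta> (Ce \<tau> k p' a)"
  have inv: "tm_inv M (length (enc_pair (x, u))) \<tau> (cf \<tau>)" unfolding cf_def by (rule tm_inv_run[OF M])
  obtain s' ws es where ndx: "nd M (fst (cf \<tau>), map (%k. cell (cf \<tau>) k (pos (cf \<tau>) k)) [0..<tm_tapes M]) = (s', ws, es)" by (metis prod_cases3)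
  have tZ: "\<tau> < Z" using h by (simp add: Z_def)
  note step = nd_step[OF M inv tZ ndx]
  have cS: "cf (Suc \<tau>) = tm_step M (cf \<tau>)" by (simp add: cf_def)
  have "int p' - int Z \<noteq> pos (cf \<tau>) k" using h(3,4) unfolding bH' by linarith
  then show "\<beta> (Ce (Suc \<tau>) k p' a)" using h(5) step(4)[OF h(2)] unfolding bC' cS by simp
 qed
 moreover have "csat \<beta> (tab_acc M T Z)" unfolding csat_tab_acc bS bC' using acc by simp
 ultimately show ?thesis by (simp add: tab_def Z_def P_def)
qed

section \<open>The disjunction of many instances\<close>

definition acc_run :: "tm => nat => bool list => bool list => bool" where
 "acc_run M T x u \<longleftrightarrow> fst ((tm_step M ^^ T) (tm_init M (enc_pair (x, u)))) = 1 &
  cell ((tm_step M ^^ T) (tm_init M (enc_pair (x, u)))) (tm_tapes M - 1) 0 = 2"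

text \<open>At least one value \<open>i\<close> for each index coordinate \<open>j\<close> is
  enough: any index composed of such values imposes its instance.\<close>

definition sel_cls :: "nat => nat => lit list list" where
 "sel_cls r s = map (%j. map (%i. (True, [3, j, i])) [0..<s]) [0..<r]"

text \<open>\<open>[4, b, a, i]\<close> is implied by two facts together: coordinate 0 of the index
  is \<open>i\<close>, and bit \<open>b\<close> of the input has symbol \<open>a\<close>. Merging
  them into one variable gives tuples of \<open>r\<close> rather than \<open>r + 1\<close>
  entries.\<close>

definition z_cls :: "nat => nat => nat => lit list list" where
 "z_cls Z n s = concat (map (%i. concat (map (%b. map (%a. [(False, [3, 0, i]), (False, Ce 0 0 (Z + 2 * b + 1) a), (True, [4, b, a, i])])
  [1, 2]) [0..<n])) [0..<s])"

definition or_cls :: "tm => nat => nat => nat => nat => nat => lit list list" where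
 "or_cls M n U T r s = tab M n U T @ sel_cls r s @ z_cls (Suc T) n s"

text \<open>Forbids that \<open>v\<close> is the selected index while bit \<open>b\<close> of the
  tableau's input is opposite to bit \<open>b\<close> of \<open>x\<close>.\<close>

definition or_tuple :: "nat => nat list => bool list => nat => nat list list" where
 "or_tuple r v x b = [4, b, bit_wrong (nthd x b), nthd v 0] # map (%j. [3, j, nthd v j]) [1..<r]"

definition or_fs :: "nat => nat => nat => bool list list => nat list list list" where
 "or_fs r n s xs = concat (map (%p. map (%b. or_tuple r (fst p) (snd p) b) [0..<n]) (zip (List.n_lists r [0..<s]) xs))"

lemma csat_sel: "csat \<beta> (sel_cls r s) \<longleftrightarrow> (\<forall>j<r. \<exists>i<s. \<beta> [3, j, i])"
 unfolding sel_cls_def csat_map by (simp add: Ball_def Bex_def)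

lemma csat_z: "csat \<beta> (z_cls Z n s) \<longleftrightarrow> (\<forall>i<s. \<forall>b<n. \<forall>a\<in>{1, 2}. \<beta> [3, 0, i] --> \<beta> (Ce 0 0 (Z + 2 * b + 1) a) --> \<beta> [4, b, a, i])"
proof -
 have b: "(\<exists>l\<in>set [a, b, c]. Q l) \<longleftrightarrow> Q a \<or> Q b \<or> Q c" for Q :: "lit => bool" and a b c by simp
 have "csat \<beta> (z_cls Z n s) \<longleftrightarrow> (\<forall>i. 0 \<le> i & i < s --> (\<forall>b. 0 \<le> b & b < n --> (\<forall>a\<in>set [1, 2]. \<not> \<beta> [3, 0, i] \<or> \<not> \<beta> (Ce 0 0 (Z + 2 * b + 1) a) \<or> \<beta> [4, b, a, i])))"
  unfolding z_cls_def csat_simps csat_map set_upt Ball_def[of "{0..<_}"] atLeastLessThan_iff b lit_true_simps ..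
 then show ?thesis unfolding set_simps le0 simp_thms imp_conv_disj by blast
qed

lemma or_fs_iff: "tu \<in> set (or_fs r n s xs) \<longleftrightarrow> (\<exists>p\<in>set (zip (List.n_lists r [0..<s]) xs). \<exists>b<n. tu = or_tuple r (fst p) (snd p) b)"
 unfolding or_fs_def mem_concat_map mem_map set_upt Bex_def[of "{0..<n}"] by simp

lemma or_tuple_all: "(\<forall>v\<in>set (or_tuple r v x b). \<beta> v) \<longleftrightarrow> \<beta> [4, b, bit_wrong (nthd x b), nthd v 0] & (\<forall>j. 1 \<le> j & j < r --> \<beta> [3, j, nthd v j])"
 unfolding or_tuple_def by auto

lemma zip_n_lists:
 assumes "length xs = s ^ r" "p \<in> set (zip (List.n_lists r [0..<s]) xs)"
 obtains m where "m < s ^ r" "fst p = List.n_lists r [0..<s] ! m" "snd p = xs ! m" "length (fst p) = r" "\<And>j. j < r ==> fst p ! j < s"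
proof -
 have l: "length (List.n_lists r [0..<s]) = s ^ r" by (simp add: length_n_lists)
 obtain m where m: "m < s ^ r" "p = (List.n_lists r [0..<s] ! m, xs ! m)"
  using assms l by (auto simp: set_zip)
 have "fst p \<in> set (List.n_lists r [0..<s])" using m l by simp
 then have "length (fst p) = r" "set (fst p) \<subseteq> {0..<s}" by (auto simp: set_n_lists)
 then show thesis using m by (intro that[of m]) (auto, metis atLeastLessThan_iff nth_mem subsetD)
qed

text \<open>The selected index determines one of the \<open>s ^ r\<close> instances, whose bits the
  forbidden tuples then impose on the tableau; all other instances remain without effect when
  exactly one index is selected.\<close>

lemma or_sat:
 assumes M: "tm_wf M" and r: "1 \<le> r" and len: "length xs = s ^ r" and n: "\<And>x. x \<in> set xs ==> length x = n"
 shows "(\<exists>\<beta>. sat (or_cls M n U T r s) (or_fs r n s xs) \<beta>) \<longleftrightarrow> (\<exists>x\<in>set xs. \<exists>u. length u \<le> U & acc_run M T x u)"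
proof
 have ll: "length (List.n_lists r [0..<s]) = s ^ r" by (simp add: length_n_lists)
 assume "\<exists>\<beta>. sat (or_cls M n U T r s) (or_fs r n s xs) \<beta>"
 then obtain \<beta> where cs: "csat \<beta> (or_cls M n U T r s)" and fs: "\<And>tu. tu \<in> set (or_fs r n s xs) ==> \<not> (\<forall>v\<in>set tu. \<beta> v)"
  unfolding sat_def csat_def by blast
 have tabs: "csat \<beta> (tab M n U T)" and sel: "\<forall>j<r. \<exists>i<s. \<beta> [3, j, i]"
  and z: "csat \<beta> (z_cls (Suc T) n s)"
  using cs unfolding or_cls_def csat_simps csat_sel by blast+
 from sel obtain ii where ii: "\<And>j. j < r ==> ii j < s & \<beta> [3, j, ii j]" by metis
 define v where "v = map ii [0..<r]"
 have v: "nthd v j = ii j" if "j < r" for j using that by (simp add: v_def nthd_nth)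
 have "v \<in> set (List.n_lists r [0..<s])" using ii by (auto simp: v_def set_n_lists)
 then obtain m where m: "m < s ^ r" "List.n_lists r [0..<s] ! m = v" using ll unfolding in_set_conv_nth by auto
 define x where "x = xs ! m"
 have x: "x \<in> set xs" "(v, x) \<in> set (zip (List.n_lists r [0..<s]) xs)"
  using m len ll by (auto simp: x_def set_zip)
 have "\<not> \<beta> (Ce 0 0 (Suc T + 2 * b + 1) (bit_wrong (x ! b)))" if b: "b < n" for b
 proof
  assume ce: "\<beta> (Ce 0 0 (Suc T + 2 * b + 1) (bit_wrong (x ! b)))"
  have xb: "nthd x b = x ! b" using n[OF x(1)] b by (simp add: nthd_nth)
  have r0: "0 < r" using r by simp
  have "or_tuple r v x b \<in> set (or_fs r n s xs)" unfolding or_fs_iff using x(2) b by (intro bexI[of _ "(v, x)"] exI[of _ b]) simp_all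
  from fs[OF this] have "\<not> \<beta> [4, b, bit_wrong (x ! b), ii 0]" unfolding or_tuple_all xb v[OF r0] using ii v by auto
  moreover have "bit_wrong (x ! b) \<in> {1, 2}" by simp
  ultimately show False using z ce ii[OF r0] b unfolding csat_z by blast
 qed
 from tab_sound[OF M tabs n[OF x(1)] this] show "\<exists>x\<in>set xs. \<exists>u. length u \<le> U & acc_run M T x u"
  using x(1) unfolding acc_run_def by blast
next
 have ll: "length (List.n_lists r [0..<s]) = s ^ r" by (simp add: length_n_lists)
 assume "\<exists>x\<in>set xs. \<exists>u. length u \<le> U & acc_run M T x u"
 then obtain x u where x: "x \<in> set xs" and u: "length u \<le> U" and acc: "acc_run M T x u" by blast
 obtain m where m: "m < s ^ r" "xs ! m = x" using x len unfolding in_set_conv_nth by auto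
 define v where "v = List.n_lists r [0..<s] ! m"
 have "v \<in> set (List.n_lists r [0..<s])" using m ll by (simp add: v_def)
 then have v: "length v = r" "set v \<subseteq> {0..<s}" by (auto simp: set_n_lists)
 have vj: "v ! j < s" if "j < r" for j using v that by (metis atLeastLessThan_iff nth_mem subsetD)
 let ?cf = "%\<tau>. (tm_step M ^^ \<tau>) (tm_init M (enc_pair (x, u)))"
 \<comment> \<open>The facts of the run on \<open>x\<close> and \<open>u\<close>, the index of
   \<open>x\<close> alone, and each merged variable exactly where both of its conditions
   hold.\<close>
 define \<beta> where "\<beta> = (%w. if hd w = 0 then w ! 2 = fst (?cf (w ! 1))
  else if hd w = 1 then int (w ! 3) = pos (?cf (w ! 1)) (w ! 2) + int (Suc T)
  else if hd w = 2 then w ! 4 = cell (?cf (w ! 1)) (w ! 2) (int (w ! 3) - int (Suc T))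
  else if hd w = 3 then w ! 2 = v ! (w ! 1)
  else w ! 3 = v ! 0 & w ! 2 = cell (?cf 0) 0 (int (Suc T + 2 * (w ! 1) + 1) - int (Suc T)))"
 have bS: "\<beta> (St \<tau> s) \<longleftrightarrow> s = fst (?cf \<tau>)" for \<tau> s by (simp add: \<beta>_def)
 have bH: "\<beta> (Hd \<tau> k p) \<longleftrightarrow> int p = pos (?cf \<tau>) k + int (Suc T)" for \<tau> k p by (simp add: \<beta>_def numeral_3_eq_3)
 have bC: "\<beta> (Ce \<tau> k p a) \<longleftrightarrow> a = cell (?cf \<tau>) k (int p - int (Suc T))" for \<tau> k p a by (simp add: \<beta>_def numeral_3_eq_3 numeral_nat)
 have b3: "\<beta> [3, j, i] \<longleftrightarrow> i = v ! j" for j i by (simp add: \<beta>_def)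
 have b4: "\<beta> [4, b, a, i] \<longleftrightarrow> i = v ! 0 & a = cell (?cf 0) 0 (int (Suc T + 2 * b + 1) - int (Suc T))" for b a i
  by (simp add: \<beta>_def numeral_3_eq_3)
 have "csat \<beta> (tab M n U T)"
  by (rule tab_complete[OF M n[OF x] u _ _ bS bH bC]) (use acc in \<open>simp_all add: acc_run_def\<close>)
 moreover have "csat \<beta> (sel_cls r s)" unfolding csat_sel b3 using vj by blast
 moreover have "csat \<beta> (z_cls (Suc T) n s)" unfolding csat_z b3 b4 bC by blast
 ultimately have "csat \<beta> (or_cls M n U T r s)" by (simp add: or_cls_def)
 moreover have "\<not> (\<forall>w\<in>set tu. \<beta> w)" if tu: "tu \<in> set (or_fs r n s xs)" for tu
 proof
  assume all: "\<forall>w\<in>set tu. \<beta> w"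
  from tu obtain p b where pb: "p \<in> set (zip (List.n_lists r [0..<s]) xs)" "b < n" "tu = or_tuple r (fst p) (snd p) b"
   unfolding or_fs_iff by blast
  from zip_n_lists[OF len pb(1)] obtain m' where m': "m' < s ^ r" "fst p = List.n_lists r [0..<s] ! m'" "snd p = xs ! m'" "length (fst p) = r" by metis
  have r0: "0 < r" using r by simp
  have a: "nthd (fst p) 0 = v ! 0" "bit_wrong (nthd (snd p) b) = cell (?cf 0) 0 (int (Suc T + 2 * b + 1) - int (Suc T))"
   "\<And>j. 1 \<le> j ==> j < r ==> nthd (fst p) j = v ! j"
   using all unfolding pb(3) or_tuple_all b3 b4 by blast+
  have "fst p = v"
  proof (rule nth_equalityI)
   show "length (fst p) = length v" using m'(4) v(1) by simp
   fix j assume j: "j < length (fst p)"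
   then have "fst p ! j = nthd (fst p) j" by (simp add: nthd_nth)
   then show "fst p ! j = v ! j" using a(1,3) j m'(4) by (cases "j = 0") simp_all
  qed
  moreover have "distinct (List.n_lists r [0..<s])" by (rule distinct_n_lists) simp
  \<comment> \<open>Different positions have different indices, so a tuple that is true throughout
    belongs to \<open>x\<close> itself; but such a tuple asks for a wrong bit.\<close>
  ultimately have "m' = m" using m' m(1) ll unfolding v_def by (simp add: nth_eq_iff_index_eq)
  then have "snd p = x" using m'(3) m(2) by simp
  moreover have "nthd x b = x ! b" using n[OF x] pb(2) by (simp add: nthd_nth)
  moreover have "cell (?cf 0) 0 (int (Suc T + 2 * b + 1) - int (Suc T)) = bit_symbol (x ! b)"
   using init_cell_input(3)[where M = M and Z = "Suc T" and x = x and u = u and b = b] n[OF x] pb(2) by simp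
  ultimately show False using a(2) by (simp add: bit_symbol_def split: if_splits)
 qed
 ultimately show "\<exists>\<beta>. sat (or_cls M n U T r s) (or_fs r n s xs) \<beta>" unfolding sat_def csat_def by blast
qed

section \<open>Sizes in the reduction\<close>

lemma length_concat_esz: "length (concat l) \<le> esz l"
proof (induction l)
 case (Cons a l)
 then show ?case using esz_length[of a] by simp
qed simp

text \<open>Linear in \<open>s\<close>, while \<open>s ^ r\<close> instances are selected: apart
  from the tableau, the modulator grows like the \<open>r\<close>-th root of their number.\<close>

lemma length_or_cls: "length (concat (or_cls M n U T r s)) = length (concat (tab M n U T)) + r * s + 6 * n * s"
proof -
 have 1: "length (concat (sel_cls r s)) = r * s" unfolding sel_cls_def by (simp add: length_concat comp_def sum_list_triv)
 have "length (concat (z_cls Z n s)) = 6 * n * s" for Z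
 proof -
  have c: "length (concat (concat (map F l))) = sum_list (map (%y. length (concat (F y))) l)" for F :: "nat => lit list list" and l
   by (induction l) simp_all
  have "length (concat (map (%a. [(False, [3, 0, i]), (False, Ce 0 0 (Z + 2 * b + 1) a), (True, [4, b, a, i])]) [1, 2])) = 6" for i b by simp
  then show ?thesis unfolding z_cls_def c by (simp add: sum_list_triv)
 qed
 then show ?thesis using 1 by (simp add: or_cls_def)
qed

text \<open>The factor \<open>A ^ r\<close> lost through \<open>k \<le> s * A\<close> is absorbed by
  \<open>s powr \<epsilon>\<close>, which is at least \<open>B\<close> because
  \<open>s = B ^ m\<close> and \<open>1 / m \<le> \<epsilon>\<close>. The factor
  \<open>2 * c0 + 2\<close> leaves room for the doubling in \<open>enc_bits\<close> and its end
  marker.\<close>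

lemma size_choice:
 fixes s A c0 m r B k h :: nat and \<epsilon> :: real
 assumes s: "s = B ^ m" and m: "1 \<le> m" "1 / real m \<le> \<epsilon>" "\<epsilon> \<le> 1 / 2" and r: "1 \<le> r" and A: "1 \<le> A"
  and B: "(2 * c0 + 2) * A ^ r \<le> B" and k: "k \<le> s * A" and h: "real h \<le> real c0 * real k powr (real r - \<epsilon>)"
 shows "2 * h + 1 < s ^ r"
proof -
 define e where "e = real r - \<epsilon>"
 have e: "0 < e" using m r by (simp add: e_def)
 have e0: "0 \<le> \<epsilon>" using m(2) order_trans[of 0 "1 / real m" \<epsilon>] by simp
 have B1: "1 \<le> B" using B A by (metis le_trans mult_le_mono one_le_power mult_1 le_add2 add_2_eq_Suc' Suc_leI zero_less_Suc One_nat_def)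
 have s1: "1 \<le> s" using B1 by (simp add: s)
 have sB: "real B \<le> real s powr \<epsilon>"
 proof -
  have "real B = (real B ^ m) powr (1 / real m)"
   using B1 m(1) by (simp add: powr_realpow[symmetric] powr_powr)
  also have "\<dots> = real s powr (1 / real m)" by (simp add: s)
  also have "\<dots> \<le> real s powr \<epsilon>" using s1 m(2) by (intro powr_mono) simp_all
  finally show ?thesis .
 qed
 have "real k \<le> real (s * A)" using k by (simp only: of_nat_le_iff)
 then have "real k powr e \<le> real (s * A) powr e" using e by (intro powr_mono2) simp_all
 also have "\<dots> = real s powr e * real A powr e" by (simp add: powr_mult)
 also have "\<dots> \<le> real s powr e * real A powr real r" using A e0 by (intro mult_left_mono powr_mono) (simp_all add: e_def)
 also have "\<dots> = real s powr e * real A ^ r" using A by (simp add: powr_realpow)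
 finally have kp: "real k powr e \<le> real s powr e * real A ^ r" .
 have se: "real s powr e * real s powr \<epsilon> = real s ^ r"
  using s1 by (simp add: powr_add[symmetric] e_def powr_realpow)
 have BA: "real (2 * c0 + 2) * real A ^ r \<le> real B" using B by (metis of_nat_le_iff of_nat_mult of_nat_power)
 have "real (2 * c0 + 2) * (real s powr e * real A ^ r) \<le> real s powr e * real B"
  using mult_left_mono[OF BA, of "real s powr e"] by (simp add: ac_simps)
 also have "\<dots> \<le> real s ^ r" using mult_left_mono[OF sB, of "real s powr e"] se by simp
 finally have "real (2 * c0 + 2) * real k powr e \<le> real s ^ r"
  using mult_left_mono[OF kp, of "real (2 * c0 + 2)"] by linarith
 then have kk: "real k powr e \<le> real s ^ r / real (2 * c0 + 2)" by (simp add: field_simps)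
 have "real h \<le> real c0 * (real s ^ r / real (2 * c0 + 2))"
  using h mult_left_mono[OF kk, of "real c0"] unfolding e_def by linarith
 then have hh: "real h * real (2 * c0 + 2) \<le> real c0 * real s ^ r" by (simp add: field_simps)
 have "B \<le> s" unfolding s using B1 m(1) by (metis self_le_power One_nat_def Suc_le_lessD)
 also have "s \<le> s ^ r" using s1 r by (metis self_le_power One_nat_def Suc_le_lessD)
 finally have "B \<le> s ^ r" .
 moreover have "2 * c0 + 2 \<le> B" using B A by (metis le_trans mult_le_mono2 one_le_power nat_mult_1_right)
 ultimately have sr: "real (2 * c0 + 2) \<le> real s ^ r" by (metis of_nat_le_iff of_nat_power le_trans)
 have "(2 * real h + 1) * real (2 * c0 + 2) \<le> 2 * (real c0 * real s ^ r) + real (2 * c0 + 2)"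
  using hh by (simp add: algebra_simps)
 also have "\<dots> < 2 * (real c0 * real s ^ r) + 2 * real s ^ r" using sr by (simp add: algebra_simps)
 also have "\<dots> = real s ^ r * real (2 * c0 + 2)" by (simp add: algebra_simps)
 finally have "2 * real h + 1 < real s ^ r" by simp
 then have "real (2 * h + 1) < real (s ^ r)" by simp
 then show ?thesis unfolding of_nat_less_iff .
qed

lemma enc_param_inj: "enc_param y = enc_param z ==> y = z"
proof -
 assume a: "enc_param y = enc_param z"
 obtain a k b l where y: "y = (a, k)" and z: "z = (b, l)" by fastforce
 from a have "a = b & replicate k True = replicate l True"
  unfolding y z enc_param_def enc_pair_def enc_unary_def case_prod_conv by (rule enc_bits_append_inj)
 then show ?thesis unfolding y z by (metis length_replicate)
qed

context gadget
begin

lemma or_fs_ok: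
 assumes r: "1 \<le> r" and len: "length xs = s ^ r" and tu: "tu \<in> set (or_fs r n s xs)"
 shows "length tu = r & set tu \<subseteq> set (vars (or_cls M n U H r s))"
proof -
 from tu obtain p b where pb: "p \<in> set (zip (List.n_lists r [0..<s]) xs)" "b < n" "tu = or_tuple r (fst p) (snd p) b"
  unfolding or_fs_iff by blast
 from zip_n_lists[OF len pb(1)] have p: "length (fst p) = r" "\<And>j. j < r ==> fst p ! j < s" by metis+
 have v: "nthd (fst p) j < s" if "j < r" for j using p that by (simp add: nthd_nth)
 have sel: "[3, j, i] \<in> set (vars (or_cls M n U H r s))" if "j < r" "i < s" for j i
 proof -
  have "(True, [3, j, i]) \<in> set (map (%i. (True, [3, j, i])) [0..<s])" using that by simp
  moreover have "map (%i. (True, [3, j, i])) [0..<s] \<in> set (sel_cls r s)" unfolding sel_cls_def mem_map using that by (intro bexI[of _ j]) simp_all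
  ultimately have "(True, [3, j, i]) \<in> set (concat (or_cls M n U H r s))" unfolding or_cls_def by fastforce
  then show ?thesis unfolding vars_def by force
 qed
 have z: "[4, b, a, i] \<in> set (vars (or_cls M n U H r s))" if "a \<in> {1, 2}" "i < s" for a i
 proof -
  let ?c = "[(False, [3, 0, i]), (False, Ce 0 0 (Suc H + 2 * b + 1) a), (True, [4, b, a, i])]"
  have "?c \<in> set (map (%a. [(False, [3, 0, i]), (False, Ce 0 0 (Suc H + 2 * b + 1) a), (True, [4, b, a, i])]) [1, 2])" using that by auto
  moreover have "i \<in> set [0..<s]" "b \<in> set [0..<n]" using that pb by simp_all
  ultimately have "?c \<in> set (z_cls (Suc H) n s)" unfolding z_cls_def mem_concat_map by blast
  then have "(True, [4, b, a, i]) \<in> set (concat (or_cls M n U H r s))" unfolding or_cls_def by fastforce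
  then show ?thesis unfolding vars_def by force
 qed
 have "[4, b, bit_wrong (nthd (snd p) b), nthd (fst p) 0] \<in> set (vars (or_cls M n U H r s))"
  using r by (intro z v) simp_all
 then show ?thesis unfolding pb(3) or_tuple_def using sel v r by auto
qed

lemma or_cls_nonempty: "1 \<le> s ==> [] \<notin> set (or_cls M n U H r s)"
 unfolding or_cls_def sel_cls_def z_cls_def using tab_nonempty[of M n U H] by auto

text \<open>Lets the parameter pass the threshold from which an O-bound on the compression size
  holds.\<close>

lemma length_inner_ge: "1 \<le> r ==> s \<le> length (inner (or_cls M n U H r s))"
proof -
 assume r: "1 \<le> r"
 have "(%i. 1 # 1 # [3, 0, i]) ` {..<s} \<subseteq> set (inner (or_cls M n U H r s))"
 proof
  fix w assume "w \<in> (%i. 1 # 1 # [3, 0, i]) ` {..<s}"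
  then obtain i where i: "i < s" "w = 1 # 1 # [3, 0, i]" by blast
  have "(True, [3, 0, i]) \<in> set (map (%i. (True, [3, 0, i])) [0..<s])" using i by simp
  moreover have "map (%i. (True, [3, 0, i])) [0..<s] \<in> set (sel_cls r s)" unfolding sel_cls_def using r by (simp add: image_iff) (intro bexI[of _ 0], simp_all)
  ultimately have "(True, [3, 0, i]) \<in> set (concat (or_cls M n U H r s))" unfolding or_cls_def by fastforce
  then have "[3, 0, i] \<in> set (vars (or_cls M n U H r s))" unfolding vars_def by force
  then show "w \<in> set (inner (or_cls M n U H r s))" unfolding i(2) by simp
 qed
 then have "card ((%i. 1 # 1 # [3, 0, i]) ` {..<s}) \<le> card (set (inner (or_cls M n U H r s)))" by (intro card_mono) simp_all
 moreover have "card ((%i. 1 # 1 # [3, 0, i]) ` {..<s}) = s" by (subst card_image) (simp_all add: inj_on_def)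
 ultimately show ?thesis using card_length le_trans by metis
qed

end

lemma tm_halted: "(tm_step M ^^ m) (1, ts) = (1, ts)"
 by (induction m) (simp_all add: tm_step_def)

text \<open>A halted machine stays as it is, so acceptance can be tested at any later time, on the
  single output symbol in cell 0 of the last tape.\<close>

lemma acc_run_iff:
 assumes M: "tm_wf M" and y: "tm_yields M (enc_pair (x, u)) T0 [b]" and T: "T0 \<le> T"
 shows "acc_run M T x u \<longleftrightarrow> b"
proof -
 let ?cf = "%\<tau>. (tm_step M ^^ \<tau>) (tm_init M (enc_pair (x, u)))"
 obtain s ts where cf: "?cf T0 = (s, ts)" by fastforce
 have s: "s = 1" and c: "fst (last ts) 0 = bit_symbol b" using y unfolding tm_yields_def cf by auto
 have "?cf T = (tm_step M ^^ (T - T0)) (?cf T0)" using T funpow_add[of "T - T0" T0 "tm_step M"] by simp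
 then have e: "?cf T = (1, ts)" unfolding cf s tm_halted .
 have "length ts = tm_tapes M" using tm_inv_run[OF M, of "enc_pair (x, u)" T] unfolding e by (simp add: tm_inv_def)
 moreover have "ts \<noteq> []" using calculation M by (auto simp: tm_wf_def)
 ultimately have "last ts = ts ! (tm_tapes M - 1)" by (simp add: last_conv_nth)
 then show ?thesis unfolding acc_run_def e cell_def using c by (simp add: bit_symbol_def)
qed

text \<open>For \<open>k \<ge> 1\<close> a smaller saving gives a weaker bound, so \<epsilon> may be
  shrunk at will.\<close>

lemma bigo_powr_bound:
 assumes "(%k. real (h k)) \<in> O(%k. real k powr (real r - \<epsilon>))" "\<epsilon>' \<le> \<epsilon>"
 shows "\<exists>c k0 :: nat. \<forall>k\<ge>k0. real (h k) \<le> real c * real k powr (real r - \<epsilon>')"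
proof -
 obtain c where c: "c > 0" "eventually (%k. norm (real (h k)) \<le> c * norm (real k powr (real r - \<epsilon>))) at_top"
  using landau_o.bigE[OF assms(1)] by blast
 then obtain k1 where k1: "\<And>k. k \<ge> k1 ==> norm (real (h k)) \<le> c * norm (real k powr (real r - \<epsilon>))"
  unfolding eventually_at_top_linorder by blast
 obtain c' :: nat where c': "c \<le> real c'" using real_arch_simple by blast
 have "real (h k) \<le> real c' * real k powr (real r - \<epsilon>')" if k: "k \<ge> max k1 1" for k
 proof -
  have "real (h k) \<le> c * real k powr (real r - \<epsilon>)" using k1[of k] k by simp
  also have "\<dots> \<le> real c' * real k powr (real r - \<epsilon>')"
   using c' k assms(2) c(1) by (intro mult_mono powr_mono) simp_all
  finally show ?thesis .
 qed
 then show ?thesis by blast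
qed

section \<open>The lower bound for compressions\<close>

context gadget
begin

theorem compression_lower_bound:
 assumes r: "1 \<le> r" and L: "L \<in> NP" and comp: "is_compression (coloring_problem q t) Q' h f"
  and O: "(%k. real (h k)) \<in> O(%k. real k powr (real r - \<epsilon>))" "0 < \<epsilon>"
 shows "L \<in> coNP_poly"
proof -
 obtain V p where V: "poly_time_via enc_pair (%b. [b]) V"
  and Lx: "\<And>x. x \<in> L \<longleftrightarrow> (\<exists>u. length u \<le> poly p (length x) & V (x, u))"
  using L unfolding NP_def by blast
 obtain M p' where M: "tm_wf M" and My: "\<And>a. \<exists>T \<le> poly p' (length (enc_pair a)). tm_yields M (enc_pair a) T [V a]"
  using V unfolding poly_time_via_def by blast
 define U where "U = (%n. poly p n)"
 define T where "T = (%n. poly p' (2 * n + 1 + U n))"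
 have acc: "acc_run M (T n) x u \<longleftrightarrow> V (x, u)" if "length x = n" "length u \<le> U n" for x u n
 proof -
  obtain T0 where T0: "T0 \<le> poly p' (length (enc_pair (x, u)))" "tm_yields M (enc_pair (x, u)) T0 [V (x, u)]" using My by blast
  have "length (enc_pair (x, u)) \<le> 2 * n + 1 + U n" using that by (simp add: enc_pair_def length_enc_bits)
  then have "T0 \<le> T n" using T0(1) poly_nat_mono unfolding T_def by (metis le_trans)
  from acc_run_iff[OF M T0(2) this] show ?thesis .
 qed
 have ptn: "pt (%n. tab M n (U n) (T n))" unfolding T_def U_def by (intro pt_tab pt_intros)
 from pt_bnd[OF this] obtain K d where K: "\<And>n. esz (tab M n (U n) (T n)) \<le> K * esz n ^ d" unfolding bnd_def by blast
 \<comment> \<open>Capping at 1/2 keeps the exponent \<open>real r - \<epsilon>'\<close> positive,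
   so the power is monotone in the parameter, as \<open>size_choice\<close> uses.\<close>
 define \<epsilon>' where "\<epsilon>' = min \<epsilon> (1 / 2)"
 have e': "0 < \<epsilon>'" "\<epsilon>' \<le> \<epsilon>" "\<epsilon>' \<le> 1 / 2" using O(2) by (simp_all add: \<epsilon>'_def)
 obtain c0 k0 :: nat where hk: "\<And>k. k \<ge> k0 ==> real (h k) \<le> real c0 * real k powr (real r - \<epsilon>')"
  using bigo_powr_bound[OF O(1) e'(2)] by blast
 obtain m :: nat where m: "1 / \<epsilon>' \<le> real m" using real_arch_simple by blast
 have m1: "1 \<le> m"
 proof (rule ccontr)
  assume "\<not> 1 \<le> m"
  then have "m = 0" by simp
  with m have "1 / \<epsilon>' \<le> 0" by simp
  then show False using e'(1) by (simp add: divide_le_0_iff)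
 qed
 have m2: "1 / real m \<le> \<epsilon>'" using m m1 e'(1) by (simp add: field_simps)
 \<comment> \<open>\<open>q\<close> and \<open>5 + 2 * r\<close> come from
   \<open>length_inner\<close>, \<open>K * 2 ^ d\<close> from the tableau with
   \<open>esz n \<le> 2 * (n + 1)\<close>, and \<open>r + 6\<close> from the selecting clauses. The
   modulator will then have at most \<open>sf n * A n\<close> vertices.\<close>
 define c1 where "c1 = q + (5 + 2 * r) * (K * 2 ^ d + r + 6)"
 define A where "A = (%n. c1 * (n + 1) ^ (d + 1))"
 \<comment> \<open>The factor \<open>k0 + 1\<close> makes \<open>sf n\<close>, and with it the
   parameter, at least \<open>k0\<close>.\<close>
 define C where "C = (2 * c0 + 2) * c1 ^ r * (k0 + 1)"
 define Sp :: "nat poly" where "Sp = ([:C:] * [:1, 1:] ^ ((d + 1) * r)) ^ m"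
 define sf where "sf = (%n. poly Sp n)"
 define Bn where "Bn = (%n. C * (n + 1) ^ ((d + 1) * r))"
 have sfB: "sf n = Bn n ^ m" for n by (simp add: sf_def Sp_def Bn_def poly_power)
 have q3: "q > 0" using TFB by simp
 have c1: "1 \<le> c1" using q3 by (simp add: c1_def)
 have A1: "1 \<le> A n" for n
 proof -
  have "1 \<le> (n + 1) ^ (d + 1)" by (rule one_le_power) simp
  from mult_le_mono[OF c1 this] show ?thesis unfolding A_def by (simp only: mult_1)
 qed
 have Bge: "(2 * c0 + 2) * A n ^ r \<le> Bn n" "k0 \<le> Bn n" "1 \<le> Bn n" for n
 proof -
  have "A n ^ r = c1 ^ r * (n + 1) ^ ((d + 1) * r)" unfolding A_def by (simp only: power_mult_distrib power_mult)
  then have "Bn n = (2 * c0 + 2) * A n ^ r * (k0 + 1)" by (simp only: Bn_def C_def ac_simps)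
  moreover have "1 \<le> A n ^ r" using A1[of n] by simp
  then have a1: "1 \<le> (2 * c0 + 2) * A n ^ r" by simp
  ultimately show "(2 * c0 + 2) * A n ^ r \<le> Bn n" "k0 \<le> Bn n" "1 \<le> Bn n"
   using mult_le_mono1[OF a1, of "k0 + 1"] mult_le_mono2[of 1 "k0 + 1" "(2 * c0 + 2) * A n ^ r"] by simp_all
 qed
 have sfge: "k0 \<le> sf n" "1 \<le> sf n" for n
 proof -
  have "Bn n \<le> Bn n ^ m" using Bge(3)[of n] m1 by (simp add: self_le_power)
  then show "k0 \<le> sf n" "1 \<le> sf n" using Bge(2,3)[of n] unfolding sfB by simp_all
 qed
 \<comment> \<open>The number of combined instances, \<open>sf n ^ r\<close>, is a polynomial in
   their length \<open>n\<close>, as \<open>or_distillation\<close> requires.\<close>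
 define P where "P = Sp ^ r"
 have PN: "poly P n = sf n ^ r" for n by (simp add: P_def sf_def poly_power)
 let ?cls = "%n. or_cls M n (U n) (T n) r (sf n)"
 let ?fs = "%xs. or_fs r (length (hd xs)) (sf (length (hd xs))) xs"
 define inst where "inst = (%xs :: bool list list. (mk_graph (inner (?cls (length (hd xs)))) (outer (?fs xs)) (edges (?cls (length (hd xs))) (?fs xs)),
  length (inner (?cls (length (hd xs))))))"
 define g where "g = (%xs. enc_param (f (inst xs)))"
 have kbound: "length (inner (?cls n)) \<le> sf n * A n" for n
 proof -
  have en: "esz n \<le> 2 * (n + 1)" by simp
  have "length (concat (tab M n (U n) (T n))) \<le> K * esz n ^ d" by (rule le_trans[OF length_concat_esz K])
  also have "\<dots> \<le> K * (2 * (n + 1)) ^ d" using en by (intro mult_le_mono2 power_mono) simp_all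
  also have "\<dots> = K * 2 ^ d * (n + 1) ^ d" by (simp only: power_mult_distrib ac_simps)
  also have "\<dots> \<le> K * 2 ^ d * (n + 1) ^ (d + 1)" by (intro mult_le_mono2 power_increasing) simp_all
  finally have t: "length (concat (tab M n (U n) (T n))) \<le> K * 2 ^ d * (n + 1) ^ (d + 1)" .
  define D where "D = (n + 1) ^ (d + 1)"
  have D1: "1 \<le> D" unfolding D_def by (rule one_le_power) simp
  have "n \<le> n + 1" by simp
  also have "\<dots> \<le> D" unfolding D_def using power_increasing[of 1 "d + 1" "n + 1"] by simp
  finally have nD: "n \<le> D" .
  have s1: "1 \<le> sf n" by (rule sfge)
  have l: "length (concat (?cls n)) \<le> sf n * ((K * 2 ^ d + r + 6) * D)"
  proof -
   have "K * 2 ^ d * D \<le> sf n * (K * 2 ^ d * D)" "r * sf n \<le> sf n * (r * D)" "6 * n * sf n \<le> sf n * (6 * D)"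
    using s1 D1 nD by simp_all
   then have "length (concat (?cls n)) \<le> sf n * (K * 2 ^ d * D) + sf n * (r * D) + sf n * (6 * D)"
    unfolding length_or_cls by (intro add_mono le_trans[OF t[folded D_def]])
   also have "\<dots> = sf n * ((K * 2 ^ d + r + 6) * D)" by (simp add: algebra_simps)
   finally show ?thesis .
  qed
  have "length (inner (?cls n)) \<le> q + (5 + 2 * r) * length (concat (?cls n))"
   using length_inner[of "?cls n"] by (simp add: algebra_simps)
  also have "\<dots> \<le> sf n * (q * D) + (5 + 2 * r) * (sf n * ((K * 2 ^ d + r + 6) * D))"
  proof (rule add_mono)
   have "q * 1 * 1 \<le> q * sf n * D" using s1 D1 by (intro mult_le_mono) simp_all
   then show "q \<le> sf n * (q * D)" by (simp add: ac_simps)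
   show "(5 + 2 * r) * length (concat (?cls n)) \<le> (5 + 2 * r) * (sf n * ((K * 2 ^ d + r + 6) * D))" by (rule mult_le_mono2[OF l])
  qed
  also have "\<dots> = sf n * A n" unfolding A_def c1_def D_def[symmetric] by (simp add: algebra_simps)
  finally show ?thesis .
 qed
 show ?thesis
 proof (rule or_distillation[of g P "enc_param ` Q'"])
  have sfp: "pt (%v. sf (a v))" if "pt a" for a :: "bool list list => nat" unfolding sf_def by (intro pt_intros that)
  have np: "pt (%xs :: bool list list. length (hd xs))" by (intro pt_intros)
  have sp: "pt (%xs :: bool list list. sf (length (hd xs)))" by (rule sfp[OF np])
  have clp: "pt (%xs :: bool list list. ?cls (length (hd xs)))"
  proof -
   have "pt (%xs :: bool list list. tab M (length (hd xs)) (U (length (hd xs))) (T (length (hd xs))))"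
    by (rule pt_comp[OF ptn np])
   moreover have "pt (%xs :: bool list list. sel_cls r (sf (length (hd xs))))"
    unfolding sel_cls_def by (intro pt_intros pt_comp[OF sp])
   moreover have "pt (%xs :: bool list list. z_cls (Suc (T (length (hd xs)))) (length (hd xs)) (sf (length (hd xs))))"
    unfolding z_cls_def T_def U_def One_nat_def by (intro pt_intros sp)
   ultimately show ?thesis unfolding or_cls_def by (intro pt_append)
  qed
  have fsp: "pt ?fs" unfolding or_fs_def or_tuple_def One_nat_def by (intro pt_intros sp)
  have ip: "pt (%xs. enc_param (inst xs))"
   unfolding inst_def enc_param_def case_prod_conv enc_unary_def
   by (intro pt_enc_pair pt_mk_graph pt_replicate pt_length pt_const pt_inner pt_outer pt_edges clp fsp)
  have "poly_time_via enc_param enc_param f" using comp by (simp add: is_compression_def)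
  from pt_of_poly_time[OF this ip] show "pt g" unfolding g_def .
 next
  fix xs :: "bool list list" and n assume len: "length xs = poly P n" and n: "\<forall>x\<in>set xs. length x = n"
  have "0 < sf n" using sfge(2)[of n] by linarith
  then have "0 < length xs" unfolding len PN by (rule zero_less_power)
  then have "xs \<noteq> []" by simp
  then have hn: "length (hd xs) = n" using n by simp
  have ls: "length xs = sf n ^ r" using len PN by simp
  have fsok: "length tu = r & set tu \<subseteq> set (vars (?cls n))" if "tu \<in> set (or_fs r n (sf n) xs)" for tu
   by (rule or_fs_ok[OF r ls that])
  have i: "inst xs = (mk_graph (inner (?cls n)) (outer (or_fs r n (sf n) xs)) (edges (?cls n) (or_fs r n (sf n) xs)), length (inner (?cls n)))"
   unfolding inst_def hn ..
  have "inst xs \<in> coloring_problem q t \<longleftrightarrow> (\<exists>\<beta>. sat (?cls n) (or_fs r n (sf n) xs) \<beta>)"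
   unfolding i by (rule graph_colorable[OF fsok or_cls_nonempty[OF sfge(2)]])
  also have "\<dots> \<longleftrightarrow> (\<exists>x\<in>set xs. \<exists>u. length u \<le> U n & acc_run M (T n) x u)"
   by (rule or_sat[OF M r ls]) (use n in blast)
  also have "\<dots> \<longleftrightarrow> (\<exists>x\<in>set xs. x \<in> L)" using acc n unfolding Lx U_def by fastforce
  finally have eq: "inst xs \<in> coloring_problem q t \<longleftrightarrow> (\<exists>x\<in>set xs. x \<in> L)" .
  have "g xs \<in> enc_param ` Q' \<longleftrightarrow> f (inst xs) \<in> Q'" unfolding g_def using enc_param_inj by blast
  also have "\<dots> \<longleftrightarrow> inst xs \<in> coloring_problem q t" using comp unfolding is_compression_def by (cases "inst xs") simp
  finally show "g xs \<in> enc_param ` Q' \<longleftrightarrow> (\<exists>x\<in>set xs. x \<in> L)" using eq by blast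
  define k where "k = length (inner (?cls n))"
  have "length (fst (f (inst xs))) + snd (f (inst xs)) \<le> h k"
   using comp unfolding is_compression_def i k_def by blast
  moreover have "length (g xs) = 2 * length (fst (f (inst xs))) + 1 + snd (f (inst xs))"
   unfolding g_def enc_param_def enc_pair_def enc_unary_def by (simp add: split_beta length_enc_bits)
  ultimately have gl: "length (g xs) \<le> 2 * h k + 1" by simp
  have kk: "k0 \<le> k" using sfge(1)[of n] length_inner_ge[OF r, of "sf n" M n "U n" "T n"] unfolding k_def by simp
  have "2 * h k + 1 < sf n ^ r"
  proof (rule size_choice[OF sfB m1 m2 e'(3) r _ Bge(1)])
   show "1 \<le> A n" by (rule A1)
   show "k \<le> sf n * A n" unfolding k_def by (rule kbound)
   show "real (h k) \<le> real c0 * real k powr (real r - \<epsilon>')" by (rule hk[OF kk])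
  qed
  then show "length (g xs) < poly P n" using gl PN by simp
 qed
qed

end

theorem coloring_compression_lower_bound:
 assumes q: "q \<ge> 3" "1 \<le> t" "t \<le> q" and NP: "\<not> NP \<subseteq> coNP_poly" and "\<epsilon> > 0"
  and h: "(%k. real (h k)) \<in> O(%k. real k powr (real (r_exp q t) - \<epsilon>))"
 shows "\<not> admits_compression (coloring_problem q t) h"
proof
 assume "admits_compression (coloring_problem q t) h"
 then obtain Q' f where c: "is_compression (coloring_problem q t) Q' h f" unfolding admits_compression_def by blast
 obtain tc ac T F B nb where "gadget q t (r_exp q t) tc ac T F B nb" using gadget_exists[OF q] by blast
 then interpret gadget q t "r_exp q t" tc ac T F B nb .
 have r: "1 \<le> r_exp q t" using r_exp_ge(1)[OF q] q(1) by linarith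
 have "L \<in> coNP_poly" if "L \<in> NP" for L
  by (rule compression_lower_bound[OF r that c h \<open>\<epsilon> > 0\<close>])
 then show False using NP by blast
qed

section \<open>Violated cliques as low-degree functions\<close>

text \<open>The Levi-Civita symbol of a word of colours.\<close>

definition psgn :: "nat => nat list => int" where
 "psgn q v = (if length v = q & distinct v & set v \<subseteq> {..<q} then sign (%i. if i < q then v ! i else i) else 0)"

lemma psgn_permutes:
 assumes "length v = q" "distinct v" "set v \<subseteq> {..<q}"
 shows "(%i. if i < q then v ! i else i) permutes {..<q}"
proof (rule bij_imp_permutes)
 have inj: "inj_on (%i. if i < q then v ! i else i) {..<q}"
  using assms by (auto simp: inj_on_def nth_eq_iff_index_eq)
 have "(%i. if i < q then v ! i else i) ` {..<q} \<subseteq> {..<q}" using assms nth_mem by fastforce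
 from endo_inj_surj[OF finite_lessThan this inj]
 show "bij_betw (%i. if i < q then v ! i else i) {..<q} {..<q}" unfolding bij_betw_def using inj by blast
qed simp

lemma psgn_values: "psgn q v \<in> {-1, 0, 1}" "psgn q v \<noteq> 0 \<longleftrightarrow> length v = q & distinct v & set v \<subseteq> {..<q}"
 by (auto simp: psgn_def sign_def)

text \<open>As positions \<open>a\<close> and \<open>b\<close> carry the same letter, the two words
  differ by the transposition of these positions.\<close>

lemma psgn_swap:
 assumes ab: "a < q" "b < q" "a \<noteq> b" and v: "length v = q" "v ! a = v ! b"
 shows "psgn q (v[a := 0]) = - psgn q (v[b := 0])"
proof -
 let ?\<tau> = "Transposition.transpose a b"
 have sw: "v[b := 0] ! i = v[a := 0] ! ?\<tau> i" if "i < q" for i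
  using that ab v by (auto simp: transpose_def nth_list_update)
 have sw': "v[a := 0] ! i = v[b := 0] ! ?\<tau> i" if "i < q" for i
  using that ab v by (auto simp: transpose_def nth_list_update)
 have tl: "?\<tau> i < q" if "i < q" for i using that ab by (auto simp: transpose_def)
 have dist: "distinct (v[b := 0]) & set (v[b := 0]) \<subseteq> {..<q} \<longleftrightarrow> distinct (v[a := 0]) & set (v[a := 0]) \<subseteq> {..<q}"
 proof -
  have *: "mset (v[a := 0]) = mset (v[b := 0])"
   using v ab by (simp add: mset_update)
  then have "distinct (v[b := 0]) = distinct (v[a := 0])" by (rule mset_eq_imp_distinct_iff[symmetric])
  moreover have "set (v[b := 0]) = set (v[a := 0])" using * by (rule mset_eq_setD[symmetric])
  ultimately show ?thesis by simp
 qed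
 show ?thesis
 proof (cases "distinct (v[a := 0]) & set (v[a := 0]) \<subseteq> {..<q}")
  case False
  then show ?thesis using dist unfolding psgn_def by auto
 next
  case True
  let ?f = "%i. if i < q then v[a := 0] ! i else i" and ?g = "%i. if i < q then v[b := 0] ! i else i"
  have "?g = ?f \<circ> ?\<tau>"
  proof
   fix i
   show "?g i = (?f \<circ> ?\<tau>) i"
   proof (cases "i < q")
    case True then show ?thesis using sw[OF True] tl[OF True] by simp
   next
    case False
    then have "?\<tau> i = i" using ab by (auto simp: transpose_def)
    then show ?thesis using False by simp
   qed
  qed
  moreover have "permutation ?f" using psgn_permutes[of "v[a := 0]" q] True v permutation_permutes[of ?f] by auto
  moreover have "permutation ?\<tau>" by (rule permutation_swap_id)
  ultimately have "sign ?g = sign ?f * sign ?\<tau>" by (simp add: sign_compose)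
  then have "sign ?g = - sign ?f" using ab by (simp add: sign_swap_id)
  then show ?thesis using True dist v unfolding psgn_def by simp
 qed
qed

text \<open>A word of length \<open>q\<close> over \<open>q - 1\<close> letters repeats a letter.
  Only replacing one of two equal letters by 0 can produce a permutation, and the two results
  cancel. This identity is the source of the lowered degree.\<close>

lemma psgn_zero_sum:
 assumes v: "length v = q" "set v \<subseteq> {1..<q}"
 shows "(\<Sum>i<q. psgn q (v[i := 0])) = 0"
proof (cases "q = 0")
 case False
 have "\<not> distinct v"
 proof
  assume "distinct v"
  then have "card (set v) = q" using v(1) by (simp add: distinct_card)
  moreover have "card (set v) \<le> card {1..<q}" by (rule card_mono[OF _ v(2)]) simp
  ultimately show False using False by simp
 qed
 then obtain a b where ab: "a < q" "b < q" "a \<noteq> b" "v ! a = v ! b" using v(1) by (auto simp: distinct_conv_nth)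
 have z: "psgn q (v[i := 0]) = 0" if "i \<noteq> a" "i \<noteq> b" for i
 proof -
  have "v[i := 0] ! a = v[i := 0] ! b" using that ab v by simp
  then have "\<not> distinct (v[i := 0])" using ab v by (metis length_list_update nth_eq_iff_index_eq)
  then show ?thesis by (simp add: psgn_def)
 qed
 have "(\<Sum>i<q. psgn q (v[i := 0])) = (\<Sum>i\<in>{a, b}. psgn q (v[i := 0]))"
  by (rule sum.mono_neutral_right) (use ab z in auto)
 also have "\<dots> = 0" using psgn_swap[OF ab(1-3) v(1) ab(4)] ab(3) by simp
 finally show ?thesis .
qed simp

section \<open>Mixed differences\<close>

definition zr :: "(nat => nat) => nat set => nat => nat" where
 "zr c T = (%x. if x \<in> T then 0 else c x)"

text \<open>With \<open>T\<close> as the set of coordinates put to 0, this is the mixed difference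
  in the coordinates \<open>Y\<close>; functions of degree below \<open>card Y\<close> are
  annihilated by it.\<close>

definition alt :: "nat set => (nat set => int) => int" where
 "alt Y f = (\<Sum>T\<in>Pow Y. (-1) ^ card T * f T)"

lemma alt_irrelevant:
 assumes "finite Y" "y \<in> Y" "\<And>T. T \<subseteq> Y - {y} ==> f (insert y T) = f T"
 shows "alt Y f = 0"
proof -
 let ?Y = "Y - {y}"
 have Y: "Y = insert y ?Y" using assms(2) by blast
 have fin: "finite ?Y" using assms(1) by simp
 have "alt Y f = (\<Sum>T\<in>Pow ?Y. (-1) ^ card T * f T) + (\<Sum>T\<in>insert y ` Pow ?Y. (-1) ^ card T * f T)"
  unfolding alt_def by (subst Y, subst Pow_insert, rule sum.union_disjoint) (use fin in auto)
 also have "(\<Sum>T\<in>insert y ` Pow ?Y. (-1) ^ card T * f T) = (\<Sum>T\<in>Pow ?Y. (-1) ^ card (insert y T) * f (insert y T))"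
  by (subst sum.reindex) (auto simp: inj_on_def)
 also have "\<dots> = (\<Sum>T\<in>Pow ?Y. - ((-1) ^ card T * f T))"
 proof (rule sum.cong[OF refl])
  fix T assume T: "T \<in> Pow ?Y"
  then have "y \<notin> T" "finite T" using fin finite_subset by auto
  then show "(-1) ^ card (insert y T) * f (insert y T) = - ((-1) ^ card T * f T)" using assms(3)[of T] T by simp
 qed
 finally show ?thesis by (simp add: sum_negf)
qed

text \<open>Two coordinates put to 0 would repeat a letter, so only sets \<open>T\<close> with at
  most one element contribute: the empty set if \<open>e\<close> already supplies the letter 0, the
  singletons if the letter is still missing.\<close>

lemma alt_psgn:
 assumes x: "distinct x" and c: "\<And>y. y \<in> set x ==> c y \<noteq> 0"
 shows "0 \<in> set e ==> alt (set x) (%T. psgn q (map (zr c T) x @ e)) = psgn q (map c x @ e)"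
  "0 \<notin> set e ==> 0 < q ==> alt (set x) (%T. psgn q (map (zr c T) x @ e)) = - (\<Sum>i<length x. psgn q ((map c x)[i := 0] @ e))"
proof -
 have m0: "map (zr c {}) x = map c x" by (simp add: zr_def)
 {
  assume e: "0 \<in> set e"
  have "psgn q (map (zr c T) x @ e) = 0" if T: "T \<subseteq> set x" "T \<noteq> {}" for T
  proof -
   obtain y where "y \<in> T" "y \<in> set x" using T by blast
   then have "0 \<in> set (map (zr c T) x)" by (force simp: zr_def)
   then have "\<not> distinct (map (zr c T) x @ e)" using e by auto
   then show ?thesis using psgn_values(2)[of q "map (zr c T) x @ e"] by blast
  qed
  then have "alt (set x) (%T. psgn q (map (zr c T) x @ e)) = (\<Sum>T\<in>{{}}. (-1) ^ card T * psgn q (map (zr c T) x @ e))"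
   unfolding alt_def by (intro sum.mono_neutral_right) auto
  then show "alt (set x) (%T. psgn q (map (zr c T) x @ e)) = psgn q (map c x @ e)" by (simp add: m0)
 }
 assume e: "0 \<notin> set e" and q: "0 < q"
 have z: "psgn q (map (zr c T) x @ e) = 0" if T: "T \<subseteq> set x" "T \<notin> (%y. {y}) ` set x" for T
 proof (cases "T = {}")
  case True
  have "0 \<notin> set (map c x)" using c by force
  with True have "0 \<notin> set (map (zr c T) x @ e)" using e m0 by simp
  moreover have "0 \<in> set w" if "psgn q w \<noteq> 0" for w
  proof -
   have "length w = q" "distinct w" "set w \<subseteq> {..<q}" using psgn_values(2)[of q w] that by blast+
   then have "set w = {..<q}" by (intro card_subset_eq) (simp_all add: distinct_card)
   then show ?thesis using q by simp
  qed
  ultimately show ?thesis by blast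
 next
  case False
  then obtain y where y: "y \<in> T" by blast
  obtain y' where y': "y' \<in> T" "y' \<noteq> y" using T y by blast
  obtain i j where ij: "i < length x" "x ! i = y" "j < length x" "x ! j = y'" using T y y' by (metis in_set_conv_nth subsetD)
  then have "i \<noteq> j" using y' by blast
  moreover have "(map (zr c T) x @ e) ! i = (map (zr c T) x @ e) ! j" using ij y y' by (simp add: nth_append zr_def)
  ultimately have "\<not> distinct (map (zr c T) x @ e)" using ij unfolding distinct_conv_nth by (metis length_append length_map trans_less_add1)
  then show ?thesis using psgn_values(2)[of q "map (zr c T) x @ e"] by blast
 qed
 have "alt (set x) (%T. psgn q (map (zr c T) x @ e)) = (\<Sum>T\<in>(%y. {y}) ` set x. (-1) ^ card T * psgn q (map (zr c T) x @ e))"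
  unfolding alt_def by (rule sum.mono_neutral_right) (use z in auto)
 also have "\<dots> = (\<Sum>y\<in>set x. - psgn q (map (zr c {y}) x @ e))"
  by (subst sum.reindex) (simp_all add: inj_on_def)
 also have "\<dots> = (\<Sum>i<length x. - psgn q (map (zr c {x ! i}) x @ e))"
  by (rule sum.reindex_bij_betw[symmetric]) (use x in \<open>auto simp: bij_betw_nth\<close>)
 also have "\<dots> = (\<Sum>i<length x. - psgn q ((map c x)[i := 0] @ e))"
 proof (rule sum.cong[OF refl])
  fix i assume i: "i \<in> {..<length x}"
  have "map (zr c {x ! i}) x = (map c x)[i := 0]"
   by (rule nth_equalityI) (use i x in \<open>auto simp: zr_def nth_list_update nth_eq_iff_index_eq\<close>)
  then show "- psgn q (map (zr c {x ! i}) x @ e) = - psgn q ((map c x)[i := 0] @ e)" by simp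
 qed
 finally show "alt (set x) (%T. psgn q (map (zr c T) x @ e)) = - (\<Sum>i<length x. psgn q ((map c x)[i := 0] @ e))"
  by (simp add: sum_negf)
qed

text \<open>
 The function that is nonzero modulo a prime divisor of \<open>q\<close> iff all lists of colours are injective
 with the same range. The signs lower its degree by one for one or two lists.
\<close>

definition viol :: "nat list list => bool" where
 "viol D \<longleftrightarrow> (\<forall>j<length D. distinct (D ! j) & set (D ! j) = set (D ! 0))"

definition vf :: "nat => nat list list => int" where
 "vf q D = (if length D = 1 then psgn q (D ! 0)
  else if length D = 2 then (\<Sum>a<q. psgn q (D ! 0 @ [a]) * psgn q (D ! 1 @ [a]))
  else if viol D then 1 else 0)"

definition colors_ok :: "nat => nat list list => bool" where
 "colors_ok q D \<longleftrightarrow> 1 \<le> length D & length D \<le> q & (\<forall>d\<in>set D. length d = q + 1 - length D & set d \<subseteq> {..<q})"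

text \<open>\<open>vf\<close> takes only the values -1, 0 and 1, and these are 0 or units modulo
  every prime. For two lists, a summand is nonzero only if \<open>a\<close> is the one colour
  missing from both, so at most one summand survives.\<close>

lemma vf_viol:
 assumes D: "colors_ok q D" and p: "prime (p::nat)"
 shows "int p dvd vf q D \<longleftrightarrow> \<not> viol D"
proof -
 have unit: "int p dvd z \<longleftrightarrow> z = 0" if "z \<in> {-1, 0, 1}" for z
  using that p by (auto simp: prime_nat_iff zdvd1_eq)
 consider "length D = 1" | "length D = 2" | "2 < length D" using D unfolding colors_ok_def by linarith
 then show ?thesis
 proof cases
  case 1
  then have d: "length (D ! 0) = q" "set (D ! 0) \<subseteq> {..<q}" using D unfolding colors_ok_def by auto
  have "vf q D = psgn q (D ! 0)" using 1 by (simp add: vf_def)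
  moreover have "viol D \<longleftrightarrow> distinct (D ! 0)" using 1 by (simp add: viol_def)
  ultimately show ?thesis using unit[OF psgn_values(1)] psgn_values(2)[of q "D ! 0"] d by auto
 next
  case 2
  then have d: "length (D ! 0) = q - 1" "set (D ! 0) \<subseteq> {..<q}" "length (D ! 1) = q - 1" "set (D ! 1) \<subseteq> {..<q}" and q: "2 \<le> q"
   using D unfolding colors_ok_def by auto
  have v: "viol D \<longleftrightarrow> distinct (D ! 0) & distinct (D ! 1) & set (D ! 1) = set (D ! 0)"
   unfolding viol_def 2 all_less_2 by blast
  have nz: "psgn q (D ! 0 @ [a]) * psgn q (D ! 1 @ [a]) \<noteq> 0 \<longleftrightarrow> distinct (D ! 0) & distinct (D ! 1) & a \<notin> set (D ! 0) & a \<notin> set (D ! 1)" if "a < q" for a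
   using psgn_values(2)[of q "D ! 0 @ [a]"] psgn_values(2)[of q "D ! 1 @ [a]"] d q that by auto
  have vf: "vf q D = (\<Sum>a<q. psgn q (D ! 0 @ [a]) * psgn q (D ! 1 @ [a]))" using 2 by (simp add: vf_def)
  have compl: "{..<q} - set d = {a}" if "distinct d" "length d = q - 1" "set d \<subseteq> {..<q}" "a < q" "a \<notin> set d" for d a
  proof -
   have "card ({..<q} - set d) = 1" using that q by (simp add: card_Diff_subset distinct_card)
   then show ?thesis using that by (metis DiffI card_1_singletonE lessThan_iff singletonD)
  qed
  show ?thesis
  proof (cases "viol D")
   case True
   then have dd: "distinct (D ! 0)" "distinct (D ! 1)" "set (D ! 1) = set (D ! 0)" using v by blast+
   have "card (set (D ! 0)) < card {..<q}" using d q dd by (simp add: distinct_card)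
   then have "\<not> {..<q} \<subseteq> set (D ! 0)" using card_mono[of "set (D ! 0)" "{..<q}"] by auto
   then obtain a where a: "a < q" "a \<notin> set (D ! 0)" by blast
   have "(\<Sum>b<q. psgn q (D ! 0 @ [b]) * psgn q (D ! 1 @ [b])) = (\<Sum>b\<in>{a}. psgn q (D ! 0 @ [b]) * psgn q (D ! 1 @ [b]))"
   proof (rule sum.mono_neutral_right)
    show "\<forall>b\<in>{..<q} - {a}. psgn q (D ! 0 @ [b]) * psgn q (D ! 1 @ [b]) = 0"
    proof
     fix b assume b: "b \<in> {..<q} - {a}"
     then have "b \<in> set (D ! 0)" using compl[OF dd(1) d(1,2) a] by blast
     then show "psgn q (D ! 0 @ [b]) * psgn q (D ! 1 @ [b]) = 0" using nz[of b] b by blast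
    qed
   qed (use a in auto)
   then have "vf q D = psgn q (D ! 0 @ [a]) * psgn q (D ! 1 @ [a])" by (simp add: vf)
   moreover have "psgn q (D ! 0 @ [a]) * psgn q (D ! 1 @ [a]) \<noteq> 0" using nz[OF a(1)] dd a(2) by simp
   moreover have "psgn q (D ! 0 @ [a]) * psgn q (D ! 1 @ [a]) \<in> {-1, 0, 1}"
    using psgn_values(1)[of q "D ! 0 @ [a]"] psgn_values(1)[of q "D ! 1 @ [a]"] by auto
   ultimately show ?thesis using unit True by auto
  next
   case False
   have z0: "psgn q (D ! 0 @ [a]) * psgn q (D ! 1 @ [a]) = 0" if a: "a < q" for a
   proof (rule ccontr)
    assume "psgn q (D ! 0 @ [a]) * psgn q (D ! 1 @ [a]) \<noteq> 0"
    then have dd: "distinct (D ! 0)" "distinct (D ! 1)" "a \<notin> set (D ! 0)" "a \<notin> set (D ! 1)" using nz[OF a] by blast+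
    have "{..<q} - set (D ! 0) = {..<q} - set (D ! 1)" using compl[OF dd(1) d(1,2) a dd(3)] compl[OF dd(2) d(3,4) a dd(4)] by simp
    then have "set (D ! 1) = set (D ! 0)" using d by blast
    then show False using False v dd by blast
   qed
   have "vf q D = 0" unfolding vf by (intro sum.neutral ballI) (use z0 in \<open>simp only: lessThan_iff\<close>)
   then show ?thesis using False by simp
  qed
 next
  case 3
  then have "vf q D = (if viol D then 1 else 0)" by (simp add: vf_def)
  then show ?thesis using unit[of 1] by simp
 qed
qed

definition W_ok :: "nat => nat => nat => nat list list => bool" where
 "W_ok q t k W \<longleftrightarrow> 1 \<le> length W & length W \<le> t & (\<forall>w\<in>set W. length w = q + 1 - length W & set w \<subseteq> {..<k})"

text \<open>A coordinate of \<open>Y\<close> outside \<open>W\<close> is irrelevant and kills the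
  difference. Otherwise counting leaves only cliques of one or two vertices whose coordinates are
  distinct and make up exactly \<open>Y\<close>. One list gives 0 by \<open>psgn_zero_sum\<close>;
  for two lists the difference factors, and the sum over the colour \<open>a\<close> has
  \<open>q\<close> equal terms.\<close>

lemma vf_degree:
 assumes q: "q \<ge> 3" "1 \<le> t" "t \<le> q" and W: "W_ok q t k W" and Y: "finite Y" "card Y = r_exp q t + 1"
  and c: "\<And>y. y \<in> Y ==> c y \<noteq> 0" "\<And>y. c y < q"
 shows "int q dvd alt Y (%T. vf q (map (map (zr c T)) W))"
proof (cases "Y \<subseteq> \<Union>(set ` set W)")
 case False
 then obtain y where y: "y \<in> Y" "\<And>w. w \<in> set W ==> y \<notin> set w" by blast
 have e: "map (map (zr c (insert y T))) W = map (map (zr c T)) W" for T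
  using y(2) by (auto simp: zr_def)
 have "alt Y (%T. vf q (map (map (zr c T)) W)) = 0"
  by (rule alt_irrelevant[OF Y(1) y(1)]) (simp only: e)
 then show ?thesis by simp
next
 case True
 let ?s = "length W"
 have s: "1 \<le> ?s" "?s \<le> t" and w: "\<And>w. w \<in> set W ==> length w = q + 1 - ?s" using W unfolding W_ok_def by auto
 have fin: "finite (\<Union>(set ` set W))" by simp
 have cW: "card (\<Union>(set ` set W)) \<le> ?s * (q + 1 - ?s)"
 proof -
  have "card (\<Union>(set ` set W)) \<le> (\<Sum>w\<in>set W. card (set w))" by (rule card_UN_le) simp
  also have "\<dots> \<le> (\<Sum>w\<in>set W. q + 1 - ?s)"
  proof (rule sum_mono)
   fix v assume "v \<in> set W"
   then show "card (set v) \<le> q + 1 - ?s" using card_length[of v] w[of v] by simp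
  qed
  also have "\<dots> \<le> ?s * (q + 1 - ?s)" using card_length[of W] by (simp add: mult_le_mono1)
  finally show ?thesis .
 qed
 have cY: "r_exp q t + 1 \<le> card (\<Union>(set ` set W))" using card_mono[OF fin True] Y(2) by simp
 consider "?s = 1" | "?s = 2" | "3 \<le> ?s" using s by linarith
 then show ?thesis
 proof cases
  case 3
  then have "?s * (q + 1 - ?s) \<le> r_exp q t" by (intro r_exp_ge(3)[OF q] s)
  then show ?thesis using cW cY by simp
 next
  case 1
  then obtain x where x: "W = [x]" by (cases W) auto
  have lx: "length x = q" using w[of x] x by simp
  have "q \<le> card (set x)" using cY r_exp_ge(1)[OF q] q x by simp
  then have dx: "distinct x" using lx card_length[of x] by (intro card_distinct) simp
  then have "card (set x) = q" using lx by (simp add: distinct_card)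
  then have Yx: "Y = set x" using True x Y cY r_exp_ge(1)[OF q] q by (intro card_subset_eq) auto
  have "alt Y (%T. vf q (map (map (zr c T)) W)) = alt (set x) (%T. psgn q (map (zr c T) x @ []))"
   unfolding Yx x by (simp add: vf_def)
  also have "\<dots> = - (\<Sum>i<length x. psgn q ((map c x)[i := 0] @ []))"
   by (rule alt_psgn(2)[OF dx]) (use c Yx q in auto)
  also have "\<dots> = 0"
  proof -
   have "set (map c x) \<subseteq> {1..<q}" using c Yx by (auto simp: Suc_le_eq)
   then show ?thesis using psgn_zero_sum[of "map c x" q] lx by simp
  qed
  finally show ?thesis by simp
 next
  case 2
  then obtain x y where xy: "W = [x, y]" by (cases W; cases "tl W") auto
  have l: "length x = q - 1" "length y = q - 1" using w[of x] w[of y] xy by simp_all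
  have U: "\<Union>(set ` set W) = set x \<union> set y" using xy by auto
  have r: "2 * q - 3 \<le> r_exp q t" using r_exp_ge(2)[OF q] s 2 by simp
  have cu: "2 * q - 2 \<le> card (set x \<union> set y)" using cY r q unfolding U by linarith
  have "card (set x) \<le> q - 1" "card (set y) \<le> q - 1" using l card_length by metis+
  moreover have "card (set x \<union> set y) + card (set x \<inter> set y) = card (set x) + card (set y)" by (rule card_Un_Int[symmetric]) simp_all
  ultimately have cs: "card (set x) = q - 1" "card (set y) = q - 1" "card (set x \<inter> set y) = 0" using cu q by linarith+
  then have d: "distinct x" "distinct y" "set x \<inter> set y = {}" using l by (auto intro: card_distinct)
  have Yxy: "Y = set x \<union> set y" using True Y cY r cs d q unfolding U
   by (intro card_subset_eq) (simp_all add: card_Un_disjoint)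
  define \<beta> where "\<beta> = (%z a. alt (set z) (%T. psgn q (map (zr c T) z @ [a])))"
  \<comment> \<open>The difference does not depend on \<open>a\<close>: for \<open>a = 0\<close>
    only the empty set contributes, and for other \<open>a\<close> the singletons sum to the same
    value by \<open>psgn_zero_sum\<close> applied to \<open>map c z @ [a]\<close>. Independence of
    \<open>a\<close> makes the final sum a multiple of \<open>q\<close>.\<close>
  have b0: "\<beta> z a = psgn q (map c z @ [0])" if z: "z \<in> {x, y}" and a: "a < q" for z a
  proof -
   have dz: "distinct z" "length z = q - 1" "set z \<subseteq> Y" using z d l Yxy by auto
   have cz: "c u \<noteq> 0" if "u \<in> set z" for u using that dz c by auto
   show ?thesis
   proof (cases "a = 0")
    case True then show ?thesis unfolding \<beta>_def using alt_psgn(1)[where c = c and x = z and e = "[a]" and q = q, OF dz(1) cz] by simp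
   next
    case False
    have q1: "q = Suc (q - 1)" using q by simp
    let ?v = "map c z @ [a]"
    have "set (map c z) \<subseteq> {1..<q}" using cz c(2) by (auto simp: Suc_le_eq)
    then have "set ?v \<subseteq> {1..<q}" using False a by simp
    then have "(\<Sum>i<q. psgn q (?v[i := 0])) = 0" using dz q by (intro psgn_zero_sum) simp_all
    then have "(\<Sum>i<q - 1. psgn q (?v[i := 0])) + psgn q (?v[q - 1 := 0]) = 0" by (subst (asm) q1) simp
    moreover have "?v[q - 1 := 0] = map c z @ [0]" using dz(2) by (simp add: list_update_append)
    moreover have "(\<Sum>i<q - 1. psgn q (?v[i := 0])) = (\<Sum>i<length z. psgn q ((map c z)[i := 0] @ [a]))"
     by (rule sum.cong) (use dz in \<open>auto simp: list_update_append\<close>)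
    ultimately show ?thesis unfolding \<beta>_def using alt_psgn(2)[where c = c and x = z and e = "[a]" and q = q, OF dz(1) cz] False q by simp
   qed
  qed
  \<comment> \<open>Over disjoint sets of coordinates the mixed difference of a product is the
    product of the differences.\<close>
  have sp: "alt (set x \<union> set y) (%T. f (T \<inter> set x) * g (T \<inter> set y)) = alt (set x) f * alt (set y) g" for f g :: "nat set => int"
  proof -
   have bij: "bij_betw (%(A, B). A \<union> B) (Pow (set x) \<times> Pow (set y)) (Pow (set x \<union> set y))"
    by (rule bij_betwI[where g = "%T. (T \<inter> set x, T \<inter> set y)"]) (use d(3) in auto)
   have "alt (set x \<union> set y) (%T. f (T \<inter> set x) * g (T \<inter> set y))
    = (\<Sum>(A, B)\<in>Pow (set x) \<times> Pow (set y). (-1) ^ card (A \<union> B) * (f ((A \<union> B) \<inter> set x) * g ((A \<union> B) \<inter> set y)))"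
    unfolding alt_def using sum.reindex_bij_betw[OF bij, of "%T. (-1) ^ card T * (f (T \<inter> set x) * g (T \<inter> set y))"] by (simp add: split_beta)
   also have "\<dots> = (\<Sum>(A, B)\<in>Pow (set x) \<times> Pow (set y). ((-1) ^ card A * f A) * ((-1) ^ card B * g B))"
   proof (rule sum.cong[OF refl], clarify)
    fix A B assume AB: "A \<subseteq> set x" "B \<subseteq> set y"
    then have "(A \<union> B) \<inter> set x = A" "(A \<union> B) \<inter> set y = B" "A \<inter> B = {}" using d(3) by auto
    moreover have "finite A" "finite B" using AB finite_subset by auto
    ultimately show "(-1) ^ card (A \<union> B) * (f ((A \<union> B) \<inter> set x) * g ((A \<union> B) \<inter> set y)) = ((-1) ^ card A * f A) * ((-1) ^ card B * g B)"
     by (simp add: card_Un_disjoint power_add)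
   qed
   finally show ?thesis unfolding alt_def by (simp add: sum_product sum.cartesian_product)
  qed
  have "alt Y (%T. vf q (map (map (zr c T)) W)) = alt (set x \<union> set y) (%T. \<Sum>a<q. psgn q (map (zr c (T \<inter> set x)) x @ [a]) * psgn q (map (zr c (T \<inter> set y)) y @ [a]))"
  proof -
   have "vf q (map (map (zr c T)) W) = (\<Sum>a<q. psgn q (map (zr c (T \<inter> set x)) x @ [a]) * psgn q (map (zr c (T \<inter> set y)) y @ [a]))" for T
   proof -
    have "map (zr c T) z = map (zr c (T \<inter> set z)) z" for z by (simp add: zr_def)
    note m = this[of x] this[of y]
    have "vf q (map (map (zr c T)) W) = (\<Sum>a<q. psgn q (map (zr c T) x @ [a]) * psgn q (map (zr c T) y @ [a]))"
     unfolding xy vf_def by simp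
    then show ?thesis unfolding m .
   qed
   then show ?thesis unfolding Yxy by simp
  qed
  also have "\<dots> = (\<Sum>a<q. alt (set x \<union> set y) (%T. psgn q (map (zr c (T \<inter> set x)) x @ [a]) * psgn q (map (zr c (T \<inter> set y)) y @ [a])))"
   unfolding alt_def sum_distrib_left by (rule sum.swap)
  also have "\<dots> = (\<Sum>a<q. \<beta> x a * \<beta> y a)" unfolding sp[of "%A. psgn q (map (zr c A) x @ [_])" "%A. psgn q (map (zr c A) y @ [_])"] \<beta>_def ..
  also have "\<dots> = (\<Sum>a<q. psgn q (map c x @ [0]) * psgn q (map c y @ [0]))"
   by (rule sum.cong[OF refl]) (use b0 in auto)
  also have "\<dots> = int q * (psgn q (map c x @ [0]) * psgn q (map c y @ [0]))" by simp
  finally show ?thesis by simp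
 qed
qed

section \<open>Reconstruction from points of low weight\<close>

definition look :: "(nat \<times> nat) list => nat => nat" where
 "look c x = hd (map snd (filter (%e. fst e = x) c) @ [0])"

lemma look_zip: "look (zip ys (map f ys)) x = (if x \<in> set ys then f x else 0)"
 by (induction ys) (auto simp: look_def)

text \<open>Association lists for the colourings that are nonzero on at most \<open>r\<close>
  coordinates; unlisted coordinates have colour 0. Repetitions among them are harmless.\<close>

definition points :: "nat => nat => nat => (nat \<times> nat) list list" where
 "points q r k = concat (map (%ys. map (%cs. zip ys cs) (List.n_lists r [0..<q])) (List.n_lists r [0..<k]))"

lemma length_points: "length (points q r k) = (k * q) ^ r"
 by (simp add: points_def length_concat length_n_lists comp_def sum_list_triv power_mult_distrib)

lemma points_mem:
 assumes "length ys = r" "set ys \<subseteq> {..<k}" "\<And>y. c y < q"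
 shows "zip ys (map c ys) \<in> set (points q r k)"
proof -
 have "ys \<in> set (List.n_lists r [0..<k])" "map c ys \<in> set (List.n_lists r [0..<q])" using assms by (auto simp: set_n_lists)
 then show ?thesis unfolding points_def mem_concat_map mem_map by blast
qed

text \<open>
 Modulo a divisor of \<open>q\<close>, the alternating sum over a set \<open>Y\<close> of \<open>r + 1\<close> nonzero coordinates
 vanishes, so the value at \<open>c\<close> is a combination of values at points of smaller weight.
\<close>

lemma low_weight_reconstruction:
 fixes c :: "nat => nat"
 assumes q: "q \<ge> 3" "1 \<le> t" "t \<le> q" and p: "p dvd q" and c: "\<And>x. c x < q"
 shows "\<exists>l :: nat => int. \<forall>W. W_ok q t k W -->
  int p dvd vf q (map (map c) W) - (\<Sum>j<length (points q (r_exp q t) k). l j * vf q (map (map (look (points q (r_exp q t) k ! j))) W))"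
 using c
proof (induction "card {x. x < k & c x \<noteq> 0}" arbitrary: c rule: less_induct)
 case (less c)
 let ?r = "r_exp q t" and ?S = "{x. x < k & c x \<noteq> 0}"
 let ?P = "points q ?r k"
 have finS: "finite ?S" by simp
 consider "k = 0" | "0 < k" "card ?S \<le> ?r" | "?r < card ?S" by linarith
 then show ?case
 proof cases
  case 1
  have "\<not> W_ok q t k W" for W
  proof
   assume W: "W_ok q t k W"
   then obtain w where w: "w \<in> set W" unfolding W_ok_def by (cases W) auto
   then have "length w = q + 1 - length W" "set w = {}" "length W \<le> q" using W 1 q unfolding W_ok_def by auto
   then show False by simp
  qed
  then show ?thesis by blast
 next
  case 2
  \<comment> \<open>Padding to length \<open>r\<close> with vertex 0, which exists as
    \<open>0 < k\<close>; repeated entries agree because all values are taken from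
    \<open>c\<close>.\<close>
  define ys where "ys = sorted_list_of_set ?S @ replicate (?r - card ?S) 0"
  have ys: "length ys = ?r" "set ys \<subseteq> {..<k}" "?S \<subseteq> set ys" using 2 unfolding ys_def by (auto split: if_splits)
  have "zip ys (map c ys) \<in> set ?P" by (rule points_mem) (use ys less.prems in auto)
  then obtain i where i: "i < length ?P" "?P ! i = zip ys (map c ys)" by (metis in_set_conv_nth)
  have "int p dvd vf q (map (map c) W) - (\<Sum>j<length ?P. (if j = i then 1 else 0) * vf q (map (map (look (?P ! j))) W))"
   if W: "W_ok q t k W" for W
  proof -
   have "(\<Sum>j<length ?P. (if j = i then 1 else 0) * vf q (map (map (look (?P ! j))) W)) = (\<Sum>j<length ?P. if j = i then vf q (map (map (look (?P ! j))) W) else 0)"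
    by (rule sum.cong) auto
   also have "\<dots> = vf q (map (map (look (?P ! i))) W)" using i by simp
   also have "map (map (look (?P ! i))) W = map (map c) W"
   proof -
    have "look (?P ! i) x = c x" if "w \<in> set W" "x \<in> set w" for w x
    proof -
     have "x < k" using W that unfolding W_ok_def by auto
     then show ?thesis using ys(3) unfolding i(2) look_zip by auto
    qed
    then show ?thesis by simp
   qed
   finally show ?thesis by simp
  qed
  then show ?thesis by (intro exI[of _ "%j. if j = i then 1 else 0"]) blast
 next
  case 3
  then have "?r + 1 \<le> card ?S" by simp
  then obtain Y where Y: "Y \<subseteq> ?S" "card Y = ?r + 1" "finite Y" by (rule obtain_subset_with_card_n)
  let ?T = "Pow Y - {{}}"
  have "\<forall>T\<in>?T. \<exists>l. \<forall>W. W_ok q t k W --> int p dvd vf q (map (map (zr c T)) W) - (\<Sum>j<length ?P. l j * vf q (map (map (look (?P ! j))) W))"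
  proof
   fix T assume T: "T \<in> ?T"
   then obtain y where y: "y \<in> T" "y \<in> ?S" using Y by blast
   have "{x. x < k & zr c T x \<noteq> 0} \<subset> ?S" using y by (auto simp: zr_def)
   then have lt: "card {x. x < k & zr c T x \<noteq> 0} < card ?S" by (rule psubset_card_mono[OF finS])
   have "zr c T x < q" for x using less.prems[of x] by (simp add: zr_def)
   then show "\<exists>l. \<forall>W. W_ok q t k W --> int p dvd vf q (map (map (zr c T)) W) - (\<Sum>j<length ?P. l j * vf q (map (map (look (?P ! j))) W))"
    by (rule less.hyps[OF lt])
  qed
  then obtain l where l: "\<And>T W. T \<in> ?T ==> W_ok q t k W ==> int p dvd vf q (map (map (zr c T)) W) - (\<Sum>j<length ?P. l T j * vf q (map (map (look (?P ! j))) W))"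
   unfolding bchoice_iff by blast
  \<comment> \<open>The alternating sum is solved for the term of the empty set. The coefficients
    are the same for every \<open>W\<close>, which makes evaluation at \<open>c\<close> a functional
    on vectors of values.\<close>
  define m where "m = (%j. - (\<Sum>T\<in>?T. (-1) ^ card T * l T j))"
  have "int p dvd vf q (map (map c) W) - (\<Sum>j<length ?P. m j * vf q (map (map (look (?P ! j))) W))" if W: "W_ok q t k W" for W
  proof -
   define v where "v = (%j. vf q (map (map (look (?P ! j))) W))"
   have "int q dvd alt Y (%T. vf q (map (map (zr c T)) W))"
    by (rule vf_degree[OF q W Y(3,2)]) (use Y less.prems in auto)
   then have a: "int p dvd alt Y (%T. vf q (map (map (zr c T)) W))" using p by (meson dvd_trans int_dvd_int_iff)
   have "alt Y (%T. vf q (map (map (zr c T)) W)) = (-1) ^ card ({}::nat set) * vf q (map (map (zr c {})) W) + (\<Sum>T\<in>?T. (-1) ^ card T * vf q (map (map (zr c T)) W))"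
    unfolding alt_def by (rule sum.remove) (use Y in auto)
   moreover have "zr c {} = c" by (simp add: zr_def)
   ultimately have e1: "vf q (map (map c) W) = alt Y (%T. vf q (map (map (zr c T)) W)) - (\<Sum>T\<in>?T. (-1) ^ card T * vf q (map (map (zr c T)) W))" by simp
   have "(\<Sum>j<length ?P. m j * v j) = - (\<Sum>j<length ?P. \<Sum>T\<in>?T. (-1) ^ card T * (l T j * v j))"
    unfolding m_def by (simp add: sum_distrib_right sum_negf mult.assoc)
   also have "(\<Sum>j<length ?P. \<Sum>T\<in>?T. (-1) ^ card T * (l T j * v j)) = (\<Sum>T\<in>?T. (-1) ^ card T * (\<Sum>j<length ?P. l T j * v j))"
    unfolding sum_distrib_left by (rule sum.swap)
   finally have "vf q (map (map c) W) - (\<Sum>j<length ?P. m j * v j) = alt Y (%T. vf q (map (map (zr c T)) W)) - (\<Sum>T\<in>?T. (-1) ^ card T * (vf q (map (map (zr c T)) W) - (\<Sum>j<length ?P. l T j * v j)))"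
    unfolding e1 by (simp only: right_diff_distrib sum_subtractf)
   moreover have "int p dvd (\<Sum>T\<in>?T. (-1) ^ card T * (vf q (map (map (zr c T)) W) - (\<Sum>j<length ?P. l T j * v j)))"
    by (intro dvd_sum dvd_mult) (use l W in \<open>simp add: v_def\<close>)
   ultimately show ?thesis using a unfolding v_def by (simp only: dvd_diff)
  qed
  then show ?thesis by blast
 qed
qed

section \<open>Gaussian elimination\<close>

text \<open>Cross-multiplied elimination, which needs no inverses modulo \<open>p\<close>;
  \<open>p - nthd w i\<close> plays the role of a negative entry.\<close>

definition comb :: "nat => nat => nat list => nat list => nat list" where
 "comb p i v w = map (%e. (nthd v i * snd e + (p - nthd w i) * fst e) mod p) (zip v w)"

definition pvs :: "nat => 'a list => nat list list => ('a \<times> nat list) list" where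
 "pvs i Ws vs = filter (%e. nthd (snd e) i \<noteq> 0) (zip Ws vs)"

text \<open>The pivot row is combined with itself as well and becomes 0 modulo \<open>p\<close>, so
  no row has to be singled out; its label is recorded.\<close>

definition estep :: "nat => 'a list => nat => nat list list \<times> 'a list => nat list list \<times> 'a list" where
 "estep p Ws i s = (if pvs i Ws (fst s) = [] then s
  else (map (%w. comb p i (snd (hd (pvs i Ws (fst s)))) w) (fst s), fst (hd (pvs i Ws (fst s))) # snd s))"

definition lin :: "nat => (nat => int) => nat list => int" where
 "lin N l v = (\<Sum>j<N. l j * int (v ! j))"

lemma comb_nth:
 assumes "i < length v" "length w = length v" "j < length v"
 shows "comb p i v w ! j = (v ! i * w ! j + (p - w ! i) * v ! j) mod p"
 using assms by (simp add: comb_def nthd_nth)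

lemma lin_comb:
 assumes "i < N" "length v = N" "length w = N" "w ! i \<le> p"
 shows "int p dvd lin N l (comb p i v w) - (int (v ! i) * lin N l w - int (w ! i) * lin N l v)"
proof -
 have "lin N l (comb p i v w) - (int (v ! i) * lin N l w - int (w ! i) * lin N l v)
  = (\<Sum>j<N. l j * int (comb p i v w ! j) - (int (v ! i) * (l j * int (w ! j)) - int (w ! i) * (l j * int (v ! j))))"
  unfolding lin_def by (simp add: sum_subtractf sum_distrib_left)
 also have "int p dvd \<dots>"
 proof (rule dvd_sum)
  fix j assume j: "j \<in> {..<N}"
  let ?A = "v ! i * w ! j + (p - w ! i) * v ! j"
  have im: "int (m mod p) = int m - int p * int (m div p)" for m
   using arg_cong[OF mult_div_mod_eq[of p m], of int] unfolding of_nat_add of_nat_mult by linarith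
  have ring: "C = a * w + (P - b) * v - P * m ==> L * C - (a * (L * w) - b * (L * v)) = P * (L * (v - m))" for C a w P b v m L :: int
   by (erule ssubst) (simp add: algebra_simps)
  have "int (comb p i v w ! j) = int (?A mod p)" using assms j comb_nth[of i v w j p] by simp
  also have "\<dots> = int ?A - int p * int (?A div p)" by (rule im)
  also have "int ?A = int (v ! i) * int (w ! j) + (int p - int (w ! i)) * int (v ! j)" using assms(4) by (simp add: of_nat_diff)
  finally have "int (comb p i v w ! j) = int (v ! i) * int (w ! j) + (int p - int (w ! i)) * int (v ! j) - int p * int (?A div p)" .
  from ring[OF this, of "l j"] show "int p dvd l j * int (comb p i v w ! j) - (int (v ! i) * (l j * int (w ! j)) - int (w ! i) * (l j * int (v ! j)))"
   by (simp only: dvd_triv_left)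
 qed
 finally show ?thesis .
qed

text \<open>Spanning in dual form: instead of coefficients, the last clause follows the functionals
  \<open>l\<close> that vanish on the recorded original rows. The recorded rows need no linear
  independence, only their number is bounded.\<close>

definition elim_inv :: "nat => nat => 'a list => nat list list => nat => nat list list \<times> 'a list => bool" where
 "elim_inv p N Ws us i s \<longleftrightarrow> length (fst s) = length Ws &
  (\<forall>v\<in>set (fst s). length v = N & (\<forall>a\<in>set v. a < p) & (\<forall>j<i. v ! j = 0)) &
  length (snd s) \<le> i & set (snd s) \<subseteq> set Ws &
  (\<forall>l. (\<forall>a<length Ws. Ws ! a \<in> set (snd s) --> int p dvd lin N l (us ! a)) -->
   (\<forall>a<length Ws. int p dvd lin N l (fst s ! a) \<longleftrightarrow> int p dvd lin N l (us ! a)))"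

lemma dvd_iff_of_dvd_diff: "(P::int) dvd x - (y - z) ==> P dvd z ==> P dvd x \<longleftrightarrow> P dvd y"
proof -
 assume "P dvd x - (y - z)" "P dvd z"
 then have "P dvd (x - (y - z)) - z" by (rule dvd_diff)
 then have "P dvd x - y" by simp
 then have "x mod P = y mod P" by (simp add: mod_eq_dvd_iff)
 then show ?thesis by (simp add: dvd_eq_mod_eq_0)
qed

lemma elim_inv_step:
 assumes p: "prime p" and I: "elim_inv p N Ws us i s" and i: "i < N"
 shows "elim_inv p N Ws us (Suc i) (estep p Ws i s)"
proof -
 obtain vs B where s: "s = (vs, B)" by (cases s)
 have len: "length vs = length Ws" and B: "length B \<le> i" "set B \<subseteq> set Ws"
  and row: "\<And>v. v \<in> set vs ==> length v = N" "\<And>v a. v \<in> set vs ==> a \<in> set v ==> a < p" "\<And>v j. v \<in> set vs ==> j < i ==> v ! j = 0"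
  and ann: "\<And>l a. (\<And>b. b < length Ws ==> Ws ! b \<in> set B ==> int p dvd lin N l (us ! b)) ==> a < length Ws ==> int p dvd lin N l (vs ! a) \<longleftrightarrow> int p dvd lin N l (us ! a)"
  using I unfolding elim_inv_def s by auto
 have p0: "0 < p" using p by (simp add: prime_gt_0_nat)
 have rowi: "v ! i < p" if "v \<in> set vs" for v using row(1,2)[OF that] i by (metis nth_mem)
 show ?thesis
 proof (cases "pvs i Ws vs = []")
  case True
  have z: "v ! i = 0" if v: "v \<in> set vs" for v
  proof (rule ccontr)
   assume nz: "v ! i \<noteq> 0"
   obtain a where a: "a < length vs" "v = vs ! a" using v by (metis in_set_conv_nth)
   then have "(Ws ! a, v) \<in> set (zip Ws vs)" using len by (auto simp: set_zip)
   then have "(Ws ! a, v) \<in> set (pvs i Ws vs)" using nz row(1)[OF v] i by (simp add: pvs_def nthd_nth)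
   then show False using True by simp
  qed
  have "estep p Ws i s = s" using True by (simp add: estep_def s)
  moreover have "v ! j = 0" if "v \<in> set vs" "j < Suc i" for v j using z[OF that(1)] row(3)[OF that(1)] that(2) by (cases "j = i") auto
  ultimately show ?thesis using I unfolding elim_inv_def s by simp
 next
  case False
  then obtain W v where h: "hd (pvs i Ws vs) = (W, v)" "(W, v) \<in> set (pvs i Ws vs)" by (metis hd_in_set surj_pair)
  then have zz: "(W, v) \<in> set (zip Ws vs)" and nz0: "nthd v i \<noteq> 0" by (auto simp: pvs_def)
  then obtain a0 where a0: "a0 < length Ws" "W = Ws ! a0" "v = vs ! a0" using len by (auto simp: set_zip)
  have v: "v \<in> set vs" using a0 len by simp
  have lv: "length v = N" by (rule row(1)[OF v])
  have nz: "v ! i \<noteq> 0" using nz0 lv i by (simp add: nthd_nth)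
  \<comment> \<open>The pivot entry is nonzero and below the prime \<open>p\<close>, so multiplying
    by it neither creates nor destroys zeros modulo \<open>p\<close>.\<close>
  have npv: "\<not> int p dvd int (v ! i)" using nz rowi[OF v] by (simp add: nat_dvd_not_less)
  have e: "estep p Ws i s = (map (comb p i v) vs, W # B)" using False h(1) by (simp add: estep_def s)
  have R: "length w' = N & (\<forall>a\<in>set w'. a < p) & (\<forall>j<Suc i. w' ! j = 0)" if w': "w' \<in> set (map (comb p i v) vs)" for w'
  proof -
   obtain w where w: "w \<in> set vs" "w' = comb p i v w" using w' by auto
   have lw: "length w = N" by (rule row(1)[OF w(1)])
   have "length w' = N" unfolding w comb_def using lv lw by simp
   moreover have "\<forall>a\<in>set w'. a < p" unfolding w comb_def using p0 by auto
   moreover have "w' ! j = 0" if j: "j < Suc i" for j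
   proof -
    have n: "w' ! j = (v ! i * w ! j + (p - w ! i) * v ! j) mod p" unfolding w(2) using lv lw i j by (intro comb_nth) simp_all
    show ?thesis
    proof (cases "j = i")
     case True
     have "v ! i * w ! i + (p - w ! i) * v ! i = p * v ! i" using rowi[OF w(1)] by (simp add: add_mult_distrib2[symmetric] mult.commute)
     then show ?thesis using n True by simp
    next
     case False
     then show ?thesis using n row(3)[OF w(1), of j] row(3)[OF v, of j] j by simp
    qed
   qed
   ultimately show ?thesis by blast
  qed
  have A: "int p dvd lin N l (map (comb p i v) vs ! a) \<longleftrightarrow> int p dvd lin N l (us ! a)"
   if l: "\<And>b. b < length Ws ==> Ws ! b \<in> set (W # B) ==> int p dvd lin N l (us ! b)" and a: "a < length Ws" for l a
  proof -
   have o: "int p dvd lin N l (vs ! b) \<longleftrightarrow> int p dvd lin N l (us ! b)" if "b < length Ws" for b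
    by (rule ann) (use l that in auto)
   have "int p dvd lin N l (us ! a0)" by (rule l) (use a0 in auto)
   then have d0: "int p dvd lin N l v" using o[OF a0(1)] a0(3) by blast
   have w: "vs ! a \<in> set vs" using a len by simp
   have "int p dvd lin N l (comb p i v (vs ! a)) - (int (v ! i) * lin N l (vs ! a) - int (vs ! a ! i) * lin N l v)"
    by (rule lin_comb[OF i lv row(1)[OF w]]) (use rowi[OF w] in simp)
   moreover have "int p dvd int (vs ! a ! i) * lin N l v" using d0 by simp
   ultimately have "int p dvd lin N l (comb p i v (vs ! a)) \<longleftrightarrow> int p dvd int (v ! i) * lin N l (vs ! a)"
    by (rule dvd_iff_of_dvd_diff)
   also have "\<dots> \<longleftrightarrow> int p dvd lin N l (vs ! a)" using npv p by (simp add: prime_dvd_mult_iff)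
   finally show ?thesis using o[OF a] a len by simp
  qed
  have "W \<in> set Ws" using a0 by simp
  then have B': "length (W # B) \<le> Suc i" "set (W # B) \<subseteq> set Ws" using B by simp_all
  have A': "\<forall>l. (\<forall>a<length Ws. Ws ! a \<in> set (W # B) --> int p dvd lin N l (us ! a)) -->
   (\<forall>a<length Ws. int p dvd lin N l (map (comb p i v) vs ! a) \<longleftrightarrow> int p dvd lin N l (us ! a))"
   using A by blast
  have "length (map (comb p i v) vs) = length Ws" using len by simp
  then show ?thesis unfolding e elim_inv_def fst_conv snd_conv using R B' A' by blast
 qed
qed

definition elim :: "nat => nat => 'a list => nat list list => 'a list" where
 "elim p N Ws vs = snd (fold (estep p Ws) [0..<N] (vs, []))"

text \<open>After \<open>N\<close> columns every row is zero, so a functional that vanishes on the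
  selected original rows vanishes on all of them.\<close>

lemma elim_correct:
 assumes p: "prime p" and us: "length us = length Ws" "\<forall>v\<in>set us. length v = N & (\<forall>a\<in>set v. a < p)"
 shows "length (elim p N Ws us) \<le> N" "set (elim p N Ws us) \<subseteq> set Ws"
  "\<And>l a. (\<And>b. b < length Ws ==> Ws ! b \<in> set (elim p N Ws us) ==> int p dvd lin N l (us ! b)) ==> a < length Ws ==> int p dvd lin N l (us ! a)"
proof -
 have "elim_inv p N Ws us i (fold (estep p Ws) [0..<i] (us, []))" if "i \<le> N" for i
  using that
 proof (induction i)
  case 0
  then show ?case using us unfolding elim_inv_def by simp
 next
  case (Suc i)
  then show ?case using elim_inv_step[OF p, of N Ws us i] by simp
 qed
 from this[of N] have I: "elim_inv p N Ws us N (fold (estep p Ws) [0..<N] (us, []))" by simp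
 then show "length (elim p N Ws us) \<le> N" "set (elim p N Ws us) \<subseteq> set Ws" unfolding elim_inv_def elim_def by blast+
 fix l a
 assume l: "\<And>b. b < length Ws ==> Ws ! b \<in> set (elim p N Ws us) ==> int p dvd lin N l (us ! b)" and a: "a < length Ws"
 let ?v = "fst (fold (estep p Ws) [0..<N] (us, [])) ! a"
 have "?v \<in> set (fst (fold (estep p Ws) [0..<N] (us, [])))" using I a unfolding elim_inv_def by (intro nth_mem) simp
 then have "\<forall>j<N. ?v ! j = 0" using I unfolding elim_inv_def by blast
 then have "lin N l ?v = 0" unfolding lin_def by simp
 moreover have "int p dvd lin N l ?v \<longleftrightarrow> int p dvd lin N l (us ! a)" using I l a unfolding elim_inv_def elim_def by blast
 ultimately show "int p dvd lin N l (us ! a)" by simp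
qed

section \<open>Elimination in polynomial time\<close>

lemma pt_mod: fixes p :: nat assumes "pt f" and p: "0 < p" shows "pt (%v. f v mod p)"
proof -
 have *: "fold (%a s. if Suc s = p then 0 else Suc s) [0..<n] 0 = n mod p" for n
  using p by (induction n) (auto simp: mod_Suc)
 have "pt (%v. fold (%a s. if Suc s = p then 0 else Suc s) [0..<f v] 0)"
 proof (rule pt_fold_add[where H = "%p. 2"])
  show "bnd (%p::'a \<times> nat. 2)" by (intro bnd_intros)
 qed (intro pt_intros assms | simp)+
 then show ?thesis by (simp add: *)
qed

lemma esz_list_le: "(\<And>a. a \<in> set xs ==> esz a \<le> e) ==> esz xs \<le> Suc (length xs * Suc e)"
proof (induction xs)
 case (Cons a xs)
 have "esz a \<le> e" "esz xs \<le> Suc (length xs * Suc e)" using Cons by auto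
 then show ?case by simp
qed simp

lemma esz_nat: "esz (n::nat) = Suc (2 * n)" by (induction n) auto

text \<open>Entries are either those of the input or at most \<open>p\<close>, so all intermediate
  matrices obey one polynomial bound.\<close>

lemma pt_elim:
 fixes Ws :: "'x::codable => 'a::codable list"
 assumes p: "0 < p" and N: "pt N" and Ws: "pt Ws" and vs: "pt vs"
 shows "pt (%x. elim p (N x) (Ws x) (vs x))"
proof -
 let ?C = "%x. esz (vs x) + 2 * p + 1"
 have F: "pt (%u. estep p (Ws (fst u)) (fst (snd u)) (snd (snd u)))"
  unfolding estep_def pvs_def comb_def by (intro pt_intros pt_mod p pt_comp[OF Ws])
 have inv: "length (fst (fold (estep p (Ws x)) l (vs x, []))) = length (vs x) &
  (\<forall>v\<in>set (fst (fold (estep p (Ws x)) l (vs x, []))). length v \<le> esz (vs x) & (\<forall>a\<in>set v. esz a \<le> ?C x)) &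
  length (snd (fold (estep p (Ws x)) l (vs x, []))) \<le> length l &
  set (snd (fold (estep p (Ws x)) l (vs x, []))) \<subseteq> set (Ws x)" (is "?I l") for x l
 proof (induction l rule: rev_induct)
  case Nil
  have "length v \<le> esz (vs x) & (\<forall>a\<in>set v. esz a \<le> ?C x)" if v: "v \<in> set (vs x)" for v
  proof -
   have "esz v < esz (vs x)" by (rule esz_mem[OF v])
   moreover have "length v < esz v" by (rule esz_length)
   moreover have "esz a < esz v" if "a \<in> set v" for a by (rule esz_mem[OF that])
   ultimately show ?thesis by fastforce
  qed
  then show ?case by simp
 next
  case (snoc i l)
  obtain us B where s: "fold (estep p (Ws x)) l (vs x, []) = (us, B)" by (metis surj_pair)
  show ?case
  proof (cases "pvs i (Ws x) us = []")
   case True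
   then have "fold (estep p (Ws x)) (l @ [i]) (vs x, []) = (us, B)" by (simp add: s estep_def)
   then show ?thesis using snoc unfolding s by simp
  next
   case False
   obtain W v where h: "hd (pvs i (Ws x) us) = (W, v)" by (metis surj_pair)
   with False have "(W, v) \<in> set (pvs i (Ws x) us)" by (metis hd_in_set)
   then have m: "W \<in> set (Ws x)" "v \<in> set us" unfolding pvs_def by (auto dest: set_zip_leftD set_zip_rightD)
   have "length (comb p i v w) \<le> esz (vs x) & (\<forall>a\<in>set (comb p i v w). esz a \<le> ?C x)" for w
   proof -
    have "length v \<le> esz (vs x)" using snoc m unfolding s by simp
    moreover have "length (comb p i v w) \<le> length v" by (simp add: comb_def)
    moreover have "esz a \<le> ?C x" if a: "a \<in> set (comb p i v w)" for a
    proof -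
     have "a \<le> p" using a p by (auto simp: comb_def intro: less_imp_le)
     then show ?thesis by simp
    qed
    ultimately show ?thesis by (meson le_trans)
   qed
   note c = this
   have "fold (estep p (Ws x)) (l @ [i]) (vs x, []) = (map (comb p i v) us, W # B)" using False by (simp add: s estep_def h)
   then show ?thesis using snoc m c unfolding s by auto
  qed
 qed
 have "pt (%x. fold (estep p (Ws x)) [0..<N x] (vs x, []))"
 proof (rule pt_fold[OF F])
  let ?B = "%x. Suc (Suc (esz (vs x) * Suc (Suc (esz (vs x) * Suc (?C x)))) + Suc (N x * Suc (esz (Ws x))))"
  show "bnd ?B"
  proof (intro bnd_intros pt_bnd vs Ws)
   show "bnd N" by (rule bnd_mono[OF pt_bnd[OF N]]) (simp add: esz_nat)
  qed
  show "pt (%x. [0..<N x])" by (intro pt_intros N)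
  show "pt (%x. (vs x, [] :: 'a list))" by (intro pt_intros vs)
  fix x l1 l2 assume l: "[0..<N x] = l1 @ l2"
  obtain us B where s: "fold (estep p (Ws x)) l1 (vs x, []) = (us, B)" by (metis surj_pair)
  have i: "length us = length (vs x)" "\<And>v. v \<in> set us ==> length v \<le> esz (vs x)" "\<And>v a. v \<in> set us ==> a \<in> set v ==> esz a \<le> ?C x"
   "length B \<le> length l1" "set B \<subseteq> set (Ws x)" using inv[of x l1] unfolding s by auto
  have "esz v \<le> Suc (esz (vs x) * Suc (?C x))" if v: "v \<in> set us" for v
  proof -
   have "esz v \<le> Suc (length v * Suc (?C x))" by (rule esz_list_le) (rule i(3)[OF v])
   also have "\<dots> \<le> Suc (esz (vs x) * Suc (?C x))" using i(2)[OF v] by (intro Suc_le_mono[THEN iffD2] mult_le_mono1)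
   finally show ?thesis .
  qed
  then have "esz us \<le> Suc (length us * Suc (Suc (esz (vs x) * Suc (?C x))))" by (rule esz_list_le)
  also have "\<dots> \<le> Suc (esz (vs x) * Suc (Suc (esz (vs x) * Suc (?C x))))"
   using esz_length[of "vs x"] i(1) by (intro Suc_le_mono[THEN iffD2] mult_le_mono1) simp
  finally have 1: "esz us \<le> Suc (esz (vs x) * Suc (Suc (esz (vs x) * Suc (?C x))))" .
  have "esz W \<le> esz (Ws x)" if "W \<in> set B" for W using esz_mem[of W "Ws x"] that i(5) by auto
  then have "esz B \<le> Suc (length B * Suc (esz (Ws x)))" by (rule esz_list_le)
  also have "\<dots> \<le> Suc (N x * Suc (esz (Ws x)))"
  proof -
   have "length l1 \<le> N x" using arg_cong[OF l, of length] by simp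
   then show ?thesis using i(4) by (intro Suc_le_mono[THEN iffD2] mult_le_mono1) simp
  qed
  finally show "esz (fold (estep p (Ws x)) l1 (vs x, [])) \<le> ?B x" unfolding s using 1 by simp
 qed
 then show ?thesis unfolding elim_def by (rule pt_snd)
qed

text \<open>A constraint is represented by its values of \<open>vf\<close> at the points of low
  weight. Modulo \<open>p\<close>, evaluation at any colouring \<open>c\<close> is a functional on
  these vectors, so if \<open>c\<close> violates no selected constraint, the functional vanishes on
  all vectors and \<open>c\<close> violates none at all.\<close>

lemma violation_basis:
 assumes q: "q \<ge> 3" "1 \<le> t" "t \<le> q"
 shows "\<exists>bf :: nat \<times> nat list list list => nat list list list. pt bf &
  (\<forall>k Ws. set (bf (k, Ws)) \<subseteq> set Ws & length (bf (k, Ws)) \<le> (k * q) ^ r_exp q t &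
   ((\<forall>W\<in>set Ws. W_ok q t k W) --> (\<forall>c W. (\<forall>x. c x < q) & W \<in> set Ws & viol (map (map c) W) -->
    (\<exists>B\<in>set (bf (k, Ws)). viol (map (map c) B)))))"
proof -
 \<comment> \<open>The reconstruction works modulo any divisor of \<open>q\<close>; primality is for
   the elimination and for detecting violations.\<close>
 obtain p :: nat where p: "prime p" "p dvd q" using q prime_factor_nat[of q] by auto
 have p0: "0 < p" using p by (simp add: prime_gt_0_nat)
 let ?r = "r_exp q t"
 let ?A = "{d. set d \<subseteq> {..<q} & length d \<le> q}"
 have fin: "finite {D. set D \<subseteq> ?A & length D \<le> q}" by (intro finite_lists_length_le) simp
 obtain g0 where g0: "pt g0" "\<forall>D\<in>{D. set D \<subseteq> ?A & length D \<le> q}. g0 D = nat (vf q D mod int p)"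
  using pt_finite[OF fin, of "%D. nat (vf q D mod int p)"] by blast
 \<comment> \<open>The outer \<open>mod p\<close> keeps entries below \<open>p\<close> even outside
   the table, where \<open>g0\<close> is arbitrary; the bound on the size must hold for every list
   \<open>Ws\<close>.\<close>
 define g where "g = (%D. g0 D mod p)"
 have g: "pt g" unfolding g_def by (intro pt_mod g0 p0)
 define vec where "vec = (%k W. map (%c. g (map (%w. map (%x. look c x) w) W)) (points q ?r k))"
 define bf where "bf = (%a. elim p ((fst a * q) ^ ?r) (snd a) (map (%W. vec (fst a) W) (snd a)))"
 have ptbf: "pt bf" unfolding bf_def vec_def look_def points_def
  by (intro pt_elim p0 pt_intros pt_comp[OF g])
 have correct: "set (bf (k, Ws)) \<subseteq> set Ws & length (bf (k, Ws)) \<le> (k * q) ^ ?r &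
   ((\<forall>W\<in>set Ws. W_ok q t k W) --> (\<forall>c W. (\<forall>x. c x < q) & W \<in> set Ws & viol (map (map c) W) -->
    (\<exists>B\<in>set (bf (k, Ws)). viol (map (map c) B))))" for k Ws
 proof -
  let ?N = "(k * q) ^ ?r" and ?us = "map (vec k) Ws"
  have bfe: "bf (k, Ws) = elim p ?N Ws ?us" by (simp add: bf_def)
  have us: "length ?us = length Ws" "\<forall>v\<in>set ?us. length v = ?N & (\<forall>a\<in>set v. a < p)"
   using p0 by (auto simp: vec_def length_points g_def)
  note ec = elim_correct[OF p(1) us]
  have "\<exists>B\<in>set (bf (k, Ws)). viol (map (map c) B)"
   if ok: "\<forall>W\<in>set Ws. W_ok q t k W" and c: "\<forall>x. c x < q" and W: "W \<in> set Ws" "viol (map (map c) W)" for c W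
  proof (rule ccontr)
   assume no: "\<not> (\<exists>B\<in>set (bf (k, Ws)). viol (map (map c) B))"
   have co: "colors_ok q (map (map d) V)" if "\<And>x. d x < q" "W_ok q t k V" for d V
    using that q unfolding colors_ok_def W_ok_def by auto
   obtain l :: "nat => int" where l: "\<And>V. W_ok q t k V ==> int p dvd vf q (map (map c) V) - (\<Sum>j<length (points q ?r k). l j * vf q (map (map (look (points q ?r k ! j))) V))"
    using low_weight_reconstruction[OF q p(2), of c k] c by blast
   have lk: "look (points q ?r k ! j) x < q" if j: "j < ?N" for j x
   proof -
    have "points q ?r k ! j \<in> set (points q ?r k)" using j by (simp add: length_points)
    then obtain ys cs where z: "points q ?r k ! j = zip ys cs" "cs \<in> set (List.n_lists ?r [0..<q])"
     unfolding points_def mem_concat_map mem_map by blast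
    then have "set cs \<subseteq> {..<q}" by (auto simp: set_n_lists)
    then have "snd e < q" if "e \<in> set (points q ?r k ! j)" for e using that z(1) by (cases e) (auto dest: set_zip_rightD)
    then have "set (map snd (filter (%e. fst e = x) (points q ?r k ! j)) @ [0]) \<subseteq> {..<q}" using q by auto
    moreover have "hd L \<in> set L" if "L \<noteq> []" for L :: "nat list" using that by simp
    ultimately show ?thesis unfolding look_def by (metis append_is_Nil_conv lessThan_iff not_Cons_self2 subsetD)
   qed
   \<comment> \<open>Modulo \<open>p\<close>, the value at \<open>c\<close> is the functional
     \<open>l\<close> applied to the vector of \<open>V\<close>, with \<open>l\<close> independent
     of \<open>V\<close>.\<close>
   have key: "int p dvd vf q (map (map c) V) \<longleftrightarrow> int p dvd lin ?N l (vec k V)" if V: "W_ok q t k V" for V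
   proof -
    have "int p dvd l j * vf q (map (map (look (points q ?r k ! j))) V) - l j * int (vec k V ! j)" if j: "j < ?N" for j
    proof -
     let ?D = "map (map (look (points q ?r k ! j))) V"
     have D: "?D \<in> {D. set D \<subseteq> ?A & length D \<le> q}" using lk[OF j] V q unfolding W_ok_def by auto
     have "vec k V ! j = g ?D" using j by (simp add: vec_def length_points)
     also have "\<dots> = nat (vf q ?D mod int p)"
     proof -
      have "g0 ?D = nat (vf q ?D mod int p)" using g0(2) D by blast
      moreover have "nat (vf q ?D mod int p) < p" using p0 by (simp add: nat_less_iff)
      ultimately show ?thesis by (simp add: g_def)
     qed
     finally have "int (vec k V ! j) = vf q ?D mod int p" using p0 by simp
     then have "int p dvd vf q ?D - int (vec k V ! j)" by (simp add: mod_eq_dvd_iff[symmetric])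
     then show ?thesis by (metis dvd_mult right_diff_distrib)
    qed
    then have "int p dvd (\<Sum>j<?N. l j * vf q (map (map (look (points q ?r k ! j))) V) - l j * int (vec k V ! j))"
     by (intro dvd_sum) simp
    then have 1: "int p dvd (\<Sum>j<?N. l j * vf q (map (map (look (points q ?r k ! j))) V)) - lin ?N l (vec k V)"
     unfolding lin_def by (simp only: sum_subtractf)
    have "int p dvd vf q (map (map c) V) - (\<Sum>j<?N. l j * vf q (map (map (look (points q ?r k ! j))) V))"
     using l[OF V] unfolding length_points .
    from dvd_add[OF this 1] have "int p dvd vf q (map (map c) V) - lin ?N l (vec k V)" by simp
    then show ?thesis by (metis diff_add_cancel dvd_add_right_iff)
   qed
   have kill: "int p dvd lin ?N l (?us ! b)" if b: "b < length Ws" "Ws ! b \<in> set (elim p ?N Ws ?us)" for b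
   proof -
    have V: "W_ok q t k (Ws ! b)" using ok b by simp
    have "\<not> viol (map (map c) (Ws ! b))" using no b bfe by auto
    then have "int p dvd vf q (map (map c) (Ws ! b))" using vf_viol[OF co[of c, OF _ V] p(1)] c by blast
    then show ?thesis using key[OF V] b by simp
   qed
   obtain a where a: "a < length Ws" "W = Ws ! a" using W by (metis in_set_conv_nth)
   have V: "W_ok q t k W" using ok W by blast
   have "int p dvd lin ?N l (?us ! a)" by (rule ec(3)[OF _ a(1)]) (rule kill)
   then have "int p dvd vf q (map (map c) W)" using key[OF V] a by simp
   then show False using vf_viol[OF co[of c, OF _ V] p(1)] c W(2) by blast
  qed
  then show ?thesis using ec(1,2) bfe by auto
 qed
 show ?thesis using ptbf correct by blast
qed

section \<open>Parsing instances\<close>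

text \<open>Reads one list element off the remaining word. The comparison with the length of
  \<open>x\<close> bounds the growth for arbitrary accumulators, as \<open>pt_fold_add\<close>
  demands.\<close>

definition pstep :: "(bool list => 'b) => (bool list => bool list) => bool list => bool list \<times> 'b list => bool list \<times> 'b list" where
 "pstep a d x s = (if fst s \<noteq> [] & hd (fst s) & length (fst s) \<le> length x then (d (tl (fst s)), snd s @ [a (tl (fst s))]) else s)"

definition plist :: "(bool list => 'b) => (bool list => bool list) => bool list => bool list => bool list \<times> 'b list" where
 "plist a d x y = fold (%_. pstep a d x) x (y, [])"

lemma plist_enc:
 assumes e: "\<And>z y. z \<in> set zs ==> a (e z @ y) = f z & d (e z @ y) = y" and l: "length (enc_list e zs @ y) \<le> length x"
 shows "plist a d x (enc_list e zs @ y) = (False # y, map f zs)"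
proof -
 have *: "fold (%_. pstep a d x) l (enc_list e zs @ y, acc) = (False # y, acc @ map f zs)"
  if "length zs \<le> length l" "length (enc_list e zs @ y) \<le> length x" "\<And>z y. z \<in> set zs ==> a (e z @ y) = f z & d (e z @ y) = y" for l acc
  using that
 proof (induction zs arbitrary: l acc)
  case Nil
  then show ?case by (induction l) (simp_all add: enc_list_def pstep_def)
 next
  case (Cons z zs)
  obtain b l' where l: "l = b # l'" using Cons.prems(1) by (cases l) auto
  have en: "enc_list e (z # zs) @ y = True # e z @ (enc_list e zs @ y)" by (simp add: enc_list_def)
  have "pstep a d x (enc_list e (z # zs) @ y, acc) = (enc_list e zs @ y, acc @ [f z])"
   using Cons.prems(2) Cons.prems(3)[of z "enc_list e zs @ y"] unfolding en pstep_def by simp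
  moreover have "fold (%_. pstep a d x) l' (enc_list e zs @ y, acc @ [f z]) = (False # y, (acc @ [f z]) @ map f zs)"
   by (rule Cons.IH) (use Cons.prems l in \<open>auto simp: enc_list_def\<close>)
  ultimately show ?case by (simp add: l)
 qed
 have "length zs \<le> length (enc_list e zs)" by (induction zs) (auto simp: enc_list_def)
 then show ?thesis unfolding plist_def using *[of x "[]"] e l by simp
qed

lemma pt_plist:
 assumes a: "pt a" and d: "pt d" and ab: "\<And>w. esz (a w) \<le> K * esz w" and db: "\<And>w. esz (d w) \<le> esz w"
  and x: "pt x" and y: "pt y"
 shows "pt (%v. plist a d (x v) (y v))"
 unfolding plist_def
proof (rule pt_fold_add[where F = "%v _. pstep a d (x v)" and H = "%p. K * (4 * esz (x (fst p))) + 2"])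
 show "pt (%p. pstep a d (x (fst p)) (snd (snd p)))" unfolding pstep_def
  by (intro pt_intros pt_comp[OF x] pt_comp[OF a] pt_comp[OF d])
 show "bnd (%p. K * (4 * esz (x (fst p))) + 2)" by (intro bnd_intros pt_bnd[OF pt_comp[OF x]] pt_intros)
 show "esz (pstep a d (x v) s) \<le> esz s + (K * (4 * esz (x (fst (v, b)))) + 2)" for v and b :: bool and s
 proof -
  obtain r c where s: "s = (r, c)" by (cases s)
  show ?thesis
  proof (cases "r \<noteq> [] & hd r & length r \<le> length (x v)")
   case True
   have "esz r \<le> Suc (length r * Suc 3)" by (rule esz_list_le) simp
   also have "\<dots> \<le> 4 * esz (x v)" using esz_length[of "x v"] True by simp
   finally have r: "esz r \<le> 4 * esz (x v)" .
   have t: "esz (tl r) \<le> esz r" using esz_drop[of 1 r] by (simp add: drop_Suc)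
   have "K * esz (tl r) \<le> K * (4 * esz (x v))" using r t by (intro mult_le_mono2) simp
   with ab[of "tl r"] have "esz (a (tl r)) \<le> K * (4 * esz (x v))" by (rule order_trans)
   moreover have "esz (d (tl r)) \<le> esz r" using db[of "tl r"] t by simp
   moreover have "esz (c @ [a (tl r)]) \<le> esz c + (esz (a (tl r)) + 2)" using esz_append_le[of c "[a (tl r)]"] by simp
   ultimately show ?thesis using True by (simp add: s pstep_def)
  qed (auto simp: s pstep_def)
 qed
qed (intro x y pt_intros)+

definition p_n :: "bool list => nat" where "p_n x = length (takeWhile (%b. b) x)"

text \<open>Decoding by search among the vertex numbers: the result never exceeds
  \<open>p_n x\<close>, whereas an arbitrary word could denote a number of exponential size in
  unary.\<close>

definition p_num :: "bool list => bool list => nat" where "p_num x b = ix (map binary [0..<p_n x]) b"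

definition p_e :: "bool list => bool list \<times> (bool list \<times> bool list) list" where
 "p_e x = plist (%w. (dec_fst w, dec_fst (dec_snd w))) (%w. dec_snd (dec_snd w)) x (drop (Suc (p_n x)) x)"

definition p_es :: "bool list => (nat \<times> nat) list" where
 "p_es x = map (%e. (p_num x (fst e), p_num x (snd e))) (snd (p_e x))"

definition p_xs :: "bool list => nat list" where
 "p_xs x = map (%b. p_num x b) (snd (plist dec_fst dec_snd x (tl (fst (p_e x)))))"

lemma parse:
 assumes es: "\<And>u v. (u, v) \<in> set es ==> u < n & v < n" and xs: "\<And>v. v \<in> set xs ==> v < n"
 shows "p_n (enc_graph n es xs) = n" "p_es (enc_graph n es xs) = es" "p_xs (enc_graph n es xs) = xs"
proof -
 let ?e = "%(u, v). enc_nat u @ enc_nat v"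
 let ?x = "enc_graph n es xs" and ?y = "enc_list ?e es @ enc_list enc_nat xs"
 have x: "?x = replicate n True @ False # ?y" by (simp add: enc_graph_def enc_unary_def)
 have tw: "takeWhile (%b. b) (replicate n True @ False # z) = replicate n True" for z by (induction n) auto
 show n: "p_n ?x = n" unfolding p_n_def x tw by simp
 have dr: "drop (Suc n) ?x = ?y" unfolding x by simp
 have num: "p_num ?x (binary v) = v" if "v < n" for v
 proof -
  have "distinct (map binary [0..<n])" by (simp add: distinct_map inj_on_def)
  from ix_nth[OF this, of v] that show ?thesis unfolding p_num_def n by simp
 qed
 have pe: "p_e ?x = (False # enc_list enc_nat xs, map (%(u, v). (binary u, binary v)) es)"
  unfolding p_e_def n dr
 proof (rule plist_enc)
  show "length ?y \<le> length ?x" by (simp add: x)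
 qed (auto simp: enc_nat_def)
 have "map (%e. (p_num ?x (fst e), p_num ?x (snd e))) (map (%(u, v). (binary u, binary v)) es) = es"
  unfolding map_map
 proof (rule map_idI)
  fix z assume z: "z \<in> set es"
  obtain u v where uv: "z = (u, v)" by (cases z)
  have "u < n" "v < n" using es z uv by blast+
  then show "((%e. (p_num ?x (fst e), p_num ?x (snd e))) \<circ> (%(u, v). (binary u, binary v))) z = z" by (simp add: uv num)
 qed
 then show "p_es ?x = es" unfolding p_es_def pe snd_conv .
 have "plist dec_fst dec_snd ?x (enc_list enc_nat xs @ []) = (False # [], map binary xs)"
 proof (rule plist_enc)
  show "length (enc_list enc_nat xs @ []) \<le> length ?x" by (simp add: x)
 qed (auto simp: enc_nat_def)
 then have "snd (plist dec_fst dec_snd ?x (tl (fst (p_e ?x)))) = map binary xs" by (simp add: pe)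
 then show "p_xs ?x = xs" unfolding p_xs_def using num xs by (simp add: map_idI)
qed

lemma esz_dec: "esz (dec_fst w) \<le> 4 * esz w" "esz (dec_snd w) \<le> esz w"
proof -
 have "esz (dec_fst w) \<le> Suc (length (dec_fst w) * 4)" using esz_list_le[of "dec_fst w" 3] by simp
 moreover have "length (dec_fst w) \<le> length w"
  unfolding dec_fst_def dec_len_def using length_takeWhile_le[of "%i. nthd w (2 * i)" "[0..<length w]"] by simp
 moreover have "length w < esz w" by (rule esz_length)
 ultimately show "esz (dec_fst w) \<le> 4 * esz w" by linarith
 show "esz (dec_snd w) \<le> esz w" unfolding dec_snd_def by (rule esz_drop)
qed

lemma pt_parse: "pt p_n" "pt p_es" "pt p_xs"
proof -
 show n: "pt p_n" unfolding p_n_def[abs_def] by (intro pt_intros)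
 have num: "pt (%p. p_num (fst p) (snd p))" unfolding p_num_def by (intro pt_intros pt_comp[OF n])
 have e: "pt p_e" unfolding p_e_def[abs_def]
 proof (rule pt_plist[where K = 10])
  show "esz (dec_fst w, dec_fst (dec_snd w)) \<le> 10 * esz w" for w
  proof -
   have "esz (dec_fst (dec_snd w)) \<le> 4 * esz w" using esz_dec(1)[of "dec_snd w"] esz_dec(2)[of w] by linarith
   then show ?thesis using esz_dec(1)[of w] esz_pos(1)[of w] by (simp del: esz_pos)
  qed
  show "esz (dec_snd (dec_snd w)) \<le> esz w" for w using esz_dec(2)[of "dec_snd w"] esz_dec(2)[of w] by linarith
 qed (intro pt_intros n)+
 have nf: "pt (%p. p_num (fst p) (fst (snd p)))" "pt (%p. p_num (fst p) (snd (snd p)))"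
  unfolding p_num_def by (intro pt_intros pt_comp[OF n])+
 show "pt p_es" unfolding p_es_def[abs_def] by (intro pt_intros nf e)
 have "pt (%x. plist dec_fst dec_snd x (tl (fst (p_e x))))"
  by (rule pt_plist[where K = 4]) (intro pt_intros e esz_dec)+
 then show "pt p_xs" unfolding p_xs_def[abs_def] by (intro pt_intros num)
qed

text \<open>Disjoint unions of cliques are the graphs in which adjacency is transitive on distinct
  vertices, and their cliques are the closed neighbourhoods. In this form the promise can be tested
  in polynomial time.\<close>

lemma t_Clique_iff:
 assumes V: "finite V" and E: "E \<subseteq> {{u, v} | u v. u \<in> V & v \<in> V & u \<noteq> v}"
 shows "(V, E) \<in> t_Clique t \<longleftrightarrow>
  (\<forall>u\<in>V. \<forall>v\<in>V. \<forall>w\<in>V. {u, v} \<in> E & {v, w} \<in> E & u \<noteq> w --> {u, w} \<in> E) & (\<forall>u\<in>V. card {v \<in> V. v = u \<or> {u, v} \<in> E} \<le> t)"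
  (is "?L \<longleftrightarrow> ?R1 & ?R2")
proof
 assume ?L
 then obtain P where P: "partition_on V P" "\<And>C. C \<in> P ==> card C \<le> t"
  "E = {{u, v} | u v. u \<noteq> v & (\<exists>C \<in> P. u \<in> C & v \<in> C)}" unfolding t_Clique_def by blast
 have ad: "{u, v} \<in> E \<longleftrightarrow> u \<noteq> v & (\<exists>C \<in> P. u \<in> C & v \<in> C)" for u v
  unfolding P(3) by (auto simp: doubleton_eq_iff)
 have un: "C = C'" if "C \<in> P" "C' \<in> P" "u \<in> C" "u \<in> C'" for C C' u
  using partition_onD2[OF P(1)] that by (auto simp: disjoint_def)
 have ?R1 unfolding ad using un by blast
 moreover have ?R2
 proof
  fix u assume u: "u \<in> V"
  then obtain C where C: "C \<in> P" "u \<in> C" using partition_onD1[OF P(1)] by blast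
  have "C \<subseteq> V" using C partition_onD1[OF P(1)] by blast
  then have "finite C" using V finite_subset by blast
  moreover have "{v \<in> V. v = u \<or> {u, v} \<in> E} \<subseteq> C" unfolding ad using C un by blast
  ultimately have "card {v \<in> V. v = u \<or> {u, v} \<in> E} \<le> card C" by (rule card_mono)
  then show "card {v \<in> V. v = u \<or> {u, v} \<in> E} \<le> t" using P(2)[OF C(1)] by simp
 qed
 ultimately show "?R1 & ?R2" ..
next
 assume R: "?R1 & ?R2"
 define N where "N = (%u. {v \<in> V. v = u \<or> {u, v} \<in> E})"
 have NE: "N u = N v" if uv: "u \<in> V" "v \<in> N u" for u v
 proof (cases "v = u")
  case False
  have v: "v \<in> V" "{u, v} \<in> E" "{v, u} \<in> E" using uv False by (auto simp: N_def insert_commute)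
  have "w \<in> N u \<longleftrightarrow> w \<in> N v" if w: "w \<in> V" for w
  proof -
   have "{u, w} \<in> E" if "{v, w} \<in> E" "u \<noteq> w" using R v uv(1) w that by blast
   moreover have "{v, w} \<in> E" if "{u, w} \<in> E" "v \<noteq> w" using R v uv(1) w that by blast
   ultimately show ?thesis using v w uv(1) unfolding N_def by blast
  qed
  moreover have "N u \<subseteq> V" "N v \<subseteq> V" by (auto simp: N_def)
  ultimately show ?thesis by blast
 qed simp
 have refl: "u \<in> N u" if "u \<in> V" for u using that by (simp add: N_def)
 have part: "partition_on V (N ` V)"
 proof (rule partition_onI)
  show "\<Union>(N ` V) = V" by (auto simp: N_def)
  show "{} \<notin> N ` V" using refl by blast
  fix p p' assume p: "p \<in> N ` V" "p' \<in> N ` V" "p \<noteq> p'"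
  then obtain u v where uv: "u \<in> V" "v \<in> V" "p = N u" "p' = N v" by blast
  have "w \<notin> N v" if "w \<in> N u" for w using NE[OF uv(1) that] NE[OF uv(2), of w] uv p(3) by metis
  then show "disjnt p p'" unfolding uv disjnt_def by blast
 qed
 have "E = {{u, v} | u v. u \<noteq> v & (\<exists>C \<in> N ` V. u \<in> C & v \<in> C)}" (is "E = ?E")
 proof
  show "E \<subseteq> ?E"
  proof
   fix e assume e: "e \<in> E"
   then obtain u v where uv: "e = {u, v}" "u \<in> V" "v \<in> V" "u \<noteq> v" using E by blast
   then have "v \<in> N u" "u \<in> N u" using e by (auto simp: N_def)
   then show "e \<in> ?E" using uv by blast
  qed
  show "?E \<subseteq> E"
  proof
   fix e assume "e \<in> ?E"
   then obtain u v w where e: "e = {u, v}" "u \<noteq> v" "w \<in> V" "u \<in> N w" "v \<in> N w" by blast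
   have "u \<in> V" using e by (simp add: N_def)
   then have "v \<in> N u" using NE[OF e(3,4)] e(5) by blast
   then show "e \<in> E" using e by (simp add: N_def)
  qed
 qed
 moreover have "\<forall>C\<in>N ` V. card C \<le> t" using R by (simp add: N_def)
 ultimately show ?L unfolding t_Clique_def using part V
  by (simp only: mem_Collect_eq case_prod_conv) blast
qed

section \<open>Checking the promise of an instance\<close>

definition adj :: "(nat \<times> nat) list => nat => nat => bool" where
 "adj es u v \<longleftrightarrow> (u, v) \<in> set es \<or> (v, u) \<in> set es"

definition outs :: "nat => nat list => nat list" where
 "outs n xs = filter (%v. v \<notin> set xs) [0..<n]"

text \<open>A decidable form of the promise; comparing \<open>x\<close> with the re-encoded graph
  rejects words that only happen to be parsed.\<close>

definition valid :: "nat => bool list => nat => nat => (nat \<times> nat) list => nat list => bool" where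
 "valid t x k n es xs \<longleftrightarrow> x = enc_graph n es xs & (\<forall>e\<in>set es. fst e < n & snd e < n & fst e \<noteq> snd e) &
  (\<forall>v\<in>set xs. v < n) & length (remdups xs) = k &
  (\<forall>u\<in>set (outs n xs). \<forall>v\<in>set (outs n xs). \<forall>w\<in>set (outs n xs). adj es u v & adj es v w & u \<noteq> w --> adj es u w) &
  (\<forall>u\<in>set (outs n xs). length (filter (%v. v = u \<or> adj es u v) (outs n xs)) \<le> t)"

lemma valid_edges:
 assumes "valid t x k n es xs" "adj es u v" shows "u < n & v < n & u \<noteq> v"
proof -
 have g: "\<forall>e\<in>set es. fst e < n & snd e < n & fst e \<noteq> snd e" using assms(1) unfolding valid_def by (elim conjE)
 show ?thesis using assms(2) bspec[OF g, of "(u, v)"] bspec[OF g, of "(v, u)"] unfolding adj_def by auto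
qed

definition gr :: "nat => (nat \<times> nat) list => graph" where
 "gr n es = ({..<n}, {{u, v} | u v. (u, v) \<in> set es})"

lemma gr_adj: "{u, v} \<in> {{u, v} | u v. (u, v) \<in> set es} \<longleftrightarrow> adj es u v"
 unfolding adj_def by (auto simp: doubleton_eq_iff)

lemma valid_iff:
 "x = enc_graph n es xs ==> clique_kv_instance t (x, k) (gr n es) (set xs) \<longleftrightarrow> valid t x k n es xs"
proof -
 assume x: "x = enc_graph n es xs"
 let ?E = "{{u, v} | u v. (u, v) \<in> set es}"
 have en: "encodes x (gr n es) (set xs)" unfolding encodes_def gr_def using x by blast
 have sg: "simple_graph (gr n es) \<longleftrightarrow> (\<forall>e\<in>set es. fst e < n & snd e < n & fst e \<noteq> snd e)"
 proof
  assume s: "simple_graph (gr n es)"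
  show "\<forall>e\<in>set es. fst e < n & snd e < n & fst e \<noteq> snd e"
  proof
   fix e assume "e \<in> set es"
   then have "{fst e, snd e} \<in> ?E" using gr_adj[of "fst e" "snd e" es] by (simp add: adj_def)
   then have "{fst e, snd e} \<in> {{u, v} | u v. u \<in> {..<n} & v \<in> {..<n} & u \<noteq> v}" using s unfolding simple_graph_def gr_def by blast
   then show "fst e < n & snd e < n & fst e \<noteq> snd e" by (auto simp: doubleton_eq_iff)
  qed
 next
  assume "\<forall>e\<in>set es. fst e < n & snd e < n & fst e \<noteq> snd e"
  then show "simple_graph (gr n es)" unfolding simple_graph_def gr_def by fastforce
 qed
 have sub: "set xs \<subseteq> fst (gr n es) \<longleftrightarrow> (\<forall>v\<in>set xs. v < n)" by (auto simp: gr_def)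
 have cd: "card (set xs) = k \<longleftrightarrow> length (remdups xs) = k" by (simp add: length_remdups_card_conv)
 have cq: "delete_vertices (gr n es) (set xs) \<in> t_Clique t \<longleftrightarrow>
  (\<forall>u\<in>set (outs n xs). \<forall>v\<in>set (outs n xs). \<forall>w\<in>set (outs n xs). adj es u v & adj es v w & u \<noteq> w --> adj es u w) &
  (\<forall>u\<in>set (outs n xs). length (filter (%v. v = u \<or> adj es u v) (outs n xs)) \<le> t)"
  if g: "\<forall>e\<in>set es. fst e < n & snd e < n & fst e \<noteq> snd e"
 proof -
  let ?V = "{..<n} - set xs" and ?E' = "{e \<in> ?E. e \<inter> set xs = {}}"
  have V: "set (outs n xs) = ?V" by (auto simp: outs_def)
  have "?E' \<subseteq> {{u, v} | u v. u \<in> ?V & v \<in> ?V & u \<noteq> v}"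
  proof
   fix e assume "e \<in> ?E'"
   then obtain u v where uv: "e = {u, v}" "(u, v) \<in> set es" "e \<inter> set xs = {}" by blast
   then have "u \<in> ?V" "v \<in> ?V" "u \<noteq> v" using bspec[OF g uv(2)] by auto
   then show "e \<in> {{u, v} | u v. u \<in> ?V & v \<in> ?V & u \<noteq> v}" using uv by blast
  qed
  note iff = t_Clique_iff[OF _ this, of t]
  have ad: "{u, v} \<in> ?E' \<longleftrightarrow> adj es u v" if "u \<in> ?V" "v \<in> ?V" for u v
   using gr_adj[of u v es] that by auto
  have c: "card {v \<in> ?V. v = u \<or> {u, v} \<in> ?E'} = length (filter (%v. v = u \<or> adj es u v) (outs n xs))" if u: "u \<in> ?V" for u
  proof -
   have "distinct (filter (%v. v = u \<or> adj es u v) (outs n xs))" by (simp add: outs_def)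
   then have "length (filter (%v. v = u \<or> adj es u v) (outs n xs)) = card (set (filter (%v. v = u \<or> adj es u v) (outs n xs)))" by (simp only: distinct_card)
   also have "set (filter (%v. v = u \<or> adj es u v) (outs n xs)) = {v \<in> ?V. v = u \<or> adj es u v}" unfolding set_filter V ..
   also have "\<dots> = {v \<in> ?V. v = u \<or> {u, v} \<in> ?E'}" using ad[OF u] by blast
   finally show ?thesis by simp
  qed
  have "delete_vertices (gr n es) (set xs) = (?V, ?E')" by (simp add: delete_vertices_def gr_def)
  then show ?thesis using iff unfolding V using ad c by simp
 qed
 show ?thesis unfolding clique_kv_instance_def valid_def case_prod_conv sub cd
  using en sg cq x by blast
qed

lemma parsed_instance:
 "(\<exists>G X. clique_kv_instance t (x, k) G X) \<longleftrightarrow> valid t x k (p_n x) (p_es x) (p_xs x)" (is "?L = ?R")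
proof
 assume ?L
 then obtain G X where i: "clique_kv_instance t (x, k) G X" by blast
 then have "encodes x G X" by (simp add: clique_kv_instance_def)
 then obtain n es xs where x: "x = enc_graph n es xs" "G = gr n es" "X = set xs" unfolding encodes_def gr_def by blast
 then have v: "valid t x k n es xs" using valid_iff[of x n es xs t k] i by blast
 have e: "u < n & v < n" if "(u, v) \<in> set es" for u v
  using valid_edges[OF v, of u v] that by (simp add: adj_def)
 have s: "v < n" if "v \<in> set xs" for v using v that unfolding valid_def by blast
 have "p_n x = n" "p_es x = es" "p_xs x = xs" unfolding x(1) using parse[of es n xs, OF e s] by blast+
 then show ?R using v by simp
next
 assume v: ?R
 then have "x = enc_graph (p_n x) (p_es x) (p_xs x)" by (simp add: valid_def)
 then show ?L using valid_iff v by blast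
qed

lemma pt_adj [pt_intros]: "pt f ==> pt g ==> pt h ==> pt (%v. adj (f v) (g v) (h v))"
 unfolding adj_def by (intro pt_intros)

lemma pt_outs [pt_intros]: assumes "pt f" "pt g" shows "pt (%v. outs (f v) (g v))"
 unfolding outs_def by (intro pt_intros assms pt_comp[OF assms(2)])

lemma pt_valid:
 assumes "pt x" "pt k" "pt n" "pt es" "pt xs" shows "pt (%v. valid t (x v) (k v) (n v) (es v) (xs v))"
 unfolding valid_def by (intro pt_intros assms assms(3-5)[THEN pt_comp])

section \<open>Constraints on the colouring of the modulator\<close>

text \<open>Entries of \<open>W\<close> are indices into \<open>Xs\<close>: \<open>nthd W j\<close>
  lists neighbours in the modulator of the \<open>j\<close>-th vertex of one and the same
  clique.\<close>

definition supp :: "nat => (nat \<times> nat) list => nat list => nat list => nat list list => bool" where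
 "supp s es Vo Xs W \<longleftrightarrow> (\<exists>us\<in>set (List.n_lists s Vo).
  (\<forall>i\<in>set [0..<s]. \<forall>j\<in>set [0..<s]. i \<noteq> j --> adj es (nthd us i) (nthd us j)) &
  (\<forall>j\<in>set [0..<s]. \<forall>y\<in>set (nthd W j). adj es (nthd us j) (nthd Xs y)))"

text \<open>All potential obstructions of the graph. They can be enumerated in polynomial time
  because \<open>q\<close> and \<open>t\<close> are constants.\<close>

definition conss :: "nat => nat => nat => (nat \<times> nat) list => nat list => nat list list list" where
 "conss q t n es xs = concat (map (%s. filter (%W. supp s es (outs n xs) (remdups xs) W)
  (List.n_lists s (List.n_lists (q + 1 - s) [0..<length (remdups xs)]))) [1..<Suc t])"

lemma conss_mem:
 "W \<in> set (conss q t n es xs) \<longleftrightarrow> W_ok q t (length (remdups xs)) W & supp (length W) es (outs n xs) (remdups xs) W"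
proof -
 have "W \<in> set (conss q t n es xs) \<longleftrightarrow> (\<exists>s. 1 \<le> s & s \<le> t & (length W = s & set W \<subseteq> {w. length w = q + 1 - s & set w \<subseteq> {..<length (remdups xs)}}) & supp s es (outs n xs) (remdups xs) W)"
  unfolding conss_def mem_concat_map set_filter set_n_lists mem_Collect_eq set_upt Bex_def atLeastLessThan_iff
  by (simp add: less_Suc_eq_le atLeast0LessThan)
 also have "\<dots> \<longleftrightarrow> W_ok q t (length (remdups xs)) W & supp (length W) es (outs n xs) (remdups xs) W"
  unfolding W_ok_def by blast
 finally show ?thesis .
qed

lemma pt_supp:
 assumes "pt f" "pt g" "pt h" "pt w" shows "pt (%v. supp s (f v) (g v) (h v) (w v))"
 unfolding supp_def by (intro pt_intros assms assms[THEN pt_comp])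

lemma pt_conss:
 assumes "pt n" "pt es" "pt xs" shows "pt (%v. conss q t (n v) (es v) (xs v))"
 unfolding conss_def by (rule pt_concat_const) (intro pt_intros pt_supp assms assms[THEN pt_comp])

lemma viol_map:
 "W \<noteq> [] ==> viol (map (map c) W) \<longleftrightarrow> (\<forall>j<length W. distinct (map c (W ! j)) & set (map c (W ! j)) = set (map c (W ! 0)))"
 unfolding viol_def by simp

text \<open>\<open>c\<close> colours positions in \<open>Xs\<close> and stays below \<open>q\<close>
  beyond the list as well, in accordance with the reconstruction from points.\<close>

definition good :: "nat => (nat \<times> nat) list => nat list => (nat => nat) => bool" where
 "good q es Xs c \<longleftrightarrow> (\<forall>x. c x < q) & (\<forall>i<length Xs. \<forall>j<length Xs. adj es (Xs ! i) (Xs ! j) --> c i \<noteq> c j)"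

lemma adj_sym: "adj es u v \<longleftrightarrow> adj es v u" unfolding adj_def by blast

lemma gr_colorable_iff:
 "q_colorable q (gr n es) \<longleftrightarrow> (\<exists>C. (\<forall>v<n. C v < q) & (\<forall>u v. adj es u v & u \<noteq> v --> C u \<noteq> C v))"
 unfolding q_colorable_def gr_def case_prod_conv gr_adj Ball_def lessThan_iff ..

text \<open>The colours of a clique supporting \<open>W\<close> avoid those of its listed
  neighbours, so \<open>clique_gadget\<close> rules out a violation.\<close>

lemma coloring_good:
 assumes q: "t \<le> q" "1 \<le> t" and v: "valid t x k n es xs" and col: "q_colorable q (gr n es)"
 shows "\<exists>c. good q es (remdups xs) c & (\<forall>W\<in>set (conss q t n es xs). \<not> viol (map (map c) W))"
proof -
 obtain C where C: "\<And>v. v < n ==> C v < q" "\<And>u v. adj es u v ==> u \<noteq> v ==> C u \<noteq> C v"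
  using col unfolding gr_colorable_iff by blast
 have irr: "u \<noteq> v" if "adj es u v" for u v using valid_edges[OF v that] by blast
 define Xs where "Xs = remdups xs"
 have Xn: "Xs ! i < n" if "i < length Xs" for i
  using nth_mem[OF that] v unfolding valid_def Xs_def set_remdups by blast
 define c where "c = (%i. if i < length Xs then C (Xs ! i) else 0)"
 have "good q es Xs c" unfolding good_def c_def using C Xn irr q by auto
 moreover have "\<not> viol (map (map c) W)" if W: "W \<in> set (conss q t n es xs)" for W
 proof -
  let ?s = "length W"
  have ok: "W_ok q t (length Xs) W" and sp: "supp ?s es (outs n xs) Xs W" using W unfolding conss_mem Xs_def by blast+
  have s: "1 \<le> ?s" "?s \<le> t" and w: "\<And>j. j < ?s ==> length (W ! j) = q + 1 - ?s & set (W ! j) \<subseteq> {..<length Xs}"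
   using ok unfolding W_ok_def by auto
  obtain us where us: "us \<in> set (List.n_lists ?s (outs n xs))"
   "\<forall>i\<in>set [0..<?s]. \<forall>j\<in>set [0..<?s]. i \<noteq> j --> adj es (nthd us i) (nthd us j)"
   "\<forall>j\<in>set [0..<?s]. \<forall>y\<in>set (nthd W j). adj es (nthd us j) (nthd Xs y)" using sp unfolding supp_def by blast
  have lu: "length us = ?s" "set us \<subseteq> set (outs n xs)" using us(1) by (auto simp: set_n_lists)
  have un: "us ! j < n" if "j < ?s" for j
  proof -
   have "us ! j \<in> set (outs n xs)" using lu that by (metis nth_mem subsetD)
   then show ?thesis by (simp add: outs_def)
  qed
  have a1: "adj es (us ! i) (us ! j)" if "i < ?s" "j < ?s" "i \<noteq> j" for i j using us(2) that lu by (simp add: nthd_nth)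
  have a2: "adj es (us ! j) (Xs ! y)" if "j < ?s" "y \<in> set (W ! j)" for j y
  proof -
   have "y < length Xs" using w[OF that(1)] that(2) by blast
   moreover have "adj es (nthd us j) (nthd Xs y)" using us(3) that by (simp add: nthd_nth)
   ultimately show ?thesis using that lu by (simp add: nthd_nth)
  qed
  have D: "length (map c (W ! j)) = q + 1 - ?s & set (map c (W ! j)) \<subseteq> {..<q}" if "j < ?s" for j
   using w[OF that] \<open>good q es Xs c\<close> unfolding good_def by auto
  have "inj_on (%j. C (us ! j)) {..<?s}" unfolding inj_on_def using a1 C(2) irr by (metis lessThan_iff)
  moreover have "C (us ! j) < q & C (us ! j) \<notin> set (map c (W ! j))" if j: "j < ?s" for j
  proof -
   have "C (us ! j) \<noteq> c y" if y: "y \<in> set (W ! j)" for y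
   proof -
    have "y < length Xs" using w[OF j] y by blast
    then show ?thesis using C(2)[OF a2[OF j y] irr[OF a2[OF j y]]] by (simp add: c_def)
   qed
   then show ?thesis using C(1)[OF un[OF j]] by auto
  qed
  ultimately have "\<exists>col. inj_on col {..<?s} & (\<forall>j<?s. col j < q & col j \<notin> set (map c (W ! j)))" by blast
  then have "\<not> (\<forall>j<?s. distinct (map c (W ! j)) & set (map c (W ! j)) = set (map c (W ! 0)))"
   using clique_gadget[of ?s q "%j. map c (W ! j)"] s q D by auto
  moreover have "W \<noteq> []" using s by auto
  ultimately show ?thesis using viol_map by blast
 qed
 ultimately show ?thesis unfolding Xs_def by blast
qed

text \<open>Each clique is coloured by Hall's theorem. If the condition fails for a set
  \<open>J\<close> of its vertices, fewer than \<open>card J\<close> colours are free for any of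
  them, so all of \<open>J\<close> sees a common set of \<open>q + 1 - card J\<close> colours;
  neighbours showing these colours form a violated constraint.\<close>

lemma good_coloring:
 assumes q: "t \<le> q" and v: "valid t x k n es xs"
  and c: "good q es (remdups xs) c" "\<And>W. W \<in> set (conss q t n es xs) ==> \<not> viol (map (map c) W)"
 shows "q_colorable q (gr n es)"
proof -
 have irr: "u \<noteq> v" if "adj es u v" for u v using valid_edges[OF v that] by blast
 have bdd: "u < n & v < n" if "adj es u v" for u v using valid_edges[OF v that] by blast
 define Xs where "Xs = remdups xs"
 define Vo where "Vo = outs n xs"
 have VoX: "u \<in> set Vo \<longleftrightarrow> u < n & u \<notin> set Xs" for u by (auto simp: Vo_def Xs_def outs_def)
 have tr: "adj es u w" if "u \<in> set Vo" "v \<in> set Vo" "w \<in> set Vo" "adj es u v" "adj es v w" "u \<noteq> w" for u v w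
  using v that unfolding valid_def Vo_def by blast
 define N where "N = (%u. {v \<in> set Vo. v = u \<or> adj es u v})"
 have cN: "card (N u) \<le> t" if "u \<in> set Vo" for u
 proof -
  have "card (N u) = length (filter (%v. v = u \<or> adj es u v) Vo)"
   using distinct_card[of "filter (%v. v = u \<or> adj es u v) Vo"] by (simp add: N_def Vo_def outs_def)
  moreover have "\<forall>u\<in>set (outs n xs). length (filter (%v. v = u \<or> adj es u v) (outs n xs)) \<le> t"
   using v unfolding valid_def by (elim conjE)
  ultimately show ?thesis using that unfolding Vo_def[symmetric] by metis
 qed
 have clq: "adj es v w" if u: "u \<in> set Vo" and vw: "v \<in> N u" "w \<in> N u" "v \<noteq> w" for u v w
 proof -
  have o: "v \<in> set Vo" "w \<in> set Vo" "v = u \<or> adj es v u" "w = u \<or> adj es u w" using vw adj_sym unfolding N_def by blast+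
  show ?thesis
  proof (cases "v = u")
   case True then show ?thesis using o vw by blast
  next
   case False
   then have vu: "adj es v u" using o by blast
   show ?thesis
   proof (cases "w = u")
    case True then show ?thesis using vu by simp
   next
    case False
    then show ?thesis using tr[OF o(1) u o(2) vu _ vw(3)] o by blast
   qed
  qed
 qed
 have NN: "N u = N v" if uv: "u \<in> set Vo" "v \<in> set Vo" "adj es u v" for u v
 proof -
  have "w \<in> N v" if uv: "u \<in> set Vo" "v \<in> set Vo" "adj es u v" and w: "w \<in> N u" for u v w
  proof -
   have "v \<in> N u" using uv by (simp add: N_def)
   then show ?thesis using clq[OF uv(1) _ w, of v] w unfolding N_def by blast
  qed
  from this[OF uv] this[OF uv(2,1) uv(3)[THEN adj_sym[THEN iffD1]]] show ?thesis by blast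
 qed
 define F where "F = (%v. {c i | i. i < length Xs & adj es v (Xs ! i)})"
 have "\<exists>col. inj_on col (N u) & (\<forall>v\<in>N u. col v \<in> {..<q} - F v)" if u: "u \<in> set Vo" for u
 proof (rule hall)
  show "finite (N u)" by (simp add: N_def)
  show "finite ({..<q} - F v)" for v by simp
  fix J assume J: "J \<subseteq> N u"
  show "card J \<le> card (\<Union>v\<in>J. {..<q} - F v)"
  proof (rule ccontr)
   assume n: "\<not> card J \<le> card (\<Union>v\<in>J. {..<q} - F v)"
   let ?U = "\<Union>v\<in>J. {..<q} - F v" and ?s = "card J"
   have finJ: "finite J" using J finite_subset[of J "N u"] by (simp add: N_def)
   have st: "?s \<le> t" using card_mono[OF _ J] cN[OF u] by (simp add: N_def)
   have "card ({..<q} - ?U) = q - card ?U" by (subst card_Diff_subset) auto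
   then have "q + 1 - ?s \<le> card ({..<q} - ?U)" using n by simp
   then obtain A where A: "A \<subseteq> {..<q} - ?U" "card A = q + 1 - ?s" "finite A" by (rule obtain_subset_with_card_n)
   have "\<exists>i. i < length Xs & adj es v (Xs ! i) & c i = a" if "v \<in> J" "a \<in> A" for v a
   proof -
    have "a \<in> F v" using A(1) that by blast
    then show ?thesis unfolding F_def by blast
   qed
   then obtain iv where iv: "\<And>v a. v \<in> J ==> a \<in> A ==> iv v a < length Xs & adj es v (Xs ! iv v a) & c (iv v a) = a"
    by metis
   define al where "al = sorted_list_of_set A"
   define js where "js = sorted_list_of_set J"
   define W where "W = map (%v. map (iv v) al) js"
   have al: "set al = A" "distinct al" "length al = q + 1 - ?s" using A by (simp_all add: al_def)
   have js: "set js = J" "distinct js" "length js = ?s" using finJ by (simp_all add: js_def)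
   have s1: "1 \<le> ?s" using n by linarith
   have ok: "W_ok q t (length Xs) W" unfolding W_ok_def W_def using s1 st al js iv by auto
   have sup: "supp (length W) es Vo Xs W"
    unfolding supp_def
   proof (rule bexI[of _ js], intro conjI ballI impI)
    have "J \<subseteq> set Vo" using J by (auto simp: N_def)
    then show "js \<in> set (List.n_lists (length W) Vo)" using js by (simp add: set_n_lists W_def)
    fix i j assume i: "i \<in> set [0..<length W]" and j: "j \<in> set [0..<length W]" and ij: "i \<noteq> j"
    have l: "i < length js" "j < length js" using i j by (simp_all add: W_def)
    then have "js ! i \<noteq> js ! j" "js ! i \<in> J" "js ! j \<in> J" using ij js by (auto simp: nth_eq_iff_index_eq)
    then have "adj es (js ! i) (js ! j)" using clq[OF u] J by blast
    then show "adj es (nthd js i) (nthd js j)" using l by (simp add: nthd_nth)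
   next
    fix j y assume j: "j \<in> set [0..<length W]" and y: "y \<in> set (nthd W j)"
    have l: "j < length js" using j by (simp add: W_def)
    then have J': "js ! j \<in> J" using js by auto
    have "nthd W j = map (iv (js ! j)) al" using j by (simp add: nthd_nth W_def)
    then obtain a where a: "a \<in> A" "y = iv (js ! j) a" using y al by auto
    show "adj es (nthd js j) (nthd Xs y)" using iv[OF J' a(1)] l by (simp add: a(2) nthd_nth)
   qed
   have "W \<in> set (conss q t n es xs)" using ok sup unfolding conss_mem Xs_def Vo_def by blast
   moreover have "viol (map (map c) W)"
   proof -
    have "map c (W ! j) = al" if j: "j < length W" for j
    proof -
     have "js ! j \<in> J" using j js by (auto simp: W_def)
     then have "c (iv (js ! j) a) = a" if "a \<in> set al" for a using iv that al by blast
     then show ?thesis using j by (simp add: W_def map_idI)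
    qed
    moreover have "W \<noteq> []" "0 < length W" using s1 js by (auto simp: W_def)
    ultimately show ?thesis using al viol_map[of W c] by simp
   qed
   ultimately show False using c(2) by blast
  qed
 qed
 \<comment> \<open>Colourings are chosen per clique, not per vertex, so that all vertices of a
   clique refer to the same one.\<close>
 then have "\<forall>K\<in>N ` set Vo. \<exists>col. inj_on col K & (\<forall>v\<in>K. col v \<in> {..<q} - F v)" by blast
 then obtain co where co: "\<And>K. K \<in> N ` set Vo ==> inj_on (co K) K & (\<forall>v\<in>K. co K v \<in> {..<q} - F v)"
  unfolding bchoice_iff by blast
 define C where "C = (%v. if v \<in> set Xs then c (ix Xs v) else co (N v) v)"
 have refl: "u \<in> N u" if "u \<in> set Vo" for u using that by (simp add: N_def)
 have CO: "C u \<in> {..<q} - F u" if "u \<in> set Vo" for u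
  using co[of "N u"] refl[OF that] that VoX by (simp add: C_def)
 have CF: "C v \<in> F u" if "v \<in> set Xs" "adj es u v" for u v
  unfolding F_def C_def using ix[OF that(1)] that by auto
 have "C v < q" if "v < n" for v
 proof (cases "v \<in> set Xs")
  case True then show ?thesis using c(1) by (simp add: C_def good_def)
 next
  case False then show ?thesis using CO[of v] VoX that by simp
 qed
 moreover have "C u \<noteq> C v" if a: "adj es u v" for u v
 proof -
  have uv: "u < n" "v < n" "u \<noteq> v" using irr[OF a] bdd[OF a] by simp_all
  consider "u \<in> set Xs" "v \<in> set Xs" | "u \<in> set Xs" "v \<in> set Vo" | "u \<in> set Vo" "v \<in> set Xs" | "u \<in> set Vo" "v \<in> set Vo"
   using VoX uv by blast
  then show ?thesis
  proof cases
   case 1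
   then show ?thesis using c(1) ix[OF 1(1)] ix[OF 1(2)] a unfolding good_def C_def Xs_def[symmetric] by simp
  next
   case 2
   then show ?thesis using CO[OF 2(2)] CF[OF 2(1), of v] a adj_sym by fastforce
  next
   case 3
   then show ?thesis using CO[OF 3(1)] CF[OF 3(2) a] by fastforce
  next
   case 4
   have "v \<in> N u" using 4 a by (simp add: N_def)
   then have "co (N u) u \<noteq> co (N u) v" using co[of "N u"] 4 refl[OF 4(1)] uv(3) by (auto simp: inj_on_def)
   then show ?thesis using NN[OF 4 a] 4 VoX by (simp add: C_def)
  qed
 qed
 ultimately show ?thesis unfolding gr_colorable_iff by blast
qed

section \<open>The kernel graph\<close>

definition k_X :: "nat => nat list list" where "k_X k = map (%i. [0, i]) [0..<k]"

definition k_O :: "nat list list list => nat list list" where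
 "k_O B = concat (map (%b. map (%j. [1, b, j]) [0..<length (nthd B b)]) [0..<length B])"

definition k_E :: "(nat \<times> nat) list => nat list => nat list list list => (nat list \<times> nat list) list" where
 "k_E es Xs B =
  concat (map (%i. map (%j. ([0, i], [0, j])) (filter (%j. i < j & adj es (nthd Xs i) (nthd Xs j)) [0..<length Xs])) [0..<length Xs]) @
  concat (map (%b. concat (map (%i. map (%j. ([1, b, i], [1, b, j])) [Suc i..<length (nthd B b)] @
   map (%y. ([1, b, i], [0, y])) (nthd (nthd B b) i)) [0..<length (nthd B b)])) [0..<length B])"

lemma k_X_mem: "u \<in> set (k_X k) \<longleftrightarrow> (\<exists>i<k. u = [0, i])"
 by (auto simp: k_X_def)

lemma k_O_mem: "u \<in> set (k_O B) \<longleftrightarrow> (\<exists>b<length B. \<exists>j<length (B ! b). u = [1, b, j])"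
 unfolding k_O_def mem_concat_map mem_map set_upt Bex_def atLeastLessThan_iff by (auto simp: nthd_nth)

lemma k_E_mem: "e \<in> set (k_E es Xs B) \<longleftrightarrow>
  (\<exists>i<length Xs. \<exists>j<length Xs. i < j & adj es (Xs ! i) (Xs ! j) & e = ([0, i], [0, j])) \<or>
  (\<exists>b<length B. \<exists>i<length (B ! b). \<exists>j<length (B ! b). i < j & e = ([1, b, i], [1, b, j])) \<or>
  (\<exists>b<length B. \<exists>i<length (B ! b). \<exists>y\<in>set (B ! b ! i). e = ([1, b, i], [0, y]))" (is "_ \<longleftrightarrow> ?X \<or> ?C \<or> ?M")
proof -
 have "e \<in> set (concat (map (%i. map (%j. ([0, i], [0, j])) (filter (%j. i < j & adj es (nthd Xs i) (nthd Xs j)) [0..<length Xs])) [0..<length Xs])) \<longleftrightarrow> ?X"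
  unfolding mem_concat_map mem_map set_filter set_upt Bex_def atLeastLessThan_iff mem_Collect_eq by (auto simp: nthd_nth)
 moreover have "e \<in> set (concat (map (%b. concat (map (%i. map (%j. ([1, b, i], [1, b, j])) [Suc i..<length (nthd B b)] @
   map (%y. ([1, b, i], [0, y])) (nthd (nthd B b) i)) [0..<length (nthd B b)])) [0..<length B])) \<longleftrightarrow> ?C \<or> ?M"
 proof -
  have "e \<in> set (concat (map (%b. concat (map (%i. map (%j. ([1, b, i], [1, b, j])) [Suc i..<length (nthd B b)] @
   map (%y. ([1, b, i], [0, y])) (nthd (nthd B b) i)) [0..<length (nthd B b)])) [0..<length B])) \<longleftrightarrow>
   (\<exists>b<length B. \<exists>i<length (nthd B b). (\<exists>j. i < j & j < length (nthd B b) & e = ([1, b, i], [1, b, j])) \<or> (\<exists>y\<in>set (nthd (nthd B b) i). e = ([1, b, i], [0, y])))"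
   unfolding mem_concat_map set_append Un_iff mem_map set_upt atLeastLessThan_iff Bex_def Suc_le_eq by auto
  also have "\<dots> \<longleftrightarrow> (\<exists>b<length B. \<exists>i<length (B ! b). (\<exists>j. i < j & j < length (B ! b) & e = ([1, b, i], [1, b, j])) \<or> (\<exists>y\<in>set (B ! b ! i). e = ([1, b, i], [0, y])))"
   by (simp add: nthd_nth cong: conj_cong)
  finally show ?thesis by blast
 qed
 ultimately show ?thesis unfolding k_E_def set_append Un_iff by blast
qed

lemma k_distinct: "distinct (k_X k @ k_O B)"
proof -
 have "distinct (concat (map (%b. map (%j. [1, b, j]) [0..<f b]) bs))" if "distinct bs" for f and bs :: "nat list"
  using that by (induction bs) (auto simp: distinct_map inj_on_def)
 then have "distinct (k_O B)" unfolding k_O_def by simp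
 moreover have "distinct (k_X k)" by (simp add: k_X_def distinct_map inj_on_def)
 moreover have "set (k_X k) \<inter> set (k_O B) = {}" by (auto simp: k_X_mem k_O_mem)
 ultimately show ?thesis by simp
qed

context
 fixes q t :: nat and es :: "(nat \<times> nat) list" and Xs :: "nat list" and B :: "nat list list list"
 assumes q: "1 \<le> t" "t \<le> q" and B: "\<And>W. W \<in> set B ==> W_ok q t (length Xs) W"
  and irr: "\<And>u. \<not> adj es u u"
begin

lemma B_ok:
 assumes "b < length B"
 shows "1 \<le> length (B ! b)" "length (B ! b) \<le> t" "\<And>j. j < length (B ! b) ==> length (B ! b ! j) = q + 1 - length (B ! b) & set (B ! b ! j) \<subseteq> {..<length Xs}"
 using B[OF nth_mem[OF assms]] unfolding W_ok_def by auto

lemma k_E_wf: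
 assumes "(u, v) \<in> set (k_E es Xs B)"
 shows "u \<in> set (k_X (length Xs) @ k_O B) & v \<in> set (k_X (length Xs) @ k_O B) & u \<noteq> v"
proof -
 have y: "y < length Xs" if "b < length B" "i < length (B ! b)" "y \<in> set (B ! b ! i)" for b i y
  using B_ok(3)[OF that(1,2)] that(3) by blast
 show ?thesis using assms y unfolding k_E_mem set_append Un_iff k_X_mem k_O_mem by auto
qed

lemma kernel_instance:
 "clique_kv_instance t (mk_graph (k_X (length Xs)) (k_O B) (k_E es Xs B), length Xs)
  (abs_graph (k_X (length Xs) @ k_O B) (k_E es Xs B)) {..<length Xs}"
proof -
 have l: "length (k_X (length Xs)) = length Xs" by (simp add: k_X_def)
 have "clique_kv_instance t (mk_graph (k_X (length Xs)) (k_O B) (k_E es Xs B), length (k_X (length Xs)))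
  (abs_graph (k_X (length Xs) @ k_O B) (k_E es Xs B)) {..<length (k_X (length Xs))}"
 proof (rule mk_graph_instance[where cl = "take 2", OF k_distinct k_E_wf])
  fix u v assume u: "u \<in> set (k_O B)" and v: "v \<in> set (k_O B)" and uv: "u \<noteq> v"
  obtain b i where bi: "b < length B" "i < length (B ! b)" "u = [1, b, i]" using u unfolding k_O_mem by blast
  obtain b' i' where bi': "b' < length B" "i' < length (B ! b')" "v = [1, b', i']" using v unfolding k_O_mem by blast
  show "((u, v) \<in> set (k_E es Xs B) \<or> (v, u) \<in> set (k_E es Xs B)) \<longleftrightarrow> take 2 u = take 2 v"
   unfolding k_E_mem using bi bi' uv by auto
 next
  fix u assume u: "u \<in> set (k_O B)"
  obtain b i where bi: "b < length B" "i < length (B ! b)" "u = [1, b, i]" using u unfolding k_O_mem by blast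
  have "{v \<in> set (k_O B). take 2 v = take 2 u} \<subseteq> (%j. [1, b, j]) ` {..<length (B ! b)}"
   unfolding k_O_mem using bi by auto
  then have "card {v \<in> set (k_O B). take 2 v = take 2 u} \<le> card {..<length (B ! b)}"
   by (rule surj_card_le[OF finite_lessThan])
  then show "card {v \<in> set (k_O B). take 2 v = take 2 u} \<le> t" using B_ok(2)[OF bi(1)] by simp
 qed assumption
 then show ?thesis unfolding l .
qed

text \<open>By \<open>clique_gadget\<close>, the clique built for \<open>W\<close> extends a
  colouring \<open>c\<close> of the modulator iff \<open>c\<close> does not violate
  \<open>W\<close>; the cliques are joined only through the modulator, so they are coloured
  independently.\<close>

lemma kernel_colorable:
 "q_colorable q (abs_graph (k_X (length Xs) @ k_O B) (k_E es Xs B)) \<longleftrightarrow>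
  (\<exists>c. good q es Xs c & (\<forall>W\<in>set B. \<not> viol (map (map c) W)))" (is "?L \<longleftrightarrow> ?R")
proof -
 let ?vs = "k_X (length Xs) @ k_O B"
 have nv: "\<not> viol (map (map c) (B ! b)) \<longleftrightarrow>
   (\<exists>col. inj_on col {..<length (B ! b)} & (\<forall>j<length (B ! b). col j < q & col j \<notin> set (map c (B ! b ! j))))"
  if c: "\<And>x. c x < q" and b: "b < length B" for c b
 proof -
  have ne: "B ! b \<noteq> []" using B_ok(1)[OF b] by auto
  have le: "length (B ! b) \<le> q" using B_ok(2)[OF b] q by linarith
  have D: "length (map c (B ! b ! j)) = q + 1 - length (B ! b) & set (map c (B ! b ! j)) \<subseteq> {..<q}" if "j < length (B ! b)" for j
   using B_ok(3)[OF b that] c by auto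
  show ?thesis unfolding viol_map[OF ne] using clique_gadget[of "length (B ! b)" q "%j. map c (B ! b ! j)", OF B_ok(1)[OF b] le D] by blast
 qed
 have iff: "?L \<longleftrightarrow> (\<exists>c. (\<forall>u\<in>set ?vs. c u < q) & (\<forall>e\<in>set (k_E es Xs B). c (fst e) \<noteq> c (snd e)))"
  by (rule mk_graph_colorable[OF k_distinct k_E_wf])
 show ?thesis
 proof
  assume ?L
  then obtain C where C: "\<And>u. u \<in> set ?vs ==> C u < q" "\<And>u v. (u, v) \<in> set (k_E es Xs B) ==> C u \<noteq> C v"
   unfolding iff by force
  define c where "c = (%i. if i < length Xs then C [0, i] else 0)"
  have cq: "c x < q" for x using C(1)[of "[0, x]"] q by (simp add: c_def k_X_mem)
  have E1: "C [0, i] \<noteq> C [0, j]" if "i < length Xs" "j < length Xs" "i < j" "adj es (Xs ! i) (Xs ! j)" for i j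
   by (rule C(2)) (use that in \<open>auto simp: k_E_mem\<close>)
  have E2: "C [1, b, i] \<noteq> C [1, b, j]" if "b < length B" "i < length (B ! b)" "j < length (B ! b)" "i < j" for b i j
   by (rule C(2)) (use that in \<open>auto simp: k_E_mem\<close>)
  have E3: "C [1, b, i] \<noteq> C [0, y]" if "b < length B" "i < length (B ! b)" "y \<in> set (B ! b ! i)" for b i y
   by (rule C(2)) (use that in \<open>auto simp: k_E_mem\<close>)
  have gd: "good q es Xs c"
   unfolding good_def
  proof (intro conjI allI impI cq)
   fix i j assume ij: "i < length Xs" "j < length Xs" "adj es (Xs ! i) (Xs ! j)"
   then have "i \<noteq> j" using irr by auto
   then consider "i < j" | "j < i" by linarith
   then have "C [0, i] \<noteq> C [0, j]"
   proof cases
    case 1 then show ?thesis using E1 ij by blast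
   next
    case 2
    then have "C [0, j] \<noteq> C [0, i]" using E1[of j i] ij adj_sym by blast
    then show ?thesis by simp
   qed
   then show "c i \<noteq> c j" using ij by (simp add: c_def)
  qed
  have "\<not> viol (map (map c) (B ! b))" if b: "b < length B" for b
   unfolding nv[OF cq b]
  proof (intro exI[of _ "%j. C [1, b, j]"] conjI allI impI)
   show "inj_on (%j. C [1, b, j]) {..<length (B ! b)}"
   proof (rule inj_onI, rule ccontr)
    fix i j assume ij: "i \<in> {..<length (B ! b)}" "j \<in> {..<length (B ! b)}" "C [1, b, i] = C [1, b, j]" "i \<noteq> j"
    then consider "i < j" | "j < i" by linarith
    then show False using E2[OF b, of i j] E2[OF b, of j i] ij by cases simp_all
   qed
   fix j assume j: "j < length (B ! b)"
   show "C [1, b, j] < q" by (rule C(1)) (use b j in \<open>auto simp: k_O_mem\<close>)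
   have "C [1, b, j] \<noteq> c y" if y: "y \<in> set (B ! b ! j)" for y
   proof -
    have "y < length Xs" using B_ok(3)[OF b j] y by blast
    then show ?thesis using E3[OF b j y] by (simp add: c_def)
   qed
   then show "C [1, b, j] \<notin> set (map c (B ! b ! j))" by auto
  qed
  then show ?R using gd by (metis in_set_conv_nth)
 next
  assume ?R
  then obtain c where c: "good q es Xs c" "\<And>W. W \<in> set B ==> \<not> viol (map (map c) W)" by blast
  have cq: "c x < q" for x using c(1) by (simp add: good_def)
  have "\<exists>col. inj_on col {..<length (B ! b)} & (\<forall>j<length (B ! b). col j < q & col j \<notin> set (map c (B ! b ! j)))" if b: "b < length B" for b
   by (rule nv[OF cq b, THEN iffD1]) (rule c(2)[OF nth_mem[OF b]])
  then obtain co where co: "\<And>b. b < length B ==> inj_on (co b) {..<length (B ! b)}"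
   "\<And>b j. b < length B ==> j < length (B ! b) ==> co b j < q & co b j \<notin> set (map c (B ! b ! j))"
   by metis
  define C where "C = (%u::nat list. if u ! 0 = 0 then c (u ! 1) else co (u ! 1) (u ! 2))"
  have C: "C [0, i] = c i" "C [1, b, j] = co b j" for i b j by (simp_all add: C_def)
  have "C u < q" if "u \<in> set ?vs" for u
   using that cq co(2) C unfolding set_append Un_iff k_X_mem k_O_mem by auto
  moreover have "C (fst e) \<noteq> C (snd e)" if e: "e \<in> set (k_E es Xs B)" for e
   using e unfolding k_E_mem
  proof (elim disjE exE conjE bexE)
   fix i j assume a: "i < length Xs" "j < length Xs" "adj es (Xs ! i) (Xs ! j)" "e = ([0, i], [0, j])"
   then have "c i \<noteq> c j" using c(1) unfolding good_def by blast
   then show ?thesis unfolding a(4) fst_conv snd_conv C .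
  next
   fix b i j assume a: "b < length B" "i < length (B ! b)" "j < length (B ! b)" "i < j" "e = ([1, b, i], [1, b, j])"
   then have "co b i \<noteq> co b j" using co(1)[OF a(1)] by (auto simp: inj_on_def)
   then show ?thesis unfolding a(5) fst_conv snd_conv C .
  next
   fix b i y assume a: "b < length B" "i < length (B ! b)" "y \<in> set (B ! b ! i)" "e = ([1, b, i], [0, y])"
   then have "co b i \<noteq> c y" using co(2)[OF a(1,2)] by auto
   then show ?thesis unfolding a(4) fst_conv snd_conv C .
  qed
  ultimately show ?L unfolding iff by blast
 qed
qed

end

section \<open>Size of the kernel\<close>

lemma length_binary_mono: "m \<le> n ==> length (binary m) \<le> length (binary n)"
proof (induction n arbitrary: m rule: less_induct)
 case (less n)
 show ?case
 proof (cases "m = 0")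
  case True
  then show ?thesis by (simp add: binary.simps[of 0])
 next
  case False
  then have "length (binary (m div 2)) \<le> length (binary (n div 2))" using less.prems by (intro less.IH) (auto simp: div_le_mono)
  then show ?thesis using False less.prems by (simp add: binary.simps[of m] binary.simps[of n])
 qed
qed

lemma power_length_binary: "0 < n ==> 2 ^ length (binary n) \<le> 2 * n"
proof (induction n rule: less_induct)
 case (less n)
 show ?case
 proof (cases "n = 1")
  case True
  then show ?thesis by (simp add: binary.simps[of "Suc 0"] binary.simps[of 0])
 next
  case False
  then have "2 ^ length (binary (n div 2)) \<le> 2 * (n div 2)" using less.prems by (intro less.IH) auto
  moreover have "2 * (n div 2) \<le> n" by simp
  ultimately have "2 ^ length (binary (n div 2)) \<le> n" by linarith
  then show ?thesis using less.prems by (simp add: binary.simps[of n])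
 qed
qed

lemma length_enc_list_le: "(\<And>z. z \<in> set zs ==> length (e z) \<le> L) ==> length (enc_list e zs) \<le> length zs * (L + 1) + 1"
proof (induction zs)
 case (Cons z zs)
 have "length (e z) \<le> L" "length (enc_list e zs) \<le> length zs * (L + 1) + 1" using Cons by auto
 then show ?case by (simp add: enc_list_def)
qed (simp add: enc_list_def)

lemma length_concat_map_le: "(\<And>z. z \<in> set zs ==> length (f z) \<le> L) ==> length (concat (map f zs)) \<le> length zs * L"
proof (induction zs)
 case (Cons z zs)
 have "length (f z) \<le> L" "length (concat (map f zs)) \<le> length zs * L" using Cons by auto
 then show ?case by simp
qed simp

lemma length_enc_graph_le:
 assumes H: "n \<le> H" "length es \<le> H" "length xs \<le> H" "1 \<le> H"
  and es: "\<And>u v. (u, v) \<in> set es ==> u < n & v < n" and xs: "\<And>v. v \<in> set xs ==> v < n"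
 shows "length (enc_graph n es xs) + length xs \<le> 20 * H * (length (binary H) + 1)"
proof -
 let ?b = "length (binary H)"
 have en: "length (enc_nat u) \<le> 2 * ?b + 1" if "u < n" for u
  using length_binary_mono[of u H] that H by (simp add: enc_nat_def length_enc_bits)
 have "length (enc_list (%(u, v). enc_nat u @ enc_nat v) es) \<le> length es * ((4 * ?b + 2) + 1) + 1"
 proof (rule length_enc_list_le)
  fix z assume z: "z \<in> set es"
  obtain u v where uv: "z = (u, v)" by (cases z)
  then have "u < n" "v < n" using es z by auto
  then show "length (case z of (u, v) => enc_nat u @ enc_nat v) \<le> 4 * ?b + 2" using en[of u] en[of v] by (simp add: uv)
 qed
 also have "\<dots> \<le> H * ((4 * ?b + 2) + 1) + 1" by (rule add_le_mono1[OF mult_le_mono1[OF H(2)]])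
 finally have 1: "length (enc_list (%(u, v). enc_nat u @ enc_nat v) es) \<le> H * ((4 * ?b + 2) + 1) + 1" .
 have "length (enc_list enc_nat xs) \<le> length xs * ((2 * ?b + 1) + 1) + 1"
  by (rule length_enc_list_le) (use en xs in auto)
 also have "\<dots> \<le> H * ((2 * ?b + 1) + 1) + 1" by (rule add_le_mono1[OF mult_le_mono1[OF H(3)]])
 finally have 2: "length (enc_list enc_nat xs) \<le> H * ((2 * ?b + 1) + 1) + 1" .
 have "length (enc_graph n es xs) = n + 1 + length (enc_list (%(u, v). enc_nat u @ enc_nat v) es) + length (enc_list enc_nat xs)"
  by (simp add: enc_graph_def enc_unary_def)
 then have "length (enc_graph n es xs) + length xs \<le> H + (H * ((4 * ?b + 2) + 1) + 1) + (H * ((2 * ?b + 1) + 1) + 1) + 1 + H"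
  using 1 2 H by linarith
 \<comment> \<open>\<open>H\<close> bounds vertices, edges and modulator alike; the unary vertex
   count is already covered by the linear term. The constant 20 is generous.\<close>
 also have "\<dots> = 6 * (H * ?b) + 7 * H + 3" by (simp add: algebra_simps)
 also have "\<dots> \<le> 20 * (H * ?b) + 20 * H" using H(4) by linarith
 also have "\<dots> = 20 * H * (?b + 1)" by (simp add: algebra_simps)
 finally show ?thesis .
qed

lemma length_mk_graph_le:
 assumes H: "length (Xs @ Os) \<le> H" "length es \<le> H" "1 \<le> H"
  and es: "\<And>u v. (u, v) \<in> set es ==> u \<in> set (Xs @ Os) & v \<in> set (Xs @ Os)"
 shows "length (mk_graph Xs Os es) + length Xs \<le> 20 * H * (length (binary H) + 1)"
proof -
 have "length (enc_graph (length (Xs @ Os)) (mk_edges (Xs @ Os) es) [0..<length Xs]) + length [0..<length Xs] \<le> 20 * H * (length (binary H) + 1)"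
 proof (rule length_enc_graph_le)
  fix a b assume "(a, b) \<in> set (mk_edges (Xs @ Os) es)"
  then obtain u v where uv: "(u, v) \<in> set es" "a = ix (Xs @ Os) u" "b = ix (Xs @ Os) v" unfolding mk_edges_iff by blast
  have "u \<in> set (Xs @ Os)" "v \<in> set (Xs @ Os)" using es[OF uv(1)] by blast+
  then show "a < length (Xs @ Os) & b < length (Xs @ Os)" unfolding uv(2,3) by (intro conjI ix(1))
 qed (use H in \<open>auto simp: mk_edges_def\<close>)
 then show ?thesis by (simp add: mk_graph_def)
qed

lemma kernel_counts:
 assumes B: "\<And>W. W \<in> set B ==> W_ok q t (length Xs) W" and q: "1 \<le> q"
 shows "length (k_O B) \<le> length B * t" "length (k_E es Xs B) \<le> length Xs * length Xs + length B * (t * (t + q))"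
proof -
 have l: "length (nthd B b) \<le> t" "i < length (nthd B b) ==> length (nthd (nthd B b) i) \<le> q" if "b \<in> set [0..<length B]" for b i
 proof -
  have b: "b < length B" using that by simp
  have "W_ok q t (length Xs) (B ! b)" by (rule B) (use b in simp)
  then have *: "length (B ! b) \<le> t" "1 \<le> length (B ! b)" "\<And>w. w \<in> set (B ! b) ==> length w = q + 1 - length (B ! b)" unfolding W_ok_def by auto
  show "length (nthd B b) \<le> t" using * b by (simp add: nthd_nth)
  assume i: "i < length (nthd B b)"
  then have "length (B ! b ! i) = q + 1 - length (B ! b)" using b *(3)[of "B ! b ! i"] by (simp add: nthd_nth)
  then show "length (nthd (nthd B b) i) \<le> q" using i b *(2) by (simp add: nthd_nth)
 qed
 have "length (concat (map (%b. map (%j. [1, b, j]) [0..<length (nthd B b)]) [0..<length B])) \<le> length [0..<length B] * t"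
  by (rule length_concat_map_le) (use l(1) in simp)
 then show "length (k_O B) \<le> length B * t" by (simp add: k_O_def)
 have "length (concat (map (%i. map (%j. ([0, i], [0, j])) (filter (%j. i < j & adj es (nthd Xs i) (nthd Xs j)) [0..<length Xs])) [0..<length Xs])) \<le> length [0..<length Xs] * length Xs"
 proof (rule length_concat_map_le)
  fix i
  show "length (map (%j. ([0, i], [0, j])) (filter (%j. i < j & adj es (nthd Xs i) (nthd Xs j)) [0..<length Xs])) \<le> length Xs"
   using length_filter_le[of "%j. i < j & adj es (nthd Xs i) (nthd Xs j)" "[0..<length Xs]"] by simp
 qed
 moreover have "length (concat (map (%b. concat (map (%i. map (%j. ([1, b, i], [1, b, j])) [Suc i..<length (nthd B b)] @
   map (%y. ([1, b, i], [0, y])) (nthd (nthd B b) i)) [0..<length (nthd B b)])) [0..<length B])) \<le> length [0..<length B] * (t * (t + q))"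
 proof (rule length_concat_map_le)
  fix b assume b: "b \<in> set [0..<length B]"
  have "length (concat (map (%i. map (%j. ([1, b, i], [1, b, j])) [Suc i..<length (nthd B b)] @
   map (%y. ([1, b, i], [0, y])) (nthd (nthd B b) i)) [0..<length (nthd B b)])) \<le> length [0..<length (nthd B b)] * (t + q)"
  proof (rule length_concat_map_le)
   fix i assume "i \<in> set [0..<length (nthd B b)]"
   then have "length (nthd (nthd B b) i) \<le> q" using l(2)[OF b] by simp
   then show "length (map (%j. ([1, b, i], [1, b, j])) [Suc i..<length (nthd B b)] @ map (%y. ([1, b, i], [0, y])) (nthd (nthd B b) i)) \<le> t + q"
    using l(1)[OF b] by simp
  qed
  also have "\<dots> \<le> t * (t + q)" using l(1)[OF b] by (simp add: mult_le_mono1)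
  finally show "length (concat (map (%i. map (%j. ([1, b, i], [1, b, j])) [Suc i..<length (nthd B b)] @
   map (%y. ([1, b, i], [0, y])) (nthd (nthd B b) i)) [0..<length (nthd B b)])) \<le> t * (t + q)" .
 qed
 ultimately show "length (k_E es Xs B) \<le> length Xs * length Xs + length B * (t * (t + q))" unfolding k_E_def by simp
qed

section \<open>A fixed no-instance\<close>

definition no_E :: "nat => (nat \<times> nat) list" where
 "no_E q = concat (map (%i. map (%j. (i, j)) [Suc i..<q + 1]) [0..<q + 1])"

text \<open>The complete graph on \<open>q + 1\<close> vertices with \<open>t\<close> of them
  outside the modulator. It is the output for words that encode no instance at all.\<close>

lemma no_instance:
 assumes t: "t \<le> q"
 shows "\<exists>G. clique_kv_instance t (mk_graph [0..<q + 1 - t] [q + 1 - t..<q + 1] (no_E q), q + 1 - t) G {..<q + 1 - t} & card (fst G) = q + 1 & \<not> q_colorable q G"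
  "length (mk_graph [0..<q + 1 - t] [q + 1 - t..<q + 1] (no_E q)) + (q + 1 - t) \<le> 20 * (q + 1)\<^sup>2 * (length (binary ((q + 1)\<^sup>2)) + 1)"
proof -
 have mem: "(u, v) \<in> set (no_E q) \<longleftrightarrow> u < v & v < q + 1" for u v
  unfolding no_E_def mem_concat_map mem_map set_upt Bex_def atLeastLessThan_iff by auto
 let ?Xs = "[0..<q + 1 - t]" and ?Os = "[q + 1 - t..<q + 1]"
 have vs: "?Xs @ ?Os = [0..<q + 1]" using upt_add_eq_append[of 0 "q + 1 - t" t] t by simp
 have d: "distinct (?Xs @ ?Os)" unfolding vs by simp
 have wf: "u \<in> set (?Xs @ ?Os) & v \<in> set (?Xs @ ?Os) & u \<noteq> v" if "(u, v) \<in> set (no_E q)" for u v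
  using that unfolding vs mem by auto
 have i: "clique_kv_instance t (mk_graph ?Xs ?Os (no_E q), length ?Xs) (abs_graph (?Xs @ ?Os) (no_E q)) {..<length ?Xs}"
 proof (rule mk_graph_instance[where cl = "%_. ()", OF d wf])
  fix u v assume "u \<in> set ?Os" "v \<in> set ?Os" "u \<noteq> v"
  then show "((u, v) \<in> set (no_E q) \<or> (v, u) \<in> set (no_E q)) \<longleftrightarrow> () = ()" unfolding mem by auto
 next
  fix u assume "u \<in> set ?Os"
  have "{v \<in> set ?Os. () = ()} = {q + 1 - t..<q + 1}" unfolding set_upt by auto
  then have "card {v \<in> set ?Os. () = ()} = q + 1 - (q + 1 - t)" by (simp only: card_atLeastLessThan)
  then show "card {v \<in> set ?Os. () = ()} \<le> t" using t by linarith
 qed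
 have "\<not> q_colorable q (abs_graph (?Xs @ ?Os) (no_E q))"
 proof
  assume "q_colorable q (abs_graph (?Xs @ ?Os) (no_E q))"
  moreover have "q_colorable q (abs_graph (?Xs @ ?Os) (no_E q)) \<longleftrightarrow>
    (\<exists>c. (\<forall>u\<in>set (?Xs @ ?Os). c u < q) & (\<forall>e\<in>set (no_E q). c (fst e) \<noteq> c (snd e)))"
   by (rule mk_graph_colorable[OF d], rule wf)
  ultimately obtain c where c0: "\<forall>u\<in>set (?Xs @ ?Os). c u < q" "\<forall>e\<in>set (no_E q). c (fst e) \<noteq> c (snd e)" by blast
  have c: "c u < q" if "u < q + 1" for u using c0(1) that unfolding vs set_upt by auto
  have ce: "c u \<noteq> c v" if "(u, v) \<in> set (no_E q)" for u v using bspec[OF c0(2) that] by simp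
  have "inj_on c {..<q + 1}"
  proof (rule inj_onI, rule ccontr)
   fix u v assume uv: "u \<in> {..<q + 1}" "v \<in> {..<q + 1}" "c u = c v" "u \<noteq> v"
   then consider "u < v" | "v < u" by linarith
   then show False using ce[of u v] ce[of v u] uv unfolding mem by cases auto
  qed
  moreover have "c ` {..<q + 1} \<subseteq> {..<q}" using c by auto
  ultimately have "card {..<q + 1} \<le> card {..<q}" by (intro card_inj_on_le) auto
  then show False by simp
 qed
 moreover have "card (fst (abs_graph (?Xs @ ?Os) (no_E q))) = q + 1" unfolding vs abs_graph_def by simp
 ultimately show "\<exists>G. clique_kv_instance t (mk_graph ?Xs ?Os (no_E q), q + 1 - t) G {..<q + 1 - t} & card (fst G) = q + 1 & \<not> q_colorable q G"
  using i by (intro exI[of _ "abs_graph (?Xs @ ?Os) (no_E q)"]) simp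
 have le: "length (no_E q) \<le> (q + 1)\<^sup>2"
 proof -
  have "length (no_E q) \<le> length [0..<q + 1] * (q + 1)" unfolding no_E_def by (rule length_concat_map_le) simp
  then show ?thesis by (simp add: power2_eq_square)
 qed
 have "length (mk_graph ?Xs ?Os (no_E q)) + length ?Xs \<le> 20 * (q + 1)\<^sup>2 * (length (binary ((q + 1)\<^sup>2)) + 1)"
 proof (rule length_mk_graph_le[OF _ le])
  show "length (?Xs @ ?Os) \<le> (q + 1)\<^sup>2" unfolding vs by (simp add: power2_eq_square)
  show "u \<in> set (?Xs @ ?Os) & v \<in> set (?Xs @ ?Os)" if "(u, v) \<in> set (no_E q)" for u v using wf[OF that] by blast
 qed simp
 then show "length (mk_graph ?Xs ?Os (no_E q)) + (q + 1 - t) \<le> 20 * (q + 1)\<^sup>2 * (length (binary ((q + 1)\<^sup>2)) + 1)" by simp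
qed

lemma kernel_asymptotics:
 fixes A r :: nat
 assumes A: "1 \<le> A"
 defines "H \<equiv> %k. A * (k + 1) ^ r"
 shows "(%k. real (H k)) \<in> O(%k. real k ^ r)"
  "(%k. real (20 * H k * (length (binary (H k)) + 1))) \<in> O(%k. real k ^ r * ln (real k))"
proof -
 have b: "real (H k) \<le> real A * 2 ^ r * real k ^ r" if "1 \<le> k" for k
 proof -
  have "(1 + real k) ^ r \<le> (2 * real k) ^ r" using that by (intro power_mono) auto
  then show ?thesis unfolding H_def by (simp add: power_mult_distrib mult.assoc mult_left_mono)
 qed
 show "(%k. real (H k)) \<in> O(%k. real k ^ r)"
  by (rule bigoI[of _ "real A * 2 ^ r"]) (use b in \<open>auto intro!: eventually_sequentiallyI[of 1]\<close>)
 define K where "K = 1 + (ln 2 + (ln (real A) + real r * ln 2) + real r) / ln 2"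
 show "(%k. real (20 * H k * (length (binary (H k)) + 1))) \<in> O(%k. real k ^ r * ln (real k))"
 proof (rule bigoI[of _ "20 * (real A * 2 ^ r) * K"], rule eventually_sequentiallyI[of 3])
  \<comment> \<open>From 3 on the logarithm is at least 1, so additive constants can be absorbed
    into multiples of \<open>ln k\<close>.\<close>
  fix k :: nat assume k: "3 \<le> k"
  let ?b = "length (binary (H k))"
  have lk: "1 \<le> ln (real k)"
  proof -
   have "exp 1 \<le> real k" using exp_le k by (meson numeral_le_real_of_nat_iff order_trans)
   then show ?thesis using k by (simp add: ln_ge_iff)
  qed
  have H0: "0 < H k" using A by (simp add: H_def)
  have "real (2 ^ ?b) \<le> real (2 * H k)" using power_length_binary[OF H0] by (simp only: of_nat_le_iff)
  then have p: "(2::real) ^ ?b \<le> 2 * real (H k)" by simp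
  have "real ?b * ln 2 = ln ((2::real) ^ ?b)" by (simp add: ln_realpow)
  also have "\<dots> \<le> ln (2 * real (H k))" using p H0 by (intro ln_mono) auto
  also have "\<dots> = ln 2 + ln (real (H k))" using H0 by (simp add: ln_mult)
  also have "ln (real (H k)) \<le> ln (real A * 2 ^ r * real k ^ r)" using b[of k] k H0 A by (intro ln_mono) auto
  also have "\<dots> = ln (real A) + real r * ln 2 + real r * ln (real k)" using A k by (simp add: ln_mult ln_realpow)
  finally have "real ?b * ln 2 \<le> ln 2 + (ln (real A) + real r * ln 2) + real r * ln (real k)" by simp
  also have "\<dots> \<le> (ln 2 + (ln (real A) + real r * ln 2)) * ln (real k) + real r * ln (real k)"
  proof -
   have "0 \<le> ln 2 + (ln (real A) + real r * ln 2)" using A by simp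
   from mult_left_mono[OF lk this] show ?thesis by simp
  qed
  also have "\<dots> = (ln 2 + (ln (real A) + real r * ln 2) + real r) * ln (real k)" by (simp add: algebra_simps)
  finally have "real ?b \<le> (ln 2 + (ln (real A) + real r * ln 2) + real r) * ln (real k) / ln 2" by (simp add: pos_le_divide_eq)
  then have B: "real ?b + 1 \<le> K * ln (real k)" using lk unfolding K_def by (simp add: algebra_simps)
  have "real (20 * H k * (?b + 1)) = 20 * (real (H k) * (real ?b + 1))"
   by (simp only: of_nat_mult of_nat_add of_nat_numeral of_nat_1 mult.assoc)
  also have "\<dots> \<le> 20 * ((real A * 2 ^ r * real k ^ r) * (K * ln (real k)))"
   using b[of k] k B by (intro mult_left_mono mult_mono) auto
  finally have "real (20 * H k * (?b + 1)) \<le> 20 * (real A * 2 ^ r) * K * (real k ^ r * ln (real k))" by (simp add: mult_ac)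
  moreover have "0 \<le> real k ^ r * ln (real k)" using lk by simp
  ultimately show "norm (real (20 * H k * (?b + 1))) \<le> 20 * (real A * 2 ^ r) * K * norm (real k ^ r * ln (real k))" by simp
 qed
qed

section \<open>The kernel\<close>

lemma coloring_kernel_exists:
 fixes q t :: nat
 assumes q: "q \<ge> 3" "1 \<le> t" "t \<le> q"
 shows "\<exists>g h f. coloring_kernel q t g h f &
      (%k. real (g k)) \<in> O(%k. real k ^ r_exp q t) &
      (%k. real (h k)) \<in> O(%k. real k ^ r_exp q t * ln (real k))"
proof -
 let ?r = "r_exp q t"
 obtain bf :: "nat \<times> nat list list list => nat list list list" where bf: "pt bf"
  and bs: "\<And>k Ws. set (bf (k, Ws)) \<subseteq> set Ws" and bl: "\<And>k Ws. length (bf (k, Ws)) \<le> (k * q) ^ ?r"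
  and bv: "\<And>k Ws c W. \<forall>W\<in>set Ws. W_ok q t k W ==> \<forall>x. c x < q ==> W \<in> set Ws ==> viol (map (map c) W) ==> \<exists>B\<in>set (bf (k, Ws)). viol (map (map c) B)"
  using violation_basis[OF q] by metis
 \<comment> \<open>The summands account for the modulator with its inner edges, for the selected
   cliques with their edges, and for the fixed no-instance.\<close>
 define A where "A = 1 + q ^ ?r * (t * (t + q)) + (q + 1)\<^sup>2"
 define H where "H = (%k. A * (k + 1) ^ ?r)"
 define h where "h = (%k. 20 * H k * (length (binary (H k)) + 1))"
 define no where "no = mk_graph [0..<q + 1 - t] [q + 1 - t..<q + 1] (no_E q)"
 define Bx where "Bx = (%x. bf (length (remdups (p_xs x)), conss q t (p_n x) (p_es x) (p_xs x)))"
 define out where "out = (%x. mk_graph (k_X (length (remdups (p_xs x)))) (k_O (Bx x)) (k_E (p_es x) (remdups (p_xs x)) (Bx x)))"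
 \<comment> \<open>The parameter is kept on valid instances; every other word is mapped to the
   no-instance.\<close>
 define f where "f = (%(x, k). if valid t x k (p_n x) (p_es x) (p_xs x) then (out x, k) else (no, q + 1 - t))"
 have A1: "1 \<le> A" by (simp add: A_def)
 have ptB: "pt Bx" unfolding Bx_def by (intro pt_comp[OF bf] pt_intros pt_conss pt_parse)
 have ptX: "pt (%v. k_X (length (remdups (p_xs v))))" unfolding k_X_def by (intro pt_intros pt_parse)
 have ptO: "pt (%v. k_O (Bx v))" unfolding k_O_def by (intro pt_intros ptB pt_comp[OF ptB])
 have ptE: "pt (%v. k_E (p_es v) (remdups (p_xs v)) (Bx v))" unfolding k_E_def
  by (intro pt_intros ptB pt_parse pt_comp[OF ptB] pt_comp[OF pt_parse(2)] pt_comp[OF pt_parse(3)])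
 have pto: "pt out" unfolding out_def by (intro pt_mk_graph ptX ptO ptE)
 have poly: "poly_time_via enc_param enc_param f"
 proof (rule pt_poly_time)
  show "pt (%w. if valid t (dec_fst w) (length (dec_snd w)) (p_n (dec_fst w)) (p_es (dec_fst w)) (p_xs (dec_fst w))
    then enc_pair (out (dec_fst w), replicate (length (dec_snd w)) True) else enc_param (no, q + 1 - t))"
   by (intro pt_intros pt_valid pt_comp[OF pto] pt_comp[OF pt_parse(1)] pt_comp[OF pt_parse(2)] pt_comp[OF pt_parse(3)])
  show "(if valid t (dec_fst (enc_param a)) (length (dec_snd (enc_param a))) (p_n (dec_fst (enc_param a))) (p_es (dec_fst (enc_param a))) (p_xs (dec_fst (enc_param a)))
    then enc_pair (out (dec_fst (enc_param a)), replicate (length (dec_snd (enc_param a))) True) else enc_param (no, q + 1 - t)) = enc_param (f a)" for a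
  proof -
   obtain x k where a: "a = (x, k)" by (cases a)
   have d: "dec_fst (enc_param a) = x" "dec_snd (enc_param a) = replicate k True" by (simp_all add: a enc_param_def enc_pair_def enc_unary_def)
   show ?thesis unfolding d by (simp add: a f_def enc_param_def enc_unary_def)
  qed
 qed
 have comp: "computable_via enc_unary enc_unary h"
 proof (rule poly_time_computable, rule pt_poly_time)
  show "pt (%w :: bool list. replicate (h (length w)) True)" unfolding h_def H_def by (intro pt_intros)
  show "replicate (h (length (enc_unary a))) True = enc_unary (h a)" for a by (simp add: enc_unary_def)
 qed
 obtain G0 where G0: "clique_kv_instance t (no, q + 1 - t) G0 {..<q + 1 - t}" "card (fst G0) = q + 1" "\<not> q_colorable q G0"
  and no_len: "length no + (q + 1 - t) \<le> 20 * (q + 1)\<^sup>2 * (length (binary ((q + 1)\<^sup>2)) + 1)"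
  unfolding no_def using no_instance[OF q(3)] by metis
 have qH: "(q + 1)\<^sup>2 \<le> H k" for k
 proof -
  have "(q + 1)\<^sup>2 * 1 \<le> A * (k + 1) ^ ?r" by (rule mult_le_mono) (simp_all add: A_def)
  then show ?thesis by (simp add: H_def)
 qed
 have main: "((x, k) \<in> coloring_problem q t \<longleftrightarrow> f (x, k) \<in> coloring_problem q t) & length (fst (f (x, k))) + snd (f (x, k)) \<le> h k &
  (\<exists>G X. clique_kv_instance t (f (x, k)) G X & card (fst G) \<le> H k)" for x k
 proof (cases "valid t x k (p_n x) (p_es x) (p_xs x)")
  case False
  then have "(x, k) \<notin> coloring_problem q t" using parsed_instance[of t x k] unfolding coloring_problem_def by blast
  moreover have fe: "f (x, k) = (no, q + 1 - t)" using False by (simp add: f_def)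
  moreover have "(no, q + 1 - t) \<notin> coloring_problem q t" using coloring_problem_iff[OF G0(1)] G0(3) by blast
  moreover have "length no + (q + 1 - t) \<le> h k"
  proof -
   have "20 * (q + 1)\<^sup>2 * (length (binary ((q + 1)\<^sup>2)) + 1) \<le> h k" unfolding h_def
    using qH[of k] length_binary_mono[OF qH[of k]] by (intro mult_le_mono) auto
   then show ?thesis using no_len by linarith
  qed
  moreover have "card (fst G0) \<le> H k"
  proof -
   have "q + 1 \<le> (q + 1)\<^sup>2" by (simp add: power2_eq_square)
   then show ?thesis using G0(2) qH[of k] by linarith
  qed
  ultimately show ?thesis using G0(1) by (simp only: fst_conv snd_conv) blast
 next
  case True
  define n es xs where "n = p_n x" and "es = p_es x" and "xs = p_xs x"
  define Xs where "Xs = remdups xs"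
  define B where "B = Bx x"
  have v: "valid t x k n es xs" using True by (simp add: n_def es_def xs_def)
  have xe: "x = enc_graph n es xs" and k: "length Xs = k" using v by (simp_all add: valid_def Xs_def)
  have fe: "f (x, k) = (mk_graph (k_X (length Xs)) (k_O B) (k_E es Xs B), length Xs)"
   using True k by (simp add: f_def out_def B_def Xs_def es_def xs_def)
  have Bc: "B = bf (length Xs, conss q t n es xs)" by (simp add: B_def Bx_def Xs_def n_def es_def xs_def)
  have cok: "\<forall>W\<in>set (conss q t n es xs). W_ok q t (length Xs) W" using conss_mem[of _ q t n es xs] unfolding Xs_def by blast
  have Bsub: "set B \<subseteq> set (conss q t n es xs)" unfolding Bc by (rule bs)
  have Bok: "W_ok q t (length Xs) W" if "W \<in> set B" for W using cok Bsub that by blast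
  have irr: "\<not> adj es u u" for u using valid_edges[OF v, of u u] by blast
  let ?G = "abs_graph (k_X (length Xs) @ k_O B) (k_E es Xs B)"
  have ki: "clique_kv_instance t (mk_graph (k_X (length Xs)) (k_O B) (k_E es Xs B), length Xs) ?G {..<length Xs}"
   by (rule kernel_instance[OF q(2,3)], rule Bok, assumption, rule irr)
  have kc: "q_colorable q ?G \<longleftrightarrow> (\<exists>c. good q es Xs c & (\<forall>W\<in>set B. \<not> viol (map (map c) W)))"
   by (rule kernel_colorable[OF q(2,3)], rule Bok, assumption, rule irr)
  have kwf: "u \<in> set (k_X (length Xs) @ k_O B) & v \<in> set (k_X (length Xs) @ k_O B) & u \<noteq> v" if "(u, v) \<in> set (k_E es Xs B)" for u v
   by (rule k_E_wf[OF q(2,3) _ _ that], rule Bok, assumption, rule irr)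
  have "(x, k) \<in> coloring_problem q t \<longleftrightarrow> q_colorable q (gr n es)"
   using coloring_problem_iff valid_iff[OF xe] v by blast
  also have "\<dots> \<longleftrightarrow> (\<exists>c. good q es Xs c & (\<forall>W\<in>set (conss q t n es xs). \<not> viol (map (map c) W)))"
   using coloring_good[OF q(3,2) v] good_coloring[OF q(3) v] unfolding Xs_def by blast
  \<comment> \<open>Constraints outside \<open>B\<close> may be dropped because every violated
    constraint entails a violated one in \<open>B\<close>, by \<open>bv\<close>.\<close>
  also have "\<dots> \<longleftrightarrow> (\<exists>c. good q es Xs c & (\<forall>W\<in>set B. \<not> viol (map (map c) W)))"
  proof -
   have "(\<forall>W\<in>set (conss q t n es xs). \<not> viol (map (map c) W)) \<longleftrightarrow> (\<forall>W\<in>set B. \<not> viol (map (map c) W))" if "good q es Xs c" for c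
   proof -
    have "\<forall>x. c x < q" using that by (simp add: good_def)
    then show ?thesis using bv[OF cok, of c] Bsub unfolding Bc by blast
   qed
   then show ?thesis by blast
  qed
  also have "\<dots> \<longleftrightarrow> q_colorable q ?G" by (rule kc[symmetric])
  also have "\<dots> \<longleftrightarrow> f (x, k) \<in> coloring_problem q t" unfolding fe by (rule coloring_problem_iff[OF ki, symmetric])
  finally have eq: "(x, k) \<in> coloring_problem q t \<longleftrightarrow> f (x, k) \<in> coloring_problem q t" .
  \<comment> \<open>Needed for the up to \<open>k * k\<close> edges inside the modulator, which must
    stay within the bound on all edges.\<close>
  have r2: "2 \<le> ?r" using r_exp_ge(1)[OF q] q by linarith
  define Z where "Z = (k + 1) ^ ?r"
  have kZ: "k * k \<le> Z" "k \<le> Z" "1 \<le> Z"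
  proof -
   have "(k + 1)\<^sup>2 \<le> Z" unfolding Z_def by (rule power_increasing[OF r2]) simp
   moreover have "k * k + k + 1 \<le> (k + 1)\<^sup>2" by (simp add: power2_eq_square)
   ultimately show "k * k \<le> Z" "k \<le> Z" "1 \<le> Z" by linarith+
  qed
  have "(k * q) ^ ?r \<le> q ^ ?r * Z" unfolding Z_def power_mult_distrib by (simp add: power_mono mult.commute)
  then have lB: "length B \<le> q ^ ?r * Z" using bl[of k "conss q t n es xs"] unfolding Bc k by linarith
  have cnt: "length (k_O B) \<le> length B * t" "length (k_E es Xs B) \<le> k * k + length B * (t * (t + q))"
   using kernel_counts(1)[of B q t Xs] kernel_counts(2)[of B q t Xs es] Bok q k by simp_all
  have HZ: "H k = Z + q ^ ?r * Z * (t * (t + q)) + (q + 1)\<^sup>2 * Z" unfolding H_def Z_def A_def by (simp add: algebra_simps)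
  have m1: "length B * (t * (t + q)) \<le> q ^ ?r * Z * (t * (t + q))" by (rule mult_le_mono1[OF lB])
  have m2: "length B * t \<le> length B * (t * (t + q))" using q by simp
  have "length (k_X (length Xs) @ k_O B) = k + length (k_O B)" using k by (simp add: k_X_def)
  then have vsl: "length (k_X (length Xs) @ k_O B) \<le> H k"
   using cnt(1) m1 m2 kZ(2) unfolding HZ by linarith
  have esl: "length (k_E es Xs B) \<le> H k" using cnt(2) m1 kZ(1) unfolding HZ by linarith
  have "length (mk_graph (k_X (length Xs)) (k_O B) (k_E es Xs B)) + length (k_X (length Xs)) \<le> 20 * H k * (length (binary (H k)) + 1)"
  proof (rule length_mk_graph_le[OF vsl esl])
   show "1 \<le> H k" using kZ(3) unfolding HZ by linarith
   show "u \<in> set (k_X (length Xs) @ k_O B) & v \<in> set (k_X (length Xs) @ k_O B)" if "(u, v) \<in> set (k_E es Xs B)" for u v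
    using kwf[OF that] by blast
  qed
  then have "length (fst (f (x, k))) + snd (f (x, k)) \<le> h k" unfolding fe h_def by (simp add: k_X_def)
  moreover have "card (fst ?G) \<le> H k" using vsl by (simp add: abs_graph_def)
  ultimately show ?thesis using eq ki unfolding fe by blast
 qed
 have "coloring_kernel q t H h f"
  unfolding coloring_kernel_def is_kernel_def is_compression_def using poly comp main by auto
 then show ?thesis using kernel_asymptotics[OF A1, of ?r] unfolding h_def H_def by blast
qed

theorem theorem6p4:
  fixes q t :: nat
  assumes "q \<ge> 3" and "1 \<le> t" and "t \<le> q"
  shows "(\<exists>g h f. coloring_kernel q t g h f \<and>
            (\<lambda>k. real (g k)) \<in> O(\<lambda>k. real k ^ r_exp q t) \<and>
            (\<lambda>k. real (h k)) \<in> O(\<lambda>k. real k ^ r_exp q t * ln (real k))) \<and>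
         (\<not> NP \<subseteq> coNP_poly \<longrightarrow>
            (\<forall>\<epsilon>::real. \<epsilon> > 0 \<longrightarrow>
               \<not> (\<exists>h. (\<lambda>k. real (h k)) \<in> O(\<lambda>k. real k powr (real (r_exp q t) - \<epsilon>)) \<and>
                      admits_compression (coloring_problem q t) h)))"
  using coloring_kernel_exists[OF assms] coloring_compression_lower_bound[OF assms] by blast

end
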